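(* Let $\mathcal{T}$ be a countable predicate $\sigma$-coherent theory over a countable relational language $\mathcal{L}$, and let $\mathcal{X}_{\mathcal{T}}$ be the topological category of (countable) models of $\mathcal{T}$. Then the functor $\mathbf{d}\colon\mathcal{X}_{\mathcal{T}}\to\mathbf{ODS}^{\mathbf{ODS}^{\mathcal{X}_{\mathcal{T}}}}$ restricts to a continuous equivalence between $\mathcal{X}_{\mathcal{T}}$ and the category of $\sigma$-pretopos morphisms from $\mathbf{ODS}^{\mathcal{X}_{\mathcal{T}}}$ to $\mathbf{ODS}$ (the full subcategory of $\mathbf{ODS}^{\mathbf{ODS}^{\mathcal{X}_{\mathcal{T}}}}$ on the $\sigma$-pretopos morphisms). Here continuous equivalence means: $\mathbf{d}$ is a continuous functor taking values in $\sigma$-pretopos morphisms, and there is a continuous functor in the opposite direction that is inverse to it up to continuous natural isomorphism.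
   Context: The category $\mathbf{ODS}$. An object $A$ is a partial equivalence relation (symmetric, transitive relation) $\equiv_A$ on $\mathbb{N}$; write $a\in A$ for $a\equiv_A a$. A morphism $f\colon A\to B$ is a function from the set of equivalence classes of $\equiv_A$ to that of $\equiv_B$; $f(a)=b$ means $a\in A$, $b\in B$ and $f$ sends the class of $a$ to the class of $b$. $\mathbf{ODS}_{\mathrm{Obj}}$ has the topology generated by the sets $\{A\mid a\equiv_A a'\}$ ($a,a'\in\mathbb{N}$); $\mathbf{ODS}_{\mathrm{Mor}}$ has the topology generated by the sets of $f\colon A\to B$ satisfying $f(a)=b$, respectively $a'\equiv_A a''$, respectively $b'\equiv_B b''$ (for numbers $a,a',a'',b,b',b''$). Using a fixed coding $\langle\cdot\rangle\colon\mathbb{N}^n\to\mathbb{N}$ (bijective), $A^n$ is the PER with $\langle\vec{a}\rangle\equiv_{A^n}\langle\vec{b}\rangle$ iff $a_i\equiv_A b_i$ for all $i$. $A$ is a subobject of $B$ if $\equiv_A\subseteq\equiv_B$ and $a\in A$, $a\equiv_B a'$ imply $a\equiv_A a'$. Logic. $\mathcal{L}$ is a countable set of predicate symbols with finite arities (single sort, no function symbols). A context $\vec{x}$ is a finite list of distinct variables. Predicate $\sigma$-coherent formulas in context $\vec{x}.\varphi$ are built from $\bot$, $\top$, $x_i=x_j$, $P(x_{i_1},\dots,x_{i_n})$ (variables in $\vec{x}$) by binary $\wedge$, countable disjunctions $\bigvee_{i\in\mathbb{N}}$ of formulas in a common context, and $\exists$ (if $\vec{x},y.\varphi$ is a formula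 so is $\vec{x}.(\exists y)\varphi$). A countable predicate $\sigma$-coherent theory is a countable set of sequents $\varphi\vdash_{\vec{x}}\psi$ with $\vec{x}.\varphi,\vec{x}.\psi$ formulas. Models. An $\mathcal{L}$-structure is $M=(\overline{M},[\![\cdot]\!]_M)$ with $\overline{M}\in\mathbf{ODS}_{\mathrm{Obj}}$ and, for each $n$-ary $P\in\mathcal{L}$, a subobject $[\![P]\!]_M$ of $\overline{M}^n$; these form a subspace of $\mathbf{ODS}_{\mathrm{Obj}}\times(\mathbf{ODS}_{\mathrm{Obj}})^{\mathcal{L}}$ ($\mathcal{L}$ discrete). Satisfaction $M\vDash(\vec{x}.\varphi)(\vec{a})$, for $\vec{a}\in\mathbb{N}^*$ of the same length as $\vec{x}$, is the usual one with $=$ interpreted by $\equiv_M$, $P$ by $[\![P]\!]_M$, quantification over $b\in M$ (i.e. $b\equiv_M b$), and always requiring $a_k\in M$ for all $k$ (the domain may be empty). $M$ is a $\mathcal{T}$-model if for each axiom $\varphi\vdash_{\vec{x}}\psi$ of $\mathcal{T}$ and each $\vec{a}$, $M\vDash(\vec{x}.\varphi)(\vec{a})$ implies $M\vDash(\vec{x}.\psi)(\vec{a})$. A homomorphism $h\colon M\to M'$ is a morphism $\overline{h}\colon\overline{M}\to\overline{M'}$ in $\mathbf{ODS}$ such that $[\![P]\!]_M(a_1,\dots,a_n)$ implies $[\![P]\!]_{M'}(\overline{h}(a_1),\dots,\overline{h}(a_n))$ for each $P$. $\mathcal{X}_{\mathcal{T}}$ is the category of all $\mathcal{T}$-models and homomorphisms;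 its object space is topologized as a subspace of the space of structures, and its morphism space as a subspace of $\mathbf{ODS}_{\mathrm{Mor}}\times(\mathcal{X}_{\mathcal{T}})_{\mathrm{Obj}}\times(\mathcal{X}_{\mathcal{T}})_{\mathrm{Obj}}$ via triples $(\overline{h},M,M')$. Functor categories. All spaces and topological categories are taken in the cartesian closed category $\mathbf{QCB}_0$ of $T_0$ quotients of countably based spaces (products, subspaces and function spaces are formed there; the function space $Y^X$ is the set of continuous maps with the sequential topology associated with the compact-open topology). A continuous functor between topological categories is a functor that is continuous on objects and on morphisms (no preservation of limits is implied). For a topological category $\mathcal{C}$, $\mathbf{ODS}^{\mathcal{C}}$ is the topological category whose objects are continuous functors $F=(F_{\mathrm{Obj}},F_{\mathrm{Mor}})\colon\mathcal{C}\to\mathbf{ODS}$ (as a subspace of $\mathbf{ODS}_{\mathrm{Obj}}^{\mathcal{C}_{\mathrm{Obj}}}\times\mathbf{ODS}_{\mathrm{Mor}}^{\mathcal{C}_{\mathrm{Mor}}}$) and whose morphisms are triples $\langle\eta,F,G\rangle$ where $\eta\colon\mathcal{C}_{\mathrm{Obj}}\to\mathbf{ODS}_{\mathrm{Mor}}$ is continuous and is a natural transformation from $F$ to $G$ (a continuous natural transformation), with the corresponding subspace topology. A $\sigma$-pretopos morphism between $\mathbf{ODS}^{\mathcal{X}_{\mathcal{T}}}$ and $\mathbf{ODS}$ is a continuous functor $\mathbf{ODS}^{\mathcal{X}_{\mathcal{T}}}\to\mathbf{ODS}$ preserving countable colimits and finite limits. The functor $\mathbf{d}$. For a model $M$, $\mathbf{d}(M)\colon\mathbf{ODS}^{\mathcal{X}_{\mathcal{T}}}\to\mathbf{ODS}$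 sends $F$ to $F_{\mathrm{Obj}}(M)$ and $\eta\colon F\to G$ to $\eta(M)\colon F_{\mathrm{Obj}}(M)\to G_{\mathrm{Obj}}(M)$. For a homomorphism $h\colon M\to M'$, $\mathbf{d}(h)\colon\mathbf{d}(M)\to\mathbf{d}(M')$ is the natural transformation $F\mapsto F_{\mathrm{Mor}}(h)$. *)

theory Defs
  imports "HOL-Analysis.Analysis" "HOL-Library.Nat_Bijection"
begin

text \<open>Products, subspaces and function spaces in QCB0 are the sequential coreflections of the
  corresponding topological constructions.  Continuous maps \<open>X \<rightarrow> Y\<close> are represented by functions
  that are \<^const>\<open>undefined\<close> outside the space \<open>X\<close>, so that equality of maps is equality
  of functions.\<close>

definition seq_open :: "'a topology \<Rightarrow> 'a set \<Rightarrow> bool" where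
  "seq_open X U \<longleftrightarrow> U \<subseteq> topspace X \<and>
     (\<forall>s l. l \<in> U \<and> limitin X s l sequentially \<longrightarrow> (\<forall>\<^sub>F n in sequentially. s n \<in> U))"

definition sequentialization :: "'a topology \<Rightarrow> 'a topology" where
  "sequentialization X = topology (seq_open X)"

lemma istopology_seq_open: "istopology (seq_open X)"
  unfolding istopology_def
proof (intro conjI allI impI)
  fix S T assume ST: "seq_open X S" "seq_open X T"
  show "seq_open X (S \<inter> T)"
    unfolding seq_open_def
  proof (intro conjI allI impI)
    show "S \<inter> T \<subseteq> topspace X" using ST unfolding seq_open_def by blast
    fix s l assume *: "l \<in> S \<inter> T \<and> limitin X s l sequentially"
    then have "\<forall>\<^sub>F n in sequentially. s n \<in> S" "\<forall>\<^sub>F n in sequentially. s n \<in> T"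
      using ST unfolding seq_open_def by blast+
    then show "\<forall>\<^sub>F n in sequentially. s n \<in> S \<inter> T"
      by eventually_elim simp
  qed
next
  fix \<K> assume \<K>: "\<forall>K\<in>\<K>. seq_open X K"
  show "seq_open X (\<Union>\<K>)"
    unfolding seq_open_def
  proof (intro conjI allI impI)
    show "\<Union>\<K> \<subseteq> topspace X" using \<K> unfolding seq_open_def by blast
    fix s l assume *: "l \<in> \<Union>\<K> \<and> limitin X s l sequentially"
    then obtain K where K: "K \<in> \<K>" "l \<in> K" by blast
    then have "\<forall>\<^sub>F n in sequentially. s n \<in> K"
      using \<K> * unfolding seq_open_def by blast
    then show "\<forall>\<^sub>F n in sequentially. s n \<in> \<Union>\<K>"
      by (rule eventually_mono) (use K in blast)
  qed
qed

lemma openin_sequentialization: "openin (sequentialization X) U \<longleftrightarrow> seq_open X U"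
  by (simp add: sequentialization_def istopology_seq_open topology_inverse')

lemma topspace_sequentialization [simp]: "topspace (sequentialization X) = topspace X"
proof -
  have "seq_open X (topspace X)"
    unfolding seq_open_def limitin_def by auto
  moreover have "U \<subseteq> topspace X" if "seq_open X U" for U
    using that unfolding seq_open_def by blast
  ultimately show ?thesis
    unfolding topspace_def[of "sequentialization X"] openin_sequentialization by blast
qed

definition qcb_prod :: "'a topology \<Rightarrow> 'b topology \<Rightarrow> ('a \<times> 'b) topology" where
  "qcb_prod X Y = sequentialization (prod_topology X Y)"

definition qcb_sub :: "'a topology \<Rightarrow> 'a set \<Rightarrow> 'a topology" where
  "qcb_sub X S = sequentialization (subtopology X S)"

definition continuous_maps :: "'a topology \<Rightarrow> 'b topology \<Rightarrow> ('a \<Rightarrow> 'b) set" where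
  "continuous_maps X Y = {f. continuous_map X Y f \<and> f \<in> extensional (topspace X)}"

definition compact_open :: "'a topology \<Rightarrow> 'b topology \<Rightarrow> ('a \<Rightarrow> 'b) topology" where
  "compact_open X Y = topology_generated_by
     {{f \<in> continuous_maps X Y. f ` K \<subseteq> U} |K U. compactin X K \<and> openin Y U}"

definition qcb_fun :: "'a topology \<Rightarrow> 'b topology \<Rightarrow> ('a \<Rightarrow> 'b) topology" where
  "qcb_fun X Y = sequentialization (compact_open X Y)"

record ('o, 'm) cat =
  Obj :: "'o set"
  Mor :: "'m set"
  Src :: "'m \<Rightarrow> 'o"
  Tgt :: "'m \<Rightarrow> 'o"
  Idn :: "'o \<Rightarrow> 'm"
  Comp :: "'m \<Rightarrow> 'm \<Rightarrow> 'm"  \<comment> \<open>\<open>Comp C g f\<close> is \<open>g \<circ> f\<close>; only relevant if \<open>Src C g = Tgt C f\<close>\<close>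

record ('o, 'm) top_cat = "('o, 'm) cat" +
  ObjTop :: "'o topology"
  MorTop :: "'m topology"

definition category :: "('o, 'm, 'z) cat_scheme \<Rightarrow> bool" where
  "category C \<longleftrightarrow>
     (\<forall>f\<in>Mor C. Src C f \<in> Obj C \<and> Tgt C f \<in> Obj C) \<and>
     (\<forall>x\<in>Obj C. Idn C x \<in> Mor C \<and> Src C (Idn C x) = x \<and> Tgt C (Idn C x) = x) \<and>
     (\<forall>f\<in>Mor C. \<forall>g\<in>Mor C. Src C g = Tgt C f \<longrightarrow>
        Comp C g f \<in> Mor C \<and> Src C (Comp C g f) = Src C f \<and> Tgt C (Comp C g f) = Tgt C g) \<and>
     (\<forall>f\<in>Mor C. Comp C f (Idn C (Src C f)) = f \<and> Comp C (Idn C (Tgt C f)) f = f) \<and>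
     (\<forall>f\<in>Mor C. \<forall>g\<in>Mor C. \<forall>h\<in>Mor C. Src C g = Tgt C f \<longrightarrow> Src C h = Tgt C g \<longrightarrow>
        Comp C h (Comp C g f) = Comp C (Comp C h g) f)"

type_synonym ('o, 'm, 'o2, 'm2) fctr = "('o \<Rightarrow> 'o2) \<times> ('m \<Rightarrow> 'm2)"

definition is_functor ::
  "('o, 'm, 'z) cat_scheme \<Rightarrow> ('o2, 'm2, 'z2) cat_scheme \<Rightarrow> ('o, 'm, 'o2, 'm2) fctr \<Rightarrow> bool" where
  "is_functor C D F \<longleftrightarrow>
     fst F \<in> Obj C \<rightarrow>\<^sub>E Obj D \<and> snd F \<in> Mor C \<rightarrow>\<^sub>E Mor D \<and>
     (\<forall>f\<in>Mor C. Src D (snd F f) = fst F (Src C f) \<and> Tgt D (snd F f) = fst F (Tgt C f)) \<and>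
     (\<forall>x\<in>Obj C. snd F (Idn C x) = Idn D (fst F x)) \<and>
     (\<forall>f\<in>Mor C. \<forall>g\<in>Mor C. Src C g = Tgt C f \<longrightarrow>
        snd F (Comp C g f) = Comp D (snd F g) (snd F f))"

definition id_functor :: "('o, 'm, 'z) cat_scheme \<Rightarrow> ('o, 'm, 'o, 'm) fctr" where
  "id_functor C = ((\<lambda>x\<in>Obj C. x), (\<lambda>f\<in>Mor C. f))"

definition comp_functor ::
  "('o, 'm, 'z) cat_scheme \<Rightarrow> ('o2, 'm2, 'o3, 'm3) fctr \<Rightarrow> ('o, 'm, 'o2, 'm2) fctr
     \<Rightarrow> ('o, 'm, 'o3, 'm3) fctr" where
  "comp_functor C G F = (compose (Obj C) (fst G) (fst F), compose (Mor C) (snd G) (snd F))"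

definition nat_trans ::
  "('o, 'm, 'z) cat_scheme \<Rightarrow> ('o2, 'm2, 'z2) cat_scheme
     \<Rightarrow> ('o, 'm, 'o2, 'm2) fctr \<Rightarrow> ('o, 'm, 'o2, 'm2) fctr \<Rightarrow> ('o \<Rightarrow> 'm2) \<Rightarrow> bool" where
  "nat_trans C D F G \<eta> \<longleftrightarrow>
     \<eta> \<in> Obj C \<rightarrow>\<^sub>E Mor D \<and>
     (\<forall>x\<in>Obj C. Src D (\<eta> x) = fst F x \<and> Tgt D (\<eta> x) = fst G x) \<and>
     (\<forall>f\<in>Mor C. Comp D (\<eta> (Tgt C f)) (snd F f) = Comp D (snd G f) (\<eta> (Src C f)))"

definition continuous_functor ::
  "('o, 'm, 'z) top_cat_scheme \<Rightarrow> ('o2, 'm2, 'z2) top_cat_scheme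
     \<Rightarrow> ('o, 'm, 'o2, 'm2) fctr \<Rightarrow> bool" where
  "continuous_functor C D F \<longleftrightarrow> is_functor C D F \<and>
     continuous_map (ObjTop C) (ObjTop D) (fst F) \<and>
     continuous_map (MorTop C) (MorTop D) (snd F)"

definition continuous_nat_trans ::
  "('o, 'm, 'z) top_cat_scheme \<Rightarrow> ('o2, 'm2, 'z2) top_cat_scheme
     \<Rightarrow> ('o, 'm, 'o2, 'm2) fctr \<Rightarrow> ('o, 'm, 'o2, 'm2) fctr \<Rightarrow> ('o \<Rightarrow> 'm2) \<Rightarrow> bool" where
  "continuous_nat_trans C D F G \<eta> \<longleftrightarrow>
     nat_trans C D F G \<eta> \<and> continuous_map (ObjTop C) (MorTop D) \<eta>"

definition continuously_isomorphic ::
  "('o, 'm, 'z) top_cat_scheme \<Rightarrow> ('o2, 'm2, 'z2) top_cat_scheme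
     \<Rightarrow> ('o, 'm, 'o2, 'm2) fctr \<Rightarrow> ('o, 'm, 'o2, 'm2) fctr \<Rightarrow> bool" where
  "continuously_isomorphic C D F G \<longleftrightarrow>
     (\<exists>\<eta> \<theta>. continuous_nat_trans C D F G \<eta> \<and> continuous_nat_trans C D G F \<theta> \<and>
        (\<forall>x\<in>Obj C. Comp D (\<theta> x) (\<eta> x) = Idn D (fst F x) \<and>
                    Comp D (\<eta> x) (\<theta> x) = Idn D (fst G x)))"

definition continuous_equivalence ::
  "('o, 'm, 'z) top_cat_scheme \<Rightarrow> ('o2, 'm2, 'z2) top_cat_scheme
     \<Rightarrow> ('o, 'm, 'o2, 'm2) fctr \<Rightarrow> bool" where
  "continuous_equivalence C D F \<longleftrightarrow> continuous_functor C D F \<and>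
     (\<exists>G. continuous_functor D C G \<and>
        continuously_isomorphic C C (comp_functor C G F) (id_functor C) \<and>
        continuously_isomorphic D D (comp_functor D F G) (id_functor D))"

definition functor_obj_space ::
  "('o, 'm, 'z) top_cat_scheme \<Rightarrow> ('o2, 'm2, 'z2) top_cat_scheme
     \<Rightarrow> ('o, 'm, 'o2, 'm2) fctr topology" where
  "functor_obj_space C D =
     qcb_sub (qcb_prod (qcb_fun (ObjTop C) (ObjTop D)) (qcb_fun (MorTop C) (MorTop D)))
       {F. continuous_functor C D F}"

type_synonym ('o, 'm, 'o2, 'm2) ntrans =
  "('o \<Rightarrow> 'm2) \<times> ('o, 'm, 'o2, 'm2) fctr \<times> ('o, 'm, 'o2, 'm2) fctr"

definition functor_mor_space ::
  "('o, 'm, 'z) top_cat_scheme \<Rightarrow> ('o2, 'm2, 'z2) top_cat_scheme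
     \<Rightarrow> ('o, 'm, 'o2, 'm2) ntrans topology" where
  "functor_mor_space C D =
     qcb_sub (qcb_prod (qcb_fun (ObjTop C) (MorTop D))
                (qcb_prod (functor_obj_space C D) (functor_obj_space C D)))
       {(\<eta>, F, G). continuous_nat_trans C D F G \<eta>}"

definition functor_cat ::
  "('o, 'm, 'z) top_cat_scheme \<Rightarrow> ('o2, 'm2, 'z2) top_cat_scheme
     \<Rightarrow> (('o, 'm, 'o2, 'm2) fctr, ('o, 'm, 'o2, 'm2) ntrans) top_cat" where
  "functor_cat C D =
     \<lparr>Obj = topspace (functor_obj_space C D),
      Mor = topspace (functor_mor_space C D),
      Src = (\<lambda>(\<eta>, F, G). F),
      Tgt = (\<lambda>(\<eta>, F, G). G),
      Idn = (\<lambda>F. ((\<lambda>x\<in>Obj C. Idn D (fst F x)), F, F)),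
      Comp = (\<lambda>(\<theta>, G, H) (\<eta>, F, G'). ((\<lambda>x\<in>Obj C. Comp D (\<theta> x) (\<eta> x)), F, H)),
      ObjTop = functor_obj_space C D,
      MorTop = functor_mor_space C D\<rparr>"

definition full_subcat ::
  "('o, 'm) top_cat \<Rightarrow> ('o \<Rightarrow> bool) \<Rightarrow> ('o, 'm) top_cat" where
  "full_subcat C P =
     (let O' = {x \<in> Obj C. P x}; M' = {f \<in> Mor C. P (Src C f) \<and> P (Tgt C f)} in
      C\<lparr>Obj := O', Mor := M',
        ObjTop := qcb_sub (ObjTop C) O', MorTop := qcb_sub (MorTop C) M'\<rparr>)"

definition cone ::
  "('i, 'u, 'y) cat_scheme \<Rightarrow> ('o, 'm, 'z) cat_scheme \<Rightarrow> ('i, 'u, 'o, 'm) fctr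
     \<Rightarrow> 'o \<Rightarrow> ('i \<Rightarrow> 'm) \<Rightarrow> bool" where
  "cone J C X v \<pi> \<longleftrightarrow> v \<in> Obj C \<and>
     (\<forall>j\<in>Obj J. \<pi> j \<in> Mor C \<and> Src C (\<pi> j) = v \<and> Tgt C (\<pi> j) = fst X j) \<and>
     (\<forall>u\<in>Mor J. Comp C (snd X u) (\<pi> (Src J u)) = \<pi> (Tgt J u))"

definition limit_cone ::
  "('i, 'u, 'y) cat_scheme \<Rightarrow> ('o, 'm, 'z) cat_scheme \<Rightarrow> ('i, 'u, 'o, 'm) fctr
     \<Rightarrow> 'o \<Rightarrow> ('i \<Rightarrow> 'm) \<Rightarrow> bool" where
  "limit_cone J C X v \<pi> \<longleftrightarrow> cone J C X v \<pi> \<and>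
     (\<forall>w \<rho>. cone J C X w \<rho> \<longrightarrow>
        (\<exists>!m. m \<in> Mor C \<and> Src C m = w \<and> Tgt C m = v \<and> (\<forall>j\<in>Obj J. Comp C (\<pi> j) m = \<rho> j)))"

definition cocone ::
  "('i, 'u, 'y) cat_scheme \<Rightarrow> ('o, 'm, 'z) cat_scheme \<Rightarrow> ('i, 'u, 'o, 'm) fctr
     \<Rightarrow> 'o \<Rightarrow> ('i \<Rightarrow> 'm) \<Rightarrow> bool" where
  "cocone J C X v \<iota> \<longleftrightarrow> v \<in> Obj C \<and>
     (\<forall>j\<in>Obj J. \<iota> j \<in> Mor C \<and> Src C (\<iota> j) = fst X j \<and> Tgt C (\<iota> j) = v) \<and>
     (\<forall>u\<in>Mor J. Comp C (\<iota> (Tgt J u)) (snd X u) = \<iota> (Src J u))"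

definition colimit_cocone ::
  "('i, 'u, 'y) cat_scheme \<Rightarrow> ('o, 'm, 'z) cat_scheme \<Rightarrow> ('i, 'u, 'o, 'm) fctr
     \<Rightarrow> 'o \<Rightarrow> ('i \<Rightarrow> 'm) \<Rightarrow> bool" where
  "colimit_cocone J C X v \<iota> \<longleftrightarrow> cocone J C X v \<iota> \<and>
     (\<forall>w \<kappa>. cocone J C X w \<kappa> \<longrightarrow>
        (\<exists>!m. m \<in> Mor C \<and> Src C m = v \<and> Tgt C m = w \<and> (\<forall>j\<in>Obj J. Comp C m (\<iota> j) = \<kappa> j)))"

text \<open>Every finite or countable category is isomorphic to one whose objects and morphisms are
  natural numbers, so diagram shapes are taken of that form.\<close>

definition preserves_finite_limits ::
  "('o, 'm, 'z) cat_scheme \<Rightarrow> ('o2, 'm2, 'z2) cat_scheme \<Rightarrow> ('o, 'm, 'o2, 'm2) fctr \<Rightarrow> bool" where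
  "preserves_finite_limits C D F \<longleftrightarrow>
     (\<forall>(J :: (nat, nat) cat) X v \<pi>.
        category J \<and> finite (Obj J) \<and> finite (Mor J) \<and> is_functor J C X \<and> limit_cone J C X v \<pi> \<longrightarrow>
        limit_cone J D (comp_functor J F X) (fst F v) (\<lambda>j. snd F (\<pi> j)))"

definition preserves_countable_colimits ::
  "('o, 'm, 'z) cat_scheme \<Rightarrow> ('o2, 'm2, 'z2) cat_scheme \<Rightarrow> ('o, 'm, 'o2, 'm2) fctr \<Rightarrow> bool" where
  "preserves_countable_colimits C D F \<longleftrightarrow>
     (\<forall>(J :: (nat, nat) cat) X v \<iota>.
        category J \<and> is_functor J C X \<and> colimit_cocone J C X v \<iota> \<longrightarrow>
        colimit_cocone J D (comp_functor J F X) (fst F v) (\<lambda>j. snd F (\<iota> j)))"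

definition sigma_pretopos_morphism ::
  "('o, 'm, 'z) top_cat_scheme \<Rightarrow> ('o2, 'm2, 'z2) top_cat_scheme
     \<Rightarrow> ('o, 'm, 'o2, 'm2) fctr \<Rightarrow> bool" where
  "sigma_pretopos_morphism C D F \<longleftrightarrow> continuous_functor C D F \<and>
     preserves_countable_colimits C D F \<and> preserves_finite_limits C D F"

type_synonym per = "(nat \<times> nat) set"

definition is_per :: "per \<Rightarrow> bool" where
  "is_per A \<longleftrightarrow> sym A \<and> trans A"

definition classes :: "per \<Rightarrow> nat set set" where
  "classes A = Domain A // A"

type_synonym ods_mor = "per \<times> per \<times> (nat set \<Rightarrow> nat set)"

definition ods_objs :: "per set" where
  "ods_objs = {A. is_per A}"

definition ods_mors :: "ods_mor set" where
  "ods_mors = {(A, B, f). is_per A \<and> is_per B \<and> f \<in> classes A \<rightarrow>\<^sub>E classes B}"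

definition maps_to :: "ods_mor \<Rightarrow> nat \<Rightarrow> nat \<Rightarrow> bool" where
  "maps_to f a b \<longleftrightarrow> (case f of (A, B, f') \<Rightarrow>
     (a, a) \<in> A \<and> (b, b) \<in> B \<and> f' (A `` {a}) = B `` {b})"

text \<open>The whole space is added to the subbases below because the empty PER, respectively the
  morphism from the empty PER to itself, belongs to none of the other subbasic open sets.\<close>

definition ods_obj_top :: "per topology" where
  "ods_obj_top = topology_generated_by
     (insert ods_objs {{A \<in> ods_objs. (a, a') \<in> A} |a a'. True})"

definition ods_mor_top :: "ods_mor topology" where
  "ods_mor_top = topology_generated_by
     (insert ods_mors
       ({{f \<in> ods_mors. maps_to f a b} |a b. True} \<union>
        {{(A, B, f) \<in> ods_mors. (a', a'') \<in> A} |a' a''. True} \<union>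
        {{(A, B, f) \<in> ods_mors. (b', b'') \<in> B} |b' b''. True}))"

definition ODS :: "(per, ods_mor) top_cat" where
  "ODS =
     \<lparr>Obj = ods_objs,
      Mor = ods_mors,
      Src = (\<lambda>(A, B, f). A),
      Tgt = (\<lambda>(A, B, f). B),
      Idn = (\<lambda>A. (A, A, (\<lambda>c\<in>classes A. c))),
      Comp = (\<lambda>(B, C, g) (A, B', f). (A, C, compose (classes A) g f)),
      ObjTop = ods_obj_top,
      MorTop = ods_mor_top\<rparr>"

text \<open>For each \<open>n > 0\<close> this coding restricts to a bijection from lists of length \<open>n\<close> to numbers;
  no such bijection exists for \<open>n = 0\<close>, where the empty list has the code \<open>0\<close>, so that
  \<open>per_power A 0\<close> has exactly one class.\<close>

fun tuple :: "nat list \<Rightarrow> nat" where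
  "tuple [] = 0"
| "tuple [a] = a"
| "tuple (a # b # bs) = prod_encode (a, tuple (b # bs))"

lemma bij_betw_tuple: "bij_betw tuple {as. length as = Suc n} UNIV"
proof (induction n)
  case 0
  show ?case
    by (rule bij_betw_byWitness[where f' = "\<lambda>a. [a]"]) (auto simp: length_Suc_conv)
next
  case (Suc n)
  have *: "\<exists>as. length as = Suc n \<and> tuple as = m" for m
    using Suc unfolding bij_betw_def by (metis (mono_tags, lifting) UNIV_I imageE mem_Collect_eq)
  have "inj_on tuple {as. length as = Suc (Suc n)}"
  proof (rule inj_onI)
    fix as bs assume l: "as \<in> {as. length as = Suc (Suc n)}" "bs \<in> {as. length as = Suc (Suc n)}"
      and eq: "tuple as = tuple bs"
    from l obtain a a' as' b b' bs' where
      "as = a # a' # as'" "bs = b # b' # bs'" "length as' = n" "length bs' = n"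
      by (auto simp: length_Suc_conv)
    moreover from this eq have "a = b" "tuple (a' # as') = tuple (b' # bs')" by auto
    ultimately show "as = bs"
      using Suc unfolding bij_betw_def inj_on_def by (metis (mono_tags, lifting) length_Cons mem_Collect_eq)
  qed
  moreover have "m \<in> tuple ` {as. length as = Suc (Suc n)}" for m
  proof -
    obtain a k where m: "m = prod_encode (a, k)" by (metis prod_decode_inverse surj_pair)
    obtain b bs where b: "length (b # bs) = Suc n" "tuple (b # bs) = k"
      using *[of k] by (metis length_Suc_conv)
    then have "tuple (a # b # bs) = m" "length (a # b # bs) = Suc (Suc n)" using m by simp_all
    then show ?thesis by blast
  qed
  ultimately show ?case unfolding bij_betw_def by blast
qed

definition per_power :: "per \<Rightarrow> nat \<Rightarrow> per" where
  "per_power A n = {(tuple as, tuple bs) |as bs.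
     length as = n \<and> length bs = n \<and> (\<forall>i<n. (as ! i, bs ! i) \<in> A)}"

definition subobject :: "per \<Rightarrow> per \<Rightarrow> bool" where
  "subobject A B \<longleftrightarrow> is_per A \<and> is_per B \<and> A \<subseteq> B \<and>
     (\<forall>a a'. (a, a) \<in> A \<and> (a, a') \<in> B \<longrightarrow> (a, a') \<in> A)"

datatype 'p fm =
    FBot
  | FTop
  | FEq nat nat
  | FPred 'p "nat list"
  | FAnd "'p fm" "'p fm"
  | FOr "nat \<Rightarrow> 'p fm"
  | FEx nat "'p fm"

text \<open>\<open>wf_fm L ar xs \<phi>\<close>: \<open>\<phi>\<close> is a formula in the context \<open>xs\<close>.  Contexts being lists of distinct
  variables, the rule for \<open>FEx\<close> only applies to a bound variable not in \<open>xs\<close>.\<close>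

inductive wf_fm :: "'p set \<Rightarrow> ('p \<Rightarrow> nat) \<Rightarrow> nat list \<Rightarrow> 'p fm \<Rightarrow> bool"
  for L :: "'p set" and ar :: "'p \<Rightarrow> nat" where
  "distinct xs \<Longrightarrow> wf_fm L ar xs FBot"
| "distinct xs \<Longrightarrow> wf_fm L ar xs FTop"
| "distinct xs \<Longrightarrow> x \<in> set xs \<Longrightarrow> y \<in> set xs \<Longrightarrow> wf_fm L ar xs (FEq x y)"
| "distinct xs \<Longrightarrow> P \<in> L \<Longrightarrow> length ys = ar P \<Longrightarrow> set ys \<subseteq> set xs \<Longrightarrow> wf_fm L ar xs (FPred P ys)"
| "wf_fm L ar xs \<phi> \<Longrightarrow> wf_fm L ar xs \<psi> \<Longrightarrow> wf_fm L ar xs (FAnd \<phi> \<psi>)"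
| "(\<And>i. wf_fm L ar xs (\<Phi> i)) \<Longrightarrow> wf_fm L ar xs (FOr \<Phi>)"
| "wf_fm L ar (xs @ [y]) \<phi> \<Longrightarrow> wf_fm L ar xs (FEx y \<phi>)"

datatype 'p sequent = Sequent (premise: "'p fm") (context_of: "nat list") (conclusion: "'p fm")

definition countable_theory :: "'p set \<Rightarrow> ('p \<Rightarrow> nat) \<Rightarrow> 'p sequent set \<Rightarrow> bool" where
  "countable_theory L ar T \<longleftrightarrow> countable T \<and>
     (\<forall>\<phi> xs \<psi>. Sequent \<phi> xs \<psi> \<in> T \<longrightarrow> wf_fm L ar xs \<phi> \<and> wf_fm L ar xs \<psi>)"

type_synonym 'p struct = "per \<times> ('p \<Rightarrow> per)"

definition holds_pred :: "'p struct \<Rightarrow> 'p \<Rightarrow> nat list \<Rightarrow> bool" where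
  "holds_pred M P as \<longleftrightarrow> (tuple as, tuple as) \<in> snd M P"

definition val :: "nat list \<Rightarrow> nat list \<Rightarrow> nat \<Rightarrow> nat" where
  "val xs as x = the (map_of (zip xs as) x)"

primrec holds :: "'p fm \<Rightarrow> 'p struct \<Rightarrow> nat list \<Rightarrow> nat list \<Rightarrow> bool" where
  "holds FBot M xs as \<longleftrightarrow> False"
| "holds FTop M xs as \<longleftrightarrow> True"
| "holds (FEq x y) M xs as \<longleftrightarrow> (val xs as x, val xs as y) \<in> fst M"
| "holds (FPred P ys) M xs as \<longleftrightarrow> holds_pred M P (map (val xs as) ys)"
| "holds (FAnd \<phi> \<psi>) M xs as \<longleftrightarrow> holds \<phi> M xs as \<and> holds \<psi> M xs as"
| "holds (FOr \<Phi>) M xs as \<longleftrightarrow> (\<exists>i. holds (\<Phi> i) M xs as)"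
| "holds (FEx y \<phi>) M xs as \<longleftrightarrow> (\<exists>b. (b, b) \<in> fst M \<and> holds \<phi> M (xs @ [y]) (as @ [b]))"

definition satisfies :: "'p struct \<Rightarrow> nat list \<Rightarrow> 'p fm \<Rightarrow> nat list \<Rightarrow> bool" where
  "satisfies M xs \<phi> as \<longleftrightarrow>
     length as = length xs \<and> (\<forall>a\<in>set as. (a, a) \<in> fst M) \<and> holds \<phi> M xs as"

definition is_structure :: "'p set \<Rightarrow> ('p \<Rightarrow> nat) \<Rightarrow> 'p struct \<Rightarrow> bool" where
  "is_structure L ar M \<longleftrightarrow> is_per (fst M) \<and> snd M \<in> extensional L \<and>
     (\<forall>P\<in>L. subobject (snd M P) (per_power (fst M) (ar P)))"

definition is_model :: "'p set \<Rightarrow> ('p \<Rightarrow> nat) \<Rightarrow> 'p sequent set \<Rightarrow> 'p struct \<Rightarrow> bool" where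
  "is_model L ar T M \<longleftrightarrow> is_structure L ar M \<and>
     (\<forall>\<phi> xs \<psi> as. Sequent \<phi> xs \<psi> \<in> T \<and> satisfies M xs \<phi> as \<longrightarrow> satisfies M xs \<psi> as)"

type_synonym 'p hom = "ods_mor \<times> 'p struct \<times> 'p struct"

definition is_hom :: "'p set \<Rightarrow> ('p \<Rightarrow> nat) \<Rightarrow> 'p hom \<Rightarrow> bool" where
  "is_hom L ar h \<longleftrightarrow> (case h of (k, M, M') \<Rightarrow>
     k \<in> Mor ODS \<and> Src ODS k = fst M \<and> Tgt ODS k = fst M' \<and>
     (\<forall>P\<in>L. \<forall>as bs. length as = ar P \<and> list_all2 (maps_to k) as bs \<and> holds_pred M P as \<longrightarrow>
        holds_pred M' P bs))"

definition structure_space :: "'p set \<Rightarrow> ('p \<Rightarrow> nat) \<Rightarrow> 'p struct topology" where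
  "structure_space L ar =
     qcb_sub (qcb_prod (ObjTop ODS) (qcb_fun (discrete_topology L) (ObjTop ODS)))
       {M. is_structure L ar M}"

definition model_space :: "'p set \<Rightarrow> ('p \<Rightarrow> nat) \<Rightarrow> 'p sequent set \<Rightarrow> 'p struct topology" where
  "model_space L ar T = qcb_sub (structure_space L ar) {M. is_model L ar T M}"

definition hom_space :: "'p set \<Rightarrow> ('p \<Rightarrow> nat) \<Rightarrow> 'p sequent set \<Rightarrow> 'p hom topology" where
  "hom_space L ar T =
     qcb_sub (qcb_prod (MorTop ODS) (qcb_prod (model_space L ar T) (model_space L ar T)))
       {h. is_hom L ar h}"

definition model_cat ::
  "'p set \<Rightarrow> ('p \<Rightarrow> nat) \<Rightarrow> 'p sequent set \<Rightarrow> ('p struct, 'p hom) top_cat" where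
  "model_cat L ar T =
     \<lparr>Obj = topspace (model_space L ar T),
      Mor = topspace (hom_space L ar T),
      Src = (\<lambda>(k, M, M'). M),
      Tgt = (\<lambda>(k, M, M'). M'),
      Idn = (\<lambda>M. (Idn ODS (fst M), M, M)),
      Comp = (\<lambda>(k', M', M'') (k, M, N). (Comp ODS k' k, M, M'')),
      ObjTop = model_space L ar T,
      MorTop = hom_space L ar T\<rparr>"

definition dual_obj ::
  "('o, 'm) top_cat \<Rightarrow> 'o \<Rightarrow>
     (('o, 'm, per, ods_mor) fctr, ('o, 'm, per, ods_mor) ntrans, per, ods_mor) fctr" where
  "dual_obj C M =
     ((\<lambda>F\<in>Obj (functor_cat C ODS). fst F M),
      (\<lambda>e\<in>Mor (functor_cat C ODS). fst e M))"

definition dual_functor ::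
  "('o, 'm) top_cat \<Rightarrow>
     ('o, 'm,
      (('o, 'm, per, ods_mor) fctr, ('o, 'm, per, ods_mor) ntrans, per, ods_mor) fctr,
      (('o, 'm, per, ods_mor) fctr, ('o, 'm, per, ods_mor) ntrans, per, ods_mor) ntrans) fctr" where
  "dual_functor C =
     ((\<lambda>M\<in>Obj C. dual_obj C M),
      (\<lambda>h\<in>Mor C. ((\<lambda>F\<in>Obj (functor_cat C ODS). snd F h),
                   dual_obj C (Src C h), dual_obj C (Tgt C h))))"

end

theory Submission imports Defs begin

text \<open>Let \<open>F\<close> be a continuous functor from models to PERs and \<open>a\<close> an element of \<open>F M\<close>. Finitely many
  elements \<open>bs\<close> of \<open>M\<close> and a finite conjunction \<open>\<phi>\<close> of atomic facts about them suffice to name \<open>a\<close>: every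
  homomorphism fixing \<open>bs\<close> between models of \<open>\<phi>\<close> sends \<open>a\<close> to \<open>a\<close>, since otherwise bad homomorphisms for
  shrinking neighbourhoods would converge to the identity of \<open>M\<close>, against the continuity of \<open>F\<close>. Hence \<open>F\<close> is
  jointly covered by the functors that send a model \<open>N\<close> to the tuples satisfying \<open>\<phi>\<close> in \<open>N\<close>.

  A \<open>\<sigma>\<close>-pretopos morphism \<open>\<Phi>\<close> respects these definable functors, their fibre products and their covers.
  So its value at the underlying-PER functor \<open>U\<close> carries a model \<open>M\<close> of the theory in which a formula holds
  iff \<open>\<Phi>\<close> forces it, and matching elements that are named by the same parameters identifies \<open>\<Phi> F\<close> with
  \<open>F M\<close>. All the topologies involved are determined by their convergent sequences, and names persist along
  convergent sequences; this gives the continuity of the identification and of the inverse functor.\<close>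

subsection \<open>Sequential spaces\<close>

text \<open>Two obstacles shape the proof. First, a functor F sees the numbers that name the
  elements of a model, whereas a definable functor sees only tuples up to equivalence. Renaming
  bridges the gap: for surjective f, \<open>pull f N\<close> uses x as a name for what N calls f x,
  and its projection to N is an isomorphism. Any tuple of N can thus be given the names
  \<open>bs\<close>, so an element of F named by \<open>bs\<close> is transported to every tuple
  satisfying the formula. Surjectivity of f keeps existential witnesses nameable, so the renamed
  structure is again a model. Second, \<Phi> is known only to preserve limit cones and colimit
  cocones. Every property used of it (joint injectivity, fibre products, an inhabited terminal
  object, joint surjectivity) must first be cast as a finite limit or a countable colimit that is
  computed pointwise. Countability of the language enters here: it leaves only countably many pairs
  of names and basic formulas, so covers by definable functors are countable colimits. Conversely,
  for evaluation at a model the limit cone is arbitrary, and it is analysed by comparison with an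
  explicitly coded cone.\<close>

abbreviation seqlim :: "'a topology \<Rightarrow> (nat \<Rightarrow> 'a) \<Rightarrow> 'a \<Rightarrow> bool" where
  "seqlim X s l \<equiv> limitin X s l sequentially"

abbreviation eventually_seq :: "(nat \<Rightarrow> bool) \<Rightarrow> bool" (binder "\<forall>\<^sub>s" 10) where
  "eventually_seq P \<equiv> eventually P sequentially"

definition sequential_space :: "'a topology \<Rightarrow> bool" where
  "sequential_space X \<longleftrightarrow> (\<forall>U. seq_open X U \<longrightarrow> openin X U)"

text \<open>A sequentially open set is by definition entered by every sequence that converges to one
  of its points, so the additional open sets destroy no convergence. Questions about sequences can
  therefore be asked in the original topology.\<close>

lemma limitin_sequentialization [simp]:
  "seqlim (sequentialization X) s l \<longleftrightarrow> seqlim X s l"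
proof
  assume "seqlim (sequentialization X) s l"
  moreover have "seq_open X U" if "openin X U" for U
    using that unfolding seq_open_def limitin_def by (auto dest: openin_subset)
  ultimately show "seqlim X s l"
    unfolding limitin_def openin_sequentialization by auto
next
  assume "seqlim X s l"
  then show "seqlim (sequentialization X) s l"
    unfolding limitin_def openin_sequentialization topspace_sequentialization
    by (auto simp: seq_open_def limitin_def)
qed

lemma sequential_space_sequentialization [simp]: "sequential_space (sequentialization X)"
  unfolding sequential_space_def openin_sequentialization by (simp add: seq_open_def)

text \<open>Preimages of open sets are sequentially open, hence open. The qcb products, subspaces
  and function spaces are sequential, so the continuity of functors and natural transformations
  below reduces to convergent sequences.\<close>

lemma continuous_map_sequentialI:
  assumes X: "sequential_space X"
    and f: "\<And>x. x \<in> topspace X \<Longrightarrow> f x \<in> topspace Y"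
    and lim: "\<And>s l. (\<And>k::nat. s k \<in> topspace X) \<Longrightarrow> seqlim X s l
                \<Longrightarrow> seqlim Y (\<lambda>k. f (s k)) (f l)"
  shows "continuous_map X Y f"
  unfolding continuous_map
proof (intro conjI allI impI)
  show "f ` topspace X \<subseteq> topspace Y" using f by blast
next
  fix V assume V: "openin Y V"
  have "seq_open X {x \<in> topspace X. f x \<in> V}"
    unfolding seq_open_def
  proof (intro conjI allI impI, blast)
    fix s l assume *: "l \<in> {x \<in> topspace X. f x \<in> V} \<and> seqlim X s l"
    \<comment> \<open>\<open>lim\<close> speaks only of sequences that lie in the space throughout;
      the finitely many other terms are replaced by the limit.\<close>
    define s' where "s' k = (if s k \<in> topspace X then s k else l)" for k
    have ev: "\<forall>\<^sub>s k. s k \<in> topspace X"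
      using * unfolding limitin_def by auto
    then have "\<forall>\<^sub>s k. s k = s' k"
      by eventually_elim (simp add: s'_def)
    then have "seqlim X s' l"
      by (rule limitin_transform_eventually) (use * in simp)
    moreover have "s' k \<in> topspace X" for k using * by (auto simp: s'_def)
    ultimately have "seqlim Y (\<lambda>k. f (s' k)) (f l)"
      by (intro lim)
    then have "\<forall>\<^sub>s k. f (s' k) \<in> V"
      using V * unfolding limitin_def by auto
    with ev show "\<forall>\<^sub>s k. s k \<in> {x \<in> topspace X. f x \<in> V}"
      by eventually_elim (auto simp: s'_def)
  qed
  then show "openin X {x \<in> topspace X. f x \<in> V}"
    using X unfolding sequential_space_def by blast
qed

text \<open>This is the form of a sequence of counterexamples that may be drawn, at stage k, from
  the limit itself or from any later term of s.\<close>

lemma limitin_mixed: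
  assumes "seqlim X s l" and "\<And>k::nat. t k = l \<or> (\<exists>j\<ge>k. t k = s j)"
  shows "seqlim X t l"
proof -
  have "\<forall>\<^sub>s k. t k \<in> U" if U: "openin X U" "l \<in> U" for U
  proof -
    have "\<forall>\<^sub>s k. s k \<in> U" using assms(1) U unfolding limitin_def by blast
    then obtain N where N: "\<And>k. k \<ge> N \<Longrightarrow> s k \<in> U" unfolding eventually_sequentially by blast
    have "t k \<in> U" if "k \<ge> N" for k
      using assms(2)[of k] N U that by (metis order_trans)
    then show ?thesis unfolding eventually_sequentially by blast
  qed
  then show ?thesis using assms(1) unfolding limitin_def by blast
qed

text \<open>The sets that s eventually enters as soon as they contain l are closed under finite
  intersections and arbitrary unions, so testing the subbase is enough.\<close>

lemma limitin_generated:
  "limitin (topology_generated_by B) s l F \<longleftrightarrow>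
     l \<in> \<Union>B \<and> (\<forall>U\<in>B. l \<in> U \<longrightarrow> (\<forall>\<^sub>F k in F. s k \<in> U))"
proof
  assume "limitin (topology_generated_by B) s l F"
  then show "l \<in> \<Union>B \<and> (\<forall>U\<in>B. l \<in> U \<longrightarrow> (\<forall>\<^sub>F k in F. s k \<in> U))"
    unfolding limitin_def using topology_generated_by_Basis
    by (metis topology_generated_by_topspace)
next
  assume *: "l \<in> \<Union>B \<and> (\<forall>U\<in>B. l \<in> U \<longrightarrow> (\<forall>\<^sub>F k in F. s k \<in> U))"
  have "l \<in> U \<longrightarrow> (\<forall>\<^sub>F k in F. s k \<in> U)" if "generate_topology_on B U" for U
    using that
  proof induction
    case (Int a b)
    then show ?case by (auto intro: eventually_conj)
  next
    case (UN K)
    show ?case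
    proof
      assume "l \<in> \<Union>K"
      then obtain k where k: "k \<in> K" "l \<in> k" by blast
      then have "\<forall>\<^sub>F i in F. s i \<in> k" using UN by blast
      then show "\<forall>\<^sub>F i in F. s i \<in> \<Union>K" by (rule eventually_mono) (use k in blast)
    qed
  qed (use * in auto)
  then show "limitin (topology_generated_by B) s l F"
    using * unfolding limitin_def openin_topology_generated_by_iff by auto
qed

section \<open>Convergence in products, subspaces and function spaces\<close>

lemma limitin_qcb_prod:
  "seqlim (qcb_prod X Y) s l \<longleftrightarrow>
     seqlim X (\<lambda>k. fst (s k)) (fst l) \<and> seqlim Y (\<lambda>k. snd (s k)) (snd l)"
  unfolding qcb_prod_def by (simp add: limitin_pairwise o_def)

lemma limitin_qcb_sub:
  "seqlim (qcb_sub X S) s l \<longleftrightarrow>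
     l \<in> S \<and> (\<forall>\<^sub>s k. s k \<in> S) \<and> seqlim X s l"
  unfolding qcb_sub_def by (simp add: limitin_subtopology)

lemma topspace_qcb [simp]:
  "topspace (qcb_prod X Y) = topspace X \<times> topspace Y"
  "topspace (qcb_sub X S) = topspace X \<inter> S"
  unfolding qcb_prod_def qcb_sub_def by simp_all

lemma sequential_space_qcb [simp]:
  "sequential_space (qcb_sub X S)" "sequential_space (qcb_prod X Y)" "sequential_space (qcb_fun X Y)"
  unfolding qcb_prod_def qcb_sub_def qcb_fun_def by simp_all

lemma topspace_compact_open [simp]: "topspace (compact_open X Y) = continuous_maps X Y"
proof -
  \<comment> \<open>The empty compact set makes the whole function set subbasic.\<close>
  have "continuous_maps X Y \<in> {{f \<in> continuous_maps X Y. f ` K \<subseteq> U} |K U. compactin X K \<and> openin Y U}"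
    by (intro CollectI exI[of _ "{}"]) auto
  then show ?thesis unfolding compact_open_def topology_generated_by_topspace by blast
qed

lemma topspace_qcb_fun [simp]: "topspace (qcb_fun X Y) = continuous_maps X Y"
  unfolding qcb_fun_def by simp

text \<open>A convergent sequence together with its limit is compact, so convergence in the
  compact-open topology lets functions and arguments vary simultaneously.\<close>

lemma limitin_compact_openD:
  assumes f: "seqlim (compact_open X Y) f g" and x: "seqlim X x l"
  shows "seqlim Y (\<lambda>k. f k (x k)) (g l)"
proof -
  have g: "continuous_map X Y g"
    using f by (auto dest: limitin_topspace simp: continuous_maps_def)
  have "\<forall>\<^sub>s k. f k (x k) \<in> U" if U: "openin Y U" "g l \<in> U" for U
  proof -
    have lX: "l \<in> topspace X" using x by (rule limitin_topspace)
    have "openin X {y \<in> topspace X. g y \<in> U}" using g U(1) by (rule openin_continuous_map_preimage)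
    then have "\<forall>\<^sub>s k. x k \<in> {y \<in> topspace X. g y \<in> U}"
      using x U lX unfolding limitin_def by blast
    then obtain m where m: "\<And>k. k \<ge> m \<Longrightarrow> x k \<in> topspace X \<and> g (x k) \<in> U"
      unfolding eventually_sequentially by blast
    \<comment> \<open>Starting the tail at m keeps the image of K under g inside U.\<close>
    define K where "K = insert l (x ` {m..})"
    have "compactin X K" unfolding K_def
      by (rule compactin_sequence_with_limit[OF x]) (use m in auto)
    moreover have "g ` K \<subseteq> U" using m U by (auto simp: K_def)
    ultimately have "{h \<in> continuous_maps X Y. h ` K \<subseteq> U} \<in>
        {{h \<in> continuous_maps X Y. h ` K \<subseteq> U} |K U. compactin X K \<and> openin Y U}"
      and "g \<in> {h \<in> continuous_maps X Y. h ` K \<subseteq> U}"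
      using U(1) limitin_topspace[OF f] by auto
    then have "\<forall>\<^sub>s k. f k \<in> {h \<in> continuous_maps X Y. h ` K \<subseteq> U}"
      using f unfolding compact_open_def limitin_generated by blast
    with eventually_ge_at_top[of m] show ?thesis
      by eventually_elim (auto simp: K_def)
  qed
  moreover have "g l \<in> topspace Y"
    using g limitin_topspace[OF x] by (auto simp: continuous_map_def)
  ultimately show ?thesis unfolding limitin_def by blast
qed

text \<open>A compact set in a sequential space is covered by the increasing open sets
  \<open>{x. g x \<in> U \<and> (\<forall>n\<ge>k. f n x \<in> U)}\<close>, so no first countability is needed.\<close>

lemma limitin_compact_openI:
  assumes X: "sequential_space X"
    and f: "\<And>k. f k \<in> continuous_maps X Y" and g: "g \<in> continuous_maps X Y"
    and cc: "\<And>x l. seqlim X x l \<Longrightarrow> (\<And>k. x k \<in> topspace X)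
                \<Longrightarrow> seqlim Y (\<lambda>k. f k (x k)) (g l)"
  shows "seqlim (compact_open X Y) f g"
proof -
  have cg: "continuous_map X Y g" and cf: "\<And>k. continuous_map X Y (f k)"
    using f g by (auto simp: continuous_maps_def)
  have "\<forall>\<^sub>s k. f k ` K \<subseteq> U" if K: "compactin X K" and U: "openin Y U" "g ` K \<subseteq> U" for K U
  proof -
    define W where "W k = {x \<in> topspace X. g x \<in> U \<and> (\<forall>n\<ge>k. f n x \<in> U)}" for k
    have "seq_open X (W k)" for k
      unfolding seq_open_def
    proof (intro conjI allI impI)
      show "W k \<subseteq> topspace X" by (auto simp: W_def)
      fix x l assume *: "l \<in> W k \<and> seqlim X x l"
      then have lx: "seqlim X x l" and lX: "l \<in> topspace X" by (auto simp: W_def)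
      have ev1: "\<forall>\<^sub>s m. x m \<in> topspace X \<and> h (x m) \<in> U"
        if "continuous_map X Y h" "h l \<in> U" for h
      proof -
        have "openin X {y \<in> topspace X. h y \<in> U}" using that(1) U(1) by (rule openin_continuous_map_preimage)
        then show ?thesis using lx that lX unfolding limitin_def by auto
      qed
      have evg: "\<forall>\<^sub>s m. x m \<in> topspace X \<and> g (x m) \<in> U"
        using * by (intro ev1 cg) (auto simp: W_def)
      have evf: "\<forall>\<^sub>s m. f n (x m) \<in> U" if "n \<ge> k" for n
        using ev1[OF cf, of n] * that by (auto simp: W_def elim: eventually_mono)
      \<comment> \<open>A single threshold is required for all n \<ge> k at once. If there is none,
        the bad pairs of indices can be arranged into one sequence that violates
        \<open>cc\<close>.\<close>
      have "\<exists>m0. \<forall>m\<ge>m0. \<forall>n\<ge>k. f n (x m) \<in> U"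
      proof (rule ccontr)
        assume "\<not> ?thesis"
        then have bad: "\<exists>m\<ge>m0. \<exists>n\<ge>k. f n (x m) \<notin> U" for m0 by blast
        \<comment> \<open>Each of the finitely many maps f n with k \<le> n < j is continuous and
          hence behaves along x from some index on, so a sufficiently late bad pair has n \<ge>
          j.\<close>
        have ex: "\<exists>n m. n \<ge> j \<and> m \<ge> j \<and> x m \<in> topspace X \<and> f n (x m) \<notin> U" for j
        proof -
          have "\<forall>\<^sub>s m. \<forall>n\<in>{k..<j}. f n (x m) \<in> U"
            using evf by (intro eventually_ball_finite) auto
          with evg have "\<forall>\<^sub>s m. (\<forall>n\<in>{k..<j}. f n (x m) \<in> U) \<and> x m \<in> topspace X"
            by eventually_elim blast
          then obtain m0 where m0: "\<And>m n. m \<ge> m0 \<Longrightarrow> n \<in> {k..<j} \<Longrightarrow> f n (x m) \<in> U"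
             "\<And>m. m \<ge> m0 \<Longrightarrow> x m \<in> topspace X"
            unfolding eventually_sequentially by blast
          obtain m n where "m \<ge> max m0 j" "n \<ge> k" "f n (x m) \<notin> U" using bad by blast
          then show ?thesis using m0 by (metis atLeastLessThan_iff max.bounded_iff not_le)
        qed
        then obtain p q where pq: "\<And>j. p j \<ge> j" "\<And>j. q j \<ge> j" "\<And>j. f (p j) (x (q j)) \<notin> U"
            "\<And>j. x (q j) \<in> topspace X" by metis
        \<comment> \<open>The bad point x (q j) is placed at position p j, and l everywhere else.
          Then y converges to l although f n (y n) leaves U for arbitrarily large n.\<close>
        define y where "y n = (if \<exists>j. p j = n then x (q (SOME j. p j = n)) else l)" for n
        have yp: "f (p j) (y (p j)) \<notin> U" for j
          unfolding y_def using pq(3) by (metis (mono_tags, lifting) someI_ex)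
        have ytop: "y n \<in> topspace X" for n unfolding y_def using pq(4) lX by auto
        have "\<forall>\<^sub>s n. y n \<in> V" if V: "openin X V" "l \<in> V" for V
        proof -
          have "\<forall>\<^sub>s m. x m \<in> V" using lx V unfolding limitin_def by blast
          then obtain m0 where m0: "\<And>m. m \<ge> m0 \<Longrightarrow> x m \<in> V" unfolding eventually_sequentially by blast
          \<comment> \<open>This exceeds p j for every j < m0, so a position n \<ge> n0 in the range
            of p comes only from indices j \<ge> m0.\<close>
          define n0 where "n0 = Suc (\<Sum>j<m0. p j)"
          have "y n \<in> V" if "n \<ge> n0" for n
          proof (cases "\<exists>j. p j = n")
            case True
            define j where "j = (SOME j. p j = n)"
            have pj: "p j = n" unfolding j_def using True by (rule someI_ex)
            have "j \<ge> m0"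
            proof (rule ccontr)
              assume "\<not> j \<ge> m0"
              then have "p j \<le> (\<Sum>j<m0. p j)" by (intro member_le_sum) auto
              then show False using pj \<open>n \<ge> n0\<close> by (simp add: n0_def)
            qed
            then have "x (q j) \<in> V" using m0 pq(2) order_trans by blast
            then show ?thesis using True by (simp add: y_def j_def)
          qed (use V in \<open>simp add: y_def\<close>)
          then show ?thesis unfolding eventually_sequentially by blast
        qed
        then have "seqlim X y l" using lX unfolding limitin_def by blast
        then have "seqlim Y (\<lambda>n. f n (y n)) (g l)" using ytop by (rule cc)
        moreover have "g l \<in> U" using * by (simp add: W_def)
        ultimately have "\<forall>\<^sub>s n. f n (y n) \<in> U" using U(1) unfolding limitin_def by blast
        then obtain n0 where "\<And>n. n \<ge> n0 \<Longrightarrow> f n (y n) \<in> U" unfolding eventually_sequentially by blast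
        then show False using yp pq(1) by blast
      qed
      then have "\<forall>\<^sub>s m. \<forall>n\<ge>k. f n (x m) \<in> U" unfolding eventually_sequentially .
      with evg show "\<forall>\<^sub>s m. x m \<in> W k"
        by eventually_elim (simp add: W_def)
    qed
    then have op: "openin X (W k)" for k using X unfolding sequential_space_def by blast
    have "K \<subseteq> \<Union>(range W)"
    proof
      fix x assume x: "x \<in> K"
      then have xX: "x \<in> topspace X" using K compactin_subset_topspace by blast
      then have "seqlim Y (\<lambda>k. f k x) (g x)"
        using cc[of "\<lambda>_. x" x] by simp
      moreover have "g x \<in> U" using U x by blast
      ultimately have "\<forall>\<^sub>s k. f k x \<in> U" using U(1) unfolding limitin_def by blast
      then obtain k where "\<And>n. n \<ge> k \<Longrightarrow> f n x \<in> U" unfolding eventually_sequentially by blast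
      then show "x \<in> \<Union>(range W)" using U x xX by (auto simp: W_def)
    qed
    then obtain \<F> where F: "finite \<F>" "\<F> \<subseteq> range W" "K \<subseteq> \<Union>\<F>"
      using K op unfolding compactin_def by (metis (no_types, lifting) imageE)
    obtain I where I: "finite I" "\<F> = W ` I" using F(1,2) by (meson finite_subset_image)
    \<comment> \<open>The sets W i increase with i, and the sum of the finite set I bounds each of
      its members.\<close>
    have "f n ` K \<subseteq> U" if n: "n \<ge> \<Sum>I" for n
    proof
      fix z assume "z \<in> f n ` K"
      then obtain x i where xi: "i \<in> I" "x \<in> W i" "z = f n x" using F(3) I by blast
      have "i \<le> \<Sum>I" using member_le_sum[of i I "\<lambda>x. x"] xi I by auto
      then show "z \<in> U" using xi n by (auto simp: W_def)
    qed
    then show ?thesis unfolding eventually_sequentially by blast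
  qed
  then show ?thesis
    using f g limitin_topspace[of "compact_open X Y"]
    unfolding compact_open_def limitin_generated
    by (auto simp flip: compact_open_def topology_generated_by_topspace)
qed

subsection \<open>Morphisms of PERs as relations\<close>

text \<open>The graph, on representatives, of a function between sets of classes.
  \<open>mk_mor\<close> and \<open>maps_to\<close> translate between the two views, so that later
  arguments chase numbers instead of classes.\<close>

definition is_map :: "per \<Rightarrow> per \<Rightarrow> (nat \<Rightarrow> nat \<Rightarrow> bool) \<Rightarrow> bool" where
  "is_map A B R \<longleftrightarrow> is_per A \<and> is_per B \<and>
     (\<forall>a b. R a b \<longrightarrow> (a, a) \<in> A \<and> (b, b) \<in> B) \<and>
     (\<forall>a a' b b'. R a b \<longrightarrow> (a, a') \<in> A \<longrightarrow> (b, b') \<in> B \<longrightarrow> R a' b') \<and>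
     (\<forall>a b b'. R a b \<longrightarrow> R a b' \<longrightarrow> (b, b') \<in> B) \<and>
     (\<forall>a. (a, a) \<in> A \<longrightarrow> (\<exists>b. R a b))"

definition mk_mor :: "per \<Rightarrow> per \<Rightarrow> (nat \<Rightarrow> nat \<Rightarrow> bool) \<Rightarrow> ods_mor" where
  "mk_mor A B R = (A, B, \<lambda>c\<in>classes A. {b. \<exists>a\<in>c. R a b})"

lemma per_sym: "is_per A \<Longrightarrow> (a, b) \<in> A \<Longrightarrow> (b, a) \<in> A"
  unfolding is_per_def by (meson symE)

lemma per_trans: "is_per A \<Longrightarrow> (a, b) \<in> A \<Longrightarrow> (b, c) \<in> A \<Longrightarrow> (a, c) \<in> A"
  unfolding is_per_def by (meson transE)

lemma per_refl: "is_per A \<Longrightarrow> (a, b) \<in> A \<Longrightarrow> (a, a) \<in> A \<and> (b, b) \<in> A"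
  by (meson per_sym per_trans)

lemma mem_classes: "is_per A \<Longrightarrow> c \<in> classes A \<longleftrightarrow> (\<exists>a. (a, a) \<in> A \<and> c = A `` {a})"
  unfolding classes_def quotient_def using per_refl by fastforce

lemma class_eq_iff: "is_per A \<Longrightarrow> (a, a) \<in> A \<Longrightarrow> A `` {a} = A `` {b} \<longleftrightarrow> (a, b) \<in> A"
  by (auto dest: per_sym per_trans)

lemma class_eq: "is_per A \<Longrightarrow> (a, b) \<in> A \<Longrightarrow> A `` {a} = A `` {b}"
  by (auto dest: per_sym per_trans)

lemma
  assumes R: "is_map A B R"
  shows mk_mor_in_mors: "mk_mor A B R \<in> ods_mors"
    and maps_to_mk_mor: "maps_to (mk_mor A B R) a b \<longleftrightarrow> R a b"
proof -
  have per: "is_per A" "is_per B" using R by (auto simp: is_map_def)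
  have val: "{b. \<exists>a'\<in>A `` {a}. R a' b} = B `` {b}" if "R a b" for a b
  proof (intro equalityI subsetI)
    fix c assume "c \<in> {b. \<exists>a'\<in>A `` {a}. R a' b}"
    then obtain a' where a': "(a, a') \<in> A" "R a' c" by blast
    then have "R a c" using R per per_sym per_refl unfolding is_map_def by metis
    then show "c \<in> B `` {b}" using R that unfolding is_map_def by blast
  next
    fix c assume "c \<in> B `` {b}"
    then show "c \<in> {b. \<exists>a'\<in>A `` {a}. R a' b}" using R that unfolding is_map_def by blast
  qed
  have "{b. \<exists>a\<in>c. R a b} \<in> classes B" if c: "c \<in> classes A" for c
  proof -
    obtain a where a: "(a, a) \<in> A" "c = A `` {a}" using c per mem_classes by blast
    then obtain b where "R a b" using R unfolding is_map_def by blast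
    moreover from this have "(b, b) \<in> B" using R unfolding is_map_def by blast
    ultimately show ?thesis using val a per mem_classes by blast
  qed
  then show "mk_mor A B R \<in> ods_mors"
    using per by (auto simp: ods_mors_def mk_mor_def)
  show "maps_to (mk_mor A B R) a b \<longleftrightarrow> R a b"
  proof
    assume "maps_to (mk_mor A B R) a b"
    then have *: "(a, a) \<in> A" "(b, b) \<in> B" "(\<lambda>c\<in>classes A. {b. \<exists>a\<in>c. R a b}) (A `` {a}) = B `` {b}"
      by (auto simp: maps_to_def mk_mor_def)
    moreover have "A `` {a} \<in> classes A" using * per mem_classes by blast
    ultimately have "{b. \<exists>a'\<in>A `` {a}. R a' b} = B `` {b}" by simp
    moreover obtain b' where "R a b'" using R * unfolding is_map_def by blast
    ultimately have "B `` {b'} = B `` {b}" using val by metis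
    then have "(b', b) \<in> B" using * per class_eq_iff per_sym by metis
    then show "R a b" using R \<open>R a b'\<close> * unfolding is_map_def by blast
  next
    assume Rab: "R a b"
    then have *: "(a, a) \<in> A" "(b, b) \<in> B" using R unfolding is_map_def by blast+
    moreover have "A `` {a} \<in> classes A" using * per mem_classes by blast
    ultimately show "maps_to (mk_mor A B R) a b" using val[OF Rab] by (simp add: maps_to_def mk_mor_def)
  qed
qed

lemma mk_mor_simps [simp]: "fst (mk_mor A B R) = A" "fst (snd (mk_mor A B R)) = B"
  by (simp_all add: mk_mor_def)

lemma ODS_simps [simp]:
  "Obj ODS = ods_objs" "Mor ODS = ods_mors" "Src ODS f = fst f" "Tgt ODS f = fst (snd f)"
  "ObjTop ODS = ods_obj_top" "MorTop ODS = ods_mor_top"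
  by (auto simp: ODS_def split: prod.splits)

lemma ods_mors_per: "f \<in> ods_mors \<Longrightarrow> is_per (fst f) \<and> is_per (fst (snd f))"
  by (auto simp: ods_mors_def)

lemma is_map_maps_to:
  assumes f: "f \<in> ods_mors"
  shows "is_map (fst f) (fst (snd f)) (maps_to f)"
proof -
  obtain A B g where fe: "f = (A, B, g)" by (cases f)
  have per: "is_per A" "is_per B" and g: "g \<in> classes A \<rightarrow>\<^sub>E classes B"
    using f fe by (auto simp: ods_mors_def)
  have f1: "\<exists>b. maps_to f a b" if "(a, a) \<in> A" for a
  proof -
    have "g (A `` {a}) \<in> classes B" using g that per mem_classes by (metis PiE_mem)
    then show ?thesis using fe that per mem_classes by (auto simp: maps_to_def)
  qed
  have f2: "maps_to f a' b'" if "maps_to f a b" "(a, a') \<in> A" "(b, b') \<in> B" for a a' b b'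
    using that per_refl[OF per(1) that(2)] per_refl[OF per(2) that(3)] class_eq[OF per(1) that(2)] class_eq[OF per(2) that(3)]
    by (simp add: maps_to_def fe)
  have f3: "(b, b') \<in> B" if "maps_to f a b" "maps_to f a b'" for a b b'
    using that class_eq_iff[OF per(2)] by (simp add: maps_to_def fe)
  have f4: "(a, a) \<in> A \<and> (b, b) \<in> B" if "maps_to f a b" for a b
    using that by (simp add: maps_to_def fe)
  have e: "fst f = A" "fst (snd f) = B" by (simp_all add: fe)
  show ?thesis unfolding is_map_def e
    by (intro conjI allI impI) (fact per | erule f1 | erule (2) f2 | erule (1) f3 | erule f4[THEN conjunct1] | erule f4[THEN conjunct2])+
qed

lemma maps_to_dom: "maps_to f a b \<Longrightarrow> (a, a) \<in> fst f"
  and maps_to_cod: "maps_to f a b \<Longrightarrow> (b, b) \<in> fst (snd f)"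
  by (auto simp: maps_to_def)

lemma maps_to_total: "f \<in> ods_mors \<Longrightarrow> (a, a) \<in> fst f \<Longrightarrow> \<exists>b. maps_to f a b"
  using is_map_maps_to unfolding is_map_def by blast

lemma maps_to_fun: "f \<in> ods_mors \<Longrightarrow> maps_to f a b \<Longrightarrow> maps_to f a b' \<Longrightarrow> (b, b') \<in> fst (snd f)"
  using is_map_maps_to unfolding is_map_def by blast

lemma maps_to_cong:
  "f \<in> ods_mors \<Longrightarrow> maps_to f a b \<Longrightarrow> (a, a') \<in> fst f \<Longrightarrow> (b, b') \<in> fst (snd f) \<Longrightarrow> maps_to f a' b'"
  using is_map_maps_to unfolding is_map_def by blast

lemma maps_to_fun2:
  "f \<in> ods_mors \<Longrightarrow> maps_to f a b \<Longrightarrow> maps_to f a' b' \<Longrightarrow> (a, a') \<in> fst f \<Longrightarrow> (b, b') \<in> fst (snd f)"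
  by (metis maps_to_cod maps_to_cong maps_to_fun)

text \<open>One inclusion of graphs suffices, because f is total and g is single-valued up to
  equivalence.\<close>

lemma ods_mor_eqI:
  assumes f: "f \<in> ods_mors" and g: "g \<in> ods_mors" and e: "fst f = fst g" "fst (snd f) = fst (snd g)"
    and le: "\<And>a b. maps_to f a b \<Longrightarrow> maps_to g a b"
  shows "f = g"
proof -
  obtain A B p q where fe: "f = (A, B, p)" "g = (A, B, q)" using e by (cases f; cases g) auto
  have per: "is_per A" "is_per B" and pq: "p \<in> classes A \<rightarrow>\<^sub>E classes B" "q \<in> classes A \<rightarrow>\<^sub>E classes B"
    using f g fe by (auto simp: ods_mors_def)
  have "p = q"
  proof (rule PiE_ext[OF pq])
    fix c assume "c \<in> classes A"
    then obtain a where a: "(a, a) \<in> A" "c = A `` {a}" using per mem_classes by blast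
    then obtain b where "maps_to f a b" using maps_to_total[OF f] fe by auto
    with le[OF this] show "p c = q c" using a by (simp add: maps_to_def fe)
  qed
  then show ?thesis using fe by simp
qed

lemma Idn_ODS: "is_per A \<Longrightarrow> Idn ODS A = mk_mor A A (\<lambda>a b. (a, b) \<in> A)"
proof -
  assume A: "is_per A"
  have "{b. \<exists>a\<in>c. (a, b) \<in> A} = c" if "c \<in> classes A" for c
  proof -
    obtain x where x: "(x, x) \<in> A" "c = A `` {x}" using \<open>c \<in> classes A\<close> mem_classes[OF A] by blast
    show ?thesis
    proof (intro equalityI subsetI)
      fix b assume "b \<in> {b. \<exists>a\<in>c. (a, b) \<in> A}"
      then show "b \<in> c" using x per_trans[OF A] by blast
    next
      fix b assume "b \<in> c"
      then show "b \<in> {b. \<exists>a\<in>c. (a, b) \<in> A}" using x by blast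
    qed
  qed
  then have "(\<lambda>c\<in>classes A. c) = (\<lambda>c\<in>classes A. {b. \<exists>a\<in>c. (a, b) \<in> A})"
    by (intro restrict_ext) simp
  then show ?thesis by (simp add: ODS_def mk_mor_def)
qed

lemma is_map_id: "is_per A \<Longrightarrow> is_map A A (\<lambda>a b. (a, b) \<in> A)"
  unfolding is_map_def by (auto intro: per_trans per_sym dest: per_refl)

lemma Idn_ODS_simps [simp]: "fst (Idn ODS A) = A" "fst (snd (Idn ODS A)) = A"
  by (simp_all add: ODS_def)

lemma Idn_in_mors: "is_per A \<Longrightarrow> Idn ODS A \<in> ods_mors"
  by (simp add: Idn_ODS is_map_id mk_mor_in_mors)

lemma maps_to_Idn: "is_per A \<Longrightarrow> maps_to (Idn ODS A) a b \<longleftrightarrow> (a, b) \<in> A"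
  by (simp add: Idn_ODS is_map_id maps_to_mk_mor)

lemma Comp_ODS_simps [simp]:
  "fst (Comp ODS g f) = fst f" "fst (snd (Comp ODS g f)) = fst (snd g)"
  by (auto simp: ODS_def split: prod.splits)

lemma
  assumes f: "f \<in> ods_mors" and g: "g \<in> ods_mors" and e: "fst g = fst (snd f)"
  shows Comp_in_mors: "Comp ODS g f \<in> ods_mors"
    and maps_to_Comp: "maps_to (Comp ODS g f) a c \<longleftrightarrow> (\<exists>b. maps_to f a b \<and> maps_to g b c)"
proof -
  obtain A B p where fe: "f = (A, B, p)" by (cases f)
  obtain C q where ge: "g = (B, C, q)" using e fe by (cases g) auto
  have per: "is_per A" "is_per B" "is_per C"
    and p: "p \<in> classes A \<rightarrow>\<^sub>E classes B" and q: "q \<in> classes B \<rightarrow>\<^sub>E classes C"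
    using f g fe ge by (auto simp: ods_mors_def)
  have ce: "Comp ODS g f = (A, C, compose (classes A) q p)"
    by (simp add: ODS_def fe ge)
  have "compose (classes A) q p \<in> classes A \<rightarrow>\<^sub>E classes C"
    using p q by (auto simp: compose_def)
  then show "Comp ODS g f \<in> ods_mors" using per by (auto simp: ce ods_mors_def)
  show "maps_to (Comp ODS g f) a c \<longleftrightarrow> (\<exists>b. maps_to f a b \<and> maps_to g b c)"
  proof
    assume "maps_to (Comp ODS g f) a c"
    then have *: "(a, a) \<in> A" "(c, c) \<in> C" "compose (classes A) q p (A `` {a}) = C `` {c}"
      by (auto simp: ce maps_to_def)
    obtain b where b: "maps_to f a b" using maps_to_total[OF f] * fe by auto
    have "A `` {a} \<in> classes A" using * per mem_classes by blast
    then have "q (B `` {b}) = C `` {c}" using b * by (simp add: compose_def maps_to_def fe)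
    then have "maps_to g b c" using b * by (simp add: maps_to_def ge fe)
    with b show "\<exists>b. maps_to f a b \<and> maps_to g b c" by blast
  next
    assume "\<exists>b. maps_to f a b \<and> maps_to g b c"
    then obtain b where b: "maps_to f a b" "maps_to g b c" by blast
    then have "A `` {a} \<in> classes A" using per mem_classes by (auto simp: maps_to_def fe)
    then show "maps_to (Comp ODS g f) a c"
      using b unfolding ce by (simp add: compose_def maps_to_def fe ge)
  qed
qed

text \<open>The topology records positive information only. This is why continuity proofs below
  amount to the persistence of finitely many facts.\<close>

lemma limitin_ods_obj:
  "seqlim ods_obj_top s A \<longleftrightarrow> A \<in> ods_objs \<and> (\<forall>\<^sub>s k. s k \<in> ods_objs) \<and>
     (\<forall>a a'. (a, a') \<in> A \<longrightarrow> (\<forall>\<^sub>s k. (a, a') \<in> s k))"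
proof -
  have "(\<forall>U\<in>{{A \<in> ods_objs. (a, a') \<in> A} |a a'. True}. Q U) \<longleftrightarrow> (\<forall>a a'. Q {A \<in> ods_objs. (a, a') \<in> A})"
    for Q :: "per set \<Rightarrow> bool" by blast
  then show ?thesis
    unfolding ods_obj_top_def limitin_generated ball_simps
    by (auto simp: eventually_conj_iff)
qed

lemma limitin_ods_mor:
  "seqlim ods_mor_top s f \<longleftrightarrow> f \<in> ods_mors \<and> (\<forall>\<^sub>s k. s k \<in> ods_mors) \<and>
     (\<forall>a b. maps_to f a b \<longrightarrow> (\<forall>\<^sub>s k. maps_to (s k) a b)) \<and>
     (\<forall>a a'. (a, a') \<in> fst f \<longrightarrow> (\<forall>\<^sub>s k. (a, a') \<in> fst (s k))) \<and>
     (\<forall>b b'. (b, b') \<in> fst (snd f) \<longrightarrow> (\<forall>\<^sub>s k. (b, b') \<in> fst (snd (s k))))"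
proof -
  have *: "{(A, B, f) \<in> ods_mors. Q A B} = {f \<in> ods_mors. Q (fst f) (fst (snd f))}" for Q :: "per \<Rightarrow> per \<Rightarrow> bool"
    by auto
  have "(\<forall>U\<in>{{f \<in> ods_mors. R f a b} |a b. True}. Q U) \<longleftrightarrow> (\<forall>a b. Q {f \<in> ods_mors. R f a b})"
    for Q :: "ods_mor set \<Rightarrow> bool" and R :: "ods_mor \<Rightarrow> nat \<Rightarrow> nat \<Rightarrow> bool" by blast
  moreover have ball_ins: "(\<forall>U\<in>insert A B. Q U) \<longleftrightarrow> Q A \<and> (\<forall>U\<in>B. Q U)" for A B and Q :: "ods_mor set \<Rightarrow> bool"
    by simp
  note ** = calculation[of maps_to] calculation[of "\<lambda>f a b. (a, b) \<in> fst f"] calculation[of "\<lambda>f a b. (a, b) \<in> fst (snd f)"]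
  show ?thesis
    unfolding ods_mor_top_def limitin_generated * ball_ins ball_Un **
    by (auto simp: eventually_conj_iff)
qed

lemma topspace_ods [simp]: "topspace ods_obj_top = ods_objs" "topspace ods_mor_top = ods_mors"
  unfolding ods_obj_top_def ods_mor_top_def topology_generated_by_topspace by auto

subsection \<open>Topological categories and functors into ODS\<close>

text \<open>What the category of models and the functor category over it have in common. The locale
  is used twice: for the models, and for the functor category itself when the double dual is
  formed.\<close>

locale tcat =
  fixes C :: "('o, 'm) top_cat"
  assumes top_Obj: "topspace (ObjTop C) = Obj C" and top_Mor: "topspace (MorTop C) = Mor C"
    and seq_Obj: "sequential_space (ObjTop C)" and seq_Mor: "sequential_space (MorTop C)"
    and cat: "category C"
    and src_lim: "seqlim (MorTop C) h h0 \<Longrightarrow> (\<And>k. h k \<in> Mor C) \<Longrightarrow>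
      seqlim (ObjTop C) (\<lambda>k. Src C (h k)) (Src C h0)"
    and tgt_lim: "seqlim (MorTop C) h h0 \<Longrightarrow> (\<And>k. h k \<in> Mor C) \<Longrightarrow>
      seqlim (ObjTop C) (\<lambda>k. Tgt C (h k)) (Tgt C h0)"
begin

abbreviation FC where "FC \<equiv> functor_cat C ODS"

lemma Src_Obj: "f \<in> Mor C \<Longrightarrow> Src C f \<in> Obj C" and Tgt_Obj: "f \<in> Mor C \<Longrightarrow> Tgt C f \<in> Obj C"
  using cat unfolding category_def by blast+

lemma Idn_Mor: "x \<in> Obj C \<Longrightarrow> Idn C x \<in> Mor C"
  and Src_Idn: "x \<in> Obj C \<Longrightarrow> Src C (Idn C x) = x" and Tgt_Idn: "x \<in> Obj C \<Longrightarrow> Tgt C (Idn C x) = x"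
  using cat unfolding category_def by blast+

lemma Comp_Mor: "f \<in> Mor C \<Longrightarrow> g \<in> Mor C \<Longrightarrow> Src C g = Tgt C f \<Longrightarrow> Comp C g f \<in> Mor C"
  and Src_Comp: "f \<in> Mor C \<Longrightarrow> g \<in> Mor C \<Longrightarrow> Src C g = Tgt C f \<Longrightarrow> Src C (Comp C g f) = Src C f"
  and Tgt_Comp: "f \<in> Mor C \<Longrightarrow> g \<in> Mor C \<Longrightarrow> Src C g = Tgt C f \<Longrightarrow> Tgt C (Comp C g f) = Tgt C g"
  using cat unfolding category_def by blast+

lemma lim_Obj: "seqlim (ObjTop C) x l \<Longrightarrow> l \<in> Obj C"
  using top_Obj limitin_topspace by fastforce

lemma lim_Mor: "seqlim (MorTop C) x l \<Longrightarrow> l \<in> Mor C"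
  using top_Mor limitin_topspace by fastforce

lemma FC_simps:
  "Src FC f = fst (snd f)" "Tgt FC f = snd (snd f)" "Idn FC F = ((\<lambda>x\<in>Obj C. Idn ODS (fst F x)), F, F)"
  "ObjTop FC = functor_obj_space C ODS" "MorTop FC = functor_mor_space C ODS"
  "Obj FC = topspace (functor_obj_space C ODS)" "Mor FC = topspace (functor_mor_space C ODS)"
  by (auto simp: functor_cat_def split: prod.splits)

lemma Comp_FC: "Comp FC g f = ((\<lambda>x\<in>Obj C. Comp ODS (fst g x) (fst f x)), fst (snd f), snd (snd g))"
  by (auto simp: functor_cat_def split: prod.splits)

lemma fobj_iff: "F \<in> Obj FC \<longleftrightarrow> continuous_functor C ODS F"
  by (cases F) (auto simp: FC_simps functor_obj_space_def continuous_functor_def is_functor_def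
        continuous_maps_def top_Obj top_Mor PiE_def)

lemma fmor_iff:
  "e \<in> Mor FC \<longleftrightarrow> continuous_nat_trans C ODS (fst (snd e)) (snd (snd e)) (fst e) \<and>
     fst (snd e) \<in> Obj FC \<and> snd (snd e) \<in> Obj FC"
  by (cases e) (auto simp: FC_simps functor_mor_space_def continuous_nat_trans_def nat_trans_def
        continuous_maps_def top_Obj PiE_def)

lemma fobj_per: "F \<in> Obj FC \<Longrightarrow> x \<in> Obj C \<Longrightarrow> is_per (fst F x)"
  unfolding fobj_iff continuous_functor_def is_functor_def by (auto simp: ods_objs_def Pi_iff PiE_iff)

lemma fobj_mor: "F \<in> Obj FC \<Longrightarrow> h \<in> Mor C \<Longrightarrow> snd F h \<in> ods_mors"
  and fobj_src: "F \<in> Obj FC \<Longrightarrow> h \<in> Mor C \<Longrightarrow> fst (snd F h) = fst F (Src C h)"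
  and fobj_tgt: "F \<in> Obj FC \<Longrightarrow> h \<in> Mor C \<Longrightarrow> fst (snd (snd F h)) = fst F (Tgt C h)"
  unfolding fobj_iff continuous_functor_def is_functor_def by auto

lemma fobj_id: "F \<in> Obj FC \<Longrightarrow> x \<in> Obj C \<Longrightarrow> maps_to (snd F (Idn C x)) a b \<longleftrightarrow> (a, b) \<in> fst F x"
  using fobj_per maps_to_Idn unfolding fobj_iff continuous_functor_def is_functor_def by auto

lemma fobj_comp:
  assumes F: "F \<in> Obj FC" and fg: "f \<in> Mor C" "g \<in> Mor C" "Src C g = Tgt C f"
  shows "maps_to (snd F (Comp C g f)) a c \<longleftrightarrow> (\<exists>b. maps_to (snd F f) a b \<and> maps_to (snd F g) b c)"
proof -
  have "snd F (Comp C g f) = Comp ODS (snd F g) (snd F f)"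
    using F fg unfolding fobj_iff continuous_functor_def is_functor_def by blast
  then show ?thesis
    using maps_to_Comp[OF fobj_mor[OF F fg(1)] fobj_mor[OF F fg(2)]] fobj_src[OF F fg(2)] fobj_tgt[OF F fg(1)] fg(3)
    by simp
qed

lemma fobj_limD: "F \<in> Obj FC \<Longrightarrow> seqlim (ObjTop C) x l \<Longrightarrow>
    seqlim ods_obj_top (\<lambda>k. fst F (x k)) (fst F l)"
  and fobj_lim_morD: "F \<in> Obj FC \<Longrightarrow> seqlim (MorTop C) h h0 \<Longrightarrow>
    seqlim ods_mor_top (\<lambda>k. snd F (h k)) (snd F h0)"
  unfolding fobj_iff continuous_functor_def
  by (auto dest: continuous_map_limit simp: o_def)

lemma fmor_mor: "e \<in> Mor FC \<Longrightarrow> x \<in> Obj C \<Longrightarrow> fst e x \<in> ods_mors"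
  and fmor_src: "e \<in> Mor FC \<Longrightarrow> x \<in> Obj C \<Longrightarrow> fst (fst e x) = fst (fst (snd e)) x"
  and fmor_tgt: "e \<in> Mor FC \<Longrightarrow> x \<in> Obj C \<Longrightarrow> fst (snd (fst e x)) = fst (snd (snd e)) x"
  and fmor_Src: "e \<in> Mor FC \<Longrightarrow> fst (snd e) \<in> Obj FC"
  and fmor_Tgt: "e \<in> Mor FC \<Longrightarrow> snd (snd e) \<in> Obj FC"
  unfolding fmor_iff continuous_nat_trans_def nat_trans_def by auto

lemma fmor_nat:
  assumes e: "e \<in> Mor FC" and h: "h \<in> Mor C"
    and m: "maps_to (snd (fst (snd e)) h) a b" "maps_to (fst e (Src C h)) a c" "maps_to (snd (snd (snd e)) h) c d"
  shows "maps_to (fst e (Tgt C h)) b d"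
proof -
  note o = fmor_Src[OF e] fmor_Tgt[OF e]
  have eq: "Comp ODS (fst e (Tgt C h)) (snd (fst (snd e)) h) = Comp ODS (snd (snd (snd e)) h) (fst e (Src C h))"
    using e h unfolding fmor_iff continuous_nat_trans_def nat_trans_def by blast
  note t = fmor_mor[OF e Tgt_Obj[OF h]] fmor_mor[OF e Src_Obj[OF h]] fobj_mor[OF o(1) h] fobj_mor[OF o(2) h]
  have "maps_to (Comp ODS (snd (snd (snd e)) h) (fst e (Src C h))) a d"
    using m by (subst maps_to_Comp) (auto simp: t fobj_src[OF o(2) h] fmor_tgt[OF e Src_Obj[OF h]])
  then have "maps_to (Comp ODS (fst e (Tgt C h)) (snd (fst (snd e)) h)) a d" by (simp add: eq)
  then obtain b' where b': "maps_to (snd (fst (snd e)) h) a b'" "maps_to (fst e (Tgt C h)) b' d"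
    by (subst (asm) maps_to_Comp) (auto simp: t fobj_tgt[OF o(1) h] fmor_src[OF e Tgt_Obj[OF h]])
  then have "(b', b) \<in> fst (fst e (Tgt C h))"
    using maps_to_fun[OF t(3) b'(1) m(1)] by (simp add: fobj_tgt[OF o(1) h] fmor_src[OF e Tgt_Obj[OF h]])
  moreover have "(d, d) \<in> fst (snd (fst e (Tgt C h)))" using b'(2) by (rule maps_to_cod)
  ultimately show ?thesis using maps_to_cong[OF t(1) b'(2)] by blast
qed

lemma fmor_limD: "e \<in> Mor FC \<Longrightarrow> seqlim (ObjTop C) x l \<Longrightarrow>
    seqlim ods_mor_top (\<lambda>k. fst e (x k)) (fst e l)"
  unfolding fmor_iff continuous_nat_trans_def
  by (auto dest: continuous_map_limit simp: o_def)

lemma fmor_eqI: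
  assumes e: "e \<in> Mor FC" "e' \<in> Mor FC" and s: "snd e = snd e'"
    and le: "\<And>x a b. x \<in> Obj C \<Longrightarrow> maps_to (fst e x) a b \<Longrightarrow> maps_to (fst e' x) a b"
  shows "e = e'"
proof -
  have "fst e = fst e'"
  proof (rule PiE_ext)
    show "fst e \<in> Obj C \<rightarrow>\<^sub>E ods_mors" "fst e' \<in> Obj C \<rightarrow>\<^sub>E ods_mors"
      using e unfolding fmor_iff continuous_nat_trans_def nat_trans_def by auto
    show "fst e x = fst e' x" if x: "x \<in> Obj C" for x
      by (rule ods_mor_eqI) (use x e s le in \<open>auto simp: fmor_mor fmor_src fmor_tgt\<close>)
  qed
  with s show ?thesis by (simp add: prod_eq_iff)
qed

text \<open>Functor and argument may vary together; this is continuous convergence as extracted from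
  the compact-open topology.\<close>

lemma lim_fobjD:
  assumes "seqlim (functor_obj_space C ODS) F G"
  shows "seqlim (ObjTop C) x l \<Longrightarrow> seqlim ods_obj_top (\<lambda>k. fst (F k) (x k)) (fst G l)"
    and "seqlim (MorTop C) h h0 \<Longrightarrow> seqlim ods_mor_top (\<lambda>k. snd (F k) (h k)) (snd G h0)"
  using assms unfolding functor_obj_space_def limitin_qcb_sub limitin_qcb_prod qcb_fun_def
  by (auto dest: limitin_compact_openD)

lemma lim_fobjI:
  assumes F: "\<And>k. F k \<in> Obj FC" and G: "G \<in> Obj FC"
    and obj: "\<And>x l. seqlim (ObjTop C) x l \<Longrightarrow> (\<And>k. x k \<in> Obj C) \<Longrightarrow>
       seqlim ods_obj_top (\<lambda>k. fst (F k) (x k)) (fst G l)"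
    and mor: "\<And>x l. seqlim (MorTop C) x l \<Longrightarrow> (\<And>k. x k \<in> Mor C) \<Longrightarrow>
       seqlim ods_mor_top (\<lambda>k. snd (F k) (x k)) (snd G l)"
  shows "seqlim (functor_obj_space C ODS) F G"
proof -
  have *: "fst H \<in> continuous_maps (ObjTop C) ods_obj_top \<and> snd H \<in> continuous_maps (MorTop C) ods_mor_top"
    if "H \<in> Obj FC" for H
    using that by (auto simp: FC_simps functor_obj_space_def)
  show ?thesis
    unfolding functor_obj_space_def limitin_qcb_sub limitin_qcb_prod qcb_fun_def limitin_sequentialization ODS_simps
  proof (intro conjI)
    show "G \<in> {F. continuous_functor C ODS F}" using G fobj_iff by simp
    show "\<forall>\<^sub>s k. F k \<in> {F. continuous_functor C ODS F}" using F fobj_iff by simp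
    show "seqlim (compact_open (ObjTop C) ods_obj_top) (\<lambda>k. fst (F k)) (fst G)"
      by (rule limitin_compact_openI) (use * F G obj seq_Obj top_Obj in auto)
    show "seqlim (compact_open (MorTop C) ods_mor_top) (\<lambda>k. snd (F k)) (snd G)"
      by (rule limitin_compact_openI) (use * F G mor seq_Mor top_Mor in auto)
  qed
qed

lemma lim_fmorD:
  assumes "seqlim (functor_mor_space C ODS) e e0"
  shows "seqlim (ObjTop C) x l \<Longrightarrow> seqlim ods_mor_top (\<lambda>k. fst (e k) (x k)) (fst e0 l)"
    and "seqlim (functor_obj_space C ODS) (\<lambda>k. fst (snd (e k))) (fst (snd e0))"
    and "seqlim (functor_obj_space C ODS) (\<lambda>k. snd (snd (e k))) (snd (snd e0))"
  using assms unfolding functor_mor_space_def limitin_qcb_sub limitin_qcb_prod qcb_fun_def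
  by (auto dest: limitin_compact_openD)

lemma lim_fmorI:
  assumes e: "\<And>k. e k \<in> Mor FC" and e0: "e0 \<in> Mor FC"
    and obj: "\<And>x l. seqlim (ObjTop C) x l \<Longrightarrow> (\<And>k. x k \<in> Obj C) \<Longrightarrow>
       seqlim ods_mor_top (\<lambda>k. fst (e k) (x k)) (fst e0 l)"
    and src: "seqlim (functor_obj_space C ODS) (\<lambda>k. fst (snd (e k))) (fst (snd e0))"
    and tgt: "seqlim (functor_obj_space C ODS) (\<lambda>k. snd (snd (e k))) (snd (snd e0))"
  shows "seqlim (functor_mor_space C ODS) e e0"
proof -
  have *: "fst d \<in> continuous_maps (ObjTop C) ods_mor_top" if "d \<in> Mor FC" for d
    using that by (auto simp: FC_simps functor_mor_space_def)
  show ?thesis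
    unfolding functor_mor_space_def limitin_qcb_sub limitin_qcb_prod qcb_fun_def limitin_sequentialization ODS_simps
  proof (intro conjI src tgt)
    show "e0 \<in> {(\<eta>, F, G). continuous_nat_trans C ODS F G \<eta>}" using e0 fmor_iff by (simp add: split_beta)
    show "\<forall>\<^sub>s k. e k \<in> {(\<eta>, F, G). continuous_nat_trans C ODS F G \<eta>}"
      using e fmor_iff by (simp add: split_beta)
    show "seqlim (compact_open (ObjTop C) ods_mor_top) (\<lambda>k. fst (e k)) (fst e0)"
      by (rule limitin_compact_openI) (use * e e0 obj seq_Obj top_Obj in auto)
  qed
qed

section \<open>Functors given by relations on numbers\<close>

definition mk_fun :: "('o \<Rightarrow> per) \<Rightarrow> ('m \<Rightarrow> nat \<Rightarrow> nat \<Rightarrow> bool) \<Rightarrow> ('o, 'm, per, ods_mor) fctr" where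
  "mk_fun A R = ((\<lambda>x\<in>Obj C. A x), (\<lambda>h\<in>Mor C. mk_mor (A (Src C h)) (A (Tgt C h)) (R h)))"

lemma continuous_mapsI_obj:
  assumes "\<And>x. x \<in> Obj C \<Longrightarrow> f x \<in> topspace Y"
    and "\<And>x l. seqlim (ObjTop C) x l \<Longrightarrow> (\<And>k. x k \<in> Obj C) \<Longrightarrow>
       seqlim Y (\<lambda>k. f (x k)) (f l)"
  shows "continuous_map (ObjTop C) Y f"
  by (rule continuous_map_sequentialI) (use assms seq_Obj top_Obj in auto)

lemma continuous_mapsI_mor:
  assumes "\<And>x. x \<in> Mor C \<Longrightarrow> f x \<in> topspace Y"
    and "\<And>x l. seqlim (MorTop C) x l \<Longrightarrow> (\<And>k. x k \<in> Mor C) \<Longrightarrow>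
       seqlim Y (\<lambda>k. f (x k)) (f l)"
  shows "continuous_map (MorTop C) Y f"
  by (rule continuous_map_sequentialI) (use assms seq_Mor top_Mor in auto)

definition fun_ok :: "('o \<Rightarrow> per) \<Rightarrow> ('m \<Rightarrow> nat \<Rightarrow> nat \<Rightarrow> bool) \<Rightarrow> bool" where
  "fun_ok A R \<longleftrightarrow> mk_fun A R \<in> Obj FC \<and> (\<forall>x\<in>Obj C. fst (mk_fun A R) x = A x) \<and>
     (\<forall>h\<in>Mor C. \<forall>a b. maps_to (snd (mk_fun A R) h) a b \<longleftrightarrow> R h a b)"

text \<open>Identities and composites are demanded in one direction only, since graph inclusion
  already forces equality of morphisms. Continuity becomes the persistence of single facts along
  convergent sequences.\<close>

lemma fun_okI:
  assumes per: "\<And>x. x \<in> Obj C \<Longrightarrow> is_per (A x)"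
    and map: "\<And>h. h \<in> Mor C \<Longrightarrow> is_map (A (Src C h)) (A (Tgt C h)) (R h)"
    and id: "\<And>x a b. x \<in> Obj C \<Longrightarrow> (a, b) \<in> A x \<Longrightarrow> R (Idn C x) a b"
    and comp: "\<And>f g a b c. f \<in> Mor C \<Longrightarrow> g \<in> Mor C \<Longrightarrow> Src C g = Tgt C f \<Longrightarrow> R f a b \<Longrightarrow> R g b c
        \<Longrightarrow> R (Comp C g f) a c"
    and obj: "\<And>x l a a'. seqlim (ObjTop C) x l \<Longrightarrow> (\<And>k. x k \<in> Obj C) \<Longrightarrow> (a, a') \<in> A l
        \<Longrightarrow> \<forall>\<^sub>s k. (a, a') \<in> A (x k)"
    and mor: "\<And>h h0 a b. seqlim (MorTop C) h h0 \<Longrightarrow> (\<And>k. h k \<in> Mor C) \<Longrightarrow> R h0 a b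
        \<Longrightarrow> \<forall>\<^sub>s k. R (h k) a b"
  shows "fun_ok A R"
proof -
  let ?F = "mk_fun A R"
  have f: "fst ?F x = A x" if "x \<in> Obj C" for x using that by (simp add: mk_fun_def)
  have s: "snd ?F h = mk_mor (A (Src C h)) (A (Tgt C h)) (R h)" if "h \<in> Mor C" for h
    using that by (simp add: mk_fun_def)
  have sm: "maps_to (snd ?F h) a b \<longleftrightarrow> R h a b" if "h \<in> Mor C" for h a b
    using s that maps_to_mk_mor map by simp
  have sin: "snd ?F h \<in> ods_mors" if "h \<in> Mor C" for h
    using s that mk_mor_in_mors map by simp
  have lim_o: "seqlim ods_obj_top (\<lambda>k. A (x k)) (A l)"
    if x: "seqlim (ObjTop C) x l" "\<And>k. x k \<in> Obj C" for x l
    using per obj[OF x] lim_Obj[OF x(1)] x(2) unfolding limitin_ods_obj ods_objs_def by simp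
  have "is_functor C ODS ?F"
    unfolding is_functor_def
  proof (intro conjI ballI impI)
    show "fst ?F \<in> Obj C \<rightarrow>\<^sub>E Obj ODS" using per by (auto simp: mk_fun_def ods_objs_def)
    show "snd ?F \<in> Mor C \<rightarrow>\<^sub>E Mor ODS" using sin by (auto simp: mk_fun_def)
    show "Src ODS (snd ?F h) = fst ?F (Src C h)" "Tgt ODS (snd ?F h) = fst ?F (Tgt C h)" if "h \<in> Mor C" for h
      using that s f Src_Obj Tgt_Obj by auto
    show "snd ?F (Idn C x) = Idn ODS (fst ?F x)" if x: "x \<in> Obj C" for x
    proof (rule ods_mor_eqI[symmetric])
      show "Idn ODS (fst ?F x) \<in> ods_mors" using Idn_in_mors per f x by simp
      show "snd ?F (Idn C x) \<in> ods_mors" using sin Idn_Mor x by simp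
      show "fst (Idn ODS (fst ?F x)) = fst (snd ?F (Idn C x))"
        "fst (snd (Idn ODS (fst ?F x))) = fst (snd (snd ?F (Idn C x)))"
        using s[OF Idn_Mor[OF x]] x f Src_Idn Tgt_Idn by simp_all
      show "maps_to (snd ?F (Idn C x)) a b" if "maps_to (Idn ODS (fst ?F x)) a b" for a b
        using that f x maps_to_Idn per id sm Idn_Mor by simp
    qed
    show "snd ?F (Comp C g f) = Comp ODS (snd ?F g) (snd ?F f)"
      if fg: "f \<in> Mor C" "g \<in> Mor C" "Src C g = Tgt C f" for f g
    proof (rule ods_mor_eqI[symmetric])
      have e: "fst (snd ?F g) = fst (snd (snd ?F f))" using s fg by simp
      show "Comp ODS (snd ?F g) (snd ?F f) \<in> ods_mors" using Comp_in_mors sin fg e by blast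
      show "snd ?F (Comp C g f) \<in> ods_mors" using fg sin Comp_Mor by blast
      show "maps_to (snd ?F (Comp C g f)) a c" if "maps_to (Comp ODS (snd ?F g) (snd ?F f)) a c" for a c
        using that fg comp[OF fg] sm Comp_Mor[OF fg] unfolding maps_to_Comp[OF sin[OF fg(1)] sin[OF fg(2)] e] by auto
    qed (use fg s Comp_Mor Src_Comp Tgt_Comp in auto)
  qed
  moreover have "continuous_map (ObjTop C) ods_obj_top (fst ?F)"
  proof (rule continuous_mapsI_obj)
    show "seqlim ods_obj_top (\<lambda>k. fst ?F (x k)) (fst ?F l)"
      if x: "seqlim (ObjTop C) x l" "\<And>k. x k \<in> Obj C" for x l
      using lim_o[OF x] f x(2) lim_Obj[OF x(1)] by simp
  qed (use f per in \<open>simp add: ods_objs_def\<close>)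
  moreover have "continuous_map (MorTop C) ods_mor_top (snd ?F)"
  proof (rule continuous_mapsI_mor)
    show "seqlim ods_mor_top (\<lambda>k. snd ?F (x k)) (snd ?F l)"
      if x: "seqlim (MorTop C) x l" "\<And>k. x k \<in> Mor C" for x l
      using lim_o[OF src_lim[OF x]] lim_o[OF tgt_lim[OF x]] mor[OF x] lim_Mor[OF x(1)] x(2) Src_Obj Tgt_Obj
      unfolding limitin_ods_mor limitin_ods_obj by (simp add: s maps_to_mk_mor mk_mor_in_mors map)
  qed (use sin in simp)
  ultimately have "mk_fun A R \<in> Obj FC" unfolding fobj_iff continuous_functor_def by simp
  with f sm show ?thesis unfolding fun_ok_def by blast
qed

lemma mk_fun_obj: "fun_ok A R \<Longrightarrow> mk_fun A R \<in> Obj FC"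
  and mk_fun_fst: "fun_ok A R \<Longrightarrow> x \<in> Obj C \<Longrightarrow> fst (mk_fun A R) x = A x"
  and mk_fun_snd: "fun_ok A R \<Longrightarrow> h \<in> Mor C \<Longrightarrow> maps_to (snd (mk_fun A R) h) a b \<longleftrightarrow> R h a b"
  unfolding fun_ok_def by blast+

section \<open>Natural transformations given by relations on numbers\<close>

definition mk_nt :: "('o, 'm, per, ods_mor) fctr \<Rightarrow> ('o, 'm, per, ods_mor) fctr \<Rightarrow> ('o \<Rightarrow> nat \<Rightarrow> nat \<Rightarrow> bool)
    \<Rightarrow> ('o, 'm, per, ods_mor) ntrans" where
  "mk_nt F G R = ((\<lambda>x\<in>Obj C. mk_mor (fst F x) (fst G x) (R x)), F, G)"

lemma mk_nt_simps [simp]: "fst (snd (mk_nt F G R)) = F" "snd (snd (mk_nt F G R)) = G" "snd (mk_nt F G R) = (F, G)"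
  by (simp_all add: mk_nt_def)

definition nt_ok :: "('o, 'm, per, ods_mor) fctr \<Rightarrow> ('o, 'm, per, ods_mor) fctr \<Rightarrow> ('o \<Rightarrow> nat \<Rightarrow> nat \<Rightarrow> bool) \<Rightarrow> bool" where
  "nt_ok F G R \<longleftrightarrow> mk_nt F G R \<in> Mor FC \<and>
     (\<forall>x\<in>Obj C. \<forall>a b. maps_to (fst (mk_nt F G R) x) a b \<longleftrightarrow> R x a b)"

text \<open>The naturality hypothesis is a plain implication on elements; both legs of the square
  are functions, so this already yields their equality.\<close>

lemma nt_okI:
  assumes F: "F \<in> Obj FC" and G: "G \<in> Obj FC"
    and map: "\<And>x. x \<in> Obj C \<Longrightarrow> is_map (fst F x) (fst G x) (R x)"
    and nat: "\<And>h a b c d. h \<in> Mor C \<Longrightarrow> maps_to (snd F h) a b \<Longrightarrow> R (Src C h) a c \<Longrightarrow> maps_to (snd G h) c d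
        \<Longrightarrow> R (Tgt C h) b d"
    and lim: "\<And>x l a b. seqlim (ObjTop C) x l \<Longrightarrow> (\<And>k. x k \<in> Obj C) \<Longrightarrow> R l a b
        \<Longrightarrow> \<forall>\<^sub>s k. R (x k) a b"
  shows "nt_ok F G R"
proof -
  let ?e = "fst (mk_nt F G R)"
  have s: "?e x = mk_mor (fst F x) (fst G x) (R x)" if "x \<in> Obj C" for x
    using that by (simp add: mk_nt_def)
  have sm: "maps_to (?e x) a b \<longleftrightarrow> R x a b" if "x \<in> Obj C" for x a b
    using s that maps_to_mk_mor map by simp
  have sin: "?e x \<in> ods_mors" if "x \<in> Obj C" for x
    using s that mk_mor_in_mors map by simp
  have "nat_trans C ODS F G ?e"
    unfolding nat_trans_def
  proof (intro conjI ballI)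
    show "?e \<in> Obj C \<rightarrow>\<^sub>E Mor ODS" using sin by (auto simp: mk_nt_def)
    show "Src ODS (?e x) = fst F x" "Tgt ODS (?e x) = fst G x" if "x \<in> Obj C" for x using that s by auto
    show "Comp ODS (?e (Tgt C h)) (snd F h) = Comp ODS (snd G h) (?e (Src C h))" if h: "h \<in> Mor C" for h
    proof (rule ods_mor_eqI)
      have e: "fst (?e (Tgt C h)) = fst (snd (snd F h))" "fst (snd G h) = fst (snd (?e (Src C h)))"
        using s h fobj_tgt[OF F h] fobj_src[OF G h] Src_Obj Tgt_Obj by auto
      note m = fobj_mor[OF F h] fobj_mor[OF G h] sin[OF Src_Obj[OF h]] sin[OF Tgt_Obj[OF h]]
      show "Comp ODS (?e (Tgt C h)) (snd F h) \<in> ods_mors" "Comp ODS (snd G h) (?e (Src C h)) \<in> ods_mors"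
        using Comp_in_mors m e by blast+
      fix a d assume "maps_to (Comp ODS (?e (Tgt C h)) (snd F h)) a d"
      then obtain b where b: "maps_to (snd F h) a b" "maps_to (?e (Tgt C h)) b d"
        using maps_to_Comp[OF m(1) m(4) e(1)] by blast
      have "(a, a) \<in> fst (?e (Src C h))"
        using maps_to_dom[OF b(1)] s[OF Src_Obj[OF h]] fobj_src[OF F h] by simp
      then obtain c where c: "maps_to (?e (Src C h)) a c" using maps_to_total m by blast
      then have "(c, c) \<in> fst (snd G h)" using maps_to_cod e by metis
      then obtain d' where d': "maps_to (snd G h) c d'" using maps_to_total m by blast
      have "R (Tgt C h) b d'" using nat[OF h b(1) _ d'] c sm Src_Obj h by blast
      then have "(d', d) \<in> fst (snd (?e (Tgt C h)))" using maps_to_fun[OF m(4) _ b(2)] sm Tgt_Obj h by blast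
      then have "(d', d) \<in> fst (snd (snd G h))" using s Tgt_Obj h fobj_tgt[OF G h] by simp
      then have "maps_to (snd G h) c d" using maps_to_cong[OF m(2) d'] maps_to_dom[OF d'] by blast
      with c show "maps_to (Comp ODS (snd G h) (?e (Src C h))) a d"
        using maps_to_Comp[OF m(3) m(2) e(2)] by blast
    qed (use h s fobj_src[OF F h] fobj_tgt[OF G h] Src_Obj Tgt_Obj in auto)
  qed
  moreover have "continuous_map (ObjTop C) ods_mor_top ?e"
  proof (rule continuous_mapsI_obj)
    show "seqlim ods_mor_top (\<lambda>k. ?e (x k)) (?e l)"
      if x: "seqlim (ObjTop C) x l" "\<And>k. x k \<in> Obj C" for x l
      using fobj_limD[OF F x(1)] fobj_limD[OF G x(1)] lim[OF x] lim_Obj[OF x(1)] x(2)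
      unfolding limitin_ods_mor limitin_ods_obj by (simp add: s maps_to_mk_mor mk_mor_in_mors map)
  qed (use sin in simp)
  ultimately have "mk_nt F G R \<in> Mor FC" unfolding fmor_iff continuous_nat_trans_def using F G by simp
  with sm show ?thesis unfolding nt_ok_def by blast
qed

lemma mk_nt_mor: "nt_ok F G R \<Longrightarrow> mk_nt F G R \<in> Mor FC"
  and maps_to_mk_nt: "nt_ok F G R \<Longrightarrow> x \<in> Obj C \<Longrightarrow> maps_to (fst (mk_nt F G R) x) a b \<longleftrightarrow> R x a b"
  unfolding nt_ok_def by blast+

text \<open>Here source, target and relation all move with k. This is the form required for the
  continuity of the comparison between \<Phi> and evaluation at its model.\<close>

lemma mk_nt_lim:
  assumes ok: "\<And>k. nt_ok (F k) (G k) (R k)" "nt_ok F0 G0 R0"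
    and F: "seqlim (functor_obj_space C ODS) F F0" and G: "seqlim (functor_obj_space C ODS) G G0"
    and lim: "\<And>x l a b. seqlim (ObjTop C) x l \<Longrightarrow> (\<And>k. x k \<in> Obj C) \<Longrightarrow> R0 l a b
        \<Longrightarrow> \<forall>\<^sub>s k. R k (x k) a b"
  shows "seqlim (functor_mor_space C ODS) (\<lambda>k. mk_nt (F k) (G k) (R k)) (mk_nt F0 G0 R0)"
proof (rule lim_fmorI)
  note m = mk_nt_mor[OF ok(1)] and m0 = mk_nt_mor[OF ok(2)]
  show "mk_nt (F k) (G k) (R k) \<in> Mor FC" "mk_nt F0 G0 R0 \<in> Mor FC" for k by (rule m m0)+
  fix x l assume x: "seqlim (ObjTop C) x l" "\<And>k. x k \<in> Obj C"
  note l = lim_Obj[OF x(1)]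
  show "seqlim ods_mor_top (\<lambda>k. fst (mk_nt (F k) (G k) (R k)) (x k)) (fst (mk_nt F0 G0 R0) l)"
    using lim_fobjD(1)[OF F x(1)] lim_fobjD(1)[OF G x(1)] lim[OF x] fmor_mor[OF m x(2)] fmor_mor[OF m0 l]
      fmor_src[OF m x(2)] fmor_src[OF m0 l] fmor_tgt[OF m x(2)] fmor_tgt[OF m0 l]
    unfolding limitin_ods_mor limitin_ods_obj by (simp add: maps_to_mk_nt[OF ok(1) x(2)] maps_to_mk_nt[OF ok(2) l])
qed (use F G in simp_all)

section \<open>The functor category as a topological category\<close>

lemma
  assumes e: "e \<in> Mor FC" and d: "d \<in> Mor FC" and s: "fst (snd d) = snd (snd e)"
  shows FC_Comp_mor: "Comp FC d e \<in> Mor FC"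
    and FC_maps_to_Comp: "x \<in> Obj C \<Longrightarrow>
      maps_to (fst (Comp FC d e) x) a c \<longleftrightarrow> (\<exists>b. maps_to (fst e x) a b \<and> maps_to (fst d x) b c)"
proof -
  let ?R = "\<lambda>x a c. \<exists>b. maps_to (fst e x) a b \<and> maps_to (fst d x) b c"
  have st: "fst (fst d x) = fst (snd (fst e x))" if "x \<in> Obj C" for x
    using that s fmor_src[OF d] fmor_tgt[OF e] by simp
  show *: "maps_to (fst (Comp FC d e) x) a c \<longleftrightarrow> ?R x a c" if x: "x \<in> Obj C" for x a c
    using x maps_to_Comp[OF fmor_mor[OF e x] fmor_mor[OF d x] st[OF x]] by (simp add: Comp_FC)
  have in_m: "Comp ODS (fst d x) (fst e x) \<in> ods_mors" if x: "x \<in> Obj C" for x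
    using Comp_in_mors[OF fmor_mor[OF e x] fmor_mor[OF d x] st[OF x]] .
  have map: "is_map (fst (fst (snd e)) x) (fst (snd (snd d)) x) (?R x)" if x: "x \<in> Obj C" for x
    using is_map_maps_to[OF in_m[OF x]] fmor_src[OF e x] fmor_tgt[OF d x]
    by (simp add: maps_to_Comp[OF fmor_mor[OF e x] fmor_mor[OF d x] st[OF x], abs_def])
  have nat: "?R (Tgt C h) b d'"
    if h: "h \<in> Mor C" "maps_to (snd (fst (snd e)) h) a b" "?R (Src C h) a c" "maps_to (snd (snd (snd d)) h) c d'"
    for h a b c d'
  proof -
    obtain m where m: "maps_to (fst e (Src C h)) a m" "maps_to (fst d (Src C h)) m c" using h by blast
    have "(m, m) \<in> fst (snd (snd (snd e)) h)"
      using maps_to_cod[OF m(1)] fmor_tgt[OF e] fobj_src[OF fmor_Tgt[OF e]] h Src_Obj by simp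
    then obtain m' where m': "maps_to (snd (snd (snd e)) h) m m'"
      using maps_to_total fobj_mor[OF fmor_Tgt[OF e]] h by blast
    have "maps_to (fst e (Tgt C h)) b m'" using fmor_nat[OF e h(1) h(2) m(1) m'] .
    moreover have "maps_to (fst d (Tgt C h)) m' d'" using fmor_nat[OF d h(1) _ m(2) h(4)] m' s by simp
    ultimately show ?thesis by blast
  qed
  have lim: "\<forall>\<^sub>s k. ?R (x k) a b"
    if x: "seqlim (ObjTop C) x l" "?R l a b" for x l a b
  proof -
    obtain m where m: "maps_to (fst e l) a m" "maps_to (fst d l) m b" using x by blast
    have "\<forall>\<^sub>s k. maps_to (fst e (x k)) a m" "\<forall>\<^sub>s k. maps_to (fst d (x k)) m b"
      using fmor_limD[OF e x(1)] fmor_limD[OF d x(1)] m unfolding limitin_ods_mor by blast+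
    then show ?thesis by eventually_elim blast
  qed
  have nt: "mk_nt (fst (snd e)) (snd (snd d)) ?R \<in> Mor FC"
    by (rule mk_nt_mor, rule nt_okI) (use fmor_Src[OF e] fmor_Tgt[OF d] map nat lim in blast)+
  have "mk_mor (fst (fst (snd e)) x) (fst (snd (snd d)) x) (?R x) = Comp ODS (fst d x) (fst e x)" if x: "x \<in> Obj C" for x
    by (rule ods_mor_eqI)
      (use x map in_m in \<open>auto simp: mk_mor_in_mors maps_to_mk_mor[OF map] fmor_src[OF e x] fmor_tgt[OF d x]
         maps_to_Comp[OF fmor_mor[OF e x] fmor_mor[OF d x] st[OF x]]\<close>)
  then have "mk_nt (fst (snd e)) (snd (snd d)) ?R = Comp FC d e"
    unfolding mk_nt_def Comp_FC by (auto intro!: restrict_ext)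
  with nt show "Comp FC d e \<in> Mor FC" by simp
qed

lemma FC_Src_Comp [simp]: "fst (snd (Comp FC d e)) = fst (snd e)" "snd (snd (Comp FC d e)) = snd (snd d)"
  by (simp_all add: Comp_FC)

lemma
  assumes F: "F \<in> Obj FC"
  shows FC_Idn_mor: "Idn FC F \<in> Mor FC"
    and FC_maps_to_Idn: "x \<in> Obj C \<Longrightarrow> maps_to (fst (Idn FC F) x) a b \<longleftrightarrow> (a, b) \<in> fst F x"
proof -
  show "maps_to (fst (Idn FC F) x) a b \<longleftrightarrow> (a, b) \<in> fst F x" if "x \<in> Obj C" for x a b
    using that fobj_per[OF F that] by (simp add: FC_simps maps_to_Idn)
  have "mk_nt F F (\<lambda>x a b. (a, b) \<in> fst F x) \<in> Mor FC"
  proof (rule mk_nt_mor, rule nt_okI)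
    show "is_map (fst F x) (fst F x) (\<lambda>a b. (a, b) \<in> fst F x)" if "x \<in> Obj C" for x
      using fobj_per[OF F that] by (rule is_map_id)
    show "(b, d) \<in> fst F (Tgt C h)"
      if "h \<in> Mor C" "maps_to (snd F h) a b" "(a, c) \<in> fst F (Src C h)" "maps_to (snd F h) c d" for h a b c d
      using maps_to_fun2[OF fobj_mor[OF F that(1)] that(2) that(4)] that(1,3) fobj_src[OF F] fobj_tgt[OF F] by simp
    show "\<forall>\<^sub>s k. (a, b) \<in> fst F (x k)"
      if "seqlim (ObjTop C) x l" "(a, b) \<in> fst F l" for x l a b
      using fobj_limD[OF F that(1)] that(2) unfolding limitin_ods_obj by blast
  qed (rule F)+
  moreover have "mk_nt F F (\<lambda>x a b. (a, b) \<in> fst F x) = Idn FC F"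
    unfolding mk_nt_def FC_simps using fobj_per[OF F] by (auto simp: Idn_ODS intro!: restrict_ext)
  ultimately show "Idn FC F \<in> Mor FC" by simp
qed

lemma FC_category: "category FC"
  unfolding category_def
proof (intro conjI ballI impI)
  show "Src FC f \<in> Obj FC" "Tgt FC f \<in> Obj FC" if "f \<in> Mor FC" for f
    using fmor_Src[OF that] fmor_Tgt[OF that] by (simp_all add: FC_simps(1,2))
  show "Idn FC F \<in> Mor FC" if "F \<in> Obj FC" for F using FC_Idn_mor[OF that] .
  show "Comp FC g f \<in> Mor FC" if "f \<in> Mor FC" "g \<in> Mor FC" "Src FC g = Tgt FC f" for f g
    using FC_Comp_mor that by (simp add: FC_simps(1,2))
  show "Comp FC f (Idn FC (Src FC f)) = f" if f: "f \<in> Mor FC" for f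
  proof (rule fmor_eqI)
    have i: "Idn FC (Src FC f) \<in> Mor FC" and S: "Src FC f \<in> Obj FC" "Src FC f = fst (snd f)"
      using FC_Idn_mor fmor_Src f by (simp_all add: FC_simps(1))
    have st: "fst (snd f) = snd (snd (Idn FC (Src FC f)))" by (simp add: FC_simps(1,3))
    show "Comp FC f (Idn FC (Src FC f)) \<in> Mor FC" using FC_Comp_mor[OF i f st] .
    show "snd (Comp FC f (Idn FC (Src FC f))) = snd f" by (simp add: Comp_FC FC_simps(1,3))
    fix x a b assume x: "x \<in> Obj C" "maps_to (fst (Comp FC f (Idn FC (Src FC f))) x) a b"
    then obtain c where c: "(a, c) \<in> fst (fst (snd f)) x" "maps_to (fst f x) c b"
      using FC_maps_to_Comp[OF i f st x(1)] FC_maps_to_Idn[OF S(1)] S(2) by auto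
    then have "(c, a) \<in> fst (fst f x)" using per_sym fobj_per[OF fmor_Src[OF f] x(1)] fmor_src[OF f x(1)] by simp
    then show "maps_to (fst f x) a b" using maps_to_cong[OF fmor_mor[OF f x(1)] c(2)] maps_to_cod[OF c(2)] by blast
  qed (rule f)
  show "Comp FC (Idn FC (Tgt FC f)) f = f" if f: "f \<in> Mor FC" for f
  proof (rule fmor_eqI)
    have i: "Idn FC (Tgt FC f) \<in> Mor FC" and S: "Tgt FC f \<in> Obj FC" "Tgt FC f = snd (snd f)"
      using FC_Idn_mor fmor_Tgt f by (simp_all add: FC_simps(2))
    have st: "fst (snd (Idn FC (Tgt FC f))) = snd (snd f)" by (simp add: FC_simps(2,3))
    show "Comp FC (Idn FC (Tgt FC f)) f \<in> Mor FC" using FC_Comp_mor[OF f i st] .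
    show "snd (Comp FC (Idn FC (Tgt FC f)) f) = snd f" by (simp add: Comp_FC FC_simps(2,3))
    fix x a b assume x: "x \<in> Obj C" "maps_to (fst (Comp FC (Idn FC (Tgt FC f)) f) x) a b"
    then obtain c where c: "maps_to (fst f x) a c" "(c, b) \<in> fst (snd (snd f)) x"
      using FC_maps_to_Comp[OF f i st x(1)] FC_maps_to_Idn[OF S(1)] S(2) by auto
    then have "(c, b) \<in> fst (snd (fst f x))" using fmor_tgt[OF f x(1)] by simp
    then show "maps_to (fst f x) a b" using maps_to_cong[OF fmor_mor[OF f x(1)] c(1)] maps_to_dom[OF c(1)] by blast
  qed (rule f)
  show "Comp FC h (Comp FC g f) = Comp FC (Comp FC h g) f"
    if m: "f \<in> Mor FC" "g \<in> Mor FC" "h \<in> Mor FC" and e: "Src FC g = Tgt FC f" "Src FC h = Tgt FC g" for f g h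
  proof (rule fmor_eqI)
    have e': "fst (snd g) = snd (snd f)" "fst (snd h) = snd (snd g)" using e by (simp_all add: FC_simps(1,2))
    note c1 = FC_Comp_mor[OF m(1,2) e'(1)] and c2 = FC_Comp_mor[OF m(2,3) e'(2)]
    have e2: "fst (snd h) = snd (snd (Comp FC g f))" "fst (snd (Comp FC h g)) = snd (snd f)" using e' by simp_all
    show "Comp FC h (Comp FC g f) \<in> Mor FC" "Comp FC (Comp FC h g) f \<in> Mor FC"
      using FC_Comp_mor[OF c1 m(3) e2(1)] FC_Comp_mor[OF m(1) c2 e2(2)] .
    show "maps_to (fst (Comp FC (Comp FC h g) f) x) a b"
      if x: "x \<in> Obj C" and "maps_to (fst (Comp FC h (Comp FC g f)) x) a b" for x a b
      using that(2) unfolding FC_maps_to_Comp[OF c1 m(3) e2(1) x] FC_maps_to_Comp[OF m(1) c2 e2(2) x]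
        FC_maps_to_Comp[OF m(1,2) e'(1) x] FC_maps_to_Comp[OF m(2,3) e'(2) x] by blast
  qed (simp add: prod_eq_iff)
qed (auto simp: FC_simps(1,2,3) Comp_FC)

text \<open>Closure of the locale under \<open>functor_cat\<close>; all results on functors into
  \<open>ODS\<close> thereby apply to functors on the functor category as well.\<close>

lemma FC_tcat: "tcat FC"
proof
  show "sequential_space (ObjTop FC)" "sequential_space (MorTop FC)"
    by (simp_all add: FC_simps functor_obj_space_def functor_mor_space_def)
  show "seqlim (ObjTop FC) (\<lambda>k. Src FC (h k)) (Src FC h0)"
    "seqlim (ObjTop FC) (\<lambda>k. Tgt FC (h k)) (Tgt FC h0)"
    if "seqlim (MorTop FC) h h0" for h h0
    using lim_fmorD(2,3)[of h h0] that unfolding FC_simps by blast+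
qed (use FC_category in \<open>simp_all add: FC_simps\<close>)

end

subsection \<open>Limits and colimits\<close>

lemma is_functorD:
  assumes "is_functor K L F"
  shows "x \<in> Obj K \<Longrightarrow> fst F x \<in> Obj L" "f \<in> Mor K \<Longrightarrow> snd F f \<in> Mor L"
    "f \<in> Mor K \<Longrightarrow> Src L (snd F f) = fst F (Src K f)" "f \<in> Mor K \<Longrightarrow> Tgt L (snd F f) = fst F (Tgt K f)"
    "x \<in> Obj K \<Longrightarrow> snd F (Idn K x) = Idn L (fst F x)"
    "f \<in> Mor K \<Longrightarrow> g \<in> Mor K \<Longrightarrow> Src K g = Tgt K f \<Longrightarrow> snd F (Comp K g f) = Comp L (snd F g) (snd F f)"
  using assms unfolding is_functor_def by (blast dest: PiE_mem)+

lemma is_functor_comp: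
  assumes F: "is_functor J K F" and G: "is_functor K L G" and J: "category J"
  shows "is_functor J L (comp_functor J G F)"
proof -
  have "\<And>f. f \<in> Mor J \<Longrightarrow> Src J f \<in> Obj J \<and> Tgt J f \<in> Obj J" "\<And>x. x \<in> Obj J \<Longrightarrow> Idn J x \<in> Mor J"
    "\<And>f g. f \<in> Mor J \<Longrightarrow> g \<in> Mor J \<Longrightarrow> Src J g = Tgt J f \<Longrightarrow> Comp J g f \<in> Mor J"
    using J unfolding category_def by blast+
  then show ?thesis
    unfolding is_functor_def comp_functor_def
    by (auto simp: compose_def is_functorD[OF F] is_functorD[OF G])
qed

lemma functor_cone:
  assumes J: "category J" and X: "is_functor J K X" and F: "is_functor K L F" and c: "cone J K X v \<pi>"
  shows "cone J L (comp_functor J F X) (fst F v) (\<lambda>j. snd F (\<pi> j))"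
proof -
  have "\<And>f. f \<in> Mor J \<Longrightarrow> Src J f \<in> Obj J \<and> Tgt J f \<in> Obj J"
    using J unfolding category_def by blast+
  moreover have "v \<in> Obj K" "\<And>j. j \<in> Obj J \<Longrightarrow> \<pi> j \<in> Mor K \<and> Src K (\<pi> j) = v \<and> Tgt K (\<pi> j) = fst X j"
    "\<And>u. u \<in> Mor J \<Longrightarrow> Comp K (snd X u) (\<pi> (Src J u)) = \<pi> (Tgt J u)"
    using c unfolding cone_def by blast+
  ultimately show ?thesis unfolding cone_def comp_functor_def
    by (auto simp: compose_def is_functorD[OF X] is_functorD(1-5)[OF F] simp flip: is_functorD(6)[OF F])
qed

lemma functor_cocone:
  assumes J: "category J" and X: "is_functor J K X" and F: "is_functor K L F" and c: "cocone J K X v \<pi>"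
  shows "cocone J L (comp_functor J F X) (fst F v) (\<lambda>j. snd F (\<pi> j))"
proof -
  have "\<And>f. f \<in> Mor J \<Longrightarrow> Src J f \<in> Obj J \<and> Tgt J f \<in> Obj J"
    using J unfolding category_def by blast+
  moreover have "v \<in> Obj K" "\<And>j. j \<in> Obj J \<Longrightarrow> \<pi> j \<in> Mor K \<and> Tgt K (\<pi> j) = v \<and> Src K (\<pi> j) = fst X j"
    "\<And>u. u \<in> Mor J \<Longrightarrow> Comp K (\<pi> (Tgt J u)) (snd X u) = \<pi> (Src J u)"
    using c unfolding cocone_def by blast+
  ultimately show ?thesis unfolding cocone_def comp_functor_def
    by (auto simp: compose_def is_functorD[OF X] is_functorD(1-5)[OF F] simp flip: is_functorD(6)[OF F])
qed

text \<open>The identity mediates the limit cone to itself, and mediating morphisms are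
  unique.\<close>

lemma limit_cone_endo:
  assumes K: "category K" and v: "limit_cone J K X v \<pi>"
    and q: "q \<in> Mor K" "Src K q = v" "Tgt K q = v" "\<And>j. j \<in> Obj J \<Longrightarrow> Comp K (\<pi> j) q = \<pi> j"
  shows "q = Idn K v"
proof -
  have c: "cone J K X v \<pi>" using v unfolding limit_cone_def by blast
  then have "v \<in> Obj K" "\<forall>j\<in>Obj J. Comp K (\<pi> j) (Idn K v) = \<pi> j"
    using K unfolding cone_def category_def by metis+
  moreover from this have "Idn K v \<in> Mor K" "Src K (Idn K v) = v" "Tgt K (Idn K v) = v"
    using K unfolding category_def by blast+
  ultimately show ?thesis using v c q unfolding limit_cone_def by blast
qed

lemma colimit_cocone_endo:
  assumes K: "category K" and v: "colimit_cocone J K X v \<iota>"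
    and q: "q \<in> Mor K" "Src K q = v" "Tgt K q = v" "\<And>j. j \<in> Obj J \<Longrightarrow> Comp K q (\<iota> j) = \<iota> j"
  shows "q = Idn K v"
proof -
  have c: "cocone J K X v \<iota>" using v unfolding colimit_cocone_def by blast
  then have "v \<in> Obj K" "\<forall>j\<in>Obj J. Comp K (Idn K v) (\<iota> j) = \<iota> j"
    using K unfolding cocone_def category_def by metis+
  moreover from this have "Idn K v \<in> Mor K" "Src K (Idn K v) = v" "Tgt K (Idn K v) = v"
    using K unfolding category_def by blast+
  ultimately show ?thesis using v c q unfolding colimit_cocone_def by blast
qed

text \<open>From t d = e s, a right inverse s' of s and a left inverse t' of t, cancelling on both
  sides gives t' e = d s'. It transfers naturality from the comparison to its inverse.\<close>

lemma natural_inverse: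
  assumes K: "category K" and m: "e \<in> Mor K" "d \<in> Mor K" "s \<in> Mor K" "s' \<in> Mor K" "t \<in> Mor K" "t' \<in> Mor K"
    and st: "Src K e = Tgt K s" "Src K s = Tgt K s'" "Src K t = Tgt K d" "Src K d = Tgt K s'" "Src K t' = Tgt K t" "Src K t' = Tgt K e"
    and inv: "Comp K s s' = Idn K (Src K e)" "Comp K t' t = Idn K (Tgt K d)" and nat: "Comp K t d = Comp K e s"
  shows "Comp K t' e = Comp K d s'"
proof -
  have a: "Comp K h (Comp K g f) = Comp K (Comp K h g) f"
    if "f \<in> Mor K" "g \<in> Mor K" "h \<in> Mor K" "Src K g = Tgt K f" "Src K h = Tgt K g" for f g h
    using K that unfolding category_def by blast
  have c: "Comp K g f \<in> Mor K \<and> Tgt K (Comp K g f) = Tgt K g" if "f \<in> Mor K" "g \<in> Mor K" "Src K g = Tgt K f" for f g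
    using K that unfolding category_def by blast
  have i: "Comp K e (Idn K (Src K e)) = e" "Comp K (Idn K (Tgt K d)) d = d" using K m unfolding category_def by blast+
  have "Comp K t' e = Comp K t' (Comp K (Comp K e s) s')" using i(1) a[OF m(4,3,1) st(2,1)] inv(1) by simp
  also have "\<dots> = Comp K t' (Comp K t (Comp K d s'))" unfolding nat[symmetric] using a[OF m(4,2,5) st(4,3)] by simp
  also have "\<dots> = Comp K (Comp K t' t) (Comp K d s')"
    using a[OF _ m(5,6) _ st(5)] c[OF m(4,2) st(4)] st(3) by simp
  also have "\<dots> = Comp K d s'" using K c[OF m(4,2) st(4)] inv(2) unfolding category_def by metis
  finally show ?thesis .
qed

section \<open>Limits and colimits of PERs in terms of elements\<close>

locale ods_diagram =
  fixes J :: "(nat, nat) cat" and D :: "(nat, nat, per, ods_mor) fctr"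
  assumes J: "category J" and D: "is_functor J ODS D"
begin

lemma st: "u \<in> Mor J \<Longrightarrow> Src J u \<in> Obj J" "u \<in> Mor J \<Longrightarrow> Tgt J u \<in> Obj J"
  using J unfolding category_def by blast+

lemma D_per: "j \<in> Obj J \<Longrightarrow> is_per (fst D j)"
  using D unfolding is_functor_def by (auto simp: ods_objs_def Pi_iff PiE_iff)

lemma D_mor: "u \<in> Mor J \<Longrightarrow> snd D u \<in> ods_mors"
  and D_src: "u \<in> Mor J \<Longrightarrow> fst (snd D u) = fst D (Src J u)"
  and D_tgt: "u \<in> Mor J \<Longrightarrow> fst (snd (snd D u)) = fst D (Tgt J u)"
  using D unfolding is_functor_def by auto

definition compat :: "(nat \<Rightarrow> nat) \<Rightarrow> bool" where
  "compat x \<longleftrightarrow> (\<forall>j\<in>Obj J. (x j, x j) \<in> fst D j) \<and>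
     (\<forall>u\<in>Mor J. maps_to (snd D u) (x (Src J u)) (x (Tgt J u)))"

definition elem_limit :: "per \<Rightarrow> (nat \<Rightarrow> ods_mor) \<Rightarrow> bool" where
  "elem_limit v \<pi> \<longleftrightarrow>
     (\<forall>x. compat x \<longrightarrow> (\<exists>y. (y, y) \<in> v \<and> (\<forall>j\<in>Obj J. maps_to (\<pi> j) y (x j)))) \<and>
     (\<forall>y y'. (y, y) \<in> v \<longrightarrow> (y', y') \<in> v \<longrightarrow>
        (\<forall>j\<in>Obj J. \<exists>x. maps_to (\<pi> j) y x \<and> maps_to (\<pi> j) y' x) \<longrightarrow> (y, y') \<in> v)"

definition mediate :: "per \<Rightarrow> (nat \<Rightarrow> ods_mor) \<Rightarrow> per \<Rightarrow> (nat \<Rightarrow> ods_mor) \<Rightarrow> nat \<Rightarrow> nat \<Rightarrow> bool" where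
  "mediate v \<pi> w \<rho> y z \<longleftrightarrow> (y, y) \<in> w \<and> (z, z) \<in> v \<and>
     (\<forall>j\<in>Obj J. \<exists>x. maps_to (\<rho> j) y x \<and> maps_to (\<pi> j) z x)"

lemma coneD:
  assumes "cone J ODS D v \<pi>"
  shows "is_per v" "j \<in> Obj J \<Longrightarrow> \<pi> j \<in> ods_mors" "j \<in> Obj J \<Longrightarrow> fst (\<pi> j) = v"
    "j \<in> Obj J \<Longrightarrow> fst (snd (\<pi> j)) = fst D j"
    "u \<in> Mor J \<Longrightarrow> maps_to (\<pi> (Src J u)) y x \<Longrightarrow> maps_to (\<pi> (Tgt J u)) y x' \<Longrightarrow> maps_to (snd D u) x x'"
proof -
  show p: "is_per v" and c: "\<And>j. j \<in> Obj J \<Longrightarrow> \<pi> j \<in> ods_mors" "\<And>j. j \<in> Obj J \<Longrightarrow> fst (\<pi> j) = v"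
    "\<And>j. j \<in> Obj J \<Longrightarrow> fst (snd (\<pi> j)) = fst D j"
    using assms unfolding cone_def by (auto simp: ods_objs_def)
  show "maps_to (snd D u) x x'"
    if u: "u \<in> Mor J" and m: "maps_to (\<pi> (Src J u)) y x" "maps_to (\<pi> (Tgt J u)) y x'"
  proof -
    have "Comp ODS (snd D u) (\<pi> (Src J u)) = \<pi> (Tgt J u)" using assms u unfolding cone_def by blast
    then have "maps_to (Comp ODS (snd D u) (\<pi> (Src J u))) y x'" using m by simp
    then obtain x2 where x2: "maps_to (\<pi> (Src J u)) y x2" "maps_to (snd D u) x2 x'"
      by (subst (asm) maps_to_Comp) (auto simp: c D_mor D_src st u)
    have "(x2, x) \<in> fst (snd D u)"
      using maps_to_fun[OF c(1)[OF st(1)[OF u]] x2(1) m(1)] c(3)[OF st(1)[OF u]] D_src[OF u] by simp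
    then show ?thesis using maps_to_cong[OF D_mor[OF u] x2(2)] maps_to_cod[OF x2(2)] by blast
  qed
qed

lemma
  assumes v: "cone J ODS D v \<pi>" "elem_limit v \<pi>" and w: "cone J ODS D w \<rho>"
  shows is_map_mediate: "is_map w v (mediate v \<pi> w \<rho>)"
    and mediate_comp: "j \<in> Obj J \<Longrightarrow> mediate v \<pi> w \<rho> y z \<Longrightarrow> maps_to (\<pi> j) z x \<Longrightarrow> maps_to (\<rho> j) y x"
proof -
  note v' = coneD[OF v(1)] and w' = coneD[OF w]
  show comp: "maps_to (\<rho> j) y x" if t: "j \<in> Obj J" "mediate v \<pi> w \<rho> y z" "maps_to (\<pi> j) z x" for j y z x
  proof -
    obtain x' where x': "maps_to (\<rho> j) y x'" "maps_to (\<pi> j) z x'" using t unfolding mediate_def by blast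
    have "(x', x) \<in> fst (snd (\<rho> j))"
      using maps_to_fun[OF v'(2)[OF t(1)] x'(2) t(3)] v'(4) w'(4) t(1) by simp
    then show ?thesis using maps_to_cong[OF w'(2)[OF t(1)] x'(1)] maps_to_dom[OF x'(1)] by blast
  qed
  show "is_map w v (mediate v \<pi> w \<rho>)"
    unfolding is_map_def
  proof (intro conjI allI impI)
    show "(a, a) \<in> w" "(b, b) \<in> v" if "mediate v \<pi> w \<rho> a b" for a b
      using that unfolding mediate_def by blast+
    show "mediate v \<pi> w \<rho> a' b'" if t: "mediate v \<pi> w \<rho> a b" "(a, a') \<in> w" "(b, b') \<in> v" for a b a' b'
      unfolding mediate_def
    proof (intro conjI ballI)
      show "(a', a') \<in> w" "(b', b') \<in> v" using t per_refl w'(1) v'(1) by blast+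
      fix j assume j: "j \<in> Obj J"
      then obtain x where x: "maps_to (\<rho> j) a x" "maps_to (\<pi> j) b x" using t unfolding mediate_def by blast
      then show "\<exists>x. maps_to (\<rho> j) a' x \<and> maps_to (\<pi> j) b' x"
        using maps_to_cong[OF w'(2)[OF j] x(1)] maps_to_cong[OF v'(2)[OF j] x(2)] t(2,3) w'(3)[OF j] v'(3)[OF j]
          maps_to_cod by blast
    qed
    show "(b, b') \<in> v" if t: "mediate v \<pi> w \<rho> a b" "mediate v \<pi> w \<rho> a b'" for a b b'
    proof -
      have "\<forall>j\<in>Obj J. \<exists>x. maps_to (\<pi> j) b x \<and> maps_to (\<pi> j) b' x"
      proof
        fix j assume j: "j \<in> Obj J"
        obtain x x' where x: "maps_to (\<rho> j) a x" "maps_to (\<pi> j) b x" "maps_to (\<rho> j) a x'" "maps_to (\<pi> j) b' x'"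
          using t j unfolding mediate_def by blast
        have "(x', x) \<in> fst (snd (\<pi> j))" using maps_to_fun[OF w'(2)[OF j] x(3,1)] w'(4)[OF j] v'(4)[OF j] by simp
        then have "maps_to (\<pi> j) b' x" using maps_to_cong[OF v'(2)[OF j] x(4)] maps_to_dom[OF x(4)] by blast
        with x show "\<exists>x. maps_to (\<pi> j) b x \<and> maps_to (\<pi> j) b' x" by blast
      qed
      then show ?thesis using v(2) t unfolding elem_limit_def mediate_def by blast
    qed
    show "\<exists>b. mediate v \<pi> w \<rho> a b" if a: "(a, a) \<in> w" for a
    proof -
      have "\<exists>x. maps_to (\<rho> j) a x" if "j \<in> Obj J" for j
        using maps_to_total w'(2,3) that a by metis
      then obtain x where x: "\<And>j. j \<in> Obj J \<Longrightarrow> maps_to (\<rho> j) a (x j)" by metis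
      have "compat x"
        unfolding compat_def
      proof (intro conjI ballI)
        show "(x j, x j) \<in> fst D j" if "j \<in> Obj J" for j using maps_to_cod[OF x[OF that]] w'(4)[OF that] by simp
        show "maps_to (snd D u) (x (Src J u)) (x (Tgt J u))" if "u \<in> Mor J" for u
          using w'(5)[OF that x[OF st(1)[OF that]] x[OF st(2)[OF that]]] .
      qed
      then obtain b where "(b, b) \<in> v" "\<And>j. j \<in> Obj J \<Longrightarrow> maps_to (\<pi> j) b (x j)"
        using v(2) unfolding elem_limit_def by blast
      then show ?thesis using a x unfolding mediate_def by blast
    qed
  qed (use v'(1) w'(1) in auto)
qed

lemma mediate_unique:
  assumes v: "cone J ODS D v \<pi>" and w: "cone J ODS D w \<rho>"
    and m: "m \<in> ods_mors" "fst m = w" "fst (snd m) = v"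
    and c: "\<And>j. j \<in> Obj J \<Longrightarrow> Comp ODS (\<pi> j) m = \<rho> j" and yz: "maps_to m y z"
  shows "mediate v \<pi> w \<rho> y z"
  unfolding mediate_def
proof (intro conjI ballI)
  note v' = coneD[OF v(1)]
  show "(y, y) \<in> w" "(z, z) \<in> v" using maps_to_dom[OF yz] maps_to_cod[OF yz] m by auto
  fix j assume j: "j \<in> Obj J"
  then obtain x where x: "maps_to (\<pi> j) z x" using maps_to_total[OF v'(2)[OF j]] v'(3)[OF j] \<open>(z, z) \<in> v\<close> by auto
  then have "maps_to (Comp ODS (\<pi> j) m) y x"
    by (subst maps_to_Comp) (use yz m v'(2,3) j in auto)
  with x c[OF j] show "\<exists>x. maps_to (\<rho> j) y x \<and> maps_to (\<pi> j) z x" by auto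
qed

lemma limit_coneI:
  assumes v: "cone J ODS D v \<pi>" "elem_limit v \<pi>"
  shows "limit_cone J ODS D v \<pi>"
  unfolding limit_cone_def
proof (intro conjI allI impI v)
  note v' = coneD[OF v(1)]
  fix w \<rho> assume w: "cone J ODS D w \<rho>"
  note w' = coneD[OF w] and map = is_map_mediate[OF v w]
  let ?m = "mk_mor w v (mediate v \<pi> w \<rho>)"
  note m_in = mk_mor_in_mors[OF map]
  show "\<exists>!m. m \<in> Mor ODS \<and> Src ODS m = w \<and> Tgt ODS m = v \<and> (\<forall>j\<in>Obj J. Comp ODS (\<pi> j) m = \<rho> j)"
  proof (rule ex1I[of _ ?m])
    show "?m \<in> Mor ODS \<and> Src ODS ?m = w \<and> Tgt ODS ?m = v \<and> (\<forall>j\<in>Obj J. Comp ODS (\<pi> j) ?m = \<rho> j)"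
    proof (intro conjI ballI)
      fix j assume j: "j \<in> Obj J"
      have e: "fst (\<pi> j) = fst (snd ?m)" using v'(3)[OF j] by simp
      show "Comp ODS (\<pi> j) ?m = \<rho> j"
      proof (rule ods_mor_eqI)
        show "Comp ODS (\<pi> j) ?m \<in> ods_mors" using Comp_in_mors[OF m_in v'(2)[OF j] e] .
        show "maps_to (\<rho> j) a b" if "maps_to (Comp ODS (\<pi> j) ?m) a b" for a b
          using that mediate_comp[OF v w j] unfolding maps_to_Comp[OF m_in v'(2)[OF j] e] maps_to_mk_mor[OF map] by blast
      qed (use w'(2-4)[OF j] v'(2-4)[OF j] in auto)
    qed (use m_in in auto)
    show "m = ?m" if m: "m \<in> Mor ODS \<and> Src ODS m = w \<and> Tgt ODS m = v \<and> (\<forall>j\<in>Obj J. Comp ODS (\<pi> j) m = \<rho> j)" for m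
    proof (rule ods_mor_eqI)
      show "maps_to ?m a b" if "maps_to m a b" for a b
        unfolding maps_to_mk_mor[OF map] by (rule mediate_unique[OF v(1) w _ _ _ _ that]) (use m in auto)
    qed (use m m_in in auto)
  qed
qed

text \<open>A compatible family is the same as a cone whose apex is the one-class PER on 0. The
  mediating morphism evaluated at 0 is the element sought.\<close>

lemma limit_coneD:
  assumes v: "limit_cone J ODS D v \<pi>" and x: "compat x"
  shows "\<exists>y. (y, y) \<in> v \<and> (\<forall>j\<in>Obj J. maps_to (\<pi> j) y (x j))"
proof -
  have cv: "cone J ODS D v \<pi>" using v unfolding limit_cone_def by blast
  note v' = coneD[OF cv]
  define w :: per where "w = {(0, 0)}"
  define \<rho> where "\<rho> j = mk_mor w (fst D j) (\<lambda>a b. a = 0 \<and> (x j, b) \<in> fst D j)" for j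
  have w: "is_per w" by (auto simp: w_def is_per_def sym_def trans_def)
  have map: "is_map w (fst D j) (\<lambda>a b. a = 0 \<and> (x j, b) \<in> fst D j)" if j: "j \<in> Obj J" for j
    unfolding is_map_def
  proof (intro conjI allI impI)
    show "is_per w" by (rule w)
    show "(a, a) \<in> w" "(b, b) \<in> fst D j" if "a = 0 \<and> (x j, b) \<in> fst D j" for a b
      using that per_refl[OF D_per[OF j]] by (auto simp: w_def)
    show "is_per (fst D j)" using D_per j .
    show "\<exists>b. a = 0 \<and> (x j, b) \<in> fst D j" if "(a, a) \<in> w" for a
      using that x j unfolding compat_def w_def by blast
    show "(b, b') \<in> fst D j" if "a = 0 \<and> (x j, b) \<in> fst D j" "a = 0 \<and> (x j, b') \<in> fst D j" for a b b'
      using that D_per[OF j] per_sym per_trans by meson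
    show "a' = 0" "(x j, b') \<in> fst D j"
      if "a = 0 \<and> (x j, b) \<in> fst D j" "(a, a') \<in> w" "(b, b') \<in> fst D j" for a a' b b'
      using that D_per[OF j] per_trans unfolding w_def by blast+
  qed
  have rho: "\<rho> j \<in> ods_mors" "fst (\<rho> j) = w" "fst (snd (\<rho> j)) = fst D j"
    "maps_to (\<rho> j) a b \<longleftrightarrow> a = 0 \<and> (x j, b) \<in> fst D j" if j: "j \<in> Obj J" for j a b
    unfolding \<rho>_def by (simp_all add: mk_mor_in_mors[OF map[OF j]] maps_to_mk_mor[OF map[OF j]])
  have "cone J ODS D w \<rho>"
    unfolding cone_def
  proof (intro conjI ballI)
    show "w \<in> Obj ODS" using w by (simp add: ods_objs_def)
    show "\<rho> j \<in> Mor ODS" "Src ODS (\<rho> j) = w" "Tgt ODS (\<rho> j) = fst D j" if "j \<in> Obj J" for j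
      using rho(1-3)[OF that] by simp_all
    fix u assume u: "u \<in> Mor J"
    note s = st[OF u]
    have e: "fst (snd D u) = fst (snd (\<rho> (Src J u)))" using D_src[OF u] rho(3)[OF s(1)] by simp
    show "Comp ODS (snd D u) (\<rho> (Src J u)) = \<rho> (Tgt J u)"
    proof (rule ods_mor_eqI)
      show "Comp ODS (snd D u) (\<rho> (Src J u)) \<in> ods_mors" using Comp_in_mors[OF rho(1)[OF s(1)] D_mor[OF u] e] .
      fix a c assume "maps_to (Comp ODS (snd D u) (\<rho> (Src J u))) a c"
      then obtain b where b: "a = 0" "(x (Src J u), b) \<in> fst D (Src J u)" "maps_to (snd D u) b c"
        unfolding maps_to_Comp[OF rho(1)[OF s(1)] D_mor[OF u] e] rho(4)[OF s(1)] by blast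
      have "maps_to (snd D u) (x (Src J u)) (x (Tgt J u))" using x u unfolding compat_def by blast
      from maps_to_fun2[OF D_mor[OF u] this b(3)] b show "maps_to (\<rho> (Tgt J u)) a c"
        unfolding rho(4)[OF s(2)] using D_src[OF u] D_tgt[OF u] by simp
    qed (use rho s D_tgt[OF u] in auto)
  qed
  then have "\<exists>!m. m \<in> Mor ODS \<and> Src ODS m = w \<and> Tgt ODS m = v \<and> (\<forall>j\<in>Obj J. Comp ODS (\<pi> j) m = \<rho> j)"
    using v unfolding limit_cone_def by blast
  then obtain m where m: "m \<in> ods_mors" "fst m = w" "fst (snd m) = v" "\<And>j. j \<in> Obj J \<Longrightarrow> Comp ODS (\<pi> j) m = \<rho> j"
    unfolding ODS_simps by blast
  obtain y where y: "maps_to m 0 y" using maps_to_total[OF m(1), of 0] m(2) by (auto simp: w_def)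
  have "maps_to (\<pi> j) y (x j)" if j: "j \<in> Obj J" for j
  proof -
    have e: "fst (\<pi> j) = fst (snd m)" using v'(3)[OF j] m by simp
    have "(x j, x j) \<in> fst D j" using x j unfolding compat_def by blast
    then have "maps_to (Comp ODS (\<pi> j) m) 0 (x j)" using rho(4)[OF j] m(4)[OF j] by simp
    then obtain y' where y': "maps_to m 0 y'" "maps_to (\<pi> j) y' (x j)"
      using maps_to_Comp[OF m(1) v'(2)[OF j] e] by blast
    have "(y', y) \<in> fst (\<pi> j)" using maps_to_fun[OF m(1) y'(1) y] e by simp
    then show ?thesis using maps_to_cong[OF v'(2)[OF j] y'(2)] maps_to_cod[OF y'(2)] by blast
  qed
  then show ?thesis using maps_to_cod[OF y] m by auto
qed

text \<open>The pair \<open>(j, x)\<close> stands for the element \<open>x\<close> of \<open>fst D j\<close>.\<close>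

inductive zz :: "nat \<times> nat \<Rightarrow> nat \<times> nat \<Rightarrow> bool" where
  zz_base: "j \<in> Obj J \<Longrightarrow> (x, x') \<in> fst D j \<Longrightarrow> zz (j, x) (j, x')"
| zz_step: "u \<in> Mor J \<Longrightarrow> maps_to (snd D u) x y \<Longrightarrow> zz (Src J u, x) (Tgt J u, y)"
| zz_sym: "zz p q \<Longrightarrow> zz q p"
| zz_trans: "zz p q \<Longrightarrow> zz q r \<Longrightarrow> zz p r"

lemma zz_dom: "zz p q \<Longrightarrow> fst p \<in> Obj J \<and> (snd p, snd p) \<in> fst D (fst p) \<and> fst q \<in> Obj J \<and> (snd q, snd q) \<in> fst D (fst q)"
proof (induction rule: zz.induct)
  case (zz_base j x x')
  then show ?case using per_refl[OF D_per] by auto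
next
  case (zz_step u x y)
  then show ?case
    using maps_to_dom[OF zz_step(2)] maps_to_cod[OF zz_step(2)] D_src[OF zz_step(1)] D_tgt[OF zz_step(1)] st by simp
qed auto

lemma coconeD:
  assumes "cocone J ODS D v \<iota>"
  shows "is_per v" "j \<in> Obj J \<Longrightarrow> \<iota> j \<in> ods_mors" "j \<in> Obj J \<Longrightarrow> fst (\<iota> j) = fst D j"
    "j \<in> Obj J \<Longrightarrow> fst (snd (\<iota> j)) = v"
    "zz p q \<Longrightarrow> maps_to (\<iota> (fst p)) (snd p) y \<longleftrightarrow> maps_to (\<iota> (fst q)) (snd q) y"
proof -
  show p: "is_per v" and c: "\<And>j. j \<in> Obj J \<Longrightarrow> \<iota> j \<in> ods_mors" "\<And>j. j \<in> Obj J \<Longrightarrow> fst (\<iota> j) = fst D j"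
    "\<And>j. j \<in> Obj J \<Longrightarrow> fst (snd (\<iota> j)) = v"
    using assms unfolding cocone_def by (auto simp: ods_objs_def)
  show "zz p q \<Longrightarrow> maps_to (\<iota> (fst p)) (snd p) y \<longleftrightarrow> maps_to (\<iota> (fst q)) (snd q) y"
  proof (induction rule: zz.induct)
    case (zz_base j x x')
    have "(x', x) \<in> fst D j" using per_sym[OF D_per] zz_base by blast
    then show ?case
      using maps_to_cong[OF c(1)[OF zz_base(1)], of x y x' y] maps_to_cong[OF c(1)[OF zz_base(1)], of x' y x y]
        maps_to_cod[of "\<iota> j"] zz_base c(2)[OF zz_base(1)] by auto
  next
    case (zz_step u x z)
    note s = st[OF zz_step(1)]
    have eq: "Comp ODS (\<iota> (Tgt J u)) (snd D u) = \<iota> (Src J u)" using assms zz_step(1) unfolding cocone_def by blast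
    have e: "fst (\<iota> (Tgt J u)) = fst (snd (snd D u))" using c(2)[OF s(2)] D_tgt zz_step(1) by simp
    note mc = maps_to_Comp[OF D_mor[OF zz_step(1)] c(1)[OF s(2)] e, unfolded eq]
    show ?case unfolding fst_conv snd_conv mc
    proof
      assume "\<exists>b. maps_to (snd D u) x b \<and> maps_to (\<iota> (Tgt J u)) b y"
      then obtain b where b: "maps_to (snd D u) x b" "maps_to (\<iota> (Tgt J u)) b y" by blast
      have "(b, z) \<in> fst (\<iota> (Tgt J u))" using maps_to_fun[OF D_mor[OF zz_step(1)] b(1) zz_step(2)] e by simp
      then show "maps_to (\<iota> (Tgt J u)) z y" using maps_to_cong[OF c(1)[OF s(2)] b(2)] maps_to_cod[OF b(2)] by blast
    qed (use zz_step in blast)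
  qed auto
qed

definition elem_colimit :: "per \<Rightarrow> (nat \<Rightarrow> ods_mor) \<Rightarrow> bool" where
  "elem_colimit v \<iota> \<longleftrightarrow>
     (\<forall>y. (y, y) \<in> v \<longrightarrow> (\<exists>j\<in>Obj J. \<exists>x. maps_to (\<iota> j) x y)) \<and>
     (\<forall>i\<in>Obj J. \<forall>j\<in>Obj J. \<forall>x x' y. maps_to (\<iota> i) x y \<longrightarrow> maps_to (\<iota> j) x' y \<longrightarrow> zz (i, x) (j, x'))"

text \<open>The mediating morphism sends y to the value of \<kappa> at any preimage of y. Two
  preimages are joined by a zigzag, along which every cocone is constant.\<close>

lemma colimit_coconeI:
  assumes v: "cocone J ODS D v \<iota>" "elem_colimit v \<iota>"
  shows "colimit_cocone J ODS D v \<iota>"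
  unfolding colimit_cocone_def
proof (intro conjI allI impI v)
  note v' = coconeD[OF v(1)]
  fix w \<kappa> assume w: "cocone J ODS D w \<kappa>"
  note w' = coconeD[OF w]
  define R where "R y z \<longleftrightarrow> (\<exists>j\<in>Obj J. \<exists>x. maps_to (\<iota> j) x y \<and> maps_to (\<kappa> j) x z)" for y z
  have R1: "maps_to (\<kappa> j) x z" if t: "R y z" "j \<in> Obj J" "maps_to (\<iota> j) x y" for j x y z
  proof -
    obtain i x' where i: "i \<in> Obj J" "maps_to (\<iota> i) x' y" "maps_to (\<kappa> i) x' z" using t unfolding R_def by blast
    have "zz (i, x') (j, x)" using v(2) i t unfolding elem_colimit_def by blast
    from w'(5)[OF this] i show ?thesis by simp
  qed
  have map: "is_map v w R"
    unfolding is_map_def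
  proof (intro conjI allI impI)
    show "(a, a) \<in> v" "(b, b) \<in> w" if "R a b" for a b
      using that v'(4) w'(4) maps_to_cod unfolding R_def by metis+
    show "R a' b'" if t: "R a b" "(a, a') \<in> v" "(b, b') \<in> w" for a b a' b'
    proof -
      obtain j x where j: "j \<in> Obj J" "maps_to (\<iota> j) x a" "maps_to (\<kappa> j) x b" using t unfolding R_def by blast
      have "maps_to (\<iota> j) x a'" "maps_to (\<kappa> j) x b'"
        using maps_to_cong[OF v'(2)[OF j(1)] j(2) maps_to_dom[OF j(2)]] v'(4)[OF j(1)]
          maps_to_cong[OF w'(2)[OF j(1)] j(3) maps_to_dom[OF j(3)]] w'(4)[OF j(1)] t by simp_all
      then show ?thesis using j unfolding R_def by blast
    qed
    show "(b, b') \<in> w" if t: "R a b" "R a b'" for a b b'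
    proof -
      obtain j x where j: "j \<in> Obj J" "maps_to (\<iota> j) x a" "maps_to (\<kappa> j) x b" using t unfolding R_def by blast
      have "maps_to (\<kappa> j) x b'" using R1[OF t(2) j(1,2)] .
      from maps_to_fun[OF w'(2)[OF j(1)] j(3) this] show ?thesis using w'(4)[OF j(1)] by simp
    qed
    show "\<exists>b. R a b" if a: "(a, a) \<in> v" for a
    proof -
      obtain j x where j: "j \<in> Obj J" "maps_to (\<iota> j) x a" using v(2) a unfolding elem_colimit_def by blast
      have "(x, x) \<in> fst (\<kappa> j)" using maps_to_dom[OF j(2)] v'(3) w'(3) j by simp
      then show ?thesis using maps_to_total[OF w'(2)[OF j(1)]] j unfolding R_def by blast
    qed
  qed (use v'(1) w'(1) in auto)
  let ?m = "mk_mor v w R"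
  note m_in = mk_mor_in_mors[OF map]
  show "\<exists>!m. m \<in> Mor ODS \<and> Src ODS m = v \<and> Tgt ODS m = w \<and> (\<forall>j\<in>Obj J. Comp ODS m (\<iota> j) = \<kappa> j)"
  proof (rule ex1I[of _ ?m])
    show "?m \<in> Mor ODS \<and> Src ODS ?m = v \<and> Tgt ODS ?m = w \<and> (\<forall>j\<in>Obj J. Comp ODS ?m (\<iota> j) = \<kappa> j)"
    proof (intro conjI ballI)
      fix j assume j: "j \<in> Obj J"
      have e: "fst ?m = fst (snd (\<iota> j))" using v'(4)[OF j] by simp
      show "Comp ODS ?m (\<iota> j) = \<kappa> j"
      proof (rule ods_mor_eqI)
        show "Comp ODS ?m (\<iota> j) \<in> ods_mors" using Comp_in_mors[OF v'(2)[OF j] m_in e] .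
        show "maps_to (\<kappa> j) a b" if "maps_to (Comp ODS ?m (\<iota> j)) a b" for a b
          using that R1[OF _ j] unfolding maps_to_Comp[OF v'(2)[OF j] m_in e] maps_to_mk_mor[OF map] by blast
      qed (use w'(2-4)[OF j] v'(2-4)[OF j] in auto)
    qed (use m_in in auto)
    show "m = ?m" if m: "m \<in> Mor ODS \<and> Src ODS m = v \<and> Tgt ODS m = w \<and> (\<forall>j\<in>Obj J. Comp ODS m (\<iota> j) = \<kappa> j)" for m
    proof (rule ods_mor_eqI)
      show "maps_to ?m a b" if ab: "maps_to m a b" for a b
      proof -
        have "(a, a) \<in> v" using maps_to_dom[OF ab] m by auto
        then obtain j x where j: "j \<in> Obj J" "maps_to (\<iota> j) x a" using v(2) unfolding elem_colimit_def by blast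
        then have "maps_to (Comp ODS m (\<iota> j)) x b"
          by (subst maps_to_Comp) (use m ab v' in auto)
        then have "maps_to (\<kappa> j) x b" using m j by simp
        then show ?thesis using j unfolding maps_to_mk_mor[OF map] R_def by blast
      qed
    qed (use m m_in in auto)
  qed
qed

end

context tcat
begin

lemma dual_obj_simps [simp]:
  "F \<in> Obj FC \<Longrightarrow> fst (dual_obj C M) F = fst F M" "e \<in> Mor FC \<Longrightarrow> snd (dual_obj C M) e = fst e M"
  by (simp_all add: dual_obj_def)

lemma FC_Comp_Idn: "e \<in> Mor FC \<Longrightarrow> Comp FC e (Idn FC (fst (snd e))) = e"
  and FC_Idn_Comp: "e \<in> Mor FC \<Longrightarrow> Comp FC (Idn FC (snd (snd e))) e = e"
  using FC_category unfolding category_def FC_simps(1,2) by blast+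

text \<open>Continuity of evaluation: convergence in the function spaces is applied to the constant
  sequence M.\<close>

lemma dual_obj_functor:
  assumes M: "M \<in> Obj C"
  shows "continuous_functor FC ODS (dual_obj C M)"
proof -
  interpret P: tcat FC by (rule FC_tcat)
  have c: "Comp FC g f \<in> Mor FC" if "f \<in> Mor FC" "g \<in> Mor FC" "Src FC g = Tgt FC f" for f g
    using that FC_Comp_mor by (simp add: FC_simps(1,2))
  have "is_functor FC ODS (dual_obj C M)"
    unfolding is_functor_def
  proof (intro conjI ballI impI)
    show "fst (dual_obj C M) \<in> Obj FC \<rightarrow>\<^sub>E Obj ODS" "snd (dual_obj C M) \<in> Mor FC \<rightarrow>\<^sub>E Mor ODS"
      using M fobj_per fmor_mor by (auto simp: dual_obj_def ods_objs_def)
    show "Src ODS (snd (dual_obj C M) f) = fst (dual_obj C M) (Src FC f)"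
      "Tgt ODS (snd (dual_obj C M) f) = fst (dual_obj C M) (Tgt FC f)" if "f \<in> Mor FC" for f
      using that M fmor_src fmor_tgt fmor_Src fmor_Tgt by (simp_all add: FC_simps(1,2))
    show "snd (dual_obj C M) (Idn FC F) = Idn ODS (fst (dual_obj C M) F)" if "F \<in> Obj FC" for F
      using that M FC_Idn_mor[OF that] by (simp add: FC_simps(3))
    show "snd (dual_obj C M) (Comp FC g f) = Comp ODS (snd (dual_obj C M) g) (snd (dual_obj C M) f)"
      if "f \<in> Mor FC" "g \<in> Mor FC" "Src FC g = Tgt FC f" for f g
      using that M c[OF that] by (simp add: Comp_FC)
  qed
  moreover have "continuous_map (ObjTop FC) (ObjTop ODS) (fst (dual_obj C M))"
  proof (rule P.continuous_mapsI_obj)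
    show "seqlim (ObjTop ODS) (\<lambda>k. fst (dual_obj C M) (F k)) (fst (dual_obj C M) G)"
      if "seqlim (ObjTop FC) F G" "\<And>k. F k \<in> Obj FC" for F G
      using lim_fobjD(1)[of F G "\<lambda>_. M" M] that P.lim_Obj[OF that(1)] M top_Obj by (simp add: FC_simps(4))
  qed (use M fobj_per in \<open>simp add: ods_objs_def\<close>)
  moreover have "continuous_map (MorTop FC) (MorTop ODS) (snd (dual_obj C M))"
  proof (rule P.continuous_mapsI_mor)
    show "seqlim (MorTop ODS) (\<lambda>k. snd (dual_obj C M) (F k)) (snd (dual_obj C M) G)"
      if "seqlim (MorTop FC) F G" "\<And>k. F k \<in> Mor FC" for F G
      using lim_fmorD(1)[of F G "\<lambda>_. M" M] that P.lim_Mor[OF that(1)] M top_Obj by (simp add: FC_simps(5))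
  qed (use M fmor_mor in simp)
  ultimately show ?thesis unfolding continuous_functor_def by blast
qed

end

section \<open>Limits and colimits of functors, computed pointwise\<close>

locale fc_diagram = tcat C for C :: "('o, 'm) top_cat" +
  fixes J :: "(nat, nat) cat" and D :: "(nat, nat, ('o, 'm, per, ods_mor) fctr, ('o, 'm, per, ods_mor) ntrans) fctr"
  assumes J: "category J" and D: "is_functor J FC D"
begin

lemma st: "u \<in> Mor J \<Longrightarrow> Src J u \<in> Obj J" "u \<in> Mor J \<Longrightarrow> Tgt J u \<in> Obj J"
  using J unfolding category_def by blast+

lemma D_obj: "j \<in> Obj J \<Longrightarrow> fst D j \<in> Obj FC"
  using D unfolding is_functor_def by (auto dest: PiE_mem)

lemma D_mor: "u \<in> Mor J \<Longrightarrow> snd D u \<in> Mor FC"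
  and D_src: "u \<in> Mor J \<Longrightarrow> fst (snd (snd D u)) = fst D (Src J u)"
  and D_tgt: "u \<in> Mor J \<Longrightarrow> snd (snd (snd D u)) = fst D (Tgt J u)"
  using D unfolding is_functor_def FC_simps(1,2) by (auto dest: PiE_mem)

abbreviation ev :: "'o \<Rightarrow> (nat, nat, per, ods_mor) fctr" where
  "ev N \<equiv> comp_functor J (dual_obj C N) D"

lemma ev_diagram: "N \<in> Obj C \<Longrightarrow> ods_diagram J (ev N)"
  using J D dual_obj_functor is_functor_comp unfolding ods_diagram_def continuous_functor_def by blast

lemma ev_simps [simp]:
  "j \<in> Obj J \<Longrightarrow> fst (ev N) j = fst (fst D j) N" "u \<in> Mor J \<Longrightarrow> snd (ev N) u = fst (snd D u) N"
  by (auto simp: comp_functor_def compose_def D_obj D_mor)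

lemma coneD:
  assumes "cone J FC D v \<pi>"
  shows "v \<in> Obj FC" "j \<in> Obj J \<Longrightarrow> \<pi> j \<in> Mor FC" "j \<in> Obj J \<Longrightarrow> fst (snd (\<pi> j)) = v"
    "j \<in> Obj J \<Longrightarrow> snd (snd (\<pi> j)) = fst D j"
  using assms unfolding cone_def FC_simps(1,2) by blast+

lemma ev_cone:
  assumes v: "cone J FC D v \<pi>" and N: "N \<in> Obj C"
  shows "cone J ODS (ev N) (fst v N) (\<lambda>j. fst (\<pi> j) N)"
proof -
  have "cone J ODS (ev N) (fst (dual_obj C N) v) (\<lambda>j. snd (dual_obj C N) (\<pi> j))"
    using functor_cone[OF J D _ v] dual_obj_functor[OF N] unfolding continuous_functor_def by blast
  then show ?thesis using coneD[OF v] by (auto simp: cone_def st)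
qed

lemma coconeD:
  assumes "cocone J FC D v \<pi>"
  shows "v \<in> Obj FC" "j \<in> Obj J \<Longrightarrow> \<pi> j \<in> Mor FC" "j \<in> Obj J \<Longrightarrow> snd (snd (\<pi> j)) = v"
    "j \<in> Obj J \<Longrightarrow> fst (snd (\<pi> j)) = fst D j"
  using assms unfolding cocone_def FC_simps(1,2) by blast+

lemma ev_cocone:
  assumes v: "cocone J FC D v \<pi>" and N: "N \<in> Obj C"
  shows "cocone J ODS (ev N) (fst v N) (\<lambda>j. fst (\<pi> j) N)"
proof -
  have "cocone J ODS (ev N) (fst (dual_obj C N) v) (\<lambda>j. snd (dual_obj C N) (\<pi> j))"
    using functor_cocone[OF J D _ v] dual_obj_functor[OF N] unfolding continuous_functor_def by blast
  then show ?thesis using coconeD[OF v] by (auto simp: cocone_def st)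
qed

text \<open>The mediating morphisms are formed separately at each N. That they vary continuously is
  where finiteness of the shape enters: agreement with the cone is then a finite conjunction of
  persistent facts.\<close>

lemma limit_cone_pointwise:
  assumes fin: "finite (Obj J)" and v: "cone J FC D v \<pi>"
    and lim: "\<And>N. N \<in> Obj C \<Longrightarrow> ods_diagram.elem_limit J (ev N) (fst v N) (\<lambda>j. fst (\<pi> j) N)"
  shows "limit_cone J FC D v \<pi>"
  unfolding limit_cone_def
proof (intro conjI allI impI v)
  note v' = coneD[OF v]
  fix w \<rho> assume w: "cone J FC D w \<rho>"
  note w' = coneD[OF w]
  define R where "R N = ods_diagram.mediate J (fst v N) (\<lambda>j. fst (\<pi> j) N) (fst w N) (\<lambda>j. fst (\<rho> j) N)" for N
  have R: "R N y z \<longleftrightarrow> (y, y) \<in> fst w N \<and> (z, z) \<in> fst v N \<and>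
     (\<forall>j\<in>Obj J. \<exists>x. maps_to (fst (\<rho> j) N) y x \<and> maps_to (fst (\<pi> j) N) z x)" if "N \<in> Obj C" for N y z
    unfolding R_def ods_diagram.mediate_def[OF ev_diagram[OF that]] ..
  have map: "is_map (fst w N) (fst v N) (R N)" if N: "N \<in> Obj C" for N
    unfolding R_def by (rule ods_diagram.is_map_mediate[OF ev_diagram ev_cone lim ev_cone]) (fact N v w)+
  have nat: "R (Tgt C h) b d"
    if h: "h \<in> Mor C" and m: "maps_to (snd w h) a b" "R (Src C h) a c" "maps_to (snd v h) c d" for h a b c d
    unfolding R[OF Tgt_Obj[OF h]]
  proof (intro conjI ballI)
    show "(b, b) \<in> fst w (Tgt C h)" "(d, d) \<in> fst v (Tgt C h)"
      using maps_to_cod[OF m(1)] maps_to_cod[OF m(3)] fobj_tgt v' w' h by simp_all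
    fix j assume j: "j \<in> Obj J"
    obtain x where x: "maps_to (fst (\<rho> j) (Src C h)) a x" "maps_to (fst (\<pi> j) (Src C h)) c x"
      using m(2) j R[OF Src_Obj[OF h]] by blast
    have "(x, x) \<in> fst (fst D j) (Src C h)"
      using maps_to_cod[OF x(1)] fmor_tgt[OF w'(2)[OF j] Src_Obj[OF h]] w'(4)[OF j] by simp
    then obtain x' where x': "maps_to (snd (fst D j) h) x x'"
      using maps_to_total[OF fobj_mor[OF D_obj[OF j] h]] fobj_src[OF D_obj[OF j] h] by auto
    show "\<exists>x. maps_to (fst (\<rho> j) (Tgt C h)) b x \<and> maps_to (fst (\<pi> j) (Tgt C h)) d x"
      using fmor_nat[OF w'(2)[OF j] h] fmor_nat[OF v'(2)[OF j] h] m x x' v'(3,4)[OF j] w'(3,4)[OF j] by metis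
  qed
  have limR: "\<forall>\<^sub>s k. R (x k) a b"
    if x: "seqlim (ObjTop C) x l" "\<And>k. x k \<in> Obj C" "R l a b" for x l a b
  proof -
    have l: "l \<in> Obj C" using lim_Obj x(1) .
    have "\<forall>\<^sub>s k. (a, a) \<in> fst w (x k)" "\<forall>\<^sub>s k. (b, b) \<in> fst v (x k)"
      using fobj_limD[OF w'(1) x(1)] fobj_limD[OF v'(1) x(1)] x(3) R[OF l] unfolding limitin_ods_obj by blast+
    moreover have "\<forall>\<^sub>s k. \<forall>j\<in>Obj J. \<exists>y. maps_to (fst (\<rho> j) (x k)) a y \<and> maps_to (fst (\<pi> j) (x k)) b y"
    proof (rule eventually_ball_finite[OF fin], rule ballI)
      fix j assume j: "j \<in> Obj J"
      then obtain y where y: "maps_to (fst (\<rho> j) l) a y" "maps_to (fst (\<pi> j) l) b y" using x(3) R[OF l] by blast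
      have "\<forall>\<^sub>s k. maps_to (fst (\<rho> j) (x k)) a y" "\<forall>\<^sub>s k. maps_to (fst (\<pi> j) (x k)) b y"
        using fmor_limD[OF w'(2)[OF j] x(1)] fmor_limD[OF v'(2)[OF j] x(1)] y unfolding limitin_ods_mor by blast+
      then show "\<forall>\<^sub>s k. \<exists>y. maps_to (fst (\<rho> j) (x k)) a y \<and> maps_to (fst (\<pi> j) (x k)) b y"
        by eventually_elim blast
    qed
    ultimately show ?thesis by eventually_elim (use R x(2) in blast)
  qed
  let ?m = "mk_nt w v R"
  have ok: "nt_ok w v R" by (rule nt_okI) (fact w'(1) v'(1) map nat limR)+
  note m_in = mk_nt_mor[OF ok] and m_rel = maps_to_mk_nt[OF ok]
  show "\<exists>!m. m \<in> Mor FC \<and> Src FC m = w \<and> Tgt FC m = v \<and> (\<forall>j\<in>Obj J. Comp FC (\<pi> j) m = \<rho> j)"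
    unfolding FC_simps(1,2)
  proof (rule ex1I[of _ ?m])
    show "?m \<in> Mor FC \<and> fst (snd ?m) = w \<and> snd (snd ?m) = v \<and> (\<forall>j\<in>Obj J. Comp FC (\<pi> j) ?m = \<rho> j)"
    proof (intro conjI ballI)
      show "?m \<in> Mor FC" by (rule m_in)
      fix j assume j: "j \<in> Obj J"
      have e: "fst (snd (\<pi> j)) = snd (snd ?m)" using v'(3)[OF j] by simp
      show "Comp FC (\<pi> j) ?m = \<rho> j"
      proof (rule fmor_eqI)
        show "Comp FC (\<pi> j) ?m \<in> Mor FC" using FC_Comp_mor[OF m_in v'(2)[OF j] e] .
        show "\<rho> j \<in> Mor FC" using w'(2) j .
        show "snd (Comp FC (\<pi> j) ?m) = snd (\<rho> j)" using v' w' j by (simp add: prod_eq_iff)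
        show "maps_to (fst (\<rho> j) x) a b" if x: "x \<in> Obj C" and ab: "maps_to (fst (Comp FC (\<pi> j) ?m) x) a b" for x a b
        proof -
          obtain c where "R x a c" "maps_to (fst (\<pi> j) x) c b"
            using ab unfolding FC_maps_to_Comp[OF m_in v'(2)[OF j] e x] m_rel[OF x] by blast
          then show ?thesis
            using ods_diagram.mediate_comp[OF ev_diagram[OF x] ev_cone[OF v x] lim[OF x] ev_cone[OF w x] j]
            unfolding R_def by blast
        qed
      qed
    qed simp_all
    fix m assume m: "m \<in> Mor FC \<and> fst (snd m) = w \<and> snd (snd m) = v \<and> (\<forall>j\<in>Obj J. Comp FC (\<pi> j) m = \<rho> j)"
    show "m = ?m"
    proof (rule fmor_eqI)
      show "snd m = snd ?m" using m by (simp add: prod_eq_iff)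
      fix x a b assume x: "x \<in> Obj C" and ab: "maps_to (fst m x) a b"
      have mm: "m \<in> Mor FC" using m by blast
      show "maps_to (fst ?m x) a b"
        unfolding m_rel[OF x] R_def
      proof (rule ods_diagram.mediate_unique[OF ev_diagram[OF x] ev_cone[OF v x] ev_cone[OF w x] _ _ _ _ ab])
        show "fst m x \<in> ods_mors" "fst (fst m x) = fst w x" "fst (snd (fst m x)) = fst v x"
          using fmor_mor[OF mm x] fmor_src[OF mm x] fmor_tgt[OF mm x] m by auto
        fix j assume "j \<in> Obj J"
        then have "fst (Comp FC (\<pi> j) m) x = fst (\<rho> j) x" using m by simp
        then show "Comp ODS (fst (\<pi> j) x) (fst m x) = fst (\<rho> j) x" using x by (simp add: Comp_FC)
      qed
    qed (use m m_in in auto)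
  qed
qed

text \<open>A finite family \<open>x\<^sub>j\<close> is coded by any number \<open>c\<close> with \<open>coord c j = x\<^sub>j\<close>.\<close>

definition coord :: "nat \<Rightarrow> nat \<Rightarrow> nat" where
  "coord c j = (if j < length (list_decode c) then list_decode c ! j else 0)"

lemma coord_ex: "finite I \<Longrightarrow> \<exists>c. \<forall>j\<in>I. coord c j = x j"
proof -
  assume "finite I"
  then obtain n where n: "\<forall>j\<in>I. j < n" using finite_nat_set_iff_bounded by blast
  then have "\<forall>j\<in>I. coord (list_encode (map x [0..<n])) j = x j"
    by (auto simp: coord_def)
  then show ?thesis by blast
qed

text \<open>The given limit cone is arbitrary, so it is compared with the functor W of coded
  compatible families. The universal property gives m from W to v, reading off coordinates gives b
  from v to W, and m b is the identity by uniqueness. The map m then represents every family at M,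
  and m b = id makes elements with the same family equivalent.\<close>

lemma ev_limit:
  assumes finO: "finite (Obj J)" and finM: "finite (Mor J)" and v: "limit_cone J FC D v \<pi>" and M: "M \<in> Obj C"
  shows "ods_diagram.elem_limit J (ev M) (fst v M) (\<lambda>j. fst (\<pi> j) M)"
proof -
  have cv: "cone J FC D v \<pi>" using v unfolding limit_cone_def by blast
  note v' = coneD[OF cv]
  define E where "E N c \<longleftrightarrow> ods_diagram.compat J (ev N) (coord c)" for N c
  have E: "E N c \<longleftrightarrow> (\<forall>j\<in>Obj J. (coord c j, coord c j) \<in> fst (fst D j) N) \<and>
     (\<forall>u\<in>Mor J. maps_to (fst (snd D u) N) (coord c (Src J u)) (coord c (Tgt J u)))" if "N \<in> Obj C" for N c
    unfolding E_def ods_diagram.compat_def[OF ev_diagram[OF that]] by simp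
  define A where "A N = {(c, c'). E N c \<and> E N c' \<and> (\<forall>j\<in>Obj J. (coord c j, coord c' j) \<in> fst (fst D j) N)}" for N
  define R where "R h c c' \<longleftrightarrow> E (Src C h) c \<and> E (Tgt C h) c' \<and>
      (\<forall>j\<in>Obj J. maps_to (snd (fst D j) h) (coord c j) (coord c' j))" for h c c'
  have Dper: "is_per (fst (fst D j) N)" if "N \<in> Obj C" "j \<in> Obj J" for N j
    using fobj_per[OF D_obj] that by blast
  have AI: "(c, c) \<in> A N \<longleftrightarrow> E N c" if "N \<in> Obj C" for N c using E that unfolding A_def by auto
  have Aper: "is_per (A N)" if N: "N \<in> Obj C" for N
    unfolding is_per_def
  proof (intro conjI symI transI)
    show "(c', c) \<in> A N" if "(c, c') \<in> A N" for c c' using that per_sym[OF Dper[OF N]] unfolding A_def by blast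
    show "(c, c'') \<in> A N" if "(c, c') \<in> A N" "(c', c'') \<in> A N" for c c' c''
      using that per_trans[OF Dper[OF N]] unfolding A_def by blast
  qed
  have Rmap: "is_map (A (Src C h)) (A (Tgt C h)) (R h)" if h: "h \<in> Mor C" for h
    unfolding is_map_def
  proof (intro conjI allI impI)
    note s = Src_Obj[OF h] and t = Tgt_Obj[OF h]
    note m = fobj_mor[OF D_obj h] and ms = fobj_src[OF D_obj h] and mt = fobj_tgt[OF D_obj h]
    show "is_per (A (Src C h))" "is_per (A (Tgt C h))" using Aper s t by blast+
    show "(a, a) \<in> A (Src C h)" "(b, b) \<in> A (Tgt C h)" if "R h a b" for a b
      using that AI s t unfolding R_def by blast+
    show "R h a' b'" if "R h a b" "(a, a') \<in> A (Src C h)" "(b, b') \<in> A (Tgt C h)" for a a' b b'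
      using that maps_to_cong[OF m] ms mt unfolding R_def A_def by auto
    show "(b, b') \<in> A (Tgt C h)" if "R h a b" "R h a b'" for a b b'
      using that maps_to_fun[OF m] mt unfolding R_def A_def by auto
    show "\<exists>b. R h a b" if a: "(a, a) \<in> A (Src C h)" for a
    proof -
      have Ea: "E (Src C h) a" using a AI s by blast
      then have "\<exists>y. maps_to (snd (fst D j) h) (coord a j) y" if "j \<in> Obj J" for j
        using maps_to_total[OF m[OF that]] ms[OF that] E[OF s] that by auto
      then obtain y where y: "\<And>j. j \<in> Obj J \<Longrightarrow> maps_to (snd (fst D j) h) (coord a j) (y j)" by metis
      obtain b where b: "\<And>j. j \<in> Obj J \<Longrightarrow> coord b j = y j" using coord_ex[OF finO] by blast
      have "E (Tgt C h) b"
        unfolding E[OF t]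
      proof (intro conjI ballI)
        show "(coord b j, coord b j) \<in> fst (fst D j) (Tgt C h)" if "j \<in> Obj J" for j
          using maps_to_cod[OF y[OF that]] mt[OF that] b[OF that] by simp
        fix u assume u: "u \<in> Mor J"
        have "maps_to (fst (snd D u) (Src C h)) (coord a (Src J u)) (coord a (Tgt J u))"
          using Ea E[OF s] u by blast
        from fmor_nat[OF D_mor[OF u] h _ this] y[OF st(1)[OF u]] y[OF st(2)[OF u]]
        show "maps_to (fst (snd D u) (Tgt C h)) (coord b (Src J u)) (coord b (Tgt J u))"
          using b st[OF u] D_src[OF u] D_tgt[OF u] by simp
      qed
      then show ?thesis using Ea y b unfolding R_def by auto
    qed
  qed
  have Rid: "R (Idn C x) a b" if x: "x \<in> Obj C" and ab: "(a, b) \<in> A x" for x a b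
    using ab fobj_id[OF D_obj x] unfolding R_def A_def Src_Idn[OF x] Tgt_Idn[OF x] by auto
  have Rcomp: "R (Comp C g f) a c"
    if fg: "f \<in> Mor C" "g \<in> Mor C" "Src C g = Tgt C f" and "R f a b" "R g b c" for f g a b c
    using that(4,5) fobj_comp[OF D_obj fg] unfolding R_def Src_Comp[OF fg] Tgt_Comp[OF fg] by auto
  \<comment> \<open>Being a compatible family is a conjunction over the objects and arrows of J;
    both sets are finite, so it persists.\<close>
  have Elim: "\<forall>\<^sub>s k. E (x k) c"
    if x: "seqlim (ObjTop C) x l" "\<And>k. x k \<in> Obj C" "E l c" for x l c
  proof -
    have l: "l \<in> Obj C" using lim_Obj x(1) .
    have "\<forall>\<^sub>s k. \<forall>j\<in>Obj J. (coord c j, coord c j) \<in> fst (fst D j) (x k)"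
      using fobj_limD[OF D_obj x(1)] x(3) E[OF l]
      unfolding limitin_ods_obj by (intro eventually_ball_finite[OF finO]) blast
    moreover have "\<forall>\<^sub>s k. \<forall>u\<in>Mor J. maps_to (fst (snd D u) (x k)) (coord c (Src J u)) (coord c (Tgt J u))"
      using fmor_limD[OF D_mor x(1)] x(3) E[OF l]
      unfolding limitin_ods_mor by (intro eventually_ball_finite[OF finM]) blast
    ultimately show ?thesis by eventually_elim (use E x(2) in blast)
  qed
  have Alim: "\<forall>\<^sub>s k. (a, a') \<in> A (x k)"
    if x: "seqlim (ObjTop C) x l" "\<And>k. x k \<in> Obj C" "(a, a') \<in> A l" for x l a a'
  proof -
    have "\<forall>\<^sub>s k. \<forall>j\<in>Obj J. (coord a j, coord a' j) \<in> fst (fst D j) (x k)"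
      using fobj_limD[OF D_obj x(1)] x(3)
      unfolding limitin_ods_obj A_def by (intro eventually_ball_finite[OF finO]) blast
    moreover have "\<forall>\<^sub>s k. E (x k) a" "\<forall>\<^sub>s k. E (x k) a'"
      using Elim[OF x(1,2)] x(3) unfolding A_def by blast+
    ultimately show ?thesis unfolding A_def by eventually_elim blast
  qed
  have Rlim: "\<forall>\<^sub>s k. R (h k) a b"
    if h: "seqlim (MorTop C) h h0" "\<And>k. h k \<in> Mor C" "R h0 a b" for h h0 a b
  proof -
    have "\<forall>\<^sub>s k. \<forall>j\<in>Obj J. maps_to (snd (fst D j) (h k)) (coord a j) (coord b j)"
      using fobj_lim_morD[OF D_obj h(1)] h(3)
      unfolding limitin_ods_mor R_def by (intro eventually_ball_finite[OF finO]) blast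
    moreover have "\<forall>\<^sub>s k. E (Src C (h k)) a" "\<forall>\<^sub>s k. E (Tgt C (h k)) b"
      using Elim[OF src_lim[OF h(1,2)]] Elim[OF tgt_lim[OF h(1,2)]] h(2,3) Src_Obj Tgt_Obj unfolding R_def by blast+
    ultimately show ?thesis unfolding R_def by eventually_elim blast
  qed
  let ?W = "mk_fun A R"
  have okW: "fun_ok A R" by (rule fun_okI) (fact Aper Rmap Rid Rcomp Alim Rlim)+
  note W = mk_fun_obj[OF okW] and W1 = mk_fun_fst[OF okW] and W2 = mk_fun_snd[OF okW]
  define K where "K j x c y \<longleftrightarrow> E x c \<and> (coord c j, y) \<in> fst (fst D j) x" for j x c y
  have Kmap: "is_map (fst ?W x) (fst (fst D j) x) (K j x)" if x: "x \<in> Obj C" and j: "j \<in> Obj J" for x j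
    unfolding is_map_def W1[OF x]
  proof (intro conjI allI impI)
    note p = Dper[OF x j]
    show "is_per (A x)" "is_per (fst (fst D j) x)" using Aper x p by blast+
    show "(a, a) \<in> A x" "(b, b) \<in> fst (fst D j) x" if "K j x a b" for a b
      using that AI[OF x] per_refl[OF p] unfolding K_def by blast+
    show "K j x a' b'" if "K j x a b" "(a, a') \<in> A x" "(b, b') \<in> fst (fst D j) x" for a a' b b'
      using that per_trans[OF p] per_sym[OF p] j unfolding K_def A_def by blast
    show "(b, b') \<in> fst (fst D j) x" if "K j x a b" "K j x a b'" for a b b'
      using that per_trans[OF p] per_sym[OF p] unfolding K_def by blast
    show "\<exists>b. K j x a b" if "(a, a) \<in> A x" for a
      using that AI[OF x] E[OF x] j unfolding K_def by blast
  qed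
  have Knat: "K j (Tgt C h) b d"
    if j: "j \<in> Obj J" and h: "h \<in> Mor C" and m: "maps_to (snd ?W h) a b" "K j (Src C h) a c" "maps_to (snd (fst D j) h) c d"
    for j h a b c d
  proof -
    have "R h a b" using m(1) W2[OF h] by blast
    then have "E (Tgt C h) b" "maps_to (snd (fst D j) h) (coord a j) (coord b j)" using j unfolding R_def by blast+
    moreover from maps_to_fun2[OF fobj_mor[OF D_obj[OF j] h] this(2) m(3)] m(2)
    have "(coord b j, d) \<in> fst (fst D j) (Tgt C h)"
      using fobj_src[OF D_obj[OF j] h] fobj_tgt[OF D_obj[OF j] h] unfolding K_def by simp
    ultimately show ?thesis unfolding K_def by blast
  qed
  have Klim: "\<forall>\<^sub>s k. K j (x k) a b"
    if j: "j \<in> Obj J" and x: "seqlim (ObjTop C) x l" "\<And>k. x k \<in> Obj C" "K j l a b" for j x l a b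
  proof -
    have "\<forall>\<^sub>s k. (coord a j, b) \<in> fst (fst D j) (x k)"
      using fobj_limD[OF D_obj[OF j] x(1)] x(3) unfolding limitin_ods_obj K_def by blast
    moreover have "\<forall>\<^sub>s k. E (x k) a" using Elim[OF x(1,2)] x(3) unfolding K_def by blast
    ultimately show ?thesis unfolding K_def by eventually_elim blast
  qed
  have okK: "nt_ok ?W (fst D j) (K j)" if j: "j \<in> Obj J" for j
    by (rule nt_okI) (fact W D_obj[OF j] Kmap[OF _ j] Knat[OF j] Klim[OF j])+
  define \<kappa> where "\<kappa> j = mk_nt ?W (fst D j) (K j)" for j
  have kap: "\<kappa> j \<in> Mor FC" "fst (snd (\<kappa> j)) = ?W" "snd (snd (\<kappa> j)) = fst D j" if j: "j \<in> Obj J" for j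
    unfolding \<kappa>_def using mk_nt_mor[OF okK[OF j]] by simp_all
  have kapr: "maps_to (fst (\<kappa> j) x) c y \<longleftrightarrow> K j x c y" if j: "j \<in> Obj J" and x: "x \<in> Obj C" for j x c y
    unfolding \<kappa>_def using maps_to_mk_nt[OF okK[OF j] x] .
  have cW: "cone J FC D ?W \<kappa>"
    unfolding cone_def FC_simps(1,2)
  proof (intro conjI ballI W kap)
    fix u assume u: "u \<in> Mor J"
    note s = st(1)[OF u] and t = st(2)[OF u]
    have e: "fst (snd (snd D u)) = snd (snd (\<kappa> (Src J u)))" using kap s D_src[OF u] by simp
    show "Comp FC (snd D u) (\<kappa> (Src J u)) = \<kappa> (Tgt J u)"
    proof (rule fmor_eqI)
      show "Comp FC (snd D u) (\<kappa> (Src J u)) \<in> Mor FC" using FC_Comp_mor[OF kap(1)[OF s] D_mor[OF u] e] .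
      show "\<kappa> (Tgt J u) \<in> Mor FC" using kap t by blast
      show "snd (Comp FC (snd D u) (\<kappa> (Src J u))) = snd (\<kappa> (Tgt J u))"
        using kap s t D_tgt[OF u] by (simp add: prod_eq_iff)
      fix x a b assume x: "x \<in> Obj C" and "maps_to (fst (Comp FC (snd D u) (\<kappa> (Src J u))) x) a b"
      then obtain c where c: "K (Src J u) x a c" "maps_to (fst (snd D u) x) c b"
        unfolding FC_maps_to_Comp[OF kap(1)[OF s] D_mor[OF u] e x] kapr[OF s x] by blast
      have "maps_to (fst (snd D u) x) (coord a (Src J u)) (coord a (Tgt J u))"
        using c(1) E[OF x] u unfolding K_def by blast
      from maps_to_fun2[OF fmor_mor[OF D_mor[OF u] x] this c(2)] c(1)
      show "maps_to (fst (\<kappa> (Tgt J u)) x) a b"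
        unfolding kapr[OF t x] K_def using fmor_src[OF D_mor[OF u] x] fmor_tgt[OF D_mor[OF u] x] D_src[OF u] D_tgt[OF u] by simp
    qed
  qed
  then obtain m where m: "m \<in> Mor FC" "fst (snd m) = ?W" "snd (snd m) = v" and mk: "\<And>j. j \<in> Obj J \<Longrightarrow> Comp FC (\<pi> j) m = \<kappa> j"
    using v unfolding limit_cone_def FC_simps(1,2) by blast
  have m_pi: "maps_to (fst (\<pi> j) x) y (coord c j)"
    if j: "j \<in> Obj J" and x: "x \<in> Obj C" and c: "maps_to (fst m x) c y" for j x c y
  proof -
    have e: "fst (snd (\<pi> j)) = snd (snd m)" using v'(3)[OF j] m by simp
    have "(c, c) \<in> fst ?W x" using maps_to_dom[OF c] fmor_src[OF m(1) x] m by simp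
    then have "E x c" using W1[OF x] AI[OF x] by simp
    then have "maps_to (fst (\<kappa> j) x) c (coord c j)" unfolding kapr[OF j x] K_def using E[OF x] j by blast
    then obtain y' where y': "maps_to (fst m x) c y'" "maps_to (fst (\<pi> j) x) y' (coord c j)"
      unfolding mk[OF j, symmetric] FC_maps_to_Comp[OF m(1) v'(2)[OF j] e x] by blast
    have "(y', y) \<in> fst (fst (\<pi> j) x)"
      using maps_to_fun[OF fmor_mor[OF m(1) x] y'(1) c] fmor_tgt[OF m(1) x] fmor_src[OF v'(2)[OF j] x] e by simp
    then show ?thesis using maps_to_cong[OF fmor_mor[OF v'(2)[OF j] x] y'(2)] maps_to_cod[OF y'(2)] by blast
  qed
  \<comment> \<open>The relation for b: the code c lists the coordinates of y in the given cone.
    Codes are not unique, but all codes of one family are equivalent in A.\<close>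
  define B where "B x y c \<longleftrightarrow> (y, y) \<in> fst v x \<and> E x c \<and> (\<forall>j\<in>Obj J. maps_to (fst (\<pi> j) x) y (coord c j))" for x y c
  have pm: "fst (\<pi> j) x \<in> ods_mors" "fst (fst (\<pi> j) x) = fst v x" "fst (snd (fst (\<pi> j) x)) = fst (fst D j) x"
    if "j \<in> Obj J" "x \<in> Obj C" for j x
    using fmor_mor[OF v'(2)] fmor_src[OF v'(2)] fmor_tgt[OF v'(2)] v'(3,4) that by auto
  have Btotal: "\<exists>c. B x y c" if x: "x \<in> Obj C" and y: "(y, y) \<in> fst v x" for x y
  proof -
    have "\<exists>z. maps_to (fst (\<pi> j) x) y z" if "j \<in> Obj J" for j
      using maps_to_total[OF pm(1)[OF that x]] pm(2)[OF that x] y by simp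
    then obtain z where z: "\<And>j. j \<in> Obj J \<Longrightarrow> maps_to (fst (\<pi> j) x) y (z j)" by metis
    obtain c where c: "\<And>j. j \<in> Obj J \<Longrightarrow> coord c j = z j" using coord_ex[OF finO] by blast
    have "E x c"
      unfolding E[OF x]
    proof (intro conjI ballI)
      show "(coord c j, coord c j) \<in> fst (fst D j) x" if j: "j \<in> Obj J" for j
        using maps_to_cod[OF z[OF j]] pm(3)[OF j x] c[OF j] by simp
      show "maps_to (fst (snd D u) x) (coord c (Src J u)) (coord c (Tgt J u))" if u: "u \<in> Mor J" for u
        using ods_diagram.coneD(5)[OF ev_diagram[OF x] ev_cone[OF cv x] u z[OF st(1)[OF u]] z[OF st(2)[OF u]]]
          c st[OF u] u by simp
    qed
    then show ?thesis using y z c unfolding B_def by auto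
  qed
  have Bmap: "is_map (fst v x) (fst ?W x) (B x)" if x: "x \<in> Obj C" for x
    unfolding is_map_def W1[OF x]
  proof (intro conjI allI impI)
    show "is_per (A x)" "is_per (fst v x)" using Aper[OF x] fobj_per[OF v'(1) x] .
    show "(a, a) \<in> fst v x" "(b, b) \<in> A x" if "B x a b" for a b
      using that AI[OF x] unfolding B_def by blast+
    show "B x a' b'" if "B x a b" "(a, a') \<in> fst v x" "(b, b') \<in> A x" for a a' b b'
      using that maps_to_cong[OF pm(1)[OF _ x]] pm(2,3)[OF _ x] per_refl[OF fobj_per[OF v'(1) x]]
      unfolding B_def A_def by (auto 4 3)
    show "(b, b') \<in> A x" if "B x a b" "B x a b'" for a b b'
      using that maps_to_fun[OF pm(1)[OF _ x]] pm(3)[OF _ x] unfolding B_def A_def by auto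
  qed (use Btotal x in blast)
  have Bnat: "B (Tgt C h) b d"
    if h: "h \<in> Mor C" and m: "maps_to (snd v h) a b" "B (Src C h) a c" "maps_to (snd ?W h) c d" for h a b c d
  proof -
    have "R h c d" using m W2[OF h] by blast
    then show ?thesis
      using m(1,2) maps_to_cod[OF m(1)] fobj_tgt[OF v'(1) h] fmor_nat[OF v'(2) h, of _ a b _ _] v'(3,4)
      unfolding B_def R_def by auto
  qed
  have Blim: "\<forall>\<^sub>s k. B (x k) a b"
    if x: "seqlim (ObjTop C) x l" "\<And>k. x k \<in> Obj C" "B l a b" for x l a b
  proof -
    have "\<forall>\<^sub>s k. \<forall>j\<in>Obj J. maps_to (fst (\<pi> j) (x k)) a (coord b j)"
      using fmor_limD[OF v'(2) x(1)] x(3)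
      unfolding limitin_ods_mor B_def by (intro eventually_ball_finite[OF finO]) blast
    moreover have "\<forall>\<^sub>s k. E (x k) b" using Elim[OF x(1,2)] x(3) unfolding B_def by blast
    moreover have "\<forall>\<^sub>s k. (a, a) \<in> fst v (x k)"
      using fobj_limD[OF v'(1) x(1)] x(3) unfolding limitin_ods_obj B_def by blast
    ultimately show ?thesis unfolding B_def by eventually_elim blast
  qed
  let ?b = "mk_nt v ?W B"
  have okB: "nt_ok v ?W B" by (rule nt_okI) (fact v'(1) W Bmap Bnat Blim)+
  note b_in = mk_nt_mor[OF okB] and b_rel = maps_to_mk_nt[OF okB]
  have eb: "fst (snd m) = snd (snd ?b)" using m by simp
  note mb = FC_Comp_mor[OF b_in m(1) eb]
  have mb_id: "Comp FC (\<pi> j) (Comp FC m ?b) = \<pi> j" if j: "j \<in> Obj J" for j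
  proof (rule fmor_eqI)
    have e: "fst (snd (\<pi> j)) = snd (snd (Comp FC m ?b))" using v'(3)[OF j] m by simp
    show "Comp FC (\<pi> j) (Comp FC m ?b) \<in> Mor FC" using FC_Comp_mor[OF mb v'(2)[OF j] e] .
    show "\<pi> j \<in> Mor FC" using v'(2) j .
    show "snd (Comp FC (\<pi> j) (Comp FC m ?b)) = snd (\<pi> j)" using v' j by (simp add: prod_eq_iff)
    fix x a d assume x: "x \<in> Obj C" and "maps_to (fst (Comp FC (\<pi> j) (Comp FC m ?b)) x) a d"
    then obtain b c where c: "B x a b" "maps_to (fst m x) b c" "maps_to (fst (\<pi> j) x) c d"
      unfolding FC_maps_to_Comp[OF mb v'(2)[OF j] e x] FC_maps_to_Comp[OF b_in m(1) eb x] b_rel[OF x] by blast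
    have "(coord b j, d) \<in> fst (snd (fst (\<pi> j) x))" using maps_to_fun[OF pm(1)[OF j x] m_pi[OF j x c(2)] c(3)] .
    moreover have "maps_to (fst (\<pi> j) x) a (coord b j)" using c(1) j unfolding B_def by blast
    ultimately show "maps_to (fst (\<pi> j) x) a d" using maps_to_cong[OF pm(1)[OF j x]] maps_to_dom by blast
  qed
  \<comment> \<open>After each projection of v the composite m b agrees with the identity.\<close>
  have "Comp FC m ?b = Idn FC v"
    by (rule limit_cone_endo[OF FC_category v mb]) (use mb_id m in \<open>simp_all add: FC_simps(1,2)\<close>)
  then have unB: "maps_to (fst m x) c y" if x: "x \<in> Obj C" and B: "B x y c" for x y c
  proof -
    have "(c, c) \<in> fst (fst m x)"
      using B AI[OF x] W1[OF x] fmor_src[OF m(1) x] m unfolding B_def by simp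
    then obtain y' where y': "maps_to (fst m x) c y'" using maps_to_total fmor_mor[OF m(1) x] by blast
    then have "maps_to (fst (Comp FC m ?b) x) y y'"
      unfolding FC_maps_to_Comp[OF b_in m(1) eb x] b_rel[OF x] using B by blast
    then have "(y, y') \<in> fst v x"
      unfolding \<open>Comp FC m ?b = Idn FC v\<close> FC_maps_to_Idn[OF v'(1) x] .
    then have "(y', y) \<in> fst (snd (fst m x))"
      using fmor_tgt[OF m(1) x] m per_sym[OF fobj_per[OF v'(1) x]] by simp
    then show ?thesis using maps_to_cong[OF fmor_mor[OF m(1) x] y'] maps_to_dom[OF y'] by blast
  qed
  show ?thesis
    unfolding ods_diagram.elem_limit_def[OF ev_diagram[OF M]]
  proof (intro conjI allI impI)
    fix x assume x: "ods_diagram.compat J (ev M) x"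
    obtain c where c: "\<And>j. j \<in> Obj J \<Longrightarrow> coord c j = x j" using coord_ex[OF finO] by blast
    have "E M c" using x c st unfolding E_def ods_diagram.compat_def[OF ev_diagram[OF M]] by simp
    then have "(c, c) \<in> fst (fst m M)" using AI[OF M] W1[OF M] fmor_src[OF m(1) M] m by simp
    then obtain y where y: "maps_to (fst m M) c y" using maps_to_total fmor_mor[OF m(1) M] by blast
    then show "\<exists>y. (y, y) \<in> fst v M \<and> (\<forall>j\<in>Obj J. maps_to (fst (\<pi> j) M) y (x j))"
      using m_pi[OF _ M y] c maps_to_cod[OF y] fmor_tgt[OF m(1) M] m by auto
  next
    fix y y' assume y: "(y, y) \<in> fst v M" "(y', y') \<in> fst v M"
      and eq: "\<forall>j\<in>Obj J. \<exists>x. maps_to (fst (\<pi> j) M) y x \<and> maps_to (fst (\<pi> j) M) y' x"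
    \<comment> \<open>A code of y is also a code of y', and m recovers both elements from
      it.\<close>
    obtain c where c: "B M y c" using Btotal[OF M y(1)] by blast
    have "B M y' c"
      unfolding B_def
    proof (intro conjI ballI)
      fix j assume j: "j \<in> Obj J"
      obtain x where x: "maps_to (fst (\<pi> j) M) y x" "maps_to (fst (\<pi> j) M) y' x" using eq j by blast
      have "maps_to (fst (\<pi> j) M) y (coord c j)" using c j unfolding B_def by blast
      from maps_to_fun[OF pm(1)[OF j M] x(1) this] show "maps_to (fst (\<pi> j) M) y' (coord c j)"
        using maps_to_cong[OF pm(1)[OF j M] x(2)] maps_to_dom[OF x(2)] by blast
    qed (use y c in \<open>auto simp: B_def\<close>)
    then show "(y, y') \<in> fst v M"
      using maps_to_fun[OF fmor_mor[OF m(1) M] unB[OF M c] unB[OF M]] fmor_tgt[OF m(1) M] m by simp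
  qed
qed

end

context fc_diagram
begin

text \<open>Dual comparison: W consists at N of coded pairs (j, x) modulo the zigzags of the diagram
  at N. The universal property gives m from v to W, the cocone gives b from W to v, and b m is the
  identity. Hence each element of v comes from the diagram, and elements with a common image in v
  are joined by a zigzag.\<close>

lemma ev_colimit:
  assumes v: "colimit_cocone J FC D v \<iota>" and M: "M \<in> Obj C"
  shows "ods_diagram.elem_colimit J (ev M) (fst v M) (\<lambda>j. fst (\<iota> j) M)"
proof -
  have cv: "cocone J FC D v \<iota>" using v unfolding colimit_cocone_def by blast
  note v' = coconeD[OF cv]
  define Z where "Z N = ods_diagram.zz J (ev N)" for N
  have Zbase: "Z N (j, x) (j, x')" if N: "N \<in> Obj C" and "j \<in> Obj J" "(x, x') \<in> fst (fst D j) N" for N j x x'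
    unfolding Z_def by (rule ods_diagram.zz_base[OF ev_diagram[OF N]]) (use that in auto)
  have Zstep: "Z N (Src J u, x) (Tgt J u, y)"
    if N: "N \<in> Obj C" and "u \<in> Mor J" "maps_to (fst (snd D u) N) x y" for N u x y
    unfolding Z_def by (rule ods_diagram.zz_step[OF ev_diagram[OF N]]) (use that in auto)
  have Zsym: "Z N q p" if N: "N \<in> Obj C" and "Z N p q" for N p q
    using ods_diagram.zz_sym[OF ev_diagram[OF N]] that unfolding Z_def by blast
  have Ztrans: "Z N p r" if N: "N \<in> Obj C" and "Z N p q" "Z N q r" for N p q r
    using ods_diagram.zz_trans[OF ev_diagram[OF N]] that unfolding Z_def by blast
  have Zdom: "fst p \<in> Obj J" "(snd p, snd p) \<in> fst (fst D (fst p)) N"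
    if N: "N \<in> Obj C" and "Z N p q" for N p q
    using ods_diagram.zz_dom[OF ev_diagram[OF N], of p q] that unfolding Z_def by auto
  have Zinduct: "P p q" if N: "N \<in> Obj C" and z: "Z N p q"
    and base: "\<And>j x x'. j \<in> Obj J \<Longrightarrow> (x, x') \<in> fst (fst D j) N \<Longrightarrow> P (j, x) (j, x')"
    and step: "\<And>u x y. u \<in> Mor J \<Longrightarrow> maps_to (fst (snd D u) N) x y \<Longrightarrow> P (Src J u, x) (Tgt J u, y)"
    and sym: "\<And>p q. Z N p q \<Longrightarrow> P p q \<Longrightarrow> P q p"
    and trans: "\<And>p q r. Z N p q \<Longrightarrow> P p q \<Longrightarrow> Z N q r \<Longrightarrow> P q r \<Longrightarrow> P p r" for P N p q
  proof -
    interpret N: ods_diagram J "ev N" using N by (rule ev_diagram)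
    show ?thesis
      using z unfolding Z_def
    proof (induction rule: N.zz.induct)
      case (zz_base j x x') then show ?case using base by simp
    next
      case (zz_step u x y) then show ?case using step by simp
    next
      case (zz_sym p q) then show ?case using sym by (simp add: Z_def)
    next
      case (zz_trans p q r) then show ?case using trans[of p q r] by (simp add: Z_def)
    qed
  qed
  \<comment> \<open>A homomorphism h carries zigzags to zigzags link by link; this makes W a
    functor.\<close>
  have Zpush: "Z (Tgt C h) (fst p, y) (fst q, y')"
    if h: "h \<in> Mor C" and z: "Z (Src C h) p q"
      and y: "maps_to (snd (fst D (fst p)) h) (snd p) y" "maps_to (snd (fst D (fst q)) h) (snd q) y'" for h p q y y'
  proof -
    note s = Src_Obj[OF h] and t = Tgt_Obj[OF h]
    note m = fobj_mor[OF D_obj h] and ms = fobj_src[OF D_obj h] and mt = fobj_tgt[OF D_obj h]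
    have "\<forall>y y'. maps_to (snd (fst D (fst p)) h) (snd p) y \<longrightarrow> maps_to (snd (fst D (fst q)) h) (snd q) y' \<longrightarrow>
        Z (Tgt C h) (fst p, y) (fst q, y')"
      using s z
    proof (rule Zinduct)
      fix j x x' assume j: "j \<in> Obj J" and x: "(x, x') \<in> fst (fst D j) (Src C h)"
      show "\<forall>y y'. maps_to (snd (fst D (fst (j, x))) h) (snd (j, x)) y \<longrightarrow>
          maps_to (snd (fst D (fst (j, x'))) h) (snd (j, x')) y' \<longrightarrow> Z (Tgt C h) (fst (j, x), y) (fst (j, x'), y')"
        using maps_to_fun2[OF m[OF j]] x ms[OF j] mt[OF j] Zbase[OF t j] by auto
    next
      fix u x z assume u: "u \<in> Mor J" and xz: "maps_to (fst (snd D u) (Src C h)) x z"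
      have "Z (Tgt C h) (Src J u, y) (Tgt J u, y')"
        if "maps_to (snd (fst D (Src J u)) h) x y" "maps_to (snd (fst D (Tgt J u)) h) z y'" for y y'
        using fmor_nat[OF D_mor[OF u] h _ xz] that D_src[OF u] D_tgt[OF u] Zstep[OF t u] by simp
      then show "\<forall>y y'. maps_to (snd (fst D (fst (Src J u, x))) h) (snd (Src J u, x)) y \<longrightarrow>
          maps_to (snd (fst D (fst (Tgt J u, z))) h) (snd (Tgt J u, z)) y' \<longrightarrow>
          Z (Tgt C h) (fst (Src J u, x), y) (fst (Tgt J u, z), y')" by simp
    next
      fix p q r assume pq: "Z (Src C h) p q" "\<forall>y y'. maps_to (snd (fst D (fst p)) h) (snd p) y \<longrightarrow>
          maps_to (snd (fst D (fst q)) h) (snd q) y' \<longrightarrow> Z (Tgt C h) (fst p, y) (fst q, y')"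
        and qr: "Z (Src C h) q r" "\<forall>y y'. maps_to (snd (fst D (fst q)) h) (snd q) y \<longrightarrow>
          maps_to (snd (fst D (fst r)) h) (snd r) y' \<longrightarrow> Z (Tgt C h) (fst q, y) (fst r, y')"
      obtain w where w: "maps_to (snd (fst D (fst q)) h) (snd q) w"
        using maps_to_total[OF m[OF Zdom(1)[OF s qr(1)]]] Zdom[OF s qr(1)] ms[OF Zdom(1)[OF s qr(1)]] by metis
      then show "\<forall>y y'. maps_to (snd (fst D (fst p)) h) (snd p) y \<longrightarrow>
          maps_to (snd (fst D (fst r)) h) (snd r) y' \<longrightarrow> Z (Tgt C h) (fst p, y) (fst r, y')"
        using pq(2) qr(2) Ztrans[OF t] by blast
    qed (use Zsym[OF t] in blast)
    then show ?thesis using y by blast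
  qed
  \<comment> \<open>A zigzag consists of finitely many links, each resting on one persistent fact,
    so it persists even when J is infinite.\<close>
  have Zlim: "\<forall>\<^sub>s k. Z (x k) p q"
    if x: "seqlim (ObjTop C) x l" "\<And>k. x k \<in> Obj C" and z: "Z l p q" for x l p q
    using lim_Obj[OF x(1)] z
  proof (rule Zinduct)
    fix j a a' assume "j \<in> Obj J" "(a, a') \<in> fst (fst D j) l"
    then have "\<forall>\<^sub>s k. (a, a') \<in> fst (fst D j) (x k)"
      using fobj_limD[OF D_obj x(1)] unfolding limitin_ods_obj by blast
    then show "\<forall>\<^sub>s k. Z (x k) (j, a) (j, a')"
      by eventually_elim (use Zbase x(2) \<open>j \<in> Obj J\<close> in blast)
  next
    fix u a b assume "u \<in> Mor J" "maps_to (fst (snd D u) l) a b"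
    then have "\<forall>\<^sub>s k. maps_to (fst (snd D u) (x k)) a b"
      using fmor_limD[OF D_mor x(1)] unfolding limitin_ods_mor by blast
    then show "\<forall>\<^sub>s k. Z (x k) (Src J u, a) (Tgt J u, b)"
      by eventually_elim (use Zstep x(2) \<open>u \<in> Mor J\<close> in blast)
  next
    fix p q assume "\<forall>\<^sub>s k. Z (x k) p q"
    then show "\<forall>\<^sub>s k. Z (x k) q p" by eventually_elim (use Zsym x(2) in blast)
  next
    fix p q r assume "\<forall>\<^sub>s k. Z (x k) p q" "\<forall>\<^sub>s k. Z (x k) q r"
    then show "\<forall>\<^sub>s k. Z (x k) p r" by eventually_elim (use Ztrans x(2) in blast)
  qed
  define A where "A N = {(a, b). Z N (prod_decode a) (prod_decode b)}" for N
  define I where "I a = fst (prod_decode a)" for a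
  define V where "V a = snd (prod_decode a)" for a
  have IV: "prod_decode a = (I a, V a)" for a by (simp add: I_def V_def)
  have AZ: "(a, b) \<in> A N \<longleftrightarrow> Z N (I a, V a) (I b, V b)" for N a b by (simp add: A_def IV)
  define R where "R h a b \<longleftrightarrow> I a \<in> Obj J \<and> (\<exists>y. maps_to (snd (fst D (I a)) h) (V a) y \<and> Z (Tgt C h) (I a, y) (I b, V b))"
    for h a b
  have Aper: "is_per (A N)" if N: "N \<in> Obj C" for N
    unfolding is_per_def
  proof (intro conjI symI transI)
    show "(c', c) \<in> A N" if "(c, c') \<in> A N" for c c' using that Zsym[OF N] unfolding AZ by blast
    show "(c, c'') \<in> A N" if "(c, c') \<in> A N" "(c', c'') \<in> A N" for c c' c''
      using that Ztrans[OF N] unfolding AZ by blast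
  qed
  have AI: "(a, a) \<in> A N \<longleftrightarrow> I a \<in> Obj J \<and> (V a, V a) \<in> fst (fst D (I a)) N" if N: "N \<in> Obj C" for N a
    using Zdom[OF N] Zbase[OF N] unfolding AZ by fastforce
  have Rmap: "is_map (A (Src C h)) (A (Tgt C h)) (R h)" if h: "h \<in> Mor C" for h
    unfolding is_map_def
  proof (intro conjI allI impI)
    note s = Src_Obj[OF h] and t = Tgt_Obj[OF h]
    note m = fobj_mor[OF D_obj h] and ms = fobj_src[OF D_obj h] and mt = fobj_tgt[OF D_obj h]
    show "is_per (A (Src C h))" "is_per (A (Tgt C h))" using Aper s t by blast+
    show "(a, a) \<in> A (Src C h)" "(b, b) \<in> A (Tgt C h)" if R: "R h a b" for a b
    proof -
      obtain y where y: "I a \<in> Obj J" "maps_to (snd (fst D (I a)) h) (V a) y" "Z (Tgt C h) (I a, y) (I b, V b)"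
        using R unfolding R_def by blast
      show "(a, a) \<in> A (Src C h)" using y(1) maps_to_dom[OF y(2)] ms[OF y(1)] by (simp add: AI[OF s])
      show "(b, b) \<in> A (Tgt C h)" using Zdom[OF t Zsym[OF t y(3)]] by (simp add: AI[OF t])
    qed
    show tot: "\<exists>b. R h a b" if a: "(a, a) \<in> A (Src C h)" for a
    proof -
      have a': "I a \<in> Obj J" "(V a, V a) \<in> fst (fst D (I a)) (Src C h)" using a AI[OF s] by blast+
      then obtain y where y: "maps_to (snd (fst D (I a)) h) (V a) y" using maps_to_total[OF m[OF a'(1)], of "V a"] ms[OF a'(1)] by auto
      then have "(y, y) \<in> fst (fst D (I a)) (Tgt C h)" using maps_to_cod mt[OF a'(1)] by metis
      then have "R h a (prod_encode (I a, y))"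
        unfolding R_def using a' y Zbase[OF t a'(1)] by (auto simp: I_def V_def)
      then show ?thesis by blast
    qed
    show "R h a' b'" if R: "R h a b" and a': "(a, a') \<in> A (Src C h)" and b': "(b, b') \<in> A (Tgt C h)" for a a' b b'
    proof -
      obtain y where y: "maps_to (snd (fst D (I a)) h) (V a) y" "Z (Tgt C h) (I a, y) (I b, V b)"
        using R unfolding R_def by blast
      have "(a', a') \<in> A (Src C h)" using per_refl[OF Aper[OF s] a'] by blast
      then obtain b2 where "R h a' b2" using tot by blast
      then obtain y' where y': "I a' \<in> Obj J" "maps_to (snd (fst D (I a')) h) (V a') y'" unfolding R_def by blast
      have "Z (Tgt C h) (I a, y) (I a', y')" using Zpush[OF h, of "(I a, V a)" "(I a', V a')"] y y' a' unfolding AZ by simp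
      then have "Z (Tgt C h) (I a', y') (I b', V b')" using b' y(2) Zsym[OF t] Ztrans[OF t] unfolding AZ by blast
      then show ?thesis using y' unfolding R_def by blast
    qed
    show "(b, b') \<in> A (Tgt C h)" if R: "R h a b" "R h a b'" for a b b'
    proof -
      obtain y y' where y: "I a \<in> Obj J" "maps_to (snd (fst D (I a)) h) (V a) y" "Z (Tgt C h) (I a, y) (I b, V b)"
        "maps_to (snd (fst D (I a)) h) (V a) y'" "Z (Tgt C h) (I a, y') (I b', V b')"
        using R unfolding R_def by blast
      have "(y, y') \<in> fst (fst D (I a)) (Tgt C h)" using maps_to_fun[OF m[OF y(1)] y(2) y(4)] mt[OF y(1)] by simp
      then have "Z (Tgt C h) (I a, y) (I a, y')" using Zbase[OF t y(1)] by blast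
      then show ?thesis using y Zsym[OF t] Ztrans[OF t] unfolding AZ by blast
    qed
  qed
  have Rid: "R (Idn C x) a b" if x: "x \<in> Obj C" and ab: "(a, b) \<in> A x" for x a b
  proof -
    have a: "I a \<in> Obj J" "(V a, V a) \<in> fst (fst D (I a)) x" using Zdom[OF x] ab unfolding AZ by fastforce+
    then have "maps_to (snd (fst D (I a)) (Idn C x)) (V a) (V a)" using fobj_id[OF D_obj x] by blast
    then show ?thesis using ab a unfolding R_def AZ Tgt_Idn[OF x] by blast
  qed
  have Rcomp: "R (Comp C g f) a c"
    if fg: "f \<in> Mor C" "g \<in> Mor C" "Src C g = Tgt C f" and R: "R f a b" "R g b c" for f g a b c
  proof -
    note t = Tgt_Obj[OF fg(2)]
    obtain y where y: "I a \<in> Obj J" "maps_to (snd (fst D (I a)) f) (V a) y" "Z (Tgt C f) (I a, y) (I b, V b)"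
      using R unfolding R_def by blast
    obtain z where z: "I b \<in> Obj J" "maps_to (snd (fst D (I b)) g) (V b) z" "Z (Tgt C g) (I b, z) (I c, V c)"
      using R unfolding R_def by blast
    have "(y, y) \<in> fst (snd (fst D (I a)) g)"
      using maps_to_cod[OF y(2)] fobj_tgt[OF D_obj[OF y(1)] fg(1)] fobj_src[OF D_obj[OF y(1)] fg(2)] fg(3) by simp
    then obtain y' where y': "maps_to (snd (fst D (I a)) g) y y'"
      using maps_to_total fobj_mor[OF D_obj[OF y(1)] fg(2)] by blast
    have "Z (Tgt C g) (I a, y') (I b, z)" using Zpush[OF fg(2), of "(I a, y)" "(I b, V b)"] y y' z fg(3) by simp
    then have "Z (Tgt C g) (I a, y') (I c, V c)" using z Ztrans[OF t] by blast
    moreover have "maps_to (snd (fst D (I a)) (Comp C g f)) (V a) y'"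
      using fobj_comp[OF D_obj[OF y(1)] fg] y y' by blast
    ultimately show ?thesis using y(1) unfolding R_def Tgt_Comp[OF fg] by blast
  qed
  have Alim: "\<forall>\<^sub>s k. (a, a') \<in> A (x k)"
    if x: "seqlim (ObjTop C) x l" "\<And>k. x k \<in> Obj C" "(a, a') \<in> A l" for x l a a'
    using Zlim[OF x(1,2)] x(3) unfolding AZ by blast
  have Rlim: "\<forall>\<^sub>s k. R (h k) a b"
    if h: "seqlim (MorTop C) h h0" "\<And>k. h k \<in> Mor C" "R h0 a b" for h h0 a b
  proof -
    obtain y where y: "I a \<in> Obj J" "maps_to (snd (fst D (I a)) h0) (V a) y" "Z (Tgt C h0) (I a, y) (I b, V b)"
      using h(3) unfolding R_def by blast
    have "\<forall>\<^sub>s k. maps_to (snd (fst D (I a)) (h k)) (V a) y"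
      using fobj_lim_morD[OF D_obj[OF y(1)] h(1)] y(2) unfolding limitin_ods_mor by blast
    moreover have "\<forall>\<^sub>s k. Z (Tgt C (h k)) (I a, y) (I b, V b)"
      by (rule Zlim[OF tgt_lim[OF h(1,2)] _ y(3)]) (use h(2) Tgt_Obj in auto)
    ultimately show ?thesis unfolding R_def by eventually_elim (use y(1) in blast)
  qed
  let ?W = "mk_fun A R"
  have okW: "fun_ok A R" by (rule fun_okI) (fact Aper Rmap Rid Rcomp Alim Rlim)+
  note W = mk_fun_obj[OF okW] and W1 = mk_fun_fst[OF okW] and W2 = mk_fun_snd[OF okW]
  define K where "K j x a c \<longleftrightarrow> (a, a) \<in> fst (fst D j) x \<and> Z x (j, a) (I c, V c)" for j x a c
  have Dper: "is_per (fst (fst D j) N)" if "N \<in> Obj C" "j \<in> Obj J" for N j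
    using fobj_per[OF D_obj] that by blast
  have Kmap: "is_map (fst (fst D j) x) (fst ?W x) (K j x)" if x: "x \<in> Obj C" and j: "j \<in> Obj J" for x j
    unfolding is_map_def W1[OF x]
  proof (intro conjI allI impI)
    note p = Dper[OF x j]
    show "is_per (A x)" "is_per (fst (fst D j) x)" using Aper x p by blast+
    show "(a, a) \<in> fst (fst D j) x" "(b, b) \<in> A x" if "K j x a b" for a b
      using that AI[OF x] Zdom[OF x Zsym[OF x]] unfolding K_def by fastforce+
    show "K j x a' b'" if t: "K j x a b" "(a, a') \<in> fst (fst D j) x" "(b, b') \<in> A x" for a a' b b'
    proof -
      have "Z x (j, a') (j, a)" using Zbase[OF x j] per_sym[OF p t(2)] by blast
      then show ?thesis using t Ztrans[OF x] per_refl[OF p t(2)] unfolding K_def AZ by blast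
    qed
    show "(b, b') \<in> A x" if "K j x a b" "K j x a b'" for a b b'
      using that Ztrans[OF x] Zsym[OF x] unfolding K_def AZ by blast
    show "\<exists>b. K j x a b" if "(a, a) \<in> fst (fst D j) x" for a
      using that Zbase[OF x j] unfolding K_def by (intro exI[of _ "prod_encode (j, a)"]) (simp add: I_def V_def)
  qed
  have Knat: "K j (Tgt C h) b d"
    if j: "j \<in> Obj J" and h: "h \<in> Mor C" and m: "maps_to (snd (fst D j) h) a b" "K j (Src C h) a c" "maps_to (snd ?W h) c d"
    for j h a b c d
  proof -
    note t = Tgt_Obj[OF h]
    have "R h c d" using m(3) W2[OF h] by blast
    then obtain y where y: "maps_to (snd (fst D (I c)) h) (V c) y" "Z (Tgt C h) (I c, y) (I d, V d)" unfolding R_def by blast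
    have "Z (Tgt C h) (j, b) (I c, y)" using Zpush[OF h, of "(j, a)" "(I c, V c)"] m y unfolding K_def by simp
    then have "Z (Tgt C h) (j, b) (I d, V d)" using y Ztrans[OF t] by blast
    then show ?thesis using maps_to_cod[OF m(1)] fobj_tgt[OF D_obj[OF j] h] unfolding K_def by simp
  qed
  have Klim: "\<forall>\<^sub>s k. K j (x k) a b"
    if j: "j \<in> Obj J" and x: "seqlim (ObjTop C) x l" "\<And>k. x k \<in> Obj C" "K j l a b" for j x l a b
  proof -
    have "\<forall>\<^sub>s k. (a, a) \<in> fst (fst D j) (x k)"
      using fobj_limD[OF D_obj[OF j] x(1)] x(3) unfolding limitin_ods_obj K_def by blast
    moreover have "\<forall>\<^sub>s k. Z (x k) (j, a) (I b, V b)" using Zlim[OF x(1,2)] x(3) unfolding K_def by blast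
    ultimately show ?thesis unfolding K_def by eventually_elim blast
  qed
  have okK: "nt_ok (fst D j) ?W (K j)" if j: "j \<in> Obj J" for j
    by (rule nt_okI) (fact W D_obj[OF j] Kmap[OF _ j] Knat[OF j] Klim[OF j])+
  define \<kappa> where "\<kappa> j = mk_nt (fst D j) ?W (K j)" for j
  have kap: "\<kappa> j \<in> Mor FC" "fst (snd (\<kappa> j)) = fst D j" "snd (snd (\<kappa> j)) = ?W" if j: "j \<in> Obj J" for j
    unfolding \<kappa>_def using mk_nt_mor[OF okK[OF j]] by simp_all
  have kapr: "maps_to (fst (\<kappa> j) x) c y \<longleftrightarrow> K j x c y" if j: "j \<in> Obj J" and x: "x \<in> Obj C" for j x c y
    unfolding \<kappa>_def using maps_to_mk_nt[OF okK[OF j] x] .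
  have cW: "cocone J FC D ?W \<kappa>"
    unfolding cocone_def FC_simps(1,2)
  proof (intro conjI ballI W kap)
    fix u assume u: "u \<in> Mor J"
    note s = st(1)[OF u] and t = st(2)[OF u]
    have e: "fst (snd (\<kappa> (Tgt J u))) = snd (snd (snd D u))" using kap t D_tgt[OF u] by simp
    show "Comp FC (\<kappa> (Tgt J u)) (snd D u) = \<kappa> (Src J u)"
    proof (rule fmor_eqI)
      show "Comp FC (\<kappa> (Tgt J u)) (snd D u) \<in> Mor FC" using FC_Comp_mor[OF D_mor[OF u] kap(1)[OF t] e] .
      show "\<kappa> (Src J u) \<in> Mor FC" using kap s by blast
      show "snd (Comp FC (\<kappa> (Tgt J u)) (snd D u)) = snd (\<kappa> (Src J u))"
        using kap s t D_src[OF u] by (simp add: prod_eq_iff)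
      fix x a b assume x: "x \<in> Obj C" and "maps_to (fst (Comp FC (\<kappa> (Tgt J u)) (snd D u)) x) a b"
      then obtain c where c: "maps_to (fst (snd D u) x) a c" "K (Tgt J u) x c b"
        unfolding FC_maps_to_Comp[OF D_mor[OF u] kap(1)[OF t] e x] kapr[OF t x] by blast
      show "maps_to (fst (\<kappa> (Src J u)) x) a b"
        unfolding kapr[OF s x] K_def
        using Zstep[OF x u c(1)] c(2) Ztrans[OF x] maps_to_dom[OF c(1)] fmor_src[OF D_mor[OF u] x] D_src[OF u]
        unfolding K_def by auto
    qed
  qed
  then obtain m where m: "m \<in> Mor FC" "fst (snd m) = v" "snd (snd m) = ?W" and mk: "\<And>j. j \<in> Obj J \<Longrightarrow> Comp FC m (\<iota> j) = \<kappa> j"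
    using v unfolding colimit_cocone_def FC_simps(1,2) by blast
  have em: "fst (snd m) = snd (snd (\<iota> j))" if "j \<in> Obj J" for j using v'(3)[OF that] m by simp
  have pm: "fst (\<iota> j) x \<in> ods_mors" "fst (fst (\<iota> j) x) = fst (fst D j) x" "fst (snd (fst (\<iota> j) x)) = fst v x"
    if "j \<in> Obj J" "x \<in> Obj C" for j x
    using fmor_mor[OF v'(2)] fmor_src[OF v'(2)] fmor_tgt[OF v'(2)] v'(3,4) that by auto
  have inv: "maps_to (fst (\<iota> (fst p)) x) (snd p) y \<longleftrightarrow> maps_to (fst (\<iota> (fst q)) x) (snd q) y"
    if x: "x \<in> Obj C" and z: "Z x p q" for x p q y
    using ods_diagram.coconeD(5)[OF ev_diagram[OF x] ev_cocone[OF cv x]] z unfolding Z_def by blast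
  define B where "B x c y \<longleftrightarrow> I c \<in> Obj J \<and> maps_to (fst (\<iota> (I c)) x) (V c) y" for x c y
  have Bmap: "is_map (fst ?W x) (fst v x) (B x)" if x: "x \<in> Obj C" for x
    unfolding is_map_def W1[OF x]
  proof (intro conjI allI impI)
    show "is_per (A x)" "is_per (fst v x)" using Aper[OF x] fobj_per[OF v'(1) x] .
    show "(a, a) \<in> A x" "(b, b) \<in> fst v x" if "B x a b" for a b
      using that AI[OF x] maps_to_dom maps_to_cod pm(2,3)[OF _ x] unfolding B_def by metis+
    show "B x a' b'" if t: "B x a b" "(a, a') \<in> A x" "(b, b') \<in> fst v x" for a a' b b'
    proof -
      have i: "I a' \<in> Obj J" using AI[OF x] per_refl[OF Aper[OF x] t(2)] by blast
      have m: "maps_to (fst (\<iota> (I a')) x) (V a') b"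
        using inv[OF x, of "(I a, V a)" "(I a', V a')"] t unfolding AZ B_def by simp
      then show ?thesis using maps_to_cong[OF pm(1)[OF i x] m maps_to_dom[OF m]] t(3) pm(3)[OF i x] i
        unfolding B_def by simp
    qed
    show "(b, b') \<in> fst v x" if "B x a b" "B x a b'" for a b b'
      using that maps_to_fun[OF pm(1)[OF _ x]] pm(3)[OF _ x] unfolding B_def by auto
    show "\<exists>b. B x a b" if "(a, a) \<in> A x" for a
      using that AI[OF x] maps_to_total[OF pm(1)[OF _ x]] pm(2)[OF _ x] unfolding B_def by auto
  qed
  have Bnat: "B (Tgt C h) b d"
    if h: "h \<in> Mor C" and m: "maps_to (snd ?W h) a b" "B (Src C h) a c" "maps_to (snd v h) c d" for h a b c d
  proof -
    have "R h a b" using m W2[OF h] by blast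
    then obtain y where y: "I a \<in> Obj J" "maps_to (snd (fst D (I a)) h) (V a) y" "Z (Tgt C h) (I a, y) (I b, V b)"
      unfolding R_def by blast
    have "maps_to (fst (\<iota> (I a)) (Tgt C h)) y d"
      using fmor_nat[OF v'(2)[OF y(1)] h, of "V a" y c d] y(2) m(2,3) v'(3,4)[OF y(1)] unfolding B_def by simp
    moreover have "I b \<in> Obj J" using Zdom(1)[OF Tgt_Obj[OF h] Zsym[OF Tgt_Obj[OF h] y(3)]] by simp
    ultimately show ?thesis using inv[OF Tgt_Obj[OF h] y(3)] unfolding B_def by simp
  qed
  have Blim: "\<forall>\<^sub>s k. B (x k) a b"
    if x: "seqlim (ObjTop C) x l" "\<And>k. x k \<in> Obj C" "B l a b" for x l a b
  proof -
    have i: "I a \<in> Obj J" using x(3) unfolding B_def by blast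
    have "\<forall>\<^sub>s k. maps_to (fst (\<iota> (I a)) (x k)) (V a) b"
      using fmor_limD[OF v'(2)[OF i] x(1)] x(3) unfolding limitin_ods_mor B_def by blast
    then show ?thesis unfolding B_def using i by simp
  qed
  let ?b = "mk_nt ?W v B"
  have okB: "nt_ok ?W v B" by (rule nt_okI) (fact v'(1) W Bmap Bnat Blim)+
  note b_in = mk_nt_mor[OF okB] and b_rel = maps_to_mk_nt[OF okB]
  have eb: "fst (snd ?b) = snd (snd m)" using m by simp
  note mb = FC_Comp_mor[OF m(1) b_in eb]
  have mb_id: "Comp FC (Comp FC ?b m) (\<iota> j) = \<iota> j" if j: "j \<in> Obj J" for j
  proof (rule fmor_eqI)
    have e: "fst (snd (Comp FC ?b m)) = snd (snd (\<iota> j))" using v'(3)[OF j] m by simp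
    show "Comp FC (Comp FC ?b m) (\<iota> j) \<in> Mor FC" using FC_Comp_mor[OF v'(2)[OF j] mb e] .
    show "\<iota> j \<in> Mor FC" using v'(2) j .
    show "snd (Comp FC (Comp FC ?b m) (\<iota> j)) = snd (\<iota> j)" using v' j by (simp add: prod_eq_iff)
    fix x a d assume x: "x \<in> Obj C" and "maps_to (fst (Comp FC (Comp FC ?b m) (\<iota> j)) x) a d"
    then obtain b c where c: "maps_to (fst (\<iota> j) x) a b" "maps_to (fst m x) b c" "B x c d"
      unfolding FC_maps_to_Comp[OF v'(2)[OF j] mb e x] FC_maps_to_Comp[OF m(1) b_in eb x] b_rel[OF x] by blast
    have "maps_to (fst (Comp FC m (\<iota> j)) x) a c"
      unfolding FC_maps_to_Comp[OF v'(2)[OF j] m(1) em[OF j] x] using c by blast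
    then have "Z x (j, a) (I c, V c)" unfolding mk[OF j] kapr[OF j x] K_def by blast
    from inv[OF x this] c(3) show "maps_to (fst (\<iota> j) x) a d" unfolding B_def by simp
  qed
  have bm: "Comp FC ?b m = Idn FC v"
    by (rule colimit_cocone_endo[OF FC_category v mb]) (use mb_id m in \<open>simp_all add: FC_simps(1,2)\<close>)
  show ?thesis
    unfolding ods_diagram.elem_colimit_def[OF ev_diagram[OF M]]
  proof (intro conjI allI impI ballI)
    fix y assume y: "(y, y) \<in> fst v M"
    then have "maps_to (fst (Comp FC ?b m) M) y y" unfolding bm FC_maps_to_Idn[OF v'(1) M] .
    then obtain c where "B M c y" unfolding FC_maps_to_Comp[OF m(1) b_in eb M] b_rel[OF M] by blast
    then show "\<exists>j\<in>Obj J. \<exists>x. maps_to (fst (\<iota> j) M) x y" unfolding B_def by blast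
  next
    fix i j x x' y assume ij: "i \<in> Obj J" "j \<in> Obj J" and y: "maps_to (fst (\<iota> i) M) x y" "maps_to (fst (\<iota> j) M) x' y"
    have "(y, y) \<in> fst (fst m M)" using maps_to_cod[OF y(1)] pm(3)[OF ij(1) M] fmor_src[OF m(1) M] m by simp
    then obtain c where c: "maps_to (fst m M) y c" using maps_to_total fmor_mor[OF m(1) M] by blast
    have "Z M (i, x) (I c, V c)" "Z M (j, x') (I c, V c)"
      using c y FC_maps_to_Comp[OF v'(2)[OF ij(1)] m(1) em[OF ij(1)] M, of x c] FC_maps_to_Comp[OF v'(2)[OF ij(2)] m(1) em[OF ij(2)] M, of x' c]
      unfolding mk[OF ij(1)] mk[OF ij(2)] kapr[OF ij(1) M] kapr[OF ij(2) M] K_def by blast+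
    then show "ods_diagram.zz J (ev M) (i, x) (j, x')"
      using Zsym[OF M] Ztrans[OF M] unfolding Z_def by blast
  qed
qed

end

context tcat
begin

lemma dual_obj_sigma:
  assumes M: "M \<in> Obj C"
  shows "sigma_pretopos_morphism FC ODS (dual_obj C M)"
  unfolding sigma_pretopos_morphism_def preserves_countable_colimits_def preserves_finite_limits_def
proof (intro conjI allI impI)
  show "continuous_functor FC ODS (dual_obj C M)" using M by (rule dual_obj_functor)
next
  fix J :: "(nat, nat) cat" and X v \<iota>
  assume a: "category J \<and> is_functor J FC X \<and> colimit_cocone J FC X v \<iota>"
  interpret d: fc_diagram C J X by unfold_locales (use a in auto)
  have cv: "cocone J FC X v \<iota>" using a unfolding colimit_cocone_def by blast
  have "colimit_cocone J ODS (d.ev M) (fst v M) (\<lambda>j. fst (\<iota> j) M)"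
    by (rule ods_diagram.colimit_coconeI[OF d.ev_diagram[OF M] d.ev_cocone[OF cv M] d.ev_colimit]) (use a M in auto)
  then show "colimit_cocone J ODS (comp_functor J (dual_obj C M) X) (fst (dual_obj C M) v) (\<lambda>j. snd (dual_obj C M) (\<iota> j))"
    unfolding colimit_cocone_def cocone_def using d.coconeD[OF cv] d.st by simp
next
  fix J :: "(nat, nat) cat" and X v \<pi>
  assume a: "category J \<and> finite (Obj J) \<and> finite (Mor J) \<and> is_functor J FC X \<and> limit_cone J FC X v \<pi>"
  interpret d: fc_diagram C J X by unfold_locales (use a in auto)
  have cv: "cone J FC X v \<pi>" using a unfolding limit_cone_def by blast
  have "limit_cone J ODS (d.ev M) (fst v M) (\<lambda>j. fst (\<pi> j) M)"
    by (rule ods_diagram.limit_coneI[OF d.ev_diagram[OF M] d.ev_cone[OF cv M] d.ev_limit]) (use a M in auto)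
  then show "limit_cone J ODS (comp_functor J (dual_obj C M) X) (fst (dual_obj C M) v) (\<lambda>j. snd (dual_obj C M) (\<pi> j))"
    unfolding limit_cone_def cone_def using d.coneD[OF cv] d.st by simp
qed

end

subsection \<open>Elementwise consequences of preserving limits and colimits\<close>

text \<open>Diagram shapes without composable pairs of non-identities: the identity of \<open>j\<close> is \<open>2 * j\<close>
  and an edge \<open>e\<close> becomes \<open>2 * e + 1\<close>.\<close>

definition edge_cat :: "nat set \<Rightarrow> nat set \<Rightarrow> (nat \<Rightarrow> nat) \<Rightarrow> (nat \<Rightarrow> nat) \<Rightarrow> (nat, nat) cat" where
  "edge_cat V E s t =
     \<lparr>Obj = V, Mor = (\<lambda>j. 2 * j) ` V \<union> (\<lambda>e. 2 * e + 1) ` E,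
      Src = (\<lambda>m. if even m then m div 2 else s (m div 2)),
      Tgt = (\<lambda>m. if even m then m div 2 else t (m div 2)),
      Idn = (\<lambda>j. 2 * j),
      Comp = (\<lambda>g f. if even g then f else g)\<rparr>"

lemma edge_cat_simps [simp]:
  "Obj (edge_cat V E s t) = V" "Mor (edge_cat V E s t) = (\<lambda>j. 2 * j) ` V \<union> (\<lambda>e. 2 * e + 1) ` E"
  "Src (edge_cat V E s t) (2 * j) = j" "Tgt (edge_cat V E s t) (2 * j) = j"
  "Src (edge_cat V E s t) (Suc (2 * j)) = s j" "Tgt (edge_cat V E s t) (Suc (2 * j)) = t j"
  "Idn (edge_cat V E s t) j = 2 * j"
  "Comp (edge_cat V E s t) (2 * j) m = m" "Comp (edge_cat V E s t) (Suc (2 * j)) m = Suc (2 * j)"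
  by (simp_all add: edge_cat_def)

lemma category_edge_cat:
  assumes "\<And>e. e \<in> E \<Longrightarrow> s e \<in> V \<and> t e \<in> V" and "\<And>e e'. e \<in> E \<Longrightarrow> e' \<in> E \<Longrightarrow> s e \<noteq> t e'"
  shows "category (edge_cat V E s t)"
  unfolding category_def using assms by auto

definition edge_fun :: "('o, 'm, 'z) cat_scheme \<Rightarrow> nat set \<Rightarrow> nat set \<Rightarrow> (nat \<Rightarrow> 'o) \<Rightarrow> (nat \<Rightarrow> 'm) \<Rightarrow> (nat, nat, 'o, 'm) fctr" where
  "edge_fun K V E Fo Fe =
     ((\<lambda>j\<in>V. Fo j), (\<lambda>m\<in>(\<lambda>j. 2 * j) ` V \<union> (\<lambda>e. 2 * e + 1) ` E. if even m then Idn K (Fo (m div 2)) else Fe (m div 2)))"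

lemma edge_fun_simps [simp]:
  "j \<in> V \<Longrightarrow> fst (edge_fun K V E Fo Fe) j = Fo j"
  "j \<in> V \<Longrightarrow> snd (edge_fun K V E Fo Fe) (2 * j) = Idn K (Fo j)"
  "j \<in> E \<Longrightarrow> snd (edge_fun K V E Fo Fe) (Suc (2 * j)) = Fe j"
  by (auto simp: edge_fun_def)

lemma is_functor_edge_fun:
  assumes K: "category K"
    and st: "\<And>e. e \<in> E \<Longrightarrow> s e \<in> V \<and> t e \<in> V" and ne: "\<And>e e'. e \<in> E \<Longrightarrow> e' \<in> E \<Longrightarrow> s e \<noteq> t e'"
    and Fo: "\<And>j. j \<in> V \<Longrightarrow> Fo j \<in> Obj K"
    and Fe: "\<And>e. e \<in> E \<Longrightarrow> Fe e \<in> Mor K \<and> Src K (Fe e) = Fo (s e) \<and> Tgt K (Fe e) = Fo (t e)"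
  shows "is_functor (edge_cat V E s t) K (edge_fun K V E Fo Fe)"
proof -
  have id: "\<And>x. x \<in> Obj K \<Longrightarrow> Idn K x \<in> Mor K \<and> Src K (Idn K x) = x \<and> Tgt K (Idn K x) = x"
    and idc: "\<And>f. f \<in> Mor K \<Longrightarrow> Comp K f (Idn K (Src K f)) = f \<and> Comp K (Idn K (Tgt K f)) f = f"
    using K unfolding category_def by blast+
  have idc1: "Comp K (Fe e) (Idn K (Fo (s e))) = Fe e" "Comp K (Idn K (Fo (t e))) (Fe e) = Fe e" if "e \<in> E" for e
    using idc[of "Fe e"] Fe[OF that] by auto
  have idc2: "Comp K (Idn K (Fo j)) (Idn K (Fo j)) = Idn K (Fo j)" if "j \<in> V" for j
    using idc[of "Idn K (Fo j)"] id[OF Fo[OF that]] by auto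
  show ?thesis
    unfolding is_functor_def
  proof (intro conjI ballI impI)
    show "fst (edge_fun K V E Fo Fe) \<in> Obj (edge_cat V E s t) \<rightarrow>\<^sub>E Obj K"
      using Fo by (auto simp: edge_fun_def)
    show "snd (edge_fun K V E Fo Fe) \<in> Mor (edge_cat V E s t) \<rightarrow>\<^sub>E Mor K"
      using Fo id Fe by (auto simp: edge_fun_def)
    show "snd (edge_fun K V E Fo Fe) (Comp (edge_cat V E s t) g f) =
        Comp K (snd (edge_fun K V E Fo Fe) g) (snd (edge_fun K V E Fo Fe) f)"
      if "f \<in> Mor (edge_cat V E s t)" "g \<in> Mor (edge_cat V E s t)" "Src (edge_cat V E s t) g = Tgt (edge_cat V E s t) f" for f g
      using that st ne idc1 idc2 by auto
  qed (use Fo id Fe st in auto)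
qed

lemma
  assumes f: "f \<in> ods_mors"
  shows ODS_Comp_Idn: "Comp ODS f (Idn ODS (fst f)) = f"
    and ODS_Idn_Comp: "Comp ODS (Idn ODS (fst (snd f))) f = f"
proof -
  note per = ods_mors_per[OF f]
  have e: "fst f = fst (snd (Idn ODS (fst f)))" "fst (Idn ODS (fst (snd f))) = fst (snd f)" by simp_all
  note i = Idn_in_mors[OF per[THEN conjunct1]] Idn_in_mors[OF per[THEN conjunct2]]
  show "Comp ODS f (Idn ODS (fst f)) = f"
  proof (rule ods_mor_eqI)
    show "maps_to f a b" if ab: "maps_to (Comp ODS f (Idn ODS (fst f))) a b" for a b
    proof -
      obtain c where c: "(a, c) \<in> fst f" "maps_to f c b"
        using ab unfolding maps_to_Comp[OF i(1) f e(1)] maps_to_Idn[OF per[THEN conjunct1]] by blast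
      have "(c, a) \<in> fst f" using per_sym per c(1) by blast
      then show ?thesis using maps_to_cong[OF f c(2)] maps_to_cod[OF c(2)] by blast
    qed
  qed (use f Comp_in_mors[OF i(1) f e(1)] in simp_all)
  show "Comp ODS (Idn ODS (fst (snd f))) f = f"
  proof (rule ods_mor_eqI)
    show "maps_to f a b" if ab: "maps_to (Comp ODS (Idn ODS (fst (snd f))) f) a b" for a b
    proof -
      obtain c where c: "maps_to f a c" "(c, b) \<in> fst (snd f)"
        using ab unfolding maps_to_Comp[OF f i(2) e(2)] maps_to_Idn[OF per[THEN conjunct2]] by blast
      then show ?thesis using maps_to_cong[OF f c(1)] maps_to_dom[OF c(1)] by blast
    qed
  qed (use f Comp_in_mors[OF f i(2) e(2)] in simp_all)
qed

locale sigma_mor = tcat C for C :: "('o, 'm) top_cat" +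
  fixes \<Phi> :: "(('o, 'm, per, ods_mor) fctr, ('o, 'm, per, ods_mor) ntrans, per, ods_mor) fctr"
  assumes \<Phi>: "sigma_pretopos_morphism (functor_cat C ODS) ODS \<Phi>"
begin

lemma Phi_functor: "is_functor FC ODS \<Phi>"
  using \<Phi> unfolding sigma_pretopos_morphism_def continuous_functor_def by blast+

lemma Phi_per: "F \<in> Obj FC \<Longrightarrow> is_per (fst \<Phi> F)"
  using Phi_functor unfolding is_functor_def by (auto simp: ods_objs_def Pi_iff PiE_iff)

lemma Phi_mor: "e \<in> Mor FC \<Longrightarrow> snd \<Phi> e \<in> ods_mors"
  and Phi_src: "e \<in> Mor FC \<Longrightarrow> fst (snd \<Phi> e) = fst \<Phi> (fst (snd e))"
  and Phi_tgt: "e \<in> Mor FC \<Longrightarrow> fst (snd (snd \<Phi> e)) = fst \<Phi> (snd (snd e))"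
  using Phi_functor unfolding is_functor_def FC_simps(1,2) by auto

lemma Phi_id_eq: "F \<in> Obj FC \<Longrightarrow> snd \<Phi> (Idn FC F) = Idn ODS (fst \<Phi> F)"
  using Phi_functor unfolding is_functor_def by blast

lemma Phi_id: "F \<in> Obj FC \<Longrightarrow> maps_to (snd \<Phi> (Idn FC F)) a b \<longleftrightarrow> (a, b) \<in> fst \<Phi> F"
  using Phi_id_eq maps_to_Idn[OF Phi_per] by simp

lemma Phi_comp_eq:
  assumes "e \<in> Mor FC" "d \<in> Mor FC" "fst (snd d) = snd (snd e)"
  shows "snd \<Phi> (Comp FC d e) = Comp ODS (snd \<Phi> d) (snd \<Phi> e)"
  using Phi_functor assms unfolding is_functor_def FC_simps(1,2) by blast

lemma Phi_comp:
  assumes ed: "e \<in> Mor FC" "d \<in> Mor FC" "fst (snd d) = snd (snd e)"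
  shows "maps_to (snd \<Phi> (Comp FC d e)) a c \<longleftrightarrow> (\<exists>b. maps_to (snd \<Phi> e) a b \<and> maps_to (snd \<Phi> d) b c)"
  unfolding Phi_comp_eq[OF ed]
  by (rule maps_to_Comp) (use ed Phi_mor Phi_src Phi_tgt in auto)

text \<open>The interface to preservation of finite limits. The hypotheses describe, on elements, a
  diagram of functors with pointwise limit v; the conclusion is that a compatible family of elements
  of the \<Phi>-values comes from an element of \<open>fst \<Phi> v\<close>.\<close>

lemma edge_limit:
  fixes s t :: "nat \<Rightarrow> nat"
  assumes fin: "finite V" "finite E"
    and st: "\<And>e. e \<in> E \<Longrightarrow> s e \<in> V \<and> t e \<in> V" and ne: "\<And>e e'. e \<in> E \<Longrightarrow> e' \<in> E \<Longrightarrow> s e \<noteq> t e'"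
    and Fe: "\<And>e. e \<in> E \<Longrightarrow> Fe e \<in> Mor FC \<and> fst (snd (Fe e)) = Fo (s e) \<and> snd (snd (Fe e)) = Fo (t e)"
    and v: "v \<in> Obj FC"
    and pi: "\<And>j. j \<in> V \<Longrightarrow> \<pi> j \<in> Mor FC \<and> fst (snd (\<pi> j)) = v \<and> snd (snd (\<pi> j)) = Fo j"
    and comm: "\<And>e N a b c. e \<in> E \<Longrightarrow> N \<in> Obj C \<Longrightarrow> maps_to (fst (\<pi> (s e)) N) a b \<Longrightarrow> maps_to (fst (Fe e) N) b c
        \<Longrightarrow> maps_to (fst (\<pi> (t e)) N) a c"
    and ex: "\<And>N x. N \<in> Obj C \<Longrightarrow> (\<And>j. j \<in> V \<Longrightarrow> (x j, x j) \<in> fst (Fo j) N) \<Longrightarrow>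
        (\<And>e. e \<in> E \<Longrightarrow> maps_to (fst (Fe e) N) (x (s e)) (x (t e))) \<Longrightarrow>
        \<exists>y. (y, y) \<in> fst v N \<and> (\<forall>j\<in>V. maps_to (fst (\<pi> j) N) y (x j))"
    and uniq: "\<And>N y y'. N \<in> Obj C \<Longrightarrow> (y, y) \<in> fst v N \<Longrightarrow> (y', y') \<in> fst v N \<Longrightarrow>
        (\<And>j. j \<in> V \<Longrightarrow> \<exists>x. maps_to (fst (\<pi> j) N) y x \<and> maps_to (fst (\<pi> j) N) y' x) \<Longrightarrow> (y, y') \<in> fst v N"
    and x: "\<And>j. j \<in> V \<Longrightarrow> (x j, x j) \<in> fst \<Phi> (Fo j)"
      "\<And>e. e \<in> E \<Longrightarrow> maps_to (snd \<Phi> (Fe e)) (x (s e)) (x (t e))"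
  shows "\<exists>y. (y, y) \<in> fst \<Phi> v \<and> (\<forall>j\<in>V. maps_to (snd \<Phi> (\<pi> j)) y (x j))"
proof -
  let ?J = "edge_cat V E s t" and ?D = "edge_fun FC V E Fo Fe"
  have Fo: "Fo j \<in> Obj FC" if "j \<in> V" for j using fmor_Tgt pi[OF that] by metis
  have J: "category ?J" using st ne by (rule category_edge_cat)
  have D: "is_functor ?J FC ?D"
    by (rule is_functor_edge_fun) (use FC_category st ne Fo Fe in \<open>auto simp: FC_simps(1,2)\<close>)
  interpret d: fc_diagram C ?J ?D by unfold_locales (fact J D)+
  have cone: "cone ?J FC ?D v \<pi>"
    unfolding cone_def
  proof (intro conjI ballI v)
    show "\<pi> j \<in> Mor FC" "Src FC (\<pi> j) = v" "Tgt FC (\<pi> j) = fst ?D j" if "j \<in> Obj ?J" for j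
      using pi that by (simp_all add: FC_simps(1,2))
    fix u assume "u \<in> Mor ?J"
    then consider j where "j \<in> V" "u = 2 * j" | e where "e \<in> E" "u = Suc (2 * e)" by auto
    then show "Comp FC (snd ?D u) (\<pi> (Src ?J u)) = \<pi> (Tgt ?J u)"
    proof cases
      case 1
      then show ?thesis using FC_Idn_Comp pi by (metis edge_cat_simps(3,4) edge_fun_simps(2))
    next
      case 2
      have f: "Fe e \<in> Mor FC" "\<pi> (s e) \<in> Mor FC" "fst (snd (Fe e)) = snd (snd (\<pi> (s e)))" "\<pi> (t e) \<in> Mor FC"
        using Fe pi st 2 by simp_all
      have "Comp FC (Fe e) (\<pi> (s e)) = \<pi> (t e)"
      proof (rule fmor_eqI)
        show "Comp FC (Fe e) (\<pi> (s e)) \<in> Mor FC" using FC_Comp_mor f by blast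
        show "snd (Comp FC (Fe e) (\<pi> (s e))) = snd (\<pi> (t e))" using Fe pi st 2 by (simp add: prod_eq_iff)
        show "maps_to (fst (\<pi> (t e)) N) a c" if "N \<in> Obj C" "maps_to (fst (Comp FC (Fe e) (\<pi> (s e))) N) a c" for N a c
          using that comm[OF 2(1) that(1)] FC_maps_to_Comp[OF f(2,1,3) that(1)] by blast
      qed (rule f)
      then show ?thesis using 2 by simp
    qed
  qed
  have "limit_cone ?J FC ?D v \<pi>"
  proof (rule d.limit_cone_pointwise[OF _ cone])
    fix N assume N: "N \<in> Obj C"
    show "ods_diagram.elem_limit ?J (d.ev N) (fst v N) (\<lambda>j. fst (\<pi> j) N)"
      unfolding ods_diagram.elem_limit_def[OF d.ev_diagram[OF N]] ods_diagram.compat_def[OF d.ev_diagram[OF N]]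
    proof (intro conjI allI impI)
      fix x assume "(\<forall>j\<in>Obj ?J. (x j, x j) \<in> fst (d.ev N) j) \<and>
        (\<forall>u\<in>Mor ?J. maps_to (snd (d.ev N) u) (x (Src ?J u)) (x (Tgt ?J u)))"
      then have *: "\<And>j. j \<in> Obj ?J \<Longrightarrow> (x j, x j) \<in> fst (d.ev N) j"
        "\<And>u. u \<in> Mor ?J \<Longrightarrow> maps_to (snd (d.ev N) u) (x (Src ?J u)) (x (Tgt ?J u))" by blast+
      show "\<exists>y. (y, y) \<in> fst v N \<and> (\<forall>j\<in>Obj ?J. maps_to (fst (\<pi> j) N) y (x j))"
        unfolding edge_cat_simps(1)
      proof (rule ex[OF N])
        show "(x j, x j) \<in> fst (Fo j) N" if "j \<in> V" for j using *(1)[of j] that by simp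
        show "maps_to (fst (Fe e) N) (x (s e)) (x (t e))" if e: "e \<in> E" for e
          using *(2)[of "Suc (2 * e)"] d.ev_simps(2)[of "Suc (2 * e)" N] e by auto
      qed
    qed (use uniq[OF N] in auto)
  qed (use fin in auto)
  then have lim: "limit_cone ?J ODS (comp_functor ?J \<Phi> ?D) (fst \<Phi> v) (\<lambda>j. snd \<Phi> (\<pi> j))"
    using \<Phi>[unfolded sigma_pretopos_morphism_def preserves_finite_limits_def, THEN conjunct2, THEN conjunct2,
        rule_format, of ?J ?D v \<pi>] J D fin by simp
  interpret o: ods_diagram ?J "comp_functor ?J \<Phi> ?D"
    by unfold_locales (use J is_functor_comp[OF D Phi_functor J] in auto)
  have "o.compat x"
    unfolding o.compat_def
  proof (intro conjI ballI)
    show "(x j, x j) \<in> fst (comp_functor ?J \<Phi> ?D) j" if "j \<in> Obj ?J" for j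
      using that x(1) by (simp add: comp_functor_def compose_def)
    fix u assume "u \<in> Mor ?J"
    then consider j where "j \<in> V" "u = 2 * j" | e where "e \<in> E" "u = Suc (2 * e)" by auto
    then show "maps_to (snd (comp_functor ?J \<Phi> ?D) u) (x (Src ?J u)) (x (Tgt ?J u))"
    proof cases
      case 1
      then have "snd (comp_functor ?J \<Phi> ?D) u = snd \<Phi> (Idn FC (Fo j))"
        by (simp add: comp_functor_def compose_def)
      then show ?thesis using 1 x(1) Phi_id[OF Fo] by simp
    next
      case 2
      then have "snd (comp_functor ?J \<Phi> ?D) u = snd \<Phi> (Fe e)"
        by (auto simp: comp_functor_def compose_def)
      then show ?thesis using 2 x(2) by simp
    qed
  qed
  from o.limit_coneD[OF lim this] show ?thesis by simp
qed

text \<open>Joint injectivity of \<open>p\<close> is expressed by the limit of two copies of the source over the targets.\<close>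

lemma Phi_jointly_inj:
  fixes n :: nat
  assumes S: "S \<in> Obj FC"
    and p: "\<And>i. i < n \<Longrightarrow> p i \<in> Mor FC \<and> fst (snd (p i)) = S"
    and inj: "\<And>N y y'. N \<in> Obj C \<Longrightarrow> (y, y) \<in> fst S N \<Longrightarrow> (y', y') \<in> fst S N \<Longrightarrow>
        (\<And>i. i < n \<Longrightarrow> \<exists>x. maps_to (fst (p i) N) y x \<and> maps_to (fst (p i) N) y' x) \<Longrightarrow> (y, y') \<in> fst S N"
    and z: "(z, z) \<in> fst \<Phi> S" "(z', z') \<in> fst \<Phi> S"
      "\<And>i. i < n \<Longrightarrow> \<exists>x. maps_to (snd \<Phi> (p i)) z x \<and> maps_to (snd \<Phi> (p i)) z' x"
  shows "(z, z') \<in> fst \<Phi> S"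
proof -
  obtain c where c: "\<And>i. i < n \<Longrightarrow> maps_to (snd \<Phi> (p i)) z (c i) \<and> maps_to (snd \<Phi> (p i)) z' (c i)"
    using z(3) by metis
  \<comment> \<open>Vertices 0 and 1 are the two copies of S, and vertex i + 2 is the target of p i.
    Edge e is p (e div 2), leaving copy e mod 2.\<close>
  define V where "V = {..<n + 2}"
  define E where "E = {..<2 * n}"
  define s where "s e = e mod 2" for e :: nat
  define t where "t e = e div 2 + 2" for e :: nat
  define Fo where "Fo j = (if j < 2 then S else snd (snd (p (j - 2))))" for j
  define Fe where "Fe e = p (e div 2)" for e
  \<comment> \<open>Both copies receive the identity of S. That S is the limit in this way is
    precisely joint injectivity.\<close>
  define \<pi> where "\<pi> j = (if j < 2 then Idn FC S else p (j - 2))" for j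
  define x where "x j = (if j = 0 then z else if j = 1 then z' else c (j - 2))" for j :: nat
  note I = FC_Idn_mor[OF S]
  have "\<exists>y. (y, y) \<in> fst \<Phi> S \<and> (\<forall>j\<in>V. maps_to (snd \<Phi> (\<pi> j)) y (x j))"
  proof (rule edge_limit[where s = s and t = t and E = E and Fe = Fe and Fo = Fo])
    show "finite V" "finite E" by (simp_all add: V_def E_def)
    show "s e \<in> V \<and> t e \<in> V" if "e \<in> E" for e
      using that by (auto simp: s_def t_def V_def E_def less_mult_imp_div_less)
    show "s e \<noteq> t e'" for e e'
      unfolding s_def t_def by (metis add.commute mod_less_divisor not_add_less1 pos2)
    show "Fe e \<in> Mor FC \<and> fst (snd (Fe e)) = Fo (s e) \<and> snd (snd (Fe e)) = Fo (t e)" if "e \<in> E" for e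
    proof -
      have "e div 2 < n" using that unfolding E_def by auto
      then show ?thesis using p[of "e div 2"] by (auto simp: Fe_def Fo_def s_def t_def)
    qed
    show "S \<in> Obj FC" by (rule S)
    show "\<pi> j \<in> Mor FC \<and> fst (snd (\<pi> j)) = S \<and> snd (snd (\<pi> j)) = Fo j" if "j \<in> V" for j
      using I p[of "j - 2"] that by (auto simp: \<pi>_def Fo_def V_def FC_simps(3))
    show "maps_to (fst (\<pi> (t e)) N) a d"
      if e: "e \<in> E" and N: "N \<in> Obj C" and m: "maps_to (fst (\<pi> (s e)) N) a b" "maps_to (fst (Fe e) N) b d" for e N a b d
    proof -
      have n: "e div 2 < n" using e unfolding E_def by auto
      note pe = p[OF n, THEN conjunct1]
      have "(a, b) \<in> fst S N" using m(1) FC_maps_to_Idn[OF S N] by (simp add: \<pi>_def s_def)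
      then have "(b, a) \<in> fst (fst (p (e div 2)) N)"
        using per_sym[OF fobj_per[OF S N]] fmor_src[OF pe N] p[OF n] by simp
      moreover have "maps_to (fst (p (e div 2)) N) b d" using m(2) by (simp add: Fe_def)
      ultimately have "maps_to (fst (p (e div 2)) N) a d"
        using maps_to_cong[OF fmor_mor[OF pe N]] maps_to_cod by blast
      then show ?thesis by (simp add: \<pi>_def t_def)
    qed
    show "\<exists>y. (y, y) \<in> fst S N \<and> (\<forall>j\<in>V. maps_to (fst (\<pi> j) N) y (x j))"
      if N: "N \<in> Obj C" and xo: "\<And>j. j \<in> V \<Longrightarrow> (x j, x j) \<in> fst (Fo j) N"
        and xe: "\<And>e. e \<in> E \<Longrightarrow> maps_to (fst (Fe e) N) (x (s e)) (x (t e))" for N x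
    proof (intro exI[of _ "x 0"] conjI ballI)
      show x0: "(x 0, x 0) \<in> fst S N" using xo[of 0] by (simp add: V_def Fo_def)
      have x1: "(x 1, x 1) \<in> fst S N" using xo[of 1] by (simp add: V_def Fo_def)
      have xi: "maps_to (fst (p i) N) (x 0) (x (i + 2))" "maps_to (fst (p i) N) (x 1) (x (i + 2))" if "i < n" for i
        using xe[of "2 * i"] xe[of "2 * i + 1"] that by (simp_all add: E_def Fe_def s_def t_def)
      have x01: "(x 0, x 1) \<in> fst S N" using inj[OF N x0 x1] xi by blast
      fix j assume j: "j \<in> V"
      consider "j = 0" | "j = 1" | "j \<ge> 2" by linarith
      then show "maps_to (fst (\<pi> j) N) (x 0) (x j)"
      proof cases
        case 3
        then have "Suc (Suc (j - 2)) = j" by simp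
        then show ?thesis using 3 xi(1)[of "j - 2"] j by (simp add: \<pi>_def V_def)
      qed (use x0 x01 FC_maps_to_Idn[OF S N] in \<open>auto simp: \<pi>_def\<close>)
    qed
    show "(y, y') \<in> fst S N"
      if N: "N \<in> Obj C" and y: "(y, y) \<in> fst S N" "(y', y') \<in> fst S N"
        and e: "\<And>j. j \<in> V \<Longrightarrow> \<exists>x. maps_to (fst (\<pi> j) N) y x \<and> maps_to (fst (\<pi> j) N) y' x" for N y y'
    proof -
      have "\<exists>x. (y, x) \<in> fst S N \<and> (y', x) \<in> fst S N"
        using e[of 0] FC_maps_to_Idn[OF S N] by (auto simp: V_def \<pi>_def)
      then show ?thesis using per_sym[OF fobj_per[OF S N]] per_trans[OF fobj_per[OF S N]] by blast
    qed
    show "(x j, x j) \<in> fst \<Phi> (Fo j)" if "j \<in> V" for j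
    proof (cases "j < 2")
      case True
      then show ?thesis using z by (auto simp: x_def Fo_def less_2_cases_iff)
    next
      case False
      then have "j - 2 < n" using that by (auto simp: V_def)
      then show ?thesis
        using maps_to_cod[OF c[THEN conjunct1], of "j - 2"] Phi_tgt[of "p (j - 2)"] p[of "j - 2"] False
        by (auto simp: x_def Fo_def)
    qed
    show "maps_to (snd \<Phi> (Fe e)) (x (s e)) (x (t e))" if "e \<in> E" for e
    proof -
      have n: "e div 2 < n" using that unfolding E_def by auto
      have "s e = 0 \<or> s e = 1" unfolding s_def by auto
      then show ?thesis using c[OF n] by (auto simp: x_def Fe_def t_def)
    qed
  qed
  \<comment> \<open>The two identity projections make y equivalent to z and to z'.\<close>
  then obtain y where y: "\<forall>j\<in>V. maps_to (snd \<Phi> (\<pi> j)) y (x j)" by blast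
  have "(y, z) \<in> fst \<Phi> S" "(y, z') \<in> fst \<Phi> S"
    using y[rule_format, of 0] y[rule_format, of 1] Phi_id[OF S] by (auto simp: V_def \<pi>_def x_def)
  then show ?thesis using per_sym[OF Phi_per[OF S]] per_trans[OF Phi_per[OF S]] by blast
qed

lemma Phi_pullback:
  assumes a: "\<alpha> \<in> Mor FC" and b: "\<beta> \<in> Mor FC" and ab: "snd (snd \<alpha>) = snd (snd \<beta>)"
    and p: "p \<in> Mor FC" "snd (snd p) = fst (snd \<alpha>)" and q: "q \<in> Mor FC" "snd (snd q) = fst (snd \<beta>)"
    and pq: "fst (snd p) = fst (snd q)"
    and comm: "\<And>N w x y c. N \<in> Obj C \<Longrightarrow> maps_to (fst p N) w x \<Longrightarrow> maps_to (fst q N) w y \<Longrightarrow>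
       maps_to (fst \<alpha> N) x c \<Longrightarrow> maps_to (fst \<beta> N) y c"
    and ex: "\<And>N x y c. N \<in> Obj C \<Longrightarrow> maps_to (fst \<alpha> N) x c \<Longrightarrow> maps_to (fst \<beta> N) y c \<Longrightarrow>
        \<exists>w. maps_to (fst p N) w x \<and> maps_to (fst q N) w y"
    and uniq: "\<And>N w w' x y. N \<in> Obj C \<Longrightarrow> maps_to (fst p N) w x \<Longrightarrow> maps_to (fst p N) w' x \<Longrightarrow>
        maps_to (fst q N) w y \<Longrightarrow> maps_to (fst q N) w' y \<Longrightarrow> (w, w') \<in> fst (fst (snd p)) N"
    and xy: "maps_to (snd \<Phi> \<alpha>) x c" "maps_to (snd \<Phi> \<beta>) y c"
  shows "\<exists>w. maps_to (snd \<Phi> p) w x \<and> maps_to (snd \<Phi> q) w y"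
proof -
  define Fo where "Fo j = (if j = 0 then fst (snd \<alpha>) else if j = 1 then fst (snd \<beta>) else snd (snd \<alpha>))" for j :: nat
  define Fe where "Fe e = (if e = 0 then \<alpha> else \<beta>)" for e :: nat
  \<comment> \<open>The common target is a third vertex of the cospan, so the cone has the composite
    through \<alpha> as its third leg.\<close>
  define \<pi> where "\<pi> j = (if j = 0 then p else if j = 1 then q else Comp FC \<alpha> p)" for j :: nat
  define z where "z j = (if j = 0 then x else if j = 1 then y else c)" for j :: nat
  let ?v = "fst (snd p)"
  note c1 = FC_Comp_mor[OF p(1) a p(2)[symmetric]] and c1r = FC_maps_to_Comp[OF p(1) a p(2)[symmetric]]
  have "\<exists>w. (w, w) \<in> fst \<Phi> ?v \<and> (\<forall>j\<in>{0, 1, 2}. maps_to (snd \<Phi> (\<pi> j)) w (z j))"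
  proof (rule edge_limit[where s = "\<lambda>e. e" and t = "\<lambda>_. 2" and E = "{0, 1}" and Fe = Fe and Fo = Fo])
    show "Fe e \<in> Mor FC \<and> fst (snd (Fe e)) = Fo e \<and> snd (snd (Fe e)) = Fo 2" if "e \<in> {0, 1}" for e
      using that a b ab by (auto simp: Fe_def Fo_def)
    show "?v \<in> Obj FC" using fmor_Src[OF p(1)] .
    show "\<pi> j \<in> Mor FC \<and> fst (snd (\<pi> j)) = ?v \<and> snd (snd (\<pi> j)) = Fo j" if "j \<in> {0, 1, 2}" for j
      using that p q pq c1 by (auto simp: \<pi>_def Fo_def)
    show "maps_to (fst (\<pi> 2) N) d f"
      if e: "e \<in> {0, 1}" and N: "N \<in> Obj C" and m: "maps_to (fst (\<pi> e) N) d g" "maps_to (fst (Fe e) N) g f" for e N d g f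
    proof (cases "e = 0")
      case True
      then show ?thesis using m c1r[OF N] by (auto simp: \<pi>_def Fe_def)
    next
      case False
      then have m': "maps_to (fst q N) d g" "maps_to (fst \<beta> N) g f" using m e by (auto simp: \<pi>_def Fe_def)
      have "(d, d) \<in> fst (fst p N)" using maps_to_dom[OF m'(1)] fmor_src[OF p(1) N] fmor_src[OF q(1) N] pq by simp
      then obtain k where k: "maps_to (fst p N) d k" using maps_to_total fmor_mor[OF p(1) N] by blast
      have "(k, k) \<in> fst (fst \<alpha> N)" using maps_to_cod[OF k] fmor_src[OF a N] fmor_tgt[OF p(1) N] p(2) by simp
      then obtain l where l: "maps_to (fst \<alpha> N) k l" using maps_to_total fmor_mor[OF a N] by blast
      have "maps_to (fst \<beta> N) g l" using comm[OF N k m'(1) l] .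
      from maps_to_fun[OF fmor_mor[OF b N] this m'(2)] have "(l, f) \<in> fst (snd (fst \<alpha> N))"
        using fmor_tgt[OF a N] fmor_tgt[OF b N] ab by simp
      then have "maps_to (fst \<alpha> N) k f" using maps_to_cong[OF fmor_mor[OF a N] l] maps_to_dom[OF l] by blast
      then show ?thesis using k c1r[OF N] by (auto simp: \<pi>_def)
    qed
    show "\<exists>y. (y, y) \<in> fst ?v N \<and> (\<forall>j\<in>{0, 1, 2}. maps_to (fst (\<pi> j) N) y (x j))"
      if N: "N \<in> Obj C" and "\<And>e. e \<in> {0, 1} \<Longrightarrow> maps_to (fst (Fe e) N) (x e) (x 2)" for N and x :: "nat \<Rightarrow> nat"
    proof -
      have m: "maps_to (fst \<alpha> N) (x 0) (x 2)" "maps_to (fst \<beta> N) (x 1) (x 2)"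
        using that(2)[of 0] that(2)[of 1] by (auto simp: Fe_def)
      obtain w where w: "maps_to (fst p N) w (x 0)" "maps_to (fst q N) w (x 1)" using ex[OF N m] by blast
      have "maps_to (fst (Comp FC \<alpha> p) N) w (x 2)" using w m c1r[OF N] by blast
      then show ?thesis using w maps_to_dom[OF w(1)] fmor_src[OF p(1) N] by (auto simp: \<pi>_def)
    qed
    show "(w, w') \<in> fst ?v N"
      if N: "N \<in> Obj C" and e: "\<And>j. j \<in> {0, 1, 2} \<Longrightarrow> \<exists>x. maps_to (fst (\<pi> j) N) w x \<and> maps_to (fst (\<pi> j) N) w' x" for N w w'
      using e[of 0] e[of 1] uniq[OF N] by (auto simp: \<pi>_def)
    show "(z j, z j) \<in> fst \<Phi> (Fo j)" if "j \<in> {0, 1, 2}" for j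
      using that maps_to_dom[OF xy(1)] maps_to_dom[OF xy(2)] maps_to_cod[OF xy(1)] Phi_src[OF a] Phi_src[OF b] Phi_tgt[OF a]
      by (auto simp: z_def Fo_def)
    show "maps_to (snd \<Phi> (Fe e)) (z e) (z 2)" if "e \<in> {0, 1}" for e
      using that xy by (auto simp: Fe_def z_def)
  qed auto
  then show ?thesis by (auto simp: \<pi>_def z_def)
qed

text \<open>Such a v is a limit of the empty diagram, and the image is a limit of the empty diagram
  in \<open>ODS\<close>, hence inhabited.\<close>

lemma Phi_terminal:
  assumes v: "v \<in> Obj FC" and ex: "\<And>N. N \<in> Obj C \<Longrightarrow> \<exists>y. (y, y) \<in> fst v N"
    and uniq: "\<And>N y y'. N \<in> Obj C \<Longrightarrow> (y, y) \<in> fst v N \<Longrightarrow> (y', y') \<in> fst v N \<Longrightarrow> (y, y') \<in> fst v N"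
  shows "\<exists>z. (z, z) \<in> fst \<Phi> v"
proof -
  have "\<exists>y. (y, y) \<in> fst \<Phi> v \<and> (\<forall>j\<in>({} :: nat set). maps_to (snd \<Phi> (Idn FC v)) y 0)"
  proof (rule edge_limit[where s = "\<lambda>e. e" and t = "\<lambda>e. e" and E = "{}" and V = "{}"
        and Fe = "\<lambda>_. Idn FC v" and Fo = "\<lambda>_. v" and \<pi> = "\<lambda>_. Idn FC v" and x = "\<lambda>_. 0"])
    show "v \<in> Obj FC" by (rule v)
    show "\<exists>y. (y, y) \<in> fst v N \<and> (\<forall>j\<in>{}. maps_to (fst (Idn FC v) N) y (x j))" if "N \<in> Obj C" for N and x :: "nat \<Rightarrow> nat"
      using ex[OF that] by simp
    show "(y, y') \<in> fst v N" if "N \<in> Obj C" "(y, y) \<in> fst v N" "(y', y') \<in> fst v N" for N y y'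
      using uniq that by blast
  qed simp_all
  then show ?thesis by simp
qed

text \<open>Joint surjectivity of \<open>\<alpha>\<close> says that the identities form a colimit of two copies of the target
  glued along \<open>\<alpha>\<close>.\<close>

lemma Phi_jointly_surj:
  fixes I :: "nat set"
  assumes F: "F \<in> Obj FC"
    and al: "\<And>i. i \<in> I \<Longrightarrow> \<alpha> i \<in> Mor FC \<and> snd (snd (\<alpha> i)) = F"
    and surj: "\<And>N y. N \<in> Obj C \<Longrightarrow> (y, y) \<in> fst F N \<Longrightarrow> \<exists>i\<in>I. \<exists>x. maps_to (fst (\<alpha> i) N) x y"
    and y: "(y, y) \<in> fst \<Phi> F"
  shows "\<exists>i\<in>I. \<exists>x. maps_to (snd \<Phi> (\<alpha> i)) x y"
proof (rule ccontr)
  assume not: "\<not> ?thesis"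
  \<comment> \<open>Vertices 0 and 1 are the copies of F, and vertex i + 2 is the source of \<alpha>
    i; for i in I the edges 2 * i and 2 * i + 1 run from there to the two copies.\<close>
  define V where "V = {0, 1} \<union> (\<lambda>i. i + 2) ` I"
  define E where "E = {e. e div 2 \<in> I}"
  define s where "s e = e div 2 + 2" for e :: nat
  define t where "t e = e mod 2" for e :: nat
  define Fo where "Fo j = (if j < 2 then F else fst (snd (\<alpha> (j - 2))))" for j
  define Fe where "Fe e = \<alpha> (e div 2)" for e
  define \<iota> where "\<iota> j = (if j < 2 then Idn FC F else \<alpha> (j - 2))" for j
  let ?J = "edge_cat V E s t" and ?D = "edge_fun FC V E Fo Fe"
  have tV: "t e = 0 \<or> t e = 1" for e unfolding t_def by auto
  have st: "s e \<in> V \<and> t e \<in> V" if "e \<in> E" for e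
    using that tV[of e] by (auto simp: s_def V_def E_def)
  have ne: "s e \<noteq> t e'" for e e' using tV[of e'] by (auto simp: s_def)
  have Vcases: "j = 0 \<or> j = 1 \<or> (j \<ge> 2 \<and> j - 2 \<in> I)" if "j \<in> V" for j using that by (auto simp: V_def)
  have Fo: "Fo j \<in> Obj FC" if "j \<in> V" for j
    using F al[THEN conjunct1, THEN fmor_Src] Vcases[OF that] by (auto simp: Fo_def)
  have Fe: "Fe e \<in> Mor FC \<and> fst (snd (Fe e)) = Fo (s e) \<and> snd (snd (Fe e)) = Fo (t e)" if "e \<in> E" for e
    using that al[of "e div 2"] tV[of e] by (auto simp: Fe_def Fo_def s_def E_def)
  have J: "category ?J" using st ne by (rule category_edge_cat)
  have D: "is_functor ?J FC ?D"
    by (rule is_functor_edge_fun) (use FC_category st ne Fo Fe in \<open>auto simp: FC_simps(1,2)\<close>)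
  have iota: "\<iota> j \<in> Mor FC \<and> fst (snd (\<iota> j)) = Fo j \<and> snd (snd (\<iota> j)) = F" if "j \<in> V" for j
    using FC_Idn_mor[OF F] al[of "j - 2"] Vcases[OF that] by (auto simp: \<iota>_def Fo_def FC_simps(3))
  have edges: "u \<in> Mor ?J \<longleftrightarrow> (\<exists>j\<in>V. u = 2 * j) \<or> (\<exists>e\<in>E. u = Suc (2 * e))" for u by auto
  have "colimit_cocone ?J FC ?D F \<iota>"
    unfolding colimit_cocone_def
  proof (intro conjI allI impI)
    show "cocone ?J FC ?D F \<iota>"
      unfolding cocone_def
    proof (intro conjI ballI F)
      show "\<iota> j \<in> Mor FC" "Src FC (\<iota> j) = fst ?D j" "Tgt FC (\<iota> j) = F" if "j \<in> Obj ?J" for j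
        using iota that by (simp_all add: FC_simps(1,2))
      fix u assume "u \<in> Mor ?J"
      then consider j where "j \<in> V" "u = 2 * j" | e where "e \<in> E" "u = Suc (2 * e)" using edges by blast
      then show "Comp FC (\<iota> (Tgt ?J u)) (snd ?D u) = \<iota> (Src ?J u)"
      proof cases
        case 1
        then show ?thesis using FC_Comp_Idn[of "\<iota> j"] iota by simp
      next
        case 2
        then have "e div 2 \<in> I" by (simp add: E_def)
        from al[OF this] show ?thesis
          using 2 tV[of e] FC_Idn_Comp[of "\<alpha> (e div 2)"] by (auto simp: \<iota>_def Fe_def s_def)
      qed
    qed
    fix w \<kappa> assume w: "cocone ?J FC ?D w \<kappa>"
    have k: "\<kappa> j \<in> Mor FC" "fst (snd (\<kappa> j)) = Fo j" "snd (snd (\<kappa> j)) = w" if "j \<in> V" for j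
      using w that unfolding cocone_def FC_simps(1,2) by auto
    have ke: "Comp FC (\<kappa> (t e)) (Fe e) = \<kappa> (s e)" if "e \<in> E" for e
    proof -
      have "Suc (2 * e) \<in> Mor ?J" using that by auto
      then have "Comp FC (\<kappa> (Tgt ?J (Suc (2 * e)))) (snd ?D (Suc (2 * e))) = \<kappa> (Src ?J (Suc (2 * e)))"
        using w unfolding cocone_def by blast
      then show ?thesis using that by simp
    qed
    have V01: "0 \<in> V" "1 \<in> V" by (auto simp: V_def)
    have kal: "Comp FC (\<kappa> 0) (\<alpha> i) = \<kappa> (i + 2)" "Comp FC (\<kappa> 1) (\<alpha> i) = \<kappa> (i + 2)" if "i \<in> I" for i
      using ke[of "2 * i"] ke[of "2 * i + 1"] that by (simp_all add: t_def s_def Fe_def E_def)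
    \<comment> \<open>Both legs agree after every \<alpha> i, and the \<alpha> i are jointly
      surjective at each object; so the two copies of F are identified.\<close>
    have k01: "\<kappa> 0 = \<kappa> 1"
    proof (rule fmor_eqI)
      show "snd (\<kappa> 0) = snd (\<kappa> 1)" using k V01 by (simp add: prod_eq_iff Fo_def)
      fix N a b assume N: "N \<in> Obj C" and ab: "maps_to (fst (\<kappa> 0) N) a b"
      have "(a, a) \<in> fst F N" using maps_to_dom[OF ab] fmor_src[OF k(1)[OF V01(1)] N] k(2)[OF V01(1)] by (simp add: Fo_def)
      then obtain i x where i: "i \<in> I" "maps_to (fst (\<alpha> i) N) x a" using surj[OF N] by blast
      have e: "fst (snd (\<kappa> 0)) = snd (snd (\<alpha> i))" "fst (snd (\<kappa> 1)) = snd (snd (\<alpha> i))"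
        using al[OF i(1)] k(2) V01 by (auto simp: Fo_def)
      note ai = al[OF i(1), THEN conjunct1]
      have "maps_to (fst (Comp FC (\<kappa> 0) (\<alpha> i)) N) x b"
        unfolding FC_maps_to_Comp[OF ai k(1)[OF V01(1)] e(1) N] using i ab by blast
      then have "maps_to (fst (Comp FC (\<kappa> 1) (\<alpha> i)) N) x b" using kal[OF i(1)] by simp
      then obtain a' where a': "maps_to (fst (\<alpha> i) N) x a'" "maps_to (fst (\<kappa> 1) N) a' b"
        unfolding FC_maps_to_Comp[OF ai k(1)[OF V01(2)] e(2) N] by blast
      have "(a', a) \<in> fst (fst (\<kappa> 1) N)"
        using maps_to_fun[OF fmor_mor[OF ai N] a'(1) i(2)] fmor_tgt[OF ai N] fmor_src[OF k(1)[OF V01(2)] N] e by simp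
      then show "maps_to (fst (\<kappa> 1) N) a b"
        using maps_to_cong[OF fmor_mor[OF k(1)[OF V01(2)] N] a'(2)] maps_to_cod[OF a'(2)] by blast
    qed (use k V01 in auto)
    show "\<exists>!m. m \<in> Mor FC \<and> Src FC m = F \<and> Tgt FC m = w \<and> (\<forall>j\<in>Obj ?J. Comp FC m (\<iota> j) = \<kappa> j)"
      unfolding FC_simps(1,2) edge_cat_simps(1)
    proof (rule ex1I[of _ "\<kappa> 0"])
      show "\<kappa> 0 \<in> Mor FC \<and> fst (snd (\<kappa> 0)) = F \<and> snd (snd (\<kappa> 0)) = w \<and> (\<forall>j\<in>V. Comp FC (\<kappa> 0) (\<iota> j) = \<kappa> j)"
      proof (intro conjI ballI)
        show e: "fst (snd (\<kappa> 0)) = F" using k(2)[OF V01(1)] by (simp add: Fo_def)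
        fix j assume "j \<in> V"
        then consider "j < 2" | "j \<ge> 2" "j - 2 \<in> I" using Vcases by force
        then show "Comp FC (\<kappa> 0) (\<iota> j) = \<kappa> j"
        proof cases
          case 1
          then have "\<kappa> j = \<kappa> 0" using k01 by (auto simp: less_2_cases_iff)
          then show ?thesis using 1 FC_Comp_Idn[OF k(1)[OF V01(1)]] e by (simp add: \<iota>_def)
        next
          case 2
          have "Suc (Suc (j - 2)) = j" using 2 by simp
          then show ?thesis using 2 kal(1)[OF 2(2)] by (simp add: \<iota>_def)
        qed
      qed (use k V01 in auto)
      fix m assume m: "m \<in> Mor FC \<and> fst (snd m) = F \<and> snd (snd m) = w \<and> (\<forall>j\<in>V. Comp FC m (\<iota> j) = \<kappa> j)"
      then have "Comp FC m (\<iota> 0) = \<kappa> 0" using V01 by blast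
      then show "m = \<kappa> 0" using FC_Comp_Idn m by (simp add: \<iota>_def) metis
    qed
  qed
  then have col: "colimit_cocone ?J ODS (comp_functor ?J \<Phi> ?D) (fst \<Phi> F) (\<lambda>j. snd \<Phi> (\<iota> j))"
    using \<Phi> J D unfolding sigma_pretopos_morphism_def preserves_countable_colimits_def by blast
  \<comment> \<open>A two-element test object. The map m1 is constantly 0, while m2 is the indicator
    of the class of y. If y is in no image, they agree after every \<alpha> i and define a cocone,
    and the colimit forces m1 = m2.\<close>
  define W :: per where "W = {(0, 0), (1, 1)}"
  have W: "is_per W" unfolding is_per_def sym_def trans_def W_def by blast
  note P = Phi_per[OF F]
  define m1 where "m1 = mk_mor (fst \<Phi> F) W (\<lambda>a b. (a, a) \<in> fst \<Phi> F \<and> b = 0)"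
  define m2 where "m2 = mk_mor (fst \<Phi> F) W (\<lambda>a b. (a, a) \<in> fst \<Phi> F \<and> b = (if (a, y) \<in> fst \<Phi> F then 1 else 0))"
  have map: "is_map (fst \<Phi> F) W (\<lambda>a b. (a, a) \<in> fst \<Phi> F \<and> b = f a)"
    if f: "\<And>a. f a < 2" "\<And>a a'. (a, a') \<in> fst \<Phi> F \<Longrightarrow> f a = f a'" for f :: "nat \<Rightarrow> nat"
    unfolding is_map_def
  proof (intro conjI allI impI P W)
    fix a b assume ab: "(a, a) \<in> fst \<Phi> F \<and> b = f a"
    then show "(a, a) \<in> fst \<Phi> F" by blast
    show "(b, b) \<in> W" using ab f(1)[of a] by (auto simp: W_def less_2_cases_iff)
  next
    fix a a' b b' assume *: "(a, a) \<in> fst \<Phi> F \<and> b = f a" "(a, a') \<in> fst \<Phi> F" "(b, b') \<in> W"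
    show "(a', a') \<in> fst \<Phi> F" using per_refl[OF P *(2)] by blast
    show "b' = f a'" using * f(2)[OF *(2)] by (auto simp: W_def)
  next
    fix a b b' assume *: "(a, a) \<in> fst \<Phi> F \<and> b = f a" "(a, a) \<in> fst \<Phi> F \<and> b' = f a"
    then show "(b, b') \<in> W" using f(1)[of a] by (auto simp: W_def less_2_cases_iff)
  qed simp
  have map1: "is_map (fst \<Phi> F) W (\<lambda>a b. (a, a) \<in> fst \<Phi> F \<and> b = 0)"
    by (rule map) simp_all
  have map2: "is_map (fst \<Phi> F) W (\<lambda>a b. (a, a) \<in> fst \<Phi> F \<and> b = (if (a, y) \<in> fst \<Phi> F then 1 else 0))"
  proof (rule map)
    fix a a' assume "(a, a') \<in> fst \<Phi> F"
    then have "(a, y) \<in> fst \<Phi> F \<longleftrightarrow> (a', y) \<in> fst \<Phi> F"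
      using per_sym[OF P] per_trans[OF P] by blast
    then show "(if (a, y) \<in> fst \<Phi> F then 1 else 0 :: nat) = (if (a', y) \<in> fst \<Phi> F then 1 else 0)" by simp
  qed simp
  note m1 = mk_mor_in_mors[OF map1, folded m1_def] maps_to_mk_mor[OF map1, folded m1_def]
  note m2 = mk_mor_in_mors[OF map2, folded m2_def] maps_to_mk_mor[OF map2, folded m2_def]
  have ms: "fst m1 = fst \<Phi> F" "fst (snd m1) = W" "fst m2 = fst \<Phi> F" "fst (snd m2) = W"
    by (simp_all add: m1_def m2_def)
  have m12: "Comp ODS m2 (snd \<Phi> (\<alpha> i)) = Comp ODS m1 (snd \<Phi> (\<alpha> i))" if i: "i \<in> I" for i
  proof -
    note ai = al[OF i, THEN conjunct1]
    have e: "fst m1 = fst (snd (snd \<Phi> (\<alpha> i)))" "fst m2 = fst (snd (snd \<Phi> (\<alpha> i)))"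
      using Phi_tgt[OF ai] al[OF i] ms by simp_all
    show ?thesis
    proof (rule ods_mor_eqI)
      show "Comp ODS m2 (snd \<Phi> (\<alpha> i)) \<in> ods_mors" "Comp ODS m1 (snd \<Phi> (\<alpha> i)) \<in> ods_mors"
        using Comp_in_mors[OF Phi_mor[OF ai] m1(1) e(1)] Comp_in_mors[OF Phi_mor[OF ai] m2(1) e(2)] by blast+
      fix a b assume "maps_to (Comp ODS m2 (snd \<Phi> (\<alpha> i))) a b"
      then obtain c where c: "maps_to (snd \<Phi> (\<alpha> i)) a c" "maps_to m2 c b"
        unfolding maps_to_Comp[OF Phi_mor[OF ai] m2(1) e(2)] by blast
      have "(c, y) \<notin> fst \<Phi> F"
      proof
        assume "(c, y) \<in> fst \<Phi> F"
        then have "maps_to (snd \<Phi> (\<alpha> i)) a y"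
          using maps_to_cong[OF Phi_mor[OF ai] c(1) maps_to_dom[OF c(1)]] Phi_tgt[OF ai] al[OF i] by simp
        then show False using not i by blast
      qed
      then have "maps_to m1 c b" using c(2) unfolding m1(2) m2(2) by simp
      then show "maps_to (Comp ODS m1 (snd \<Phi> (\<alpha> i))) a b"
        unfolding maps_to_Comp[OF Phi_mor[OF ai] m1(1) e(1)] using c by blast
    qed (use ms in simp_all)
  qed
  define \<kappa> where "\<kappa> j = (if j = 0 then m1 else if j = 1 then m2 else Comp ODS m1 (snd \<Phi> (\<alpha> (j - 2))))" for j
  have kap: "\<kappa> j \<in> ods_mors \<and> fst (\<kappa> j) = fst \<Phi> (Fo j) \<and> fst (snd (\<kappa> j)) = W" if "j \<in> V" for j
    using Vcases[OF that]
  proof (elim disjE)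
    assume j: "j \<ge> 2 \<and> j - 2 \<in> I"
    note ai = al[OF j[THEN conjunct2]]
    have "Comp ODS m1 (snd \<Phi> (\<alpha> (j - 2))) \<in> ods_mors"
      using Comp_in_mors[OF Phi_mor m1(1)] ai Phi_tgt ms by auto
    then show ?thesis using ai j ms Phi_src by (auto simp: \<kappa>_def Fo_def)
  qed (use m1(1) m2(1) ms in \<open>auto simp: \<kappa>_def Fo_def\<close>)
  have "cocone ?J ODS (comp_functor ?J \<Phi> ?D) W \<kappa>"
    unfolding cocone_def
  proof (intro conjI ballI)
    show "W \<in> Obj ODS" using W by (simp add: ods_objs_def)
    show "\<kappa> j \<in> Mor ODS" "Src ODS (\<kappa> j) = fst (comp_functor ?J \<Phi> ?D) j" "Tgt ODS (\<kappa> j) = W" if "j \<in> Obj ?J" for j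
      using kap that by (auto simp: comp_functor_def compose_def)
    fix u assume "u \<in> Mor ?J"
    then consider j where "j \<in> V" "u = 2 * j" | e where "e \<in> E" "u = Suc (2 * e)" using edges by blast
    then show "Comp ODS (\<kappa> (Tgt ?J u)) (snd (comp_functor ?J \<Phi> ?D) u) = \<kappa> (Src ?J u)"
    proof cases
      case 1
      then have "snd (comp_functor ?J \<Phi> ?D) u = Idn ODS (fst \<Phi> (Fo j))"
        using Phi_id_eq[OF Fo] by (simp add: comp_functor_def compose_def)
      then show ?thesis using 1 kap[of j] ODS_Comp_Idn[of "\<kappa> j"] by simp
    next
      case 2
      then have D2: "snd (comp_functor ?J \<Phi> ?D) u = snd \<Phi> (\<alpha> (e div 2))"
        by (auto simp: comp_functor_def compose_def Fe_def)
      have i: "e div 2 \<in> I" using 2 by (simp add: E_def)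
      have "Comp ODS (\<kappa> (t e)) (snd \<Phi> (\<alpha> (e div 2))) = \<kappa> (s e)"
        using tV[of e] m12[OF i] by (auto simp: \<kappa>_def s_def)
      then show ?thesis using 2 D2 by simp
    qed
  qed
  then have "\<exists>!m. m \<in> Mor ODS \<and> Src ODS m = fst \<Phi> F \<and> Tgt ODS m = W \<and> (\<forall>j\<in>Obj ?J. Comp ODS m (snd \<Phi> (\<iota> j)) = \<kappa> j)"
    using col unfolding colimit_cocone_def by blast
  then obtain m where m: "m \<in> ods_mors" "fst m = fst \<Phi> F" and mk: "\<And>j. j \<in> V \<Longrightarrow> Comp ODS m (snd \<Phi> (\<iota> j)) = \<kappa> j"
    unfolding ODS_simps edge_cat_simps(1) by blast
  have "m = \<kappa> 0" "m = \<kappa> 1"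
    using mk[of 0] mk[of 1] ODS_Comp_Idn[OF m(1)] m(2) Phi_id_eq[OF F] by (auto simp: V_def \<iota>_def)
  then have "m1 = m2" by (simp add: \<kappa>_def)
  moreover have "maps_to m1 y 0" "\<not> maps_to m2 y 0" using y unfolding m1(2) m2(2) by auto
  ultimately show False by simp
qed

end

subsection \<open>The topological category of models\<close>

lemma tuple_eq_iff: "length as = length bs \<Longrightarrow> tuple as = tuple bs \<longleftrightarrow> as = bs"
proof (cases "length as")
  case (Suc n)
  assume "length as = length bs"
  then show ?thesis using bij_betw_tuple[of n] Suc unfolding bij_betw_def inj_on_def by auto
qed auto

abbreviation eqv :: "'p struct \<Rightarrow> nat \<Rightarrow> nat \<Rightarrow> bool" where
  "eqv M a b \<equiv> (a, b) \<in> fst M"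

lemma per_power_iff: "(u, v) \<in> per_power A n \<longleftrightarrow>
    (\<exists>as bs. u = tuple as \<and> v = tuple bs \<and> length as = n \<and> list_all2 (\<lambda>a b. (a, b) \<in> A) as bs)"
  unfolding per_power_def list_all2_conv_all_nth by (auto; metis)

lemma list_all2_refl_iff: "list_all2 (\<lambda>a b. (a, b) \<in> A) as as \<longleftrightarrow> (\<forall>a\<in>set as. (a, a) \<in> A)"
  by (rule list_all2_same)

lemma list_eqv_sym: "is_per A \<Longrightarrow> list_all2 (\<lambda>a b. (a, b) \<in> A) as bs \<Longrightarrow> list_all2 (\<lambda>a b. (a, b) \<in> A) bs as"
  using per_sym unfolding list_all2_conv_all_nth by metis

lemma list_eqv_trans: "is_per A \<Longrightarrow> list_all2 (\<lambda>a b. (a, b) \<in> A) as bs \<Longrightarrow> list_all2 (\<lambda>a b. (a, b) \<in> A) bs cs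
    \<Longrightarrow> list_all2 (\<lambda>a b. (a, b) \<in> A) as cs"
  by (erule list_all2_trans[rotated]) (assumption | erule (2) per_trans)+

lemma is_per_tuples:
  assumes A: "is_per A" and len: "\<And>as. K as \<Longrightarrow> length as = n"
    and cong: "\<And>as bs. K as \<Longrightarrow> list_all2 (\<lambda>a b. (a, b) \<in> A) as bs \<Longrightarrow> K bs"
  shows "is_per {(u, v). \<exists>as bs. u = tuple as \<and> v = tuple bs \<and> K as \<and> list_all2 (\<lambda>a b. (a, b) \<in> A) as bs}" (is "is_per ?R")
  unfolding is_per_def
proof (intro conjI symI transI)
  fix u v assume "(u, v) \<in> ?R"
  then obtain as bs where 1: "u = tuple as" "v = tuple bs" "K as" "list_all2 (\<lambda>a b. (a, b) \<in> A) as bs" by blast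
  then show "(v, u) \<in> ?R" using cong list_eqv_sym[OF A] by blast
  fix w assume "(v, w) \<in> ?R"
  then obtain bs' cs where 2: "v = tuple bs'" "w = tuple cs" "K bs'" "list_all2 (\<lambda>a b. (a, b) \<in> A) bs' cs" by blast
  have "bs = bs'" using tuple_eq_iff 1 2 len[OF 1(3)] len[OF 2(3)] list_all2_lengthD[OF 1(4)] by metis
  then show "(u, w) \<in> ?R" using 1 2 list_eqv_trans[OF A] by blast
qed

lemma subobject_tuples:
  assumes A: "is_per A"
    and cong: "\<And>as bs. length as = n \<Longrightarrow> K as \<Longrightarrow> list_all2 (\<lambda>a b. (a, b) \<in> A) as bs \<Longrightarrow> K bs"
  shows "subobject {(u, v). \<exists>as bs. u = tuple as \<and> v = tuple bs \<and> length as = n \<and>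
      list_all2 (\<lambda>a b. (a, b) \<in> A) as bs \<and> K as} (per_power A n)" (is "subobject ?R _")
  unfolding subobject_def
proof (intro conjI allI impI)
  have "?R = {(u, v). \<exists>as bs. u = tuple as \<and> v = tuple bs \<and> (length as = n \<and> K as) \<and> list_all2 (\<lambda>a b. (a, b) \<in> A) as bs}" by blast
  also have "is_per \<dots>"
  proof (rule is_per_tuples[OF A])
    show "length bs = n \<and> K bs" if "length as = n \<and> K as" "list_all2 (\<lambda>a b. (a, b) \<in> A) as bs" for as bs
      using cong[OF _ _ that(2)] that list_all2_lengthD[OF that(2)] by simp
  qed (rule conjunct1)
  finally show "is_per ?R" .
  have "per_power A n = {(u, v). \<exists>as bs. u = tuple as \<and> v = tuple bs \<and> length as = n \<and> list_all2 (\<lambda>a b. (a, b) \<in> A) as bs}"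
    by (intro set_eqI, clarify) (simp only: per_power_iff mem_Collect_eq case_prod_conv)
  also have "is_per \<dots>" by (rule is_per_tuples[OF A]) (auto dest: list_all2_lengthD)
  finally show "is_per (per_power A n)" .
  show "?R \<subseteq> per_power A n" using per_power_iff by blast
  fix u v assume uv: "(u, u) \<in> ?R \<and> (u, v) \<in> per_power A n"
  then obtain as where 1: "u = tuple as" "length as = n" "K as" by blast
  obtain as' bs where 2: "u = tuple as'" "v = tuple bs" "length as' = n" "list_all2 (\<lambda>a b. (a, b) \<in> A) as' bs"
    using uv per_power_iff by blast
  have "as = as'" using tuple_eq_iff 1 2 by metis
  then show "(u, v) \<in> ?R" using 1 2 by blast
qed

lemma list_eqv_refl: "is_per A \<Longrightarrow> list_all2 (\<lambda>a b. (a, b) \<in> A) as bs \<Longrightarrow>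
    (\<forall>a\<in>set as. (a, a) \<in> A) \<and> (\<forall>b\<in>set bs. (b, b) \<in> A)"
  using per_refl unfolding list_all2_conv_all_nth all_set_conv_all_nth by metis

lemma list_all2_total: "(\<And>a. a \<in> set as \<Longrightarrow> \<exists>b. R a b) \<Longrightarrow> \<exists>bs. list_all2 R as bs"
  by (induction as) (auto simp: list_all2_Cons1)

lemma list_maps_cong:
  assumes k: "k \<in> ods_mors" and "list_all2 (maps_to k) as bs"
    "list_all2 (\<lambda>a b. (a, b) \<in> fst k) as as'" "list_all2 (\<lambda>a b. (a, b) \<in> fst (snd k)) bs bs'"
  shows "list_all2 (maps_to k) as' bs'"
  using assms maps_to_cong[OF k] unfolding list_all2_conv_all_nth by metis

lemma list_maps_fun:
  assumes k: "k \<in> ods_mors" and "list_all2 (maps_to k) as bs" "list_all2 (maps_to k) as' bs'"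
    "list_all2 (\<lambda>a b. (a, b) \<in> fst k) as as'"
  shows "list_all2 (\<lambda>a b. (a, b) \<in> fst (snd k)) bs bs'"
  using assms maps_to_fun2[OF k] unfolding list_all2_conv_all_nth by metis

lemma list_eventually:
  assumes "list_all2 R as bs" and "\<And>a b. R a b \<Longrightarrow> eventually (\<lambda>k. R' k a b) F"
  shows "eventually (\<lambda>k. list_all2 (R' k) as bs) F"
  using assms(1)
proof (induction rule: list_all2_induct)
  case (Cons a as b bs)
  then show ?case using assms(2)[of a b] by (auto intro: eventually_conj)
qed simp

lemma list_all2_split:
  assumes "list_all2 (\<lambda>a c. \<exists>b. R a b \<and> S b c) as cs"
  shows "\<exists>bs. list_all2 R as bs \<and> list_all2 S bs cs"
  using assms
proof (induction rule: list_all2_induct)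
  case (Cons a as c cs)
  then show ?case by (auto simp: list_all2_Cons1 list_all2_Cons2)
qed auto

lemma val_nth: "distinct xs \<Longrightarrow> length as = length xs \<Longrightarrow> i < length xs \<Longrightarrow> val xs as (xs ! i) = as ! i"
  unfolding val_def by (simp add: map_of_zip_nth)

lemma val_rel: "distinct xs \<Longrightarrow> length as = length xs \<Longrightarrow> list_all2 R as bs \<Longrightarrow> x \<in> set xs \<Longrightarrow> R (val xs as x) (val xs bs x)"
  by (auto simp: in_set_conv_nth list_all2_conv_all_nth val_nth)

lemma val_map: "distinct xs \<Longrightarrow> length as = length xs \<Longrightarrow> x \<in> set xs \<Longrightarrow> val xs (map f as) x = f (val xs as x)"
  by (auto simp: in_set_conv_nth val_nth)

lemma val_self: "distinct xs \<Longrightarrow> x \<in> set xs \<Longrightarrow> val xs xs x = x"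
  by (auto simp: in_set_conv_nth val_nth)

lemma val_list_rel: "distinct xs \<Longrightarrow> length as = length xs \<Longrightarrow> list_all2 R as bs \<Longrightarrow> set ys \<subseteq> set xs \<Longrightarrow>
    list_all2 R (map (val xs as) ys) (map (val xs bs) ys)"
  by (auto simp: list_all2_conv_all_nth val_rel[OF _ _ _ subsetD] intro!: val_rel)

lemma list_maps_Idn: "is_per A \<Longrightarrow> list_all2 (maps_to (Idn ODS A)) as bs \<longleftrightarrow> list_all2 (\<lambda>a b. (a, b) \<in> A) as bs"
  by (simp add: list_all2_conv_all_nth maps_to_Idn)

locale models =
  fixes L :: "'p set" and ar :: "'p \<Rightarrow> nat" and T :: "'p sequent set"
  assumes cL: "countable L" and cT: "countable_theory L ar T"
begin

abbreviation X :: "('p struct, 'p hom) top_cat" where "X \<equiv> model_cat L ar T"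

lemma X_simps [simp]:
  "Src X h = fst (snd h)" "Tgt X h = snd (snd h)" "Idn X M = (Idn ODS (fst M), M, M)"
  "Comp X g h = (Comp ODS (fst g) (fst h), fst (snd h), snd (snd g))"
  "ObjTop X = model_space L ar T" "MorTop X = hom_space L ar T"
  by (auto simp: model_cat_def split: prod.splits)

lemma structure_in_space:
  "is_structure L ar M \<Longrightarrow> fst M \<in> ods_objs \<and> snd M \<in> continuous_maps (discrete_topology L) ods_obj_top"
  unfolding is_structure_def continuous_maps_def subobject_def by (auto simp: ods_objs_def Pi_iff)

lemma topspace_model: "topspace (model_space L ar T) = {M. is_model L ar T M}"
  unfolding model_space_def structure_space_def is_model_def using structure_in_space
  by (auto simp: mem_Times_iff)

lemma Obj_X: "M \<in> Obj X \<longleftrightarrow> is_model L ar T M"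
  using topspace_model by (simp add: model_cat_def)

lemma Obj_structure: "M \<in> Obj X \<Longrightarrow> is_structure L ar M"
  by (simp add: Obj_X is_model_def)

lemma Obj_per: "M \<in> Obj X \<Longrightarrow> is_per (fst M)"
  using Obj_structure unfolding is_structure_def by blast

lemma Mor_X: "h \<in> Mor X \<longleftrightarrow> is_hom L ar h \<and> fst (snd h) \<in> Obj X \<and> snd (snd h) \<in> Obj X"
  by (cases h) (auto simp: model_cat_def hom_space_def is_hom_def)

lemma hom_mor: "h \<in> Mor X \<Longrightarrow> fst h \<in> ods_mors" and hom_src: "h \<in> Mor X \<Longrightarrow> fst (fst h) = fst (fst (snd h))"
  and hom_tgt: "h \<in> Mor X \<Longrightarrow> fst (snd (fst h)) = fst (snd (snd h))"
  unfolding Mor_X by (auto simp: is_hom_def split: prod.splits)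

lemma hom_pred: "h \<in> Mor X \<Longrightarrow> P \<in> L \<Longrightarrow> length as = ar P \<Longrightarrow> list_all2 (maps_to (fst h)) as bs \<Longrightarrow>
    holds_pred (fst (snd h)) P as \<Longrightarrow> holds_pred (snd (snd h)) P bs"
  unfolding Mor_X is_hom_def by (auto split: prod.splits)

lemma MorI:
  assumes "k \<in> ods_mors" "fst k = fst M" "fst (snd k) = fst M'" "M \<in> Obj X" "M' \<in> Obj X"
    and "\<And>P as bs. P \<in> L \<Longrightarrow> length as = ar P \<Longrightarrow> list_all2 (maps_to k) as bs \<Longrightarrow> holds_pred M P as \<Longrightarrow> holds_pred M' P bs"
  shows "(k, M, M') \<in> Mor X"
  using assms unfolding Mor_X is_hom_def by auto

text \<open>A subobject of a power is determined by the tuples lying in it, so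
  \<open>holds_pred\<close> together with the underlying PER carries all the information of the
  structure.\<close>

lemma pred_iff:
  assumes M: "is_structure L ar M" and P: "P \<in> L"
  shows "(u, v) \<in> snd M P \<longleftrightarrow> (\<exists>as bs. u = tuple as \<and> v = tuple bs \<and> length as = ar P \<and>
     list_all2 (eqv M) as bs \<and> holds_pred M P as)"
proof -
  have s: "is_per (snd M P)" "snd M P \<subseteq> per_power (fst M) (ar P)"
    "\<And>a a'. (a, a) \<in> snd M P \<Longrightarrow> (a, a') \<in> per_power (fst M) (ar P) \<Longrightarrow> (a, a') \<in> snd M P"
    using M P unfolding is_structure_def subobject_def by blast+
  show ?thesis
  proof
    assume uv: "(u, v) \<in> snd M P"
    then obtain as bs where "u = tuple as" "v = tuple bs" "length as = ar P" "list_all2 (eqv M) as bs"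
      using s(2) per_power_iff by blast
    moreover have "(u, u) \<in> snd M P" using per_refl[OF s(1) uv] by blast
    ultimately show "\<exists>as bs. u = tuple as \<and> v = tuple bs \<and> length as = ar P \<and> list_all2 (eqv M) as bs \<and> holds_pred M P as"
      unfolding holds_pred_def by blast
  next
    assume "\<exists>as bs. u = tuple as \<and> v = tuple bs \<and> length as = ar P \<and> list_all2 (eqv M) as bs \<and> holds_pred M P as"
    then show "(u, v) \<in> snd M P" using s(3) per_power_iff unfolding holds_pred_def by blast
  qed
qed

lemma pred_dom:
  assumes M: "is_structure L ar M" and P: "P \<in> L" and as: "holds_pred M P as" "length as = ar P"
  shows "\<forall>a\<in>set as. eqv M a a"
proof -
  obtain as' bs' where "tuple as = tuple as'" "length as' = ar P" "list_all2 (eqv M) as' bs'"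
    using as(1) pred_iff[OF M P] unfolding holds_pred_def by blast
  then show ?thesis
    using as(2) tuple_eq_iff list_eqv_refl M unfolding is_structure_def by metis
qed

lemma pred_cong:
  assumes M: "is_structure L ar M" and P: "P \<in> L" and as: "holds_pred M P as" "length as = ar P" "list_all2 (eqv M) as bs"
  shows "holds_pred M P bs"
proof -
  have "(tuple as, tuple bs) \<in> snd M P" using pred_iff[OF M P] as by blast
  moreover have "is_per (snd M P)" using M P unfolding is_structure_def subobject_def by blast
  ultimately show ?thesis unfolding holds_pred_def using per_refl by blast
qed

lemma lim_structure:
  "seqlim (structure_space L ar) M l \<longleftrightarrow> is_structure L ar l \<and> (\<forall>\<^sub>s k. is_structure L ar (M k)) \<and>
     (\<forall>a b. eqv l a b \<longrightarrow> (\<forall>\<^sub>s k. eqv (M k) a b)) \<and>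
     (\<forall>P\<in>L. \<forall>u v. (u, v) \<in> snd l P \<longrightarrow> (\<forall>\<^sub>s k. (u, v) \<in> snd (M k) P))"
  (is "?lhs \<longleftrightarrow> ?rhs")
proof
  assume ?lhs
  then have *: "is_structure L ar l" "\<forall>\<^sub>s k. is_structure L ar (M k)"
    "seqlim ods_obj_top (\<lambda>k. fst (M k)) (fst l)"
    "seqlim (compact_open (discrete_topology L) ods_obj_top) (\<lambda>k. snd (M k)) (snd l)"
    unfolding structure_space_def limitin_qcb_sub limitin_qcb_prod qcb_fun_def by auto
  have "seqlim ods_obj_top (\<lambda>k. snd (M k) P) (snd l P)" if "P \<in> L" for P
    using limitin_compact_openD[OF *(4), of "\<lambda>_. P" P] that by simp
  with * show ?rhs unfolding limitin_ods_obj by blast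
next
  assume r: ?rhs
  \<comment> \<open>The function-space criterion requires every term to be continuous; the finitely
    many terms that are not structures are replaced by the limit.\<close>
  define M' where "M' k = (if is_structure L ar (M k) then M k else l)" for k
  have M': "is_structure L ar (M' k)" for k using r by (simp add: M'_def)
  have ev: "\<forall>\<^sub>s k. M' k = M k"
    using r by (auto simp: M'_def elim: eventually_mono)
  have ev2: "\<forall>\<^sub>s k. Q (M' k)" if "\<forall>\<^sub>s k. Q (M k)" for Q
    using ev that by eventually_elim simp
  have "seqlim (structure_space L ar) M' l"
    unfolding structure_space_def limitin_qcb_sub limitin_qcb_prod qcb_fun_def limitin_sequentialization ODS_simps
  proof (intro conjI)
    show "l \<in> {M. is_structure L ar M}" "\<forall>\<^sub>s k. M' k \<in> {M. is_structure L ar M}"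
      using r M' by auto
    show "seqlim ods_obj_top (\<lambda>k. fst (M' k)) (fst l)"
      unfolding limitin_ods_obj using r structure_in_space M' ev2[of "\<lambda>N. eqv N _ _"] by auto
    show "seqlim (compact_open (discrete_topology L) ods_obj_top) (\<lambda>k. snd (M' k)) (snd l)"
    proof (rule limitin_compact_openI)
      show "sequential_space (discrete_topology L)" unfolding sequential_space_def seq_open_def by auto
      show "snd (M' k) \<in> continuous_maps (discrete_topology L) ods_obj_top" for k using structure_in_space[OF M'] by blast
      show "snd l \<in> continuous_maps (discrete_topology L) ods_obj_top" using structure_in_space r by blast
      fix x P assume x: "seqlim (discrete_topology L) x P"
      then have P: "P \<in> L" using limitin_topspace by fastforce
      \<comment> \<open>In the discrete space L a convergent sequence is eventually constant, so
        continuous convergence reduces to pointwise convergence.\<close>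
      then have e: "\<forall>\<^sub>s k. x k = P"
        using x P unfolding limitin_def by (elim conjE allE[of _ "{P}"]) simp
      have "snd N P \<in> ods_objs" if "is_structure L ar N" for N
        using that P unfolding is_structure_def subobject_def ods_objs_def by blast
      then have s: "seqlim ods_obj_top (\<lambda>k. snd (M' k) P) (snd l P)"
        unfolding limitin_ods_obj using r M' P ev2[of "\<lambda>N. (_, _) \<in> snd N P"] by auto
      have "\<forall>\<^sub>s k. snd (M' k) P = snd (M' k) (x k)" using e by eventually_elim simp
      then show "seqlim ods_obj_top (\<lambda>k. snd (M' k) (x k)) (snd l P)"
        using s by (rule limitin_transform_eventually)
    qed
  qed
  then show ?lhs by (rule limitin_transform_eventually[OF ev])
qed

lemma lim_modelI:
  assumes "\<And>k. M k \<in> Obj X" "l \<in> Obj X" "\<And>a b. eqv l a b \<Longrightarrow> \<forall>\<^sub>s k. eqv (M k) a b"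
    and "\<And>P as. P \<in> L \<Longrightarrow> length as = ar P \<Longrightarrow> holds_pred l P as \<Longrightarrow> \<forall>\<^sub>s k. holds_pred (M k) P as"
  shows "seqlim (model_space L ar T) M l"
  unfolding model_space_def limitin_qcb_sub lim_structure
proof (intro conjI allI ballI impI)
  fix P u v assume P: "P \<in> L" and "(u, v) \<in> snd l P"
  then obtain as bs where *: "u = tuple as" "v = tuple bs" "length as = ar P" "list_all2 (eqv l) as bs" "holds_pred l P as"
    using pred_iff[OF Obj_structure[OF assms(2)] P] by blast
  have "\<forall>\<^sub>s k. list_all2 (eqv (M k)) as bs"
    using *(4) assms(3) by (rule list_eventually)
  with assms(4)[OF P *(3,5)] show "\<forall>\<^sub>s k. (u, v) \<in> snd (M k) P"
    by eventually_elim (use pred_iff[OF Obj_structure[OF assms(1)] P] * in blast)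
qed (use assms Obj_X Obj_structure in auto)

lemma
  assumes "seqlim (model_space L ar T) M l"
  shows lim_model_eqv: "eqv l a b \<Longrightarrow> \<forall>\<^sub>s k. eqv (M k) a b"
    and lim_model_pred: "P \<in> L \<Longrightarrow> holds_pred l P as \<Longrightarrow> \<forall>\<^sub>s k. holds_pred (M k) P as"
  using assms unfolding model_space_def limitin_qcb_sub lim_structure holds_pred_def by blast+

lemma lim_hom:
  assumes "\<And>k. h k \<in> Mor X" "g \<in> Mor X"
  shows "seqlim (hom_space L ar T) h g \<longleftrightarrow> seqlim ods_mor_top (\<lambda>k. fst (h k)) (fst g) \<and>
    seqlim (model_space L ar T) (\<lambda>k. fst (snd (h k))) (fst (snd g)) \<and>
    seqlim (model_space L ar T) (\<lambda>k. snd (snd (h k))) (snd (snd g))"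
  using assms unfolding hom_space_def limitin_qcb_sub limitin_qcb_prod Mor_X by auto

lemma Idn_hom: "M \<in> Obj X \<Longrightarrow> Idn X M \<in> Mor X"
  unfolding X_simps
  by (rule MorI) (auto simp: Idn_in_mors Obj_per list_maps_Idn intro: pred_cong Obj_structure)

lemma maps_to_comp_hom:
  assumes "f \<in> Mor X" "g \<in> Mor X" "fst (snd g) = snd (snd f)"
  shows "maps_to (Comp ODS (fst g) (fst f)) a c \<longleftrightarrow> (\<exists>b. maps_to (fst f) a b \<and> maps_to (fst g) b c)"
  by (rule maps_to_Comp) (use assms hom_mor hom_src hom_tgt in auto)

lemma Comp_hom:
  assumes f: "f \<in> Mor X" and g: "g \<in> Mor X" and e: "fst (snd g) = snd (snd f)"
  shows "Comp X g f \<in> Mor X"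
  unfolding X_simps
proof (rule MorI)
  show "Comp ODS (fst g) (fst f) \<in> ods_mors"
    by (rule Comp_in_mors) (use assms hom_mor hom_src hom_tgt in auto)
  fix P as cs assume P: "P \<in> L" "length as = ar P" and as: "list_all2 (maps_to (Comp ODS (fst g) (fst f))) as cs" "holds_pred (fst (snd f)) P as"
  obtain bs where bs: "list_all2 (maps_to (fst f)) as bs" "list_all2 (maps_to (fst g)) bs cs"
    using as(1) list_all2_split[of "maps_to (fst f)" "maps_to (fst g)"] maps_to_comp_hom[OF f g e, abs_def] by auto
  have "length bs = ar P" using bs P by (auto dest: list_all2_lengthD)
  then show "holds_pred (snd (snd g)) P cs" using hom_pred[OF f P bs(1) as(2)] hom_pred[OF g P(1) _ bs(2)] e by simp
qed (use assms hom_src hom_tgt Mor_X in auto)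

lemma tcat_X: "tcat X"
proof
  show "topspace (ObjTop X) = Obj X" "topspace (MorTop X) = Mor X" by (simp_all add: model_cat_def)
  show "sequential_space (ObjTop X)" "sequential_space (MorTop X)" by (simp_all add: model_space_def hom_space_def)
  show "category X"
    unfolding category_def
  proof (intro conjI ballI impI)
    show "Idn X M \<in> Mor X" if "M \<in> Obj X" for M using Idn_hom that .
    show "Comp X g f \<in> Mor X" if "f \<in> Mor X" "g \<in> Mor X" "Src X g = Tgt X f" for f g
      using Comp_hom that by simp
    show "Comp X f (Idn X (Src X f)) = f" if "f \<in> Mor X" for f
      using ODS_Comp_Idn[OF hom_mor[OF that]] hom_src[OF that] by (simp add: prod_eq_iff)
    show "Comp X (Idn X (Tgt X f)) f = f" if "f \<in> Mor X" for f
      using ODS_Idn_Comp[OF hom_mor[OF that]] hom_tgt[OF that] by (simp add: prod_eq_iff)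
    show "Comp X h (Comp X g f) = Comp X (Comp X h g) f"
      if m: "f \<in> Mor X" "g \<in> Mor X" "h \<in> Mor X" and e: "Src X g = Tgt X f" "Src X h = Tgt X g" for f g h
    proof -
      have e': "fst (snd g) = snd (snd f)" "fst (snd h) = snd (snd g)" using e by simp_all
      note c = Comp_hom[OF m(1,2) e'(1)] Comp_hom[OF m(2,3) e'(2)]
      have "fst (Comp X h (Comp X g f)) = fst (Comp X (Comp X h g) f)"
      proof (rule ods_mor_eqI)
        show "fst (Comp X h (Comp X g f)) \<in> ods_mors" "fst (Comp X (Comp X h g) f) \<in> ods_mors"
          using hom_mor[OF Comp_hom[OF c(1) m(3)]] hom_mor[OF Comp_hom[OF m(1) c(2)]] e' by simp_all
        fix a b assume "maps_to (fst (Comp X h (Comp X g f))) a b"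
        then show "maps_to (fst (Comp X (Comp X h g) f)) a b"
          using maps_to_comp_hom[OF c(1) m(3)] maps_to_comp_hom[OF m(1) c(2)] maps_to_comp_hom[OF m(1,2) e'(1)]
            maps_to_comp_hom[OF m(2,3) e'(2)] e' by auto
      qed simp_all
      then show ?thesis by (simp add: prod_eq_iff)
    qed
  qed (auto simp: Mor_X)
  fix h h0 assume "seqlim (MorTop X) h h0"
  then show "seqlim (ObjTop X) (\<lambda>k. Src X (h k)) (Src X h0)"
    "seqlim (ObjTop X) (\<lambda>k. Tgt X (h k)) (Tgt X h0)"
    unfolding X_simps hom_space_def limitin_qcb_sub limitin_qcb_prod by simp_all
qed

sublocale tcat X by (rule tcat_X)

lemma lim_hom_maps: "seqlim (hom_space L ar T) h g \<Longrightarrow> maps_to (fst g) a b \<Longrightarrow>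
    \<forall>\<^sub>s k. maps_to (fst (h k)) a b"
  unfolding hom_space_def limitin_qcb_sub limitin_qcb_prod limitin_ods_mor ODS_simps by blast

subsection \<open>Natural predicates and the functors they define\<close>

text \<open>An open subfunctor of the n-th power of the underlying-PER functor: closure under
  homomorphisms gives functoriality, and persistence gives continuity. The notion is semantic so
  that fibre products of definable functors stay within it without being written as
  formulas.\<close>

definition npred :: "nat \<Rightarrow> ('p struct \<Rightarrow> nat list \<Rightarrow> bool) \<Rightarrow> bool" where
  "npred n S \<longleftrightarrow>
     (\<forall>N\<in>Obj X. \<forall>as. S N as \<longrightarrow> length as = n \<and> (\<forall>a\<in>set as. eqv N a a)) \<and>
     (\<forall>h\<in>Mor X. \<forall>as bs. S (fst (snd h)) as \<longrightarrow> list_all2 (maps_to (fst h)) as bs \<longrightarrow> S (snd (snd h)) bs) \<and>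
     (\<forall>M l as. seqlim (model_space L ar T) M l \<longrightarrow> (\<forall>k. M k \<in> Obj X) \<longrightarrow> S l as \<longrightarrow>
        (\<forall>\<^sub>s k. S (M k) as))"

lemma npred_len: "npred n S \<Longrightarrow> N \<in> Obj X \<Longrightarrow> S N as \<Longrightarrow> length as = n"
  and npred_dom: "npred n S \<Longrightarrow> N \<in> Obj X \<Longrightarrow> S N as \<Longrightarrow> \<forall>a\<in>set as. eqv N a a"
  and npred_hom: "npred n S \<Longrightarrow> h \<in> Mor X \<Longrightarrow> S (fst (snd h)) as \<Longrightarrow> list_all2 (maps_to (fst h)) as bs \<Longrightarrow> S (snd (snd h)) bs"
  and npred_lim: "npred n S \<Longrightarrow> seqlim (model_space L ar T) M l \<Longrightarrow> (\<And>k. M k \<in> Obj X) \<Longrightarrow> S l as \<Longrightarrow>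
     \<forall>\<^sub>s k. S (M k) as"
  unfolding npred_def by blast+

text \<open>The graph of the identity homomorphism is the equivalence itself.\<close>

lemma npred_cong: "npred n S \<Longrightarrow> N \<in> Obj X \<Longrightarrow> S N as \<Longrightarrow> list_all2 (eqv N) as bs \<Longrightarrow> S N bs"
  using npred_hom[of n S "Idn X N" as bs] Idn_hom[of N] by (simp add: list_maps_Idn Obj_per)

definition relf :: "('p struct \<Rightarrow> nat list \<Rightarrow> bool) \<Rightarrow> ('p struct, 'p hom, per, ods_mor) fctr" where
  "relf S = mk_fun (\<lambda>N. {(u, v). \<exists>as bs. u = tuple as \<and> v = tuple bs \<and> S N as \<and> list_all2 (eqv N) as bs})
     (\<lambda>h u v. \<exists>as bs. u = tuple as \<and> v = tuple bs \<and> S (fst (snd h)) as \<and> list_all2 (maps_to (fst h)) as bs)"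

lemma relf_ok:
  assumes S: "npred n S"
  shows "fun_ok (\<lambda>N. {(u, v). \<exists>as bs. u = tuple as \<and> v = tuple bs \<and> S N as \<and> list_all2 (eqv N) as bs})
     (\<lambda>h u v. \<exists>as bs. u = tuple as \<and> v = tuple bs \<and> S (fst (snd h)) as \<and> list_all2 (maps_to (fst h)) as bs)"
  (is "fun_ok ?A ?R")
proof -
  \<comment> \<open>\<open>tuple\<close> is injective only among lists of equal length, so every
    comparison of codes has to fix the lengths first.\<close>
  have tup: "as = bs" if "tuple as = tuple bs" "length as = n" "length bs = n" for as bs
    using tuple_eq_iff that by metis
  have len2: "length bs = n" if "list_all2 Q as bs" "length as = n" for Q :: "nat \<Rightarrow> nat \<Rightarrow> bool" and as bs
    using that list_all2_lengthD by metis
  have per: "is_per (?A N)" if N: "N \<in> Obj X" for N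
    using Obj_per[OF N] npred_len[OF S N] npred_cong[OF S N] by (rule is_per_tuples)
  have dom: "(u, u) \<in> ?A N \<longleftrightarrow> (\<exists>as. u = tuple as \<and> S N as)" if N: "N \<in> Obj X" for N u
  proof
    assume "(u, u) \<in> ?A N"
    then show "\<exists>as. u = tuple as \<and> S N as" by blast
  next
    assume "\<exists>as. u = tuple as \<and> S N as"
    then show "(u, u) \<in> ?A N" using npred_dom[OF S N] list_all2_refl_iff by blast
  qed
  show ?thesis
  proof (rule fun_okI)
    show "is_per (?A N)" if "N \<in> Obj X" for N using per[OF that] .
    fix h assume h: "h \<in> Mor X"
    have s: "fst (snd h) \<in> Obj X" "snd (snd h) \<in> Obj X" using h Mor_X by blast+
    note hm = hom_mor[OF h] and hs = hom_src[OF h] hom_tgt[OF h]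
    show "is_map (?A (Src X h)) (?A (Tgt X h)) (?R h)"
      unfolding is_map_def X_simps
    proof (intro conjI allI impI)
      fix u v assume uv: "?R h u v"
      then obtain as bs where 1: "u = tuple as" "v = tuple bs" "S (fst (snd h)) as" "list_all2 (maps_to (fst h)) as bs" by blast
      show "(u, u) \<in> ?A (fst (snd h))" "(v, v) \<in> ?A (snd (snd h))"
        using dom[OF s(1), of u] dom[OF s(2), of v] 1 npred_hom[OF S h] by blast+
    next
      fix u u' v v' assume uv: "?R h u v" and uu: "(u, u') \<in> ?A (fst (snd h))" and vv: "(v, v') \<in> ?A (snd (snd h))"
      obtain as bs where 1: "u = tuple as" "v = tuple bs" "S (fst (snd h)) as" "list_all2 (maps_to (fst h)) as bs"
        using uv by blast
      obtain as2 as' where 2: "u = tuple as2" "u' = tuple as'" "S (fst (snd h)) as2" "list_all2 (eqv (fst (snd h))) as2 as'"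
        using uu by blast
      obtain bs2 bs' where 3: "v = tuple bs2" "v' = tuple bs'" "S (snd (snd h)) bs2" "list_all2 (eqv (snd (snd h))) bs2 bs'"
        using vv by blast
      have "as = as2" using tup 1 2 npred_len[OF S s(1)] by metis
      moreover have "bs = bs2" using tup 1 3 npred_len[OF S s(1)] npred_len[OF S s(2)] len2 by metis
      ultimately have "list_all2 (maps_to (fst h)) as' bs'"
        using list_maps_cong[OF hm 1(4)] 2 3 hs by simp
      moreover have "S (fst (snd h)) as'" using npred_cong[OF S s(1) 2(3,4)] .
      ultimately show "?R h u' v'" using 2 3 by blast
    next
      fix u v v' assume uv: "?R h u v" and uv': "?R h u v'"
      obtain as bs where 1: "u = tuple as" "v = tuple bs" "S (fst (snd h)) as" "list_all2 (maps_to (fst h)) as bs"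
        using uv by blast
      obtain as2 bs2 where 2: "u = tuple as2" "v' = tuple bs2" "S (fst (snd h)) as2" "list_all2 (maps_to (fst h)) as2 bs2"
        using uv' by blast
      have "as = as2" using tup 1 2 npred_len[OF S s(1)] by metis
      moreover have "list_all2 (eqv (fst (snd h))) as as" using npred_dom[OF S s(1) 1(3)] list_all2_refl_iff by blast
      ultimately have "list_all2 (eqv (snd (snd h))) bs bs2"
        using list_maps_fun[OF hm 1(4)] 2 hs by simp
      moreover have "S (snd (snd h)) bs" using npred_hom[OF S h 1(3,4)] .
      ultimately show "(v, v') \<in> ?A (snd (snd h))" using 1 2 by blast
    next
      fix u assume "(u, u) \<in> ?A (fst (snd h))"
      then obtain as where as: "u = tuple as" "S (fst (snd h)) as" using dom[OF s(1)] by blast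
      have "\<exists>bs. list_all2 (maps_to (fst h)) as bs"
        by (rule list_all2_total, rule maps_to_total[OF hm]) (use npred_dom[OF S s(1) as(2)] hs in simp)
      then show "\<exists>v. ?R h u v" using as by blast
    qed (use per s in blast)+
  next
    fix N u v assume N: "N \<in> Obj X" and "(u, v) \<in> ?A N"
    then show "?R (Idn X N) u v" by (simp add: list_maps_Idn Obj_per)
  next
    fix f g u v w assume fg: "f \<in> Mor X" "g \<in> Mor X" "Src X g = Tgt X f" and uv: "?R f u v" and vw: "?R g v w"
    obtain as bs where 1: "u = tuple as" "v = tuple bs" "S (fst (snd f)) as" "list_all2 (maps_to (fst f)) as bs"
      using uv by blast
    obtain bs2 cs where 2: "v = tuple bs2" "w = tuple cs" "S (fst (snd g)) bs2" "list_all2 (maps_to (fst g)) bs2 cs"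
      using vw by blast
    have s: "fst (snd f) \<in> Obj X" "fst (snd g) \<in> Obj X" using fg Mor_X by blast+
    have "bs = bs2" using tup 1 2 npred_len[OF S s(1)] npred_len[OF S s(2)] len2 by metis
    then have "list_all2 (\<lambda>a c. \<exists>b. maps_to (fst f) a b \<and> maps_to (fst g) b c) as cs"
      using 1(4) 2(4) by (auto intro: list_all2_trans[rotated])
    then have "list_all2 (maps_to (fst (Comp X g f))) as cs"
      using maps_to_comp_hom[OF fg(1,2)] fg(3) by (simp add: list_all2_conv_all_nth)
    then show "?R (Comp X g f) u w" using 1 2 by auto
  next
    fix M l u v assume M: "seqlim (ObjTop X) M l" "\<And>k. M k \<in> Obj X" and "(u, v) \<in> ?A l"
    then obtain as bs where 1: "u = tuple as" "v = tuple bs" "S l as" "list_all2 (eqv l) as bs" by blast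
    have M': "seqlim (model_space L ar T) M l" using M by simp
    have "\<forall>\<^sub>s k. S (M k) as" using npred_lim[OF S M' M(2) 1(3)] .
    moreover have "\<forall>\<^sub>s k. list_all2 (eqv (M k)) as bs"
      using 1(4) by (rule list_eventually) (rule lim_model_eqv[OF M'])
    ultimately show "\<forall>\<^sub>s k. (u, v) \<in> ?A (M k)"
      by eventually_elim (use 1 in blast)
  next
    fix h h0 u v assume h: "seqlim (MorTop X) h h0" "\<And>k. h k \<in> Mor X" and "?R h0 u v"
    then obtain as bs where 1: "u = tuple as" "v = tuple bs" "S (fst (snd h0)) as" "list_all2 (maps_to (fst h0)) as bs" by blast
    have "seqlim (model_space L ar T) (\<lambda>k. fst (snd (h k))) (fst (snd h0))" using src_lim[OF h] by simp
    then have "\<forall>\<^sub>s k. S (fst (snd (h k))) as"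
      by (rule npred_lim[OF S]) (use h Mor_X 1 in auto)
    moreover have "\<forall>\<^sub>s k. list_all2 (maps_to (fst (h k))) as bs"
      using 1(4) by (rule list_eventually) (rule lim_hom_maps, use h in simp_all)
    ultimately show "\<forall>\<^sub>s k. ?R (h k) u v"
      by eventually_elim (use 1 in blast)
  qed
qed

lemma relf_obj: "npred n S \<Longrightarrow> relf S \<in> Obj FC"
  unfolding relf_def by (rule mk_fun_obj[OF relf_ok])

lemma relf_fst: "npred n S \<Longrightarrow> N \<in> Obj X \<Longrightarrow>
    (u, v) \<in> fst (relf S) N \<longleftrightarrow> (\<exists>as bs. u = tuple as \<and> v = tuple bs \<and> S N as \<and> list_all2 (eqv N) as bs)"
  unfolding relf_def using mk_fun_fst[OF relf_ok] by auto

lemma relf_snd: "npred n S \<Longrightarrow> h \<in> Mor X \<Longrightarrow>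
    maps_to (snd (relf S) h) u v \<longleftrightarrow>
      (\<exists>as bs. u = tuple as \<and> v = tuple bs \<and> S (fst (snd h)) as \<and> list_all2 (maps_to (fst h)) as bs)"
  unfolding relf_def using mk_fun_snd[OF relf_ok] by auto

lemma relf_tuple: "npred n S \<Longrightarrow> N \<in> Obj X \<Longrightarrow> length as = n \<Longrightarrow> length bs = n \<Longrightarrow>
    (tuple as, tuple bs) \<in> fst (relf S) N \<longleftrightarrow> S N as \<and> list_all2 (eqv N) as bs"
proof
  assume S: "npred n S" and N: "N \<in> Obj X" and l: "length as = n" "length bs = n"
    and "(tuple as, tuple bs) \<in> fst (relf S) N"
  then obtain as2 bs2 where 1: "tuple as = tuple as2" "tuple bs = tuple bs2" "S N as2" "list_all2 (eqv N) as2 bs2"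
    using relf_fst[OF S N] by blast
  have "length as2 = n" "length bs2 = n" using 1 npred_len[OF S N] list_all2_lengthD[OF 1(4)] by auto
  then have "as = as2" "bs = bs2" using 1 l tuple_eq_iff by auto
  then show "S N as \<and> list_all2 (eqv N) as bs" using 1 by blast
qed (use relf_fst in blast)

lemma relf_self: "npred n S \<Longrightarrow> N \<in> Obj X \<Longrightarrow> (u, u) \<in> fst (relf S) N \<longleftrightarrow> (\<exists>as. u = tuple as \<and> S N as)"
  using relf_fst[of n S N u u] npred_dom[of n S N] list_all2_refl_iff[of "fst N"] by metis

section \<open>Coordinate maps between natural predicates\<close>

definition rx :: "('p struct \<Rightarrow> nat list \<Rightarrow> bool) \<Rightarrow> ('p struct \<Rightarrow> nat list \<Rightarrow> bool) \<Rightarrow> nat list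
    \<Rightarrow> ('p struct, 'p hom, per, ods_mor) ntrans" where
  "rx S S' \<sigma> = mk_nt (relf S) (relf S')
     (\<lambda>N u v. \<exists>as bs. u = tuple as \<and> v = tuple bs \<and> S N as \<and> list_all2 (eqv N) (map ((!) as) \<sigma>) bs)"

text \<open>The list \<sigma> may select, repeat or drop coordinates, so this one notion covers
  projections, inclusions, the map to the terminal functor and the legs of fibre products.\<close>

definition reindex :: "nat \<Rightarrow> ('p struct \<Rightarrow> nat list \<Rightarrow> bool) \<Rightarrow> nat \<Rightarrow> ('p struct \<Rightarrow> nat list \<Rightarrow> bool) \<Rightarrow> nat list \<Rightarrow> bool" where
  "reindex n S m S' \<sigma> \<longleftrightarrow> npred n S \<and> npred m S' \<and> length \<sigma> = m \<and> (\<forall>i\<in>set \<sigma>. i < n) \<and>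
     (\<forall>N\<in>Obj X. \<forall>as. S N as \<longrightarrow> S' N (map ((!) as) \<sigma>))"

lemma rx_ok:
  assumes r: "reindex n S m S' \<sigma>"
  shows "nt_ok (relf S) (relf S')
     (\<lambda>N u v. \<exists>as bs. u = tuple as \<and> v = tuple bs \<and> S N as \<and> list_all2 (eqv N) (map ((!) as) \<sigma>) bs)"
  (is "nt_ok _ _ ?R")
proof -
  have S: "npred n S" and S': "npred m S'" and \<sigma>: "length \<sigma> = m" "\<And>i. i \<in> set \<sigma> \<Longrightarrow> i < n"
    and imp: "\<And>N as. N \<in> Obj X \<Longrightarrow> S N as \<Longrightarrow> S' N (map ((!) as) \<sigma>)"
    using r unfolding reindex_def by blast+
  have tup: "as = bs" if "tuple as = tuple bs" "length as = k" "length bs = k" for as bs k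
    using tuple_eq_iff that by metis
  have mapr: "list_all2 Q (map ((!) as) \<sigma>) (map ((!) bs) \<sigma>)" if "list_all2 Q as bs" "length as = n" for Q and as bs :: "nat list"
    using that \<sigma>(2) by (auto simp: list_all2_conv_all_nth)
  show ?thesis
  proof (rule nt_okI)
    show "relf S \<in> Obj FC" "relf S' \<in> Obj FC" using relf_obj S S' by blast+
  next
    fix N assume N: "N \<in> Obj X"
    note p = Obj_per[OF N]
    show "is_map (fst (relf S) N) (fst (relf S') N) (?R N)"
      unfolding is_map_def
    proof (intro conjI allI impI)
      show "is_per (fst (relf S) N)" "is_per (fst (relf S') N)" using fobj_per[OF relf_obj N] S S' by blast+
    next
      fix u v assume "?R N u v"
      then obtain as bs where 1: "u = tuple as" "v = tuple bs" "S N as" "list_all2 (eqv N) (map ((!) as) \<sigma>) bs" by blast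
      show "(u, u) \<in> fst (relf S) N" using relf_self[OF S N] 1 by blast
      show "(v, v) \<in> fst (relf S') N" using relf_self[OF S' N] 1 npred_cong[OF S' N imp[OF N 1(3)] 1(4)] by blast
    next
      fix u u' v v' assume R: "?R N u v" and uu: "(u, u') \<in> fst (relf S) N" and vv: "(v, v') \<in> fst (relf S') N"
      obtain as bs where 1: "u = tuple as" "v = tuple bs" "S N as" "list_all2 (eqv N) (map ((!) as) \<sigma>) bs" using R by blast
      obtain as2 as' where 2: "u = tuple as2" "u' = tuple as'" "S N as2" "list_all2 (eqv N) as2 as'"
        using uu relf_fst[OF S N] by blast
      obtain bs2 bs' where 3: "v = tuple bs2" "v' = tuple bs'" "S' N bs2" "list_all2 (eqv N) bs2 bs'"
        using vv relf_fst[OF S' N] by blast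
      have l: "length as = n" "length as2 = n" "length bs2 = m" "length bs = m"
        using npred_len[OF S N] npred_len[OF S' N] 1 2 3 \<sigma> list_all2_lengthD[OF 1(4)] by auto
      have "as = as2" "bs = bs2" using tup[of as as2 n] tup[of bs bs2 m] 1 2 3 l by auto
      then have "list_all2 (eqv N) (map ((!) as2) \<sigma>) bs'" using list_eqv_trans[OF p 1(4)] 3(4) by simp
      then have "list_all2 (eqv N) (map ((!) as') \<sigma>) bs'"
        using list_eqv_trans[OF p list_eqv_sym[OF p mapr[OF 2(4) l(2)]]] by blast
      then show "?R N u' v'" using 2 3 npred_cong[OF S N 2(3,4)] by blast
    next
      fix u v v' assume R: "?R N u v" "?R N u v'"
      obtain as bs where 1: "u = tuple as" "v = tuple bs" "S N as" "list_all2 (eqv N) (map ((!) as) \<sigma>) bs" using R by blast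
      obtain as2 bs2 where 2: "u = tuple as2" "v' = tuple bs2" "S N as2" "list_all2 (eqv N) (map ((!) as2) \<sigma>) bs2" using R by blast
      have "as = as2" using tup[of as as2 n] 1 2 npred_len[OF S N] by auto
      then have "list_all2 (eqv N) bs bs2" using list_eqv_trans[OF p list_eqv_sym[OF p 1(4)]] 2(4) by simp
      then show "(v, v') \<in> fst (relf S') N"
        using relf_fst[OF S' N] 1 2 npred_cong[OF S' N imp[OF N 1(3)] 1(4)] by blast
    next
      fix u assume "(u, u) \<in> fst (relf S) N"
      then obtain as where as: "u = tuple as" "S N as" using relf_self[OF S N] by blast
      then have "list_all2 (eqv N) (map ((!) as) \<sigma>) (map ((!) as) \<sigma>)"
        using npred_dom[OF S' N imp[OF N]] list_all2_refl_iff by blast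
      then show "\<exists>v. ?R N u v" using as by blast
    qed
  next
    fix h u u' v v' assume h: "h \<in> Mor X" and uu: "maps_to (snd (relf S) h) u u'" and uv: "?R (Src X h) u v"
      and vv: "maps_to (snd (relf S') h) v v'"
    have s: "fst (snd h) \<in> Obj X" "snd (snd h) \<in> Obj X" using h Mor_X by blast+
    obtain as as' where 1: "u = tuple as" "u' = tuple as'" "S (fst (snd h)) as" "list_all2 (maps_to (fst h)) as as'"
      using uu relf_snd[OF S h] by blast
    obtain as2 bs where 2: "u = tuple as2" "v = tuple bs" "S (fst (snd h)) as2" "list_all2 (eqv (fst (snd h))) (map ((!) as2) \<sigma>) bs"
      using uv by auto
    obtain bs2 bs' where 3: "v = tuple bs2" "v' = tuple bs'" "S' (fst (snd h)) bs2" "list_all2 (maps_to (fst h)) bs2 bs'"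
      using vv relf_snd[OF S' h] by blast
    have l: "length as = n" "length as2 = n" "length bs2 = m" "length bs = m"
      using npred_len[OF S s(1)] npred_len[OF S' s(1)] 1 2 3 \<sigma> list_all2_lengthD[OF 2(4)] by auto
    have e: "as = as2" "bs = bs2" using tup[of as as2 n] tup[of bs bs2 m] 1 2 3 l by auto
    have "list_all2 (eqv (snd (snd h))) (map ((!) as') \<sigma>) bs'"
      using list_maps_fun[OF hom_mor[OF h] mapr[OF 1(4) l(1)] 3(4)] 2(4) e hom_src[OF h] hom_tgt[OF h] by simp
    then show "?R (Tgt X h) u' v'" using 1 3 npred_hom[OF S h 1(3,4)] by auto
  next
    fix M l u v assume M: "seqlim (ObjTop X) M l" "\<And>k. M k \<in> Obj X" and R: "?R l u v"
    obtain as bs where 1: "u = tuple as" "v = tuple bs" "S l as" "list_all2 (eqv l) (map ((!) as) \<sigma>) bs" using R by blast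
    have M': "seqlim (model_space L ar T) M l" using M by simp
    have "\<forall>\<^sub>s k. S (M k) as" using npred_lim[OF S M' M(2) 1(3)] .
    moreover have "\<forall>\<^sub>s k. list_all2 (eqv (M k)) (map ((!) as) \<sigma>) bs"
      using 1(4) by (rule list_eventually) (rule lim_model_eqv[OF M'])
    ultimately show "\<forall>\<^sub>s k. ?R (M k) u v"
      by eventually_elim (use 1 in blast)
  qed
qed

lemma rx_mor: "reindex n S m S' \<sigma> \<Longrightarrow> rx S S' \<sigma> \<in> Mor FC"
  unfolding rx_def by (rule mk_nt_mor[OF rx_ok])

lemma rx_st [simp]: "fst (snd (rx S S' \<sigma>)) = relf S" "snd (snd (rx S S' \<sigma>)) = relf S'" "snd (rx S S' \<sigma>) = (relf S, relf S')"
  unfolding rx_def by simp_all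

lemma rx_rel: "reindex n S m S' \<sigma> \<Longrightarrow> N \<in> Obj X \<Longrightarrow> maps_to (fst (rx S S' \<sigma>) N) u v \<longleftrightarrow>
    (\<exists>as bs. u = tuple as \<and> v = tuple bs \<and> S N as \<and> list_all2 (eqv N) (map ((!) as) \<sigma>) bs)"
  unfolding rx_def by (rule maps_to_mk_nt[OF rx_ok])

lemma rx_tuple:
  assumes r: "reindex n S m S' \<sigma>" and N: "N \<in> Obj X" and l: "length as = n" "length bs = m"
  shows "maps_to (fst (rx S S' \<sigma>) N) (tuple as) (tuple bs) \<longleftrightarrow> S N as \<and> list_all2 (eqv N) (map ((!) as) \<sigma>) bs"
proof
  assume "maps_to (fst (rx S S' \<sigma>) N) (tuple as) (tuple bs)"
  then obtain as2 bs2 where 1: "tuple as = tuple as2" "tuple bs = tuple bs2" "S N as2" "list_all2 (eqv N) (map ((!) as2) \<sigma>) bs2"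
    using rx_rel[OF r N] by blast
  have "length as2 = n" "length bs2 = m"
    using 1 npred_len[OF _ N] r list_all2_lengthD[OF 1(4)] unfolding reindex_def by auto
  then have "as = as2" "bs = bs2" using 1 l tuple_eq_iff by metis+
  then show "S N as \<and> list_all2 (eqv N) (map ((!) as) \<sigma>) bs" using 1 by blast
qed (use rx_rel[OF r N] in blast)

text \<open>For \<tau> = [j] this says that the j-th coordinate after reindexing by \<sigma> is the
  coordinate \<sigma> ! j before it; \<Phi> sees coordinates only through this equation between
  morphisms.\<close>

lemma rx_comp:
  assumes r: "reindex n S m S' \<sigma>" and r': "reindex m S' k S'' \<tau>"
  shows "reindex n S k S'' (map ((!) \<sigma>) \<tau>)"
    and "Comp FC (rx S' S'' \<tau>) (rx S S' \<sigma>) = rx S S'' (map ((!) \<sigma>) \<tau>)"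
proof -
  have S: "npred n S" and S': "npred m S'" and \<sigma>: "length \<sigma> = m" "\<And>i. i \<in> set \<tau> \<Longrightarrow> i < m"
    and \<tau>: "length \<tau> = k" and S'': "npred k S''"
    using r r' unfolding reindex_def by blast+
  have c: "map ((!) as) (map ((!) \<sigma>) \<tau>) = map ((!) (map ((!) as) \<sigma>)) \<tau>" for as :: "nat list"
    using \<sigma> by auto
  show rr: "reindex n S k S'' (map ((!) \<sigma>) \<tau>)"
    unfolding reindex_def c using r r' \<sigma> unfolding reindex_def by auto
  have e: "fst (snd (rx S' S'' \<tau>)) = snd (snd (rx S S' \<sigma>))" by simp
  show "Comp FC (rx S' S'' \<tau>) (rx S S' \<sigma>) = rx S S'' (map ((!) \<sigma>) \<tau>)"
  proof (rule fmor_eqI)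
    show "Comp FC (rx S' S'' \<tau>) (rx S S' \<sigma>) \<in> Mor FC" using FC_Comp_mor[OF rx_mor[OF r] rx_mor[OF r'] e] .
    show "rx S S'' (map ((!) \<sigma>) \<tau>) \<in> Mor FC" using rx_mor[OF rr] .
    show "snd (Comp FC (rx S' S'' \<tau>) (rx S S' \<sigma>)) = snd (rx S S'' (map ((!) \<sigma>) \<tau>))" by (simp add: prod_eq_iff)
    fix N u w assume N: "N \<in> Obj X" and uw: "maps_to (fst (Comp FC (rx S' S'' \<tau>) (rx S S' \<sigma>)) N) u w"
    obtain v where v: "maps_to (fst (rx S S' \<sigma>) N) u v" "maps_to (fst (rx S' S'' \<tau>) N) v w"
      using uw unfolding FC_maps_to_Comp[OF rx_mor[OF r] rx_mor[OF r'] e N] by blast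
    obtain as bs where 1: "u = tuple as" "v = tuple bs" "S N as" "list_all2 (eqv N) (map ((!) as) \<sigma>) bs"
      using v(1) rx_rel[OF r N] by blast
    obtain bs2 cs where 2: "v = tuple bs2" "w = tuple cs" "S' N bs2" "list_all2 (eqv N) (map ((!) bs2) \<tau>) cs"
      using v(2) rx_rel[OF r' N] by blast
    have l: "length bs = m" "length bs2 = m" using list_all2_lengthD[OF 1(4)] \<sigma> npred_len[OF S' N 2(3)] by auto
    have "bs = bs2" using 1 2 l tuple_eq_iff by metis
    moreover have "list_all2 (eqv N) (map ((!) (map ((!) as) \<sigma>)) \<tau>) (map ((!) bs) \<tau>)"
      using 1(4) \<sigma> by (auto simp: list_all2_conv_all_nth)
    ultimately have "list_all2 (eqv N) (map ((!) as) (map ((!) \<sigma>) \<tau>)) cs"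
      using list_eqv_trans[OF Obj_per[OF N]] 2(4) c by metis
    then show "maps_to (fst (rx S S'' (map ((!) \<sigma>) \<tau>)) N) u w"
      using rx_rel[OF rr N] 1 2 by blast
  qed
qed

end

context models
begin

subsection \<open>Formulas are natural predicates\<close>

abbreviation sat :: "nat list \<Rightarrow> 'p fm \<Rightarrow> 'p struct \<Rightarrow> nat list \<Rightarrow> bool" where
  "sat xs \<phi> \<equiv> (\<lambda>N as. satisfies N xs \<phi> as)"

text \<open>Coherent formulas contain no negation, implication or universal quantifier, so
  homomorphisms preserve their truth.\<close>

lemma holds_hom:
  assumes "wf_fm L ar xs \<phi>" and h: "h \<in> Mor X"
  shows "length as = length xs \<Longrightarrow> list_all2 (maps_to (fst h)) as bs \<Longrightarrow> holds \<phi> (fst (snd h)) xs as \<Longrightarrow> holds \<phi> (snd (snd h)) xs bs"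
  using assms(1)
proof (induction arbitrary: as bs)
  case (3 xs x y)
  then show ?case
    using maps_to_fun2[OF hom_mor[OF h] val_rel[of xs as "maps_to (fst h)" bs x] val_rel[of xs as "maps_to (fst h)" bs y]]
      hom_src[OF h] hom_tgt[OF h] by simp
next
  case (4 xs P ys)
  have "list_all2 (maps_to (fst h)) (map (val xs as) ys) (map (val xs bs) ys)"
    using 4 by (intro val_list_rel) auto
  from hom_pred[OF h 4(2) _ this] show ?case using 4 by simp
next
  case (5 xs \<phi> \<psi>)
  then show ?case by simp
next
  case (6 xs \<Phi>)
  then show ?case unfolding holds.simps by blast
next
  case (7 xs y \<phi>)
  obtain b where b: "eqv (fst (snd h)) b b" "holds \<phi> (fst (snd h)) (xs @ [y]) (as @ [b])" using 7 by auto
  obtain b' where b': "maps_to (fst h) b b'" using maps_to_total[OF hom_mor[OF h]] hom_src[OF h] b by auto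
  have "holds \<phi> (snd (snd h)) (xs @ [y]) (bs @ [b'])"
    using 7 b b' by (intro "7.IH"[of "as @ [b]"]) (auto intro: list_all2_appendI)
  then show ?case using maps_to_cod[OF b'] hom_tgt[OF h] by auto
qed auto

text \<open>Truth at l rests on finitely many atomic facts, since a disjunction needs one disjunct
  and a quantifier one witness; the same number serves as witness along the sequence.\<close>

lemma holds_lim:
  assumes "wf_fm L ar xs \<phi>" and M: "seqlim (model_space L ar T) M l"
  shows "holds \<phi> l xs as \<Longrightarrow> \<forall>\<^sub>s k. holds \<phi> (M k) xs as"
  using assms(1)
proof (induction arbitrary: as)
  case (3 xs x y)
  then show ?case using lim_model_eqv[OF M] by simp
next
  case (4 xs P ys)
  then show ?case using lim_model_pred[OF M 4(2)] by simp
next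
  case (5 xs \<phi> \<psi>)
  then show ?case by (simp add: eventually_conj)
next
  case (6 xs \<Phi>)
  then obtain i where "holds (\<Phi> i) l xs as" by auto
  then have "\<forall>\<^sub>s k. holds (\<Phi> i) (M k) xs as" using 6 by blast
  then show ?case by eventually_elim auto
next
  case (7 xs y \<phi>)
  obtain b where b: "eqv l b b" "holds \<phi> l (xs @ [y]) (as @ [b])" using 7 by auto
  have "\<forall>\<^sub>s k. holds \<phi> (M k) (xs @ [y]) (as @ [b])" using "7.IH" b by blast
  with lim_model_eqv[OF M b(1)] show ?case by eventually_elim auto
qed auto

lemma sat_npred:
  assumes wf: "wf_fm L ar xs \<phi>"
  shows "npred (length xs) (sat xs \<phi>)"
  unfolding npred_def
proof (intro conjI ballI allI impI)
  fix h as bs assume h: "h \<in> Mor X" "satisfies (fst (snd h)) xs \<phi> as" "list_all2 (maps_to (fst h)) as bs"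
  have "\<forall>b\<in>set bs. (b, b) \<in> fst (snd (fst h))"
    using h(3) by (induction rule: list_all2_induct) (auto intro: maps_to_cod)
  then show "satisfies (snd (snd h)) xs \<phi> bs"
    using holds_hom[OF wf h(1) _ h(3)] list_all2_lengthD[OF h(3)] hom_tgt[OF h(1)] h(2)
    unfolding satisfies_def by simp
next
  fix M l as assume M: "seqlim (model_space L ar T) M l" "satisfies l xs \<phi> as"
  have "\<forall>\<^sub>s k. \<forall>a\<in>set as. eqv (M k) a a"
    by (rule eventually_ball_finite) (use lim_model_eqv[OF M(1)] M(2) in \<open>auto simp: satisfies_def\<close>)
  moreover have "\<forall>\<^sub>s k. holds \<phi> (M k) xs as"
    using holds_lim[OF wf M(1)] M(2) by (simp add: satisfies_def)
  ultimately show "\<forall>\<^sub>s k. satisfies (M k) xs \<phi> as"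
    by eventually_elim (use M(2) in \<open>simp add: satisfies_def\<close>)
qed (auto simp: satisfies_def)

subsection \<open>Renaming the elements of a model along a surjection\<close>

text \<open>The number x becomes a name for the element f x of N. Names can be redistributed at will
  in this way without changing N up to isomorphism.\<close>

definition pull :: "(nat \<Rightarrow> nat) \<Rightarrow> 'p struct \<Rightarrow> 'p struct" where
  "pull f N = ({(x, y). eqv N (f x) (f y)},
     \<lambda>P\<in>L. {(u, v). \<exists>as bs. u = tuple as \<and> v = tuple bs \<and> length as = ar P \<and>
        list_all2 (\<lambda>x y. eqv N (f x) (f y)) as bs \<and> holds_pred N P (map f as)})"

definition ren :: "(nat \<Rightarrow> nat) \<Rightarrow> 'p struct \<Rightarrow> 'p hom" where
  "ren f N = (mk_mor (fst (pull f N)) (fst N) (\<lambda>x y. eqv N (f x) y), pull f N, N)"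

lemma pull_eqv [simp]: "eqv (pull f N) x y \<longleftrightarrow> eqv N (f x) (f y)"
  by (simp add: pull_def)

lemma pull_pred:
  assumes N: "N \<in> Obj X" and P: "P \<in> L" and as: "length as = ar P"
  shows "holds_pred (pull f N) P as \<longleftrightarrow> holds_pred N P (map f as)"
proof
  assume "holds_pred (pull f N) P as"
  then obtain as' where "tuple as = tuple as'" "length as' = ar P" "holds_pred N P (map f as')"
    using P unfolding holds_pred_def pull_def by auto
  then show "holds_pred N P (map f as)" using as tuple_eq_iff by metis
next
  assume *: "holds_pred N P (map f as)"
  then have "\<forall>a\<in>set as. eqv N (f a) (f a)" using pred_dom[OF Obj_structure[OF N] P *] as by simp
  then have "list_all2 (\<lambda>x y. eqv N (f x) (f y)) as as" by (simp add: list_all2_same)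
  then show "holds_pred (pull f N) P as"
    using P as * unfolding holds_pred_def pull_def by auto
qed

lemma pull_structure:
  assumes N: "N \<in> Obj X"
  shows "is_structure L ar (pull f N)"
  unfolding is_structure_def
proof (intro conjI ballI)
  note p = Obj_per[OF N]
  show per: "is_per (fst (pull f N))"
    unfolding is_per_def by (auto intro!: symI transI intro: per_sym[OF p] per_trans[OF p] simp: pull_def)
  show "snd (pull f N) \<in> extensional L" by (simp add: pull_def)
  fix P assume P: "P \<in> L"
  have "holds_pred N P (map f bs)"
    if "length as = ar P" "holds_pred N P (map f as)" "list_all2 (eqv (pull f N)) as bs" for as bs
    using pred_cong[OF Obj_structure[OF N] P that(2)] that by (simp add: list_all2_map1 list_all2_map2)
  from subobject_tuples[OF per, of "ar P" "\<lambda>as. holds_pred N P (map f as)", OF this]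
  show "subobject (snd (pull f N) P) (per_power (fst (pull f N)) (ar P))"
    using P by (simp add: pull_def)
qed

lemma holds_pull:
  assumes "wf_fm L ar xs \<phi>" and N: "N \<in> Obj X" and f: "surj f"
  shows "length as = length xs \<Longrightarrow> holds \<phi> (pull f N) xs as \<longleftrightarrow> holds \<phi> N xs (map f as)"
  using assms(1)
proof (induction arbitrary: as)
  case (3 xs x y)
  then show ?case by (simp add: val_map)
next
  case (4 xs P ys)
  have eq: "map f (map (val xs as) ys) = map (val xs (map f as)) ys" using 4 by (auto simp: val_map)
  show ?case
    unfolding holds.simps eq[symmetric] by (rule pull_pred[OF N 4(2)]) (use 4 in simp)
next
  case (7 xs y \<phi>)
  \<comment> \<open>Existential witnesses of \<open>pull f N\<close> are numbers b standing for f b;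
    surjectivity of f makes every witness in N reachable.\<close>
  have "holds \<phi> (pull f N) (xs @ [y]) (as @ [b]) \<longleftrightarrow> holds \<phi> N (xs @ [y]) (map f as @ [f b])" for b
    using "7.IH"[of "as @ [b]"] 7 by simp
  then show ?case using f by simp (metis surjD)
qed auto

lemma satisfies_pull:
  assumes "wf_fm L ar xs \<phi>" and N: "N \<in> Obj X" and f: "surj f"
  shows "satisfies (pull f N) xs \<phi> as \<longleftrightarrow> satisfies N xs \<phi> (map f as)"
  unfolding satisfies_def using holds_pull[OF assms] by auto

lemma pull_Obj:
  assumes N: "N \<in> Obj X" and f: "surj f"
  shows "pull f N \<in> Obj X"
  unfolding Obj_X is_model_def
proof (intro conjI allI impI pull_structure[OF N])
  fix \<phi> xs \<psi> as assume *: "Sequent \<phi> xs \<psi> \<in> T \<and> satisfies (pull f N) xs \<phi> as"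
  then have wf: "wf_fm L ar xs \<phi>" "wf_fm L ar xs \<psi>" using cT unfolding countable_theory_def by blast+
  have "satisfies N xs \<phi> (map f as)" using * satisfies_pull[OF wf(1) N f] by blast
  then have "satisfies N xs \<psi> (map f as)" using N * unfolding Obj_X is_model_def by blast
  then show "satisfies (pull f N) xs \<psi> as" using satisfies_pull[OF wf(2) N f] by blast
qed

lemma
  assumes N: "N \<in> Obj X" and f: "surj f"
  shows ren_Mor: "ren f N \<in> Mor X" and ren_maps: "maps_to (fst (ren f N)) x y \<longleftrightarrow> eqv N (f x) y"
proof -
  note p = Obj_per[OF N]
  have map: "is_map (fst (pull f N)) (fst N) (\<lambda>x y. eqv N (f x) y)"
    unfolding is_map_def
  proof (intro conjI allI impI)
    show "is_per (fst (pull f N))" "is_per (fst N)" using Obj_per[OF pull_Obj[OF N f]] p .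
  next
    fix a b assume "eqv N (f a) b"
    then show "eqv (pull f N) a a" "eqv N b b" using per_refl[OF p] by auto
  next
    fix a a' b b' assume "eqv N (f a) b" "eqv (pull f N) a a'" "eqv N b b'"
    then show "eqv N (f a') b'" using per_sym[OF p] per_trans[OF p] pull_eqv by blast
  next
    fix a b b' assume "eqv N (f a) b" "eqv N (f a) b'"
    then show "eqv N b b'" using per_sym[OF p] per_trans[OF p] by blast
  next
    fix a assume "eqv (pull f N) a a"
    then show "\<exists>b. eqv N (f a) b" by auto
  qed
  show m: "maps_to (fst (ren f N)) x y \<longleftrightarrow> eqv N (f x) y" for x y
    unfolding ren_def by (simp add: maps_to_mk_mor[OF map])
  show "ren f N \<in> Mor X"
    unfolding ren_def
  proof (rule MorI)
    fix P as bs assume P: "P \<in> L" "length as = ar P" and as: "list_all2 (maps_to (mk_mor (fst (pull f N)) (fst N) (\<lambda>x y. eqv N (f x) y))) as bs"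
      and h: "holds_pred (pull f N) P as"
    have "list_all2 (eqv N) (map f as) bs"
      using as unfolding maps_to_mk_mor[OF map, abs_def] by (simp add: list_all2_map1)
    then show "holds_pred N P bs"
      using pred_cong[OF Obj_structure[OF N] P(1)] h P pull_pred[OF N P] by simp
  qed (use mk_mor_in_mors[OF map] N pull_Obj[OF N f] in simp_all)
qed

lemma ren_st [simp]: "fst (snd (ren f N)) = pull f N" "snd (snd (ren f N)) = N"
  by (simp_all add: ren_def)

lemma ren_lim:
  assumes M: "seqlim (model_space L ar T) M l" "\<And>k. M k \<in> Obj X" and f: "surj f"
  shows "seqlim (hom_space L ar T) (\<lambda>k. ren f (M k)) (ren f l)"
proof -
  have l: "l \<in> Obj X" using lim_Obj M(1) by simp
  have pl: "seqlim (model_space L ar T) (\<lambda>k. pull f (M k)) (pull f l)"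
  proof (rule lim_modelI)
    show "\<forall>\<^sub>s k. eqv (pull f (M k)) a b" if "eqv (pull f l) a b" for a b
      using that lim_model_eqv[OF M(1)] by simp
    show "\<forall>\<^sub>s k. holds_pred (pull f (M k)) P as"
      if "P \<in> L" "length as = ar P" "holds_pred (pull f l) P as" for P as
      using that lim_model_pred[OF M(1)] pull_pred[OF M(2)] pull_pred[OF l] by simp
  qed (use M l pull_Obj[OF _ f] in auto)
  moreover have "seqlim ods_mor_top (\<lambda>k. fst (ren f (M k))) (fst (ren f l))"
    unfolding limitin_ods_mor
    using hom_mor[OF ren_Mor[OF _ f]] hom_src[OF ren_Mor[OF _ f]] hom_tgt[OF ren_Mor[OF _ f]] M(2) l
      ren_maps[OF _ f] lim_model_eqv[OF M(1)] lim_model_eqv[OF pl] by simp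
  ultimately show ?thesis using M(1) lim_hom[OF ren_Mor[OF M(2) f] ren_Mor[OF l f]] by simp
qed

text \<open>The numbers beyond \<open>sum_list bs\<close>, which bounds every member of \<open>bs\<close>, make \<open>move\<close> surjective.\<close>

definition move :: "nat list \<Rightarrow> nat list \<Rightarrow> nat \<Rightarrow> nat" where
  "move bs xs n = (if n \<in> set bs then val bs xs n else n - Suc (sum_list bs))"

lemma surj_move: "surj (move bs xs)"
proof (rule surjI)
  fix y
  have "y + Suc (sum_list bs) \<notin> set bs" using member_le_sum_list[of _ bs] by fastforce
  then show "move bs xs (y + Suc (sum_list bs)) = y" by (simp add: move_def)
qed

lemma map_move: "distinct bs \<Longrightarrow> length xs = length bs \<Longrightarrow> map (move bs xs) bs = xs"
  by (simp add: list_eq_iff_nth_eq move_def val_nth)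

subsection \<open>Basic neighbourhoods\<close>

text \<open>Contexts consist of the very numbers that name elements, so that \<open>sat bs \<phi> M bs\<close> expresses
  that \<open>M\<close> lies in a basic open set.\<close>

definition atoms :: "'p fm set" where
  "atoms = {FEq a b |a b. True} \<union> {FPred P ys |P ys. P \<in> L \<and> length ys = ar P}"

fun vars :: "'p fm \<Rightarrow> nat list" where
  "vars (FEq a b) = [a, b]"
| "vars (FPred P ys) = ys"
| "vars _ = []"

definition conj :: "'p fm list \<Rightarrow> 'p fm" where
  "conj fs = foldr FAnd fs FTop"

lemma holds_conj: "holds (conj fs) M xs as \<longleftrightarrow> (\<forall>\<phi>\<in>set fs. holds \<phi> M xs as)"
  unfolding conj_def by (induction fs) auto

definition basic :: "nat list \<Rightarrow> 'p fm \<Rightarrow> bool" where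
  "basic bs \<phi> \<longleftrightarrow> distinct bs \<and> (\<exists>fs. \<phi> = conj fs \<and> set fs \<subseteq> atoms \<and> (\<forall>\<psi>\<in>set fs. set (vars \<psi>) \<subseteq> set bs))"

lemma wf_atom: "\<psi> \<in> atoms \<Longrightarrow> distinct bs \<Longrightarrow> set (vars \<psi>) \<subseteq> set bs \<Longrightarrow> wf_fm L ar bs \<psi>"
  unfolding atoms_def by (auto intro: wf_fm.intros)

lemma basic_wf: "basic bs \<phi> \<Longrightarrow> wf_fm L ar bs \<phi>"
proof -
  assume "basic bs \<phi>"
  then obtain fs where "\<phi> = conj fs" "set fs \<subseteq> atoms" "\<forall>\<psi>\<in>set fs. set (vars \<psi>) \<subseteq> set bs" and d: "distinct bs"
    unfolding basic_def by blast
  then show ?thesis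
    unfolding conj_def by (induction fs arbitrary: \<phi>) (auto intro: wf_fm.intros wf_atom)
qed

lemma basic_distinct: "basic bs \<phi> \<Longrightarrow> distinct bs"
  by (simp add: basic_def)

lemma countable_atoms: "countable atoms"
proof -
  have "{FEq a b |a b. True} = range (\<lambda>(a, b). FEq a b :: 'p fm)" by auto
  then have 1: "countable {FEq a b :: 'p fm |a b. True}" by simp
  have "{FPred P ys |P ys. P \<in> L \<and> length ys = ar P} \<subseteq> (\<lambda>(P, ys). FPred P ys) ` (L \<times> UNIV)" by auto
  moreover have "countable (L \<times> (UNIV :: nat list set))" using cL by auto
  ultimately have "countable {FPred P ys |P ys. P \<in> L \<and> length ys = ar P}"
    using countable_image by (blast intro: countable_subset)
  with 1 show ?thesis unfolding atoms_def by (rule countable_Un)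
qed

text \<open>The point where countability of L is used. It makes the covers by definable functors
  countable, so that preservation of countable colimits applies to them.\<close>

lemma countable_basic: "countable {(bs, \<phi>). basic bs \<phi>}"
proof -
  have "{(bs, \<phi>). basic bs \<phi>} \<subseteq> (\<lambda>(bs, fs). (bs, conj fs)) ` (UNIV \<times> lists atoms)"
    unfolding basic_def by auto
  then show ?thesis by (rule countable_subset) (use countable_atoms in auto)
qed

text \<open>The truth of an atom read directly as a statement about the numbers in it;
  \<open>remdups\<close> turns those numbers into a legitimate context in which each variable takes
  itself as value.\<close>

definition true_at :: "'p struct \<Rightarrow> 'p fm \<Rightarrow> bool" where
  "true_at M \<psi> \<longleftrightarrow> holds \<psi> M (remdups (vars \<psi>)) (remdups (vars \<psi>))"

lemma true_at_simps [simp]: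
  "true_at M (FEq a b) \<longleftrightarrow> eqv M a b" "true_at M (FPred P ys) \<longleftrightarrow> holds_pred M P ys"
proof -
  show "true_at M (FEq a b) \<longleftrightarrow> eqv M a b"
    unfolding true_at_def by (simp add: val_self del: remdups.simps)
  have "map (val (remdups ys) (remdups ys)) ys = ys" by (rule map_idI) (simp add: val_self)
  then show "true_at M (FPred P ys) \<longleftrightarrow> holds_pred M P ys"
    unfolding true_at_def by simp
qed

lemma holds_atom: "\<psi> \<in> atoms \<Longrightarrow> distinct bs \<Longrightarrow> set (vars \<psi>) \<subseteq> set bs \<Longrightarrow> holds \<psi> M bs bs \<longleftrightarrow> true_at M \<psi>"
proof -
  assume a: "\<psi> \<in> atoms" "distinct bs" "set (vars \<psi>) \<subseteq> set bs"
  have "map (val bs bs) ys = ys" if "set ys \<subseteq> set bs" for ys using that a by (intro map_idI) (auto simp: val_self)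
  then show ?thesis using a unfolding atoms_def by (auto simp: val_self)
qed

lemma true_at_dom: "M \<in> Obj X \<Longrightarrow> \<psi> \<in> atoms \<Longrightarrow> true_at M \<psi> \<Longrightarrow> a \<in> set (vars \<psi>) \<Longrightarrow> eqv M a a"
  using pred_dom[OF Obj_structure] per_refl[OF Obj_per] unfolding atoms_def by fastforce

text \<open>Enumerate the atoms, and let \<phi> i be the conjunction of those among the first i + 1
  that are true in M. Each true atom is eventually implied, so the sequence is a neighbourhood base
  of M given by formulas.\<close>

lemma basic_sequence:
  assumes M: "M \<in> Obj X"
  obtains bs \<phi> where "\<And>i :: nat. basic (bs i) (\<phi> i)" "\<And>i. sat (bs i) (\<phi> i) M (bs i)"
    "\<And>\<psi>. \<psi> \<in> atoms \<Longrightarrow> true_at M \<psi> \<Longrightarrow>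
       \<exists>j. \<forall>i\<ge>j. set (vars \<psi>) \<subseteq> set (bs i) \<and> (\<forall>N. sat (bs i) (\<phi> i) N (bs i) \<longrightarrow> true_at N \<psi>)"
proof -
  define e where "e = from_nat_into atoms"
  have ne: "atoms \<noteq> {}" unfolding atoms_def by auto
  have e: "e i \<in> atoms" for i unfolding e_def by (rule from_nat_into[OF ne])
  define fs where "fs i = filter (true_at M) (map e [0..<Suc i])" for i
  define bs where "bs i = remdups (concat (map vars (fs i)))" for i
  define \<phi> where "\<phi> i = conj (fs i)" for i
  have fs: "\<psi> \<in> set (fs i) \<longleftrightarrow> true_at M \<psi> \<and> (\<exists>j\<le>i. \<psi> = e j)" for \<psi> i
    by (auto simp: fs_def less_Suc_eq_le simp del: upt_Suc)
  have fs_atoms: "set (fs i) \<subseteq> atoms" for i using e by (auto simp: fs)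
  have b: "basic (bs i) (\<phi> i)" for i
    unfolding basic_def \<phi>_def using fs_atoms by (intro conjI exI[of _ "fs i"]) (auto simp: bs_def)
  have holds: "holds (\<phi> i) N (bs i) (bs i) \<longleftrightarrow> (\<forall>\<psi>\<in>set (fs i). true_at N \<psi>)" for N i
  proof -
    have "holds \<psi> N (bs i) (bs i) \<longleftrightarrow> true_at N \<psi>" if "\<psi> \<in> set (fs i)" for \<psi>
      by (rule holds_atom) (use that fs_atoms in \<open>auto simp: bs_def\<close>)
    then show ?thesis unfolding \<phi>_def holds_conj by blast
  qed
  show thesis
  proof (rule that)
    show "basic (bs i) (\<phi> i)" for i by (rule b)
    show "sat (bs i) (\<phi> i) M (bs i)" for i
      unfolding satisfies_def holds
    proof (intro conjI ballI)
      fix a assume "a \<in> set (bs i)"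
      then obtain \<psi> where "\<psi> \<in> set (fs i)" "a \<in> set (vars \<psi>)" by (auto simp: bs_def)
      then show "eqv M a a" using true_at_dom[OF M, of \<psi> a] fs fs_atoms by blast
    qed (use fs in auto)
    fix \<psi> assume "\<psi> \<in> atoms" and t: "true_at M \<psi>"
    then obtain j where j: "\<psi> = e j" using countable_atoms unfolding e_def by (metis from_nat_into_surj)
    show "\<exists>j. \<forall>i\<ge>j. set (vars \<psi>) \<subseteq> set (bs i) \<and> (\<forall>N. sat (bs i) (\<phi> i) N (bs i) \<longrightarrow> true_at N \<psi>)"
    proof (intro exI[of _ j] allI impI conjI)
      fix i assume "i \<ge> j"
      then have m: "\<psi> \<in> set (fs i)" using fs t j by blast
      then show "set (vars \<psi>) \<subseteq> set (bs i)" by (auto simp: bs_def)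
      fix N assume "sat (bs i) (\<phi> i) N (bs i)"
      then show "true_at N \<psi>" using m holds unfolding satisfies_def by blast
    qed
  qed
qed

text \<open>Any tuple of N satisfying \<phi> can be given the names \<open>bs\<close> in an
  isomorphic model. Statements about the single tuple \<open>bs\<close> in all models thereby speak
  about all tuples.\<close>

lemma ren_move_maps:
  assumes N: "N \<in> Obj X" and b: "basic bs \<phi>" and xs: "sat bs \<phi> N xs" and e: "list_all2 (eqv N) xs ys"
  shows "list_all2 (maps_to (fst (ren (move bs xs) N))) bs ys"
    and "sat bs \<phi> (pull (move bs xs) N) bs"
proof -
  note d = basic_distinct[OF b]
  have l: "length xs = length bs" using xs by (simp add: satisfies_def)
  have "list_all2 (eqv N) (map (move bs xs) bs) ys" using e map_move[OF d l] by simp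
  then show "list_all2 (maps_to (fst (ren (move bs xs) N))) bs ys"
    by (simp add: list_all2_map1 ren_maps[OF N surj_move] list_all2_conv_all_nth)
  show "sat bs \<phi> (pull (move bs xs) N) bs"
    using satisfies_pull[OF basic_wf[OF b] N surj_move] map_move[OF d l] xs by simp
qed

lemma sat_refl: "sat bs \<phi> N xs \<Longrightarrow> list_all2 (eqv N) xs xs"
  unfolding satisfies_def list_all2_same by simp

lemma index_ex: "set ys \<subseteq> set xs \<Longrightarrow> \<exists>\<sigma>. length \<sigma> = length ys \<and> (\<forall>i\<in>set \<sigma>. i < length xs) \<and> map ((!) xs) \<sigma> = ys"
proof (induction ys)
  case (Cons y ys)
  then obtain \<sigma> i where "length \<sigma> = length ys" "\<forall>i\<in>set \<sigma>. i < length xs" "map ((!) xs) \<sigma> = ys" "i < length xs" "xs ! i = y"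
    by (auto simp: in_set_conv_nth)
  then show ?case by (intro exI[of _ "i # \<sigma>"]) simp
qed simp

text \<open>The function r allows the use of a tail of the neighbourhood sequence, where finitely
  many prescribed numbers are already among the names.\<close>

lemma basic_lim:
  assumes M: "M \<in> Obj X"
    and conv: "\<And>\<psi>. \<psi> \<in> atoms \<Longrightarrow> true_at M \<psi> \<Longrightarrow>
       \<exists>j. \<forall>i\<ge>j. set (vars \<psi>) \<subseteq> set (bs i) \<and> (\<forall>N. sat (bs i) (\<phi> i) N (bs i) \<longrightarrow> true_at N \<psi>)"
    and N: "\<And>i :: nat. N i \<in> Obj X" "\<And>i. sat (bs (r i)) (\<phi> (r i)) (N i) (bs (r i))" "\<And>i. r i \<ge> i"
  shows "seqlim (model_space L ar T) N M"
proof -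
  have ev: "\<forall>\<^sub>s i. true_at (N i) \<psi>" if \<psi>: "\<psi> \<in> atoms" "true_at M \<psi>" for \<psi>
  proof -
    obtain j where j: "\<forall>i\<ge>j. \<forall>N. sat (bs i) (\<phi> i) N (bs i) \<longrightarrow> true_at N \<psi>" using conv[OF \<psi>] by blast
    have "true_at (N i) \<psi>" if "i \<ge> j" for i using j N(2,3)[of i] that order_trans by blast
    then show ?thesis unfolding eventually_sequentially by blast
  qed
  show ?thesis
  proof (rule lim_modelI)
    show "\<forall>\<^sub>s k. eqv (N k) a b" if "eqv M a b" for a b
      using ev[of "FEq a b"] that by (simp add: atoms_def)
    show "\<forall>\<^sub>s k. holds_pred (N k) P as" if "P \<in> L" "length as = ar P" "holds_pred M P as" for P as
      using ev[of "FPred P as"] that by (simp add: atoms_def)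
  qed (use N M in auto)
qed

text \<open>If no basic neighbourhood implied S at \<open>as\<close>, counterexamples would converge
  to M, against the persistence of S. Applied at every model, this makes each natural predicate a
  union of images of basic formulas, which reduces natural predicates to formulas.\<close>

lemma npred_basic:
  assumes S: "npred n S" and M: "M \<in> Obj X" and as: "S M as"
  obtains bs \<phi> \<sigma> where "basic bs \<phi>" "sat bs \<phi> M bs" "reindex (length bs) (sat bs \<phi>) n S \<sigma>" "map ((!) bs) \<sigma> = as"
proof -
  obtain bs \<phi> where b: "\<And>i :: nat. basic (bs i) (\<phi> i)" "\<And>i. sat (bs i) (\<phi> i) M (bs i)"
    and conv: "\<And>\<psi>. \<psi> \<in> atoms \<Longrightarrow> true_at M \<psi> \<Longrightarrow>
       \<exists>j. \<forall>i\<ge>j. set (vars \<psi>) \<subseteq> set (bs i) \<and> (\<forall>N. sat (bs i) (\<phi> i) N (bs i) \<longrightarrow> true_at N \<psi>)"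
    using basic_sequence[OF M] by blast
  have "\<exists>j. \<forall>i\<ge>j. a \<in> set (bs i)" if "a \<in> set as" for a
  proof -
    have "true_at M (FEq a a)" using npred_dom[OF S M as] that by simp
    then have "\<exists>j. \<forall>i\<ge>j. set (vars (FEq a a :: 'p fm)) \<subseteq> set (bs i)" using conv[of "FEq a a"] by (auto simp: atoms_def)
    then show ?thesis by simp
  qed
  then obtain j where j: "\<And>a i. a \<in> set as \<Longrightarrow> i \<ge> j a \<Longrightarrow> a \<in> set (bs i)" by metis
  \<comment> \<open>Bounds each of the finitely many thresholds j a.\<close>
  define j0 where "j0 = sum_list (map j as)"
  have j0: "set as \<subseteq> set (bs i)" if "i \<ge> j0" for i
    using j member_le_sum_list[of _ "map j as"] that unfolding j0_def by fastforce
  have "\<exists>i\<ge>j0. \<forall>N\<in>Obj X. sat (bs i) (\<phi> i) N (bs i) \<longrightarrow> S N as"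
  proof (rule ccontr)
    assume "\<not> ?thesis"
    then have "\<exists>N. N \<in> Obj X \<and> sat (bs (i + j0)) (\<phi> (i + j0)) N (bs (i + j0)) \<and> \<not> S N as" for i
      by (metis le_add2)
    then obtain N where N: "\<And>i. N i \<in> Obj X" "\<And>i. sat (bs (i + j0)) (\<phi> (i + j0)) (N i) (bs (i + j0))" "\<And>i. \<not> S (N i) as"
      by metis
    have "seqlim (model_space L ar T) N M"
      by (rule basic_lim[OF M conv, where r = "\<lambda>i. i + j0"]) (use N in auto)
    then have "\<forall>\<^sub>s k. S (N k) as" by (rule npred_lim[OF S _ N(1) as])
    then show False using N(3) by (auto simp: eventually_sequentially)
  qed
  then obtain i where i: "i \<ge> j0" "\<And>N. N \<in> Obj X \<Longrightarrow> sat (bs i) (\<phi> i) N (bs i) \<Longrightarrow> S N as" by blast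
  obtain \<sigma> where \<sigma>: "length \<sigma> = length as" "\<forall>k\<in>set \<sigma>. k < length (bs i)" "map ((!) (bs i)) \<sigma> = as"
    using index_ex[OF j0[OF i(1)]] by blast
  have "reindex (length (bs i)) (sat (bs i) (\<phi> i)) n S \<sigma>"
    unfolding reindex_def
  proof (intro conjI ballI allI impI S sat_npred[OF basic_wf[OF b(1)]])
    show "length \<sigma> = n" using \<sigma> npred_len[OF S M as] by simp
    show "k < length (bs i)" if "k \<in> set \<sigma>" for k using \<sigma> that by blast
    fix N xs assume N: "N \<in> Obj X" and xs: "sat (bs i) (\<phi> i) N xs"
    \<comment> \<open>The implication is known only for the names bs i. Give xs these names, apply
      it there, and return along the projection, which sends \<open>as\<close> to the coordinates of
      xs selected by \<sigma>.\<close>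
    let ?f = "move (bs i) xs"
    have l: "length xs = length (bs i)" using xs by (simp add: satisfies_def)
    note P = pull_Obj[OF N surj_move, of "bs i" xs]
    have sP: "S (pull ?f N) as" using i(2)[OF P] ren_move_maps(2)[OF N b(1) xs sat_refl[OF xs]] by blast
    have "list_all2 (maps_to (fst (ren ?f N))) as (map ?f as)"
      using npred_dom[OF S P sP] by (simp add: list_all2_map2 ren_maps[OF N surj_move] list_all2_same)
    then have "S N (map ?f as)" using npred_hom[OF S ren_Mor[OF N surj_move, of "bs i" xs]] sP by simp
    moreover have "map ?f as = map ((!) xs) \<sigma>"
    proof -
      have e: "?f (bs i ! k) = xs ! k" if "k < length (bs i)" for k
        using map_move[OF basic_distinct[OF b(1)] l] that by (metis nth_map)
      have "map ?f as = map (\<lambda>k. ?f (bs i ! k)) \<sigma>" by (simp flip: \<sigma>(3))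
      also have "\<dots> = map ((!) xs) \<sigma>" using e \<sigma>(2) by simp
      finally show ?thesis .
    qed
    ultimately show "S N (map ((!) xs) \<sigma>)" by simp
  qed
  then show thesis using that b \<sigma>(3) by blast
qed

subsection \<open>Every element of a functor is definable\<close>

definition good :: "('p struct, 'p hom, per, ods_mor) fctr \<Rightarrow> nat list \<Rightarrow> 'p fm \<Rightarrow> nat \<Rightarrow> bool" where
  "good H bs \<phi> a \<longleftrightarrow> (\<forall>h\<in>Mor X. sat bs \<phi> (fst (snd h)) bs \<longrightarrow> sat bs \<phi> (snd (snd h)) bs \<longrightarrow>
     (\<forall>b\<in>set bs. maps_to (fst h) b b) \<longrightarrow> maps_to (snd H h) a a)"

text \<open>Otherwise bad homomorphisms for a decreasing sequence of basic neighbourhoods would converge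
  to the identity of \<open>M\<close>.\<close>

lemma good_neighbourhood:
  assumes F: "seqlim (functor_obj_space X ODS) F G"
    and G: "G \<in> Obj FC" and M: "M \<in> Obj X" and a: "(a, a) \<in> fst G M"
  obtains bs \<phi> k0 where "basic bs \<phi>" "sat bs \<phi> M bs" "good G bs \<phi> a" "\<And>k. k \<ge> k0 \<Longrightarrow> good (F k) bs \<phi> a"
proof -
  obtain bs \<phi> where b: "\<And>i :: nat. basic (bs i) (\<phi> i)" "\<And>i. sat (bs i) (\<phi> i) M (bs i)"
    and conv: "\<And>\<psi>. \<psi> \<in> atoms \<Longrightarrow> true_at M \<psi> \<Longrightarrow>
       \<exists>j. \<forall>i\<ge>j. set (vars \<psi>) \<subseteq> set (bs i) \<and> (\<forall>N. sat (bs i) (\<phi> i) N (bs i) \<longrightarrow> true_at N \<psi>)"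
    using basic_sequence[OF M] by blast
  \<comment> \<open>One neighbourhood has to serve G and all late F k simultaneously. This
    uniformity lets a name persist while the functor itself varies.\<close>
  have "\<exists>i. good G (bs i) (\<phi> i) a \<and> (\<forall>k\<ge>i. good (F k) (bs i) (\<phi> i) a)"
  proof (rule ccontr)
    assume "\<not> ?thesis"
    \<comment> \<open>The failing functors are G or members with index at least i, so they still
      converge to G.\<close>
    then have "\<exists>H. (H = G \<or> (\<exists>j\<ge>i. H = F j)) \<and> \<not> good H (bs i) (\<phi> i) a" for i by blast
    then obtain H where H: "\<And>i. H i = G \<or> (\<exists>j\<ge>i. H i = F j)" "\<And>i. \<not> good (H i) (bs i) (\<phi> i) a" by metis
    then have "\<exists>h. h \<in> Mor X \<and> sat (bs i) (\<phi> i) (fst (snd h)) (bs i) \<and> sat (bs i) (\<phi> i) (snd (snd h)) (bs i) \<and>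
        (\<forall>b\<in>set (bs i). maps_to (fst h) b b) \<and> \<not> maps_to (snd (H i) h) a a" for i
      unfolding good_def by blast
    then obtain h where h: "\<And>i. h i \<in> Mor X" "\<And>i. sat (bs i) (\<phi> i) (fst (snd (h i))) (bs i)"
      "\<And>i. sat (bs i) (\<phi> i) (snd (snd (h i))) (bs i)" "\<And>i b. b \<in> set (bs i) \<Longrightarrow> maps_to (fst (h i)) b b"
      "\<And>i. \<not> maps_to (snd (H i) (h i)) a a"
      by metis
    have s: "fst (snd (h i)) \<in> Obj X" "snd (snd (h i)) \<in> Obj X" for i using h(1) Mor_X by blast+
    have limM: "seqlim (model_space L ar T) N M"
      if "\<And>i. N i \<in> Obj X" "\<And>i. sat (bs i) (\<phi> i) (N i) (bs i)" for N
      by (rule basic_lim[OF M conv, where r = "\<lambda>i. i"]) (use that in auto)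
    note l1 = limM[of "\<lambda>i. fst (snd (h i))", OF s(1) h(2)] and l2 = limM[of "\<lambda>i. snd (snd (h i))", OF s(2) h(3)]
    have "seqlim ods_mor_top (\<lambda>i. fst (h i)) (Idn ODS (fst M))"
      unfolding limitin_ods_mor
    proof (intro conjI allI impI)
      fix u v assume "maps_to (Idn ODS (fst M)) u v"
      then have uv: "eqv M u v" using maps_to_Idn[OF Obj_per[OF M]] by blast
      \<comment> \<open>The equation of u and v is an atom true in M, so u is eventually among the
        names that h i fixes.\<close>
      obtain j where j: "\<forall>i\<ge>j. set (vars (FEq u v :: 'p fm)) \<subseteq> set (bs i)" using conv[of "FEq u v"] uv by (auto simp: atoms_def)
      have "\<forall>\<^sub>s i. i \<ge> j" by (rule eventually_ge_at_top)
      then show "\<forall>\<^sub>s i. maps_to (fst (h i)) u v"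
        using lim_model_eqv[OF l2 uv]
      proof eventually_elim
        case (elim i)
        then have "maps_to (fst (h i)) u u" using j h(4) by simp
        then show ?case
          using maps_to_cong[OF hom_mor[OF h(1)] _ maps_to_dom[of "fst (h i)" u u]] elim hom_tgt[OF h(1)] by simp
      qed
    qed (use Idn_in_mors[OF Obj_per[OF M]] hom_mor[OF h(1)] hom_src[OF h(1)] hom_tgt[OF h(1)]
        lim_model_eqv[OF l1] lim_model_eqv[OF l2] in auto)
    then have lh: "seqlim (MorTop X) h (Idn X M)"
      using lim_hom[OF h(1) Idn_hom[OF M]] l1 l2 by simp
    have lH: "seqlim (functor_obj_space X ODS) H G"
      using F H(1) by (rule limitin_mixed)
    have "\<forall>\<^sub>s i. maps_to (snd (H i) (h i)) a a"
      using lim_fobjD(2)[OF lH lh] fobj_id[OF G M] a unfolding limitin_ods_mor by blast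
    then show False using h(5) by (auto simp: eventually_sequentially)
  qed
  then show thesis using that b by blast
qed

lemma good_const:
  assumes G: "G \<in> Obj FC" and M: "M \<in> Obj X" and a: "(a, a) \<in> fst G M"
  obtains bs \<phi> where "basic bs \<phi>" "sat bs \<phi> M bs" "good G bs \<phi> a"
  using good_neighbourhood[of "\<lambda>_. G" G M a] G M a
  by (auto simp: FC_simps)

text \<open>A homomorphism naming \<open>xs\<close> by \<open>bs\<close> factors through the renaming \<open>ren (move bs xs)\<close>.\<close>

lemma good_factor:
  assumes H: "H \<in> Obj FC" and b: "basic bs \<phi>" and gd: "good H bs \<phi> a"
    and g: "g \<in> Mor X" and sg: "sat bs \<phi> (fst (snd g)) bs" and gx: "list_all2 (maps_to (fst g)) bs xs"
  shows "maps_to (snd H g) a d \<longleftrightarrow> maps_to (snd H (ren (move bs xs) (snd (snd g)))) a d"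
proof -
  let ?f = "move bs xs" and ?N = "snd (snd g)" and ?M = "fst (snd g)"
  note f = surj_move[of bs xs]
  have o: "?M \<in> Obj X" "?N \<in> Obj X" using g Mor_X by blast+
  note p = Obj_per[OF o(2)]
  note gm = hom_mor[OF g] and gs = hom_src[OF g] and gt = hom_tgt[OF g]
  have l: "length xs = length bs" using list_all2_lengthD[OF gx] by simp
  note d = basic_distinct[OF b]
  \<comment> \<open>The factor through the renaming relates u to every name v of its image under g;
    surjectivity of the renaming makes it total.\<close>
  define k where "k = mk_mor (fst ?M) (fst (pull ?f ?N)) (\<lambda>x y. maps_to (fst g) x (?f y))"
  have map: "is_map (fst ?M) (fst (pull ?f ?N)) (\<lambda>x y. maps_to (fst g) x (?f y))"
    unfolding is_map_def
  proof (intro conjI allI impI)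
    show "is_per (fst ?M)" "is_per (fst (pull ?f ?N))" using Obj_per[OF o(1)] Obj_per[OF pull_Obj[OF o(2) f]] .
  next
    fix u v assume m: "maps_to (fst g) u (?f v)"
    show "eqv ?M u u" "eqv (pull ?f ?N) v v" using maps_to_dom[OF m] maps_to_cod[OF m] gs gt by simp_all
  next
    fix u u' v v' assume "maps_to (fst g) u (?f v)" "eqv ?M u u'" "eqv (pull ?f ?N) v v'"
    then show "maps_to (fst g) u' (?f v')" using maps_to_cong[OF gm] gs gt by simp
  next
    fix u v v' assume "maps_to (fst g) u (?f v)" "maps_to (fst g) u (?f v')"
    then show "eqv (pull ?f ?N) v v'" using maps_to_fun[OF gm] gt by simp
  next
    fix u assume "eqv ?M u u"
    then obtain w where "maps_to (fst g) u w" using maps_to_total[OF gm] gs by auto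
    moreover obtain v where "w = ?f v" using f by (metis surjD)
    ultimately show "\<exists>v. maps_to (fst g) u (?f v)" by blast
  qed
  have kr: "maps_to k u v \<longleftrightarrow> maps_to (fst g) u (?f v)" for u v unfolding k_def by (rule maps_to_mk_mor[OF map])
  define g0 where "g0 = (k, ?M, pull ?f ?N)"
  have g0: "g0 \<in> Mor X"
    unfolding g0_def
  proof (rule MorI)
    show "k \<in> ods_mors" "fst k = fst ?M" "fst (snd k) = fst (pull ?f ?N)"
      unfolding k_def using mk_mor_in_mors[OF map] by simp_all
    fix P as cs assume P: "P \<in> L" "length as = ar P" and as: "list_all2 (maps_to k) as cs" "holds_pred ?M P as"
    have "list_all2 (maps_to (fst g)) as (map ?f cs)"
      using as(1) unfolding kr[abs_def] by (simp add: list_all2_map2)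
    then have "holds_pred ?N P (map ?f cs)" using hom_pred[OF g P] as by blast
    then show "holds_pred (pull ?f ?N) P cs"
      using pull_pred[OF o(2) P(1)] P list_all2_lengthD[OF as(1)] by simp
  qed (use o pull_Obj[OF o(2) f] in auto)
  have kb: "list_all2 (maps_to (fst g0)) bs bs"
  proof -
    have "list_all2 (maps_to (fst g)) bs (map ?f bs)" using gx map_move[OF d l] by simp
    then show ?thesis unfolding g0_def by (simp add: kr list_all2_map2 list_all2_conv_all_nth)
  qed
  have e: "fst (snd (ren ?f ?N)) = snd (snd g0)" by (simp add: g0_def)
  note rM = ren_Mor[OF o(2) f]
  have gc: "g = Comp X (ren ?f ?N) g0"
  proof -
    note c = Comp_hom[OF g0 rM e]
    have "fst (Comp X (ren ?f ?N) g0) = fst g"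
    proof (rule ods_mor_eqI)
      fix u w assume "maps_to (fst (Comp X (ren ?f ?N) g0)) u w"
      then obtain v where "maps_to (fst g) u (?f v)" "eqv ?N (?f v) w"
        using maps_to_comp_hom[OF g0 rM e] ren_maps[OF o(2) f] kr by (auto simp: g0_def)
      then show "maps_to (fst g) u w" using maps_to_cong[OF gm] maps_to_dom gt by metis
    qed (use hom_mor[OF c] gm hom_src[OF c] hom_tgt[OF c] gs gt in \<open>auto simp: g0_def\<close>)
    then show ?thesis by (simp add: prod_eq_iff g0_def)
  qed
  have "sat bs \<phi> (snd (snd g0)) bs"
    using npred_hom[OF sat_npred[OF basic_wf[OF b]] g0 _ kb] sg by (simp add: g0_def)
  \<comment> \<open>The factor g0 fixes the names \<open>bs\<close> and runs between models of
    \<phi>, so goodness applies to it and leaves a in place.\<close>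
  then have aa: "maps_to (snd H g0) a a"
    using gd g0 sg kb unfolding good_def list_all2_same by (simp add: g0_def)
  have e': "Src X (ren ?f ?N) = Tgt X g0" using e by simp
  have "maps_to (snd H g) a d \<longleftrightarrow> (\<exists>c. maps_to (snd H g0) a c \<and> maps_to (snd H (ren ?f ?N)) c d)"
    using fobj_comp[OF H g0 rM e', of a d] gc by simp
  also have "\<dots> \<longleftrightarrow> maps_to (snd H (ren ?f ?N)) a d"
  proof
    assume "\<exists>c. maps_to (snd H g0) a c \<and> maps_to (snd H (ren ?f ?N)) c d"
    then obtain c where c: "maps_to (snd H g0) a c" "maps_to (snd H (ren ?f ?N)) c d" by blast
    have "(c, a) \<in> fst (snd H (ren ?f ?N))"
      using maps_to_fun[OF fobj_mor[OF H g0] c(1) aa] fobj_tgt[OF H g0] fobj_src[OF H rM] e by simp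
    then show "maps_to (snd H (ren ?f ?N)) a d"
      using maps_to_cong[OF fobj_mor[OF H rM] c(2)] maps_to_cod[OF c(2)] by blast
  qed (use aa in blast)
  finally show ?thesis .
qed

text \<open>The definable map through a: a tuple xs goes to what a becomes under the renaming that
  gives xs the names \<open>bs\<close>. At M itself the tuple \<open>bs\<close> goes to a, so these
  maps jointly cover H.\<close>

definition alpha :: "nat list \<Rightarrow> 'p fm \<Rightarrow> nat \<Rightarrow> ('p struct, 'p hom, per, ods_mor) fctr \<Rightarrow> ('p struct, 'p hom, per, ods_mor) ntrans" where
  "alpha bs \<phi> a H = mk_nt (relf (sat bs \<phi>)) H
     (\<lambda>N u d. \<exists>xs. u = tuple xs \<and> sat bs \<phi> N xs \<and> maps_to (snd H (ren (move bs xs) N)) a d)"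

lemma alpha_lim_aux:
  assumes M: "seqlim (model_space L ar T) M l" "\<And>k. M k \<in> Obj X"
    and H: "seqlim (functor_obj_space X ODS) H G"
    and m: "maps_to (snd G (ren f l)) a d" and f: "surj f"
  shows "\<forall>\<^sub>s k. maps_to (snd (H k) (ren f (M k))) a d"
proof -
  have "seqlim (MorTop X) (\<lambda>k. ren f (M k)) (ren f l)" using ren_lim[OF M f] by simp
  then show ?thesis using lim_fobjD(2)[OF H] m unfolding limitin_ods_mor by blast
qed

lemma alpha_ok:
  assumes H: "H \<in> Obj FC" and b: "basic bs \<phi>" and gd: "good H bs \<phi> a"
  shows "nt_ok (relf (sat bs \<phi>)) H (\<lambda>N u d. \<exists>xs. u = tuple xs \<and> sat bs \<phi> N xs \<and> maps_to (snd H (ren (move bs xs) N)) a d)"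
    (is "nt_ok _ _ ?R")
proof -
  note S = sat_npred[OF basic_wf[OF b]]
  have tup: "xs = ys" if "tuple xs = tuple ys" "sat bs \<phi> N xs" "sat bs \<phi> N' ys" for xs ys N N'
    using that tuple_eq_iff unfolding satisfies_def by metis
  note rM = ren_Mor[OF _ surj_move]
  \<comment> \<open>The renaming along xs also sends \<open>bs\<close> to the equivalent tuple ys,
    so by factorisation both renamings act alike on a.\<close>
  have Hc: "maps_to (snd H (ren (move bs xs) N)) a d \<longleftrightarrow> maps_to (snd H (ren (move bs ys) N)) a d"
    if N: "N \<in> Obj X" and xs: "sat bs \<phi> N xs" and e: "list_all2 (eqv N) xs ys" for N xs ys d
    using good_factor[OF H b gd rM[OF N] _ ren_move_maps(1)[OF N b xs e]] ren_move_maps(2)[OF N b xs e] by simp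
  show ?thesis
  proof (rule nt_okI)
    show "relf (sat bs \<phi>) \<in> Obj FC" using relf_obj[OF S] .
    show "H \<in> Obj FC" by (rule H)
  next
    fix N assume N: "N \<in> Obj X"
    have hm: "snd H (ren (move bs xs) N) \<in> ods_mors" "fst (snd (snd H (ren (move bs xs) N))) = fst H N"
      "fst (snd H (ren (move bs xs) N)) = fst H (pull (move bs xs) N)" for xs
      using fobj_mor[OF H rM[OF N]] fobj_tgt[OF H rM[OF N]] fobj_src[OF H rM[OF N]] by simp_all
    show "is_map (fst (relf (sat bs \<phi>)) N) (fst H N) (?R N)"
      unfolding is_map_def
    proof (intro conjI allI impI)
      show "is_per (fst (relf (sat bs \<phi>)) N)" "is_per (fst H N)" using fobj_per[OF relf_obj[OF S] N] fobj_per[OF H N] .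
    next
      fix u d assume "?R N u d"
      then show "(u, u) \<in> fst (relf (sat bs \<phi>)) N" "(d, d) \<in> fst H N"
        using relf_self[OF S N] maps_to_cod hm(2) by blast+
    next
      fix u u' d d' assume R: "?R N u d" and uu: "(u, u') \<in> fst (relf (sat bs \<phi>)) N" and dd: "(d, d') \<in> fst H N"
      obtain xs where 1: "u = tuple xs" "sat bs \<phi> N xs" "maps_to (snd H (ren (move bs xs) N)) a d" using R by blast
      obtain xs' ys where 2: "u = tuple xs'" "u' = tuple ys" "sat bs \<phi> N xs'" "list_all2 (eqv N) xs' ys"
        using uu relf_fst[OF S N] by blast
      have "xs = xs'" using tup[of xs xs' N N] 1 2 by simp
      then have "maps_to (snd H (ren (move bs ys) N)) a d" using Hc[OF N 2(3,4)] 1 by simp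
      then have "maps_to (snd H (ren (move bs ys) N)) a d'"
        using maps_to_cong[OF hm(1)] maps_to_dom hm(2) dd by metis
      moreover have "sat bs \<phi> N ys" using npred_cong[OF S N 2(3,4)] .
      ultimately show "?R N u' d'" using 2 by blast
    next
      fix u d d' assume "?R N u d" "?R N u d'"
      then obtain xs xs' where 1: "u = tuple xs" "sat bs \<phi> N xs" "maps_to (snd H (ren (move bs xs) N)) a d"
        "u = tuple xs'" "sat bs \<phi> N xs'" "maps_to (snd H (ren (move bs xs') N)) a d'" by blast
      have "xs = xs'" using tup[of xs xs' N N] 1 by simp
      then show "(d, d') \<in> fst H N" using maps_to_fun[OF hm(1)] hm(2) 1 by metis
    next
      fix u assume "(u, u) \<in> fst (relf (sat bs \<phi>)) N"
      then obtain xs where xs: "u = tuple xs" "sat bs \<phi> N xs" using relf_self[OF S N] by blast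
      let ?P = "pull (move bs xs) N"
      note P = pull_Obj[OF N surj_move, of bs xs]
      have sP: "sat bs \<phi> ?P bs" using ren_move_maps(2)[OF N b xs(2) sat_refl[OF xs(2)]] .
      \<comment> \<open>Goodness at the identity of the renamed model shows that a is an element of
        H there, which gives totality.\<close>
      have "\<forall>b\<in>set bs. maps_to (fst (Idn X ?P)) b b"
        using sP unfolding satisfies_def by (simp add: maps_to_Idn[OF Obj_per[OF P]])
      then have "maps_to (snd H (Idn X ?P)) a a"
        using gd Idn_hom[OF P] sP unfolding good_def by simp
      then have "(a, a) \<in> fst (snd H (ren (move bs xs) N))" using fobj_id[OF H P] hm(3) by blast
      then show "\<exists>d. ?R N u d" using maps_to_total[OF hm(1)] xs by blast
    qed
  next
    fix h u u' d d' assume h: "h \<in> Mor X" and uu: "maps_to (snd (relf (sat bs \<phi>)) h) u u'" and R: "?R (Src X h) u d"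
      and dd: "maps_to (snd H h) d d'"
    have o: "fst (snd h) \<in> Obj X" "snd (snd h) \<in> Obj X" using h Mor_X by blast+
    obtain xs where 1: "u = tuple xs" "sat bs \<phi> (fst (snd h)) xs" "maps_to (snd H (ren (move bs xs) (fst (snd h)))) a d"
      using R by auto
    obtain xs' ys where 2: "u = tuple xs'" "u' = tuple ys" "sat bs \<phi> (fst (snd h)) xs'" "list_all2 (maps_to (fst h)) xs' ys"
      using uu relf_snd[OF S h] by blast
    have x: "xs = xs'" using tup 1 2 by metis
    let ?r = "ren (move bs xs) (fst (snd h))"
    have e: "fst (snd h) = snd (snd ?r)" by simp
    note c = Comp_hom[OF rM[OF o(1)] h, of bs xs]
    \<comment> \<open>The renaming followed by h sends \<open>bs\<close> to ys, and may therefore be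
      exchanged for the renaming along ys.\<close>
    have "list_all2 (maps_to (fst (Comp X h ?r))) bs ys"
    proof -
      have "list_all2 (maps_to (fst ?r)) bs xs" using ren_move_maps(1)[OF o(1) b 1(2) sat_refl[OF 1(2)]] .
      then have "list_all2 (\<lambda>u w. \<exists>v. maps_to (fst ?r) u v \<and> maps_to (fst h) v w) bs ys"
        using 2(4) x by (auto intro: list_all2_trans[rotated])
      then show ?thesis
        using maps_to_comp_hom[OF rM[OF o(1)] h e] by (simp add: list_all2_conv_all_nth)
    qed
    moreover have "maps_to (snd H (Comp X h ?r)) a d'"
      using fobj_comp[OF H rM[OF o(1)] h] 1 dd by auto
    ultimately have "maps_to (snd H (ren (move bs ys) (snd (snd h)))) a d'"
      using good_factor[OF H b gd c] ren_move_maps(2)[OF o(1) b 1(2) sat_refl[OF 1(2)]] by simp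
    moreover have "sat bs \<phi> (snd (snd h)) ys" using npred_hom[OF S h 2(3,4)] .
    ultimately show "?R (Tgt X h) u' d'" using 2 by auto
  next
    fix M l u d assume M: "seqlim (ObjTop X) M l" "\<And>k. M k \<in> Obj X" and "?R l u d"
    then obtain xs where 1: "u = tuple xs" "sat bs \<phi> l xs" "maps_to (snd H (ren (move bs xs) l)) a d" by blast
    have M': "seqlim (model_space L ar T) M l" using M by simp
    have "H \<in> topspace (functor_obj_space X ODS)" using H by (simp add: FC_simps)
    then have "seqlim (functor_obj_space X ODS) (\<lambda>_. H) H" by simp
    note ev = alpha_lim_aux[OF M' M(2) this 1(3) surj_move]
    have "\<forall>\<^sub>s k. sat bs \<phi> (M k) xs" using npred_lim[OF S M' M(2) 1(2)] .
    with ev show "\<forall>\<^sub>s k. ?R (M k) u d" by eventually_elim (use 1 in blast)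
  qed
qed

lemma alpha_mor: "H \<in> Obj FC \<Longrightarrow> basic bs \<phi> \<Longrightarrow> good H bs \<phi> a \<Longrightarrow> alpha bs \<phi> a H \<in> Mor FC"
  unfolding alpha_def by (rule mk_nt_mor[OF alpha_ok])

lemma alpha_st [simp]: "fst (snd (alpha bs \<phi> a H)) = relf (sat bs \<phi>)" "snd (snd (alpha bs \<phi> a H)) = H"
  by (simp_all add: alpha_def)

lemma alpha_rel: "H \<in> Obj FC \<Longrightarrow> basic bs \<phi> \<Longrightarrow> good H bs \<phi> a \<Longrightarrow> N \<in> Obj X \<Longrightarrow> maps_to (fst (alpha bs \<phi> a H) N) u d \<longleftrightarrow>
    (\<exists>xs. u = tuple xs \<and> sat bs \<phi> N xs \<and> maps_to (snd H (ren (move bs xs) N)) a d)"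
  unfolding alpha_def by (rule maps_to_mk_nt[OF alpha_ok])

lemma alpha_at:
  assumes H: "H \<in> Obj FC" and b: "basic bs \<phi>" and gd: "good H bs \<phi> a" and M: "M \<in> Obj X" and s: "sat bs \<phi> M bs"
  shows "maps_to (fst (alpha bs \<phi> a H) M) (tuple bs) a"
proof -
  have i: "list_all2 (maps_to (fst (Idn X M))) bs bs"
    using sat_refl[OF s] by (simp add: list_maps_Idn[OF Obj_per[OF M]])
  then have "maps_to (snd H (Idn X M)) a a"
    using gd Idn_hom[OF M] s unfolding good_def list_all2_same by simp
  then have "maps_to (snd H (ren (move bs bs) M)) a a"
    using good_factor[OF H b gd Idn_hom[OF M] _ i] s by simp
  then show ?thesis using alpha_rel[OF H b gd M] s by blast
qed

lemma alpha_lim: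
  assumes H: "seqlim (functor_obj_space X ODS) H G" "\<And>k. H k \<in> Obj FC" "G \<in> Obj FC"
    and b: "basic bs \<phi>" and gd: "\<And>k. good (H k) bs \<phi> a" "good G bs \<phi> a"
  shows "seqlim (functor_mor_space X ODS) (\<lambda>k. alpha bs \<phi> a (H k)) (alpha bs \<phi> a G)"
proof (rule lim_fmorI)
  note S = sat_npred[OF basic_wf[OF b]]
  show "alpha bs \<phi> a (H k) \<in> Mor FC" for k using alpha_mor[OF H(2) b gd(1)] .
  show "alpha bs \<phi> a G \<in> Mor FC" using alpha_mor[OF H(3) b gd(2)] .
  show "seqlim (functor_obj_space X ODS) (\<lambda>k. snd (snd (alpha bs \<phi> a (H k)))) (snd (snd (alpha bs \<phi> a G)))"
    using H(1) by simp
  show "seqlim (functor_obj_space X ODS) (\<lambda>k. fst (snd (alpha bs \<phi> a (H k)))) (fst (snd (alpha bs \<phi> a G)))"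
    using relf_obj[OF S] by (simp add: FC_simps)
  fix M l assume M: "seqlim (ObjTop X) M l" "\<And>k. M k \<in> Obj X"
  have M': "seqlim (model_space L ar T) M l" using M by simp
  have l: "l \<in> Obj X" using lim_Obj[OF M(1)] .
  have e: "\<forall>\<^sub>s k. maps_to (fst (alpha bs \<phi> a (H k)) (M k)) u d" if t: "maps_to (fst (alpha bs \<phi> a G) l) u d" for u d
  proof -
    obtain xs where 1: "u = tuple xs" "sat bs \<phi> l xs" "maps_to (snd G (ren (move bs xs) l)) a d"
      using t alpha_rel[OF H(3) b gd(2) l] by blast
    have "\<forall>\<^sub>s k. sat bs \<phi> (M k) xs" using npred_lim[OF S M' M(2) 1(2)] .
    with alpha_lim_aux[OF M' M(2) H(1) 1(3) surj_move] show ?thesis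
      by eventually_elim (use 1 alpha_rel[OF H(2) b gd(1) M(2)] in blast)
  qed
  show "seqlim ods_mor_top (\<lambda>k. fst (alpha bs \<phi> a (H k)) (M k)) (fst (alpha bs \<phi> a G) l)"
    using fobj_limD[OF relf_obj[OF S] M(1)] lim_fobjD(1)[OF H(1) M(1)] e
      fmor_mor[OF alpha_mor[OF H(2) b gd(1)] M(2)] fmor_mor[OF alpha_mor[OF H(3) b gd(2)] l]
      fmor_src[OF alpha_mor[OF H(2) b gd(1)] M(2)] fmor_src[OF alpha_mor[OF H(3) b gd(2)] l]
      fmor_tgt[OF alpha_mor[OF H(2) b gd(1)] M(2)] fmor_tgt[OF alpha_mor[OF H(3) b gd(2)] l]
    unfolding limitin_ods_mor limitin_ods_obj by simp
qed

end

subsection \<open>The model defined by a \<open>\<sigma>\<close>-pretopos morphism\<close>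

lemma map_nth_upt: "length as = n \<Longrightarrow> map ((!) as) [0..<n] = as"
  by (simp add: list_eq_iff_nth_eq)

lemma map_nth_take: "n \<le> length cs \<Longrightarrow> map ((!) cs) [0..<n] = take n cs"
  by (intro nth_equalityI) simp_all

lemma map_nth_drop: "length cs = n + m \<Longrightarrow> map ((!) cs) [n..<n + m] = drop n cs"
  by (intro nth_equalityI) simp_all

context models
begin

definition elems :: "nat \<Rightarrow> 'p struct \<Rightarrow> nat list \<Rightarrow> bool" where
  "elems n N as \<longleftrightarrow> length as = n \<and> (\<forall>a\<in>set as. eqv N a a)"

abbreviation U :: "('p struct, 'p hom, per, ods_mor) fctr" where
  "U \<equiv> relf (elems 1)"

definition atom_pred :: "'p \<Rightarrow> 'p struct \<Rightarrow> nat list \<Rightarrow> bool" where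
  "atom_pred P N as \<longleftrightarrow> elems (ar P) N as \<and> holds_pred N P as"

abbreviation proj :: "('p struct \<Rightarrow> nat list \<Rightarrow> bool) \<Rightarrow> nat \<Rightarrow> ('p struct, 'p hom, per, ods_mor) ntrans" where
  "proj S i \<equiv> rx S (elems 1) [i]"

lemma dom_npred: "npred n (elems n)"
  unfolding npred_def
proof (intro conjI ballI allI impI)
  fix h as bs assume h: "h \<in> Mor X" "elems n (fst (snd h)) as" "list_all2 (maps_to (fst h)) as bs"
  have "\<forall>b\<in>set bs. (b, b) \<in> fst (snd (fst h))"
    using h(3) by (induction rule: list_all2_induct) (auto intro: maps_to_cod)
  then show "elems n (snd (snd h)) bs"
    using h list_all2_lengthD[OF h(3)] hom_tgt[OF h(1)] by (simp add: elems_def)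
next
  fix M l as assume M: "seqlim (model_space L ar T) M l" "elems n l as"
  have "\<forall>\<^sub>s k. \<forall>a\<in>set as. eqv (M k) a a"
    by (rule eventually_ball_finite) (use lim_model_eqv[OF M(1)] M(2) in \<open>auto simp: elems_def\<close>)
  then show "\<forall>\<^sub>s k. elems n (M k) as"
    by eventually_elim (use M(2) in \<open>simp add: elems_def\<close>)
qed (auto simp: elems_def)

lemma U_obj: "U \<in> Obj FC"
  by (rule relf_obj[OF dom_npred])

lemma pred_npred:
  assumes P: "P \<in> L"
  shows "npred (ar P) (atom_pred P)"
  unfolding npred_def
proof (intro conjI ballI allI impI)
  fix h as bs assume h: "h \<in> Mor X" "atom_pred P (fst (snd h)) as" "list_all2 (maps_to (fst h)) as bs"
  then show "atom_pred P (snd (snd h)) bs"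
    using npred_hom[OF dom_npred h(1) _ h(3)] hom_pred[OF h(1) P _ h(3)] by (auto simp: atom_pred_def elems_def)
next
  fix M l as assume M: "seqlim (model_space L ar T) M l" "\<forall>k. M k \<in> Obj X" "atom_pred P l as"
  have "\<forall>\<^sub>s k. elems (ar P) (M k) as" "\<forall>\<^sub>s k. holds_pred (M k) P as"
    using npred_lim[OF dom_npred M(1)] lim_model_pred[OF M(1) P] M(2,3) by (auto simp: atom_pred_def)
  then show "\<forall>\<^sub>s k. atom_pred P (M k) as"
    by eventually_elim (simp add: atom_pred_def)
qed (auto simp: atom_pred_def elems_def)

text \<open>Since \<open>tuple [a] = a\<close>, the coding is invisible for one-element lists. The
  resulting equality, rather than an isomorphism, later makes one composite of the equivalence the
  identity itself.\<close>

lemma U_fst: "N \<in> Obj X \<Longrightarrow> fst U N = fst N"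
proof -
  assume N: "N \<in> Obj X"
  have "(u, v) \<in> fst U N \<longleftrightarrow> eqv N u v" for u v
  proof
    assume "(u, v) \<in> fst U N"
    then obtain as bs where "u = tuple as" "v = tuple bs" "length as = 1" "list_all2 (eqv N) as bs"
      using relf_fst[OF dom_npred N] by (auto simp: elems_def)
    then show "eqv N u v" by (cases as; cases bs) auto
  next
    assume uv: "eqv N u v"
    then have "elems 1 N [u]" using per_refl[OF Obj_per[OF N]] by (simp add: elems_def)
    then show "(u, v) \<in> fst U N"
      using relf_fst[OF dom_npred N, of u v] uv by (intro iffD2[OF relf_fst[OF dom_npred N]] exI[of _ "[u]"] exI[of _ "[v]"]) simp
  qed
  then show ?thesis by auto
qed

lemma reindex_proj: "npred n S \<Longrightarrow> i < n \<Longrightarrow> reindex n S 1 (elems 1) [i]"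
  unfolding reindex_def using dom_npred npred_dom npred_len by (auto simp: elems_def)

lemma reindex_mono:
  assumes "npred n S" "npred n S'" "\<And>N as. N \<in> Obj X \<Longrightarrow> S N as \<Longrightarrow> S' N as"
  shows "reindex n S n S' [0..<n]"
  unfolding reindex_def using assms npred_len[OF assms(1)] by (auto simp: map_nth_upt)

lemma proj_rel:
  assumes S: "npred n S" and i: "i < n" and N: "N \<in> Obj X" and as: "length as = n"
  shows "maps_to (fst (proj S i) N) (tuple as) b \<longleftrightarrow> S N as \<and> eqv N (as ! i) b"
  using rx_tuple[OF reindex_proj[OF S i] N as, of "[b]"] by simp

section \<open>Fibre products of definable functors\<close>

definition fibre :: "nat \<Rightarrow> nat \<Rightarrow> ('p struct, 'p hom, per, ods_mor) ntrans \<Rightarrow> ('p struct, 'p hom, per, ods_mor) ntrans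
    \<Rightarrow> 'p struct \<Rightarrow> nat list \<Rightarrow> bool" where
  "fibre n m \<alpha> \<beta> N cs \<longleftrightarrow> length cs = n + m \<and>
     (\<exists>c. maps_to (fst \<alpha> N) (tuple (take n cs)) c \<and> maps_to (fst \<beta> N) (tuple (drop n cs)) c)"

context
  fixes n m S S' \<alpha> \<beta>
  assumes S: "npred n S" and S': "npred m S'" and a: "\<alpha> \<in> Mor FC" and b: "\<beta> \<in> Mor FC"
    and as: "fst (snd \<alpha>) = relf S" and bs: "fst (snd \<beta>) = relf S'" and ab: "snd (snd \<alpha>) = snd (snd \<beta>)"
begin

lemma dom_tuple:
  "N \<in> Obj X \<Longrightarrow> length xs = n \<Longrightarrow> maps_to (fst \<alpha> N) (tuple xs) c \<Longrightarrow> S N xs"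
  "N \<in> Obj X \<Longrightarrow> length ys = m \<Longrightarrow> maps_to (fst \<beta> N) (tuple ys) c \<Longrightarrow> S' N ys"
  using maps_to_dom[of "fst \<alpha> N" "tuple xs" c] maps_to_dom[of "fst \<beta> N" "tuple ys" c]
    fmor_src[OF a] fmor_src[OF b] as bs relf_tuple[OF S, of N xs xs] relf_tuple[OF S', of N ys ys] by simp_all

lemma fibre_parts: "N \<in> Obj X \<Longrightarrow> fibre n m \<alpha> \<beta> N cs \<Longrightarrow> S N (take n cs) \<and> S' N (drop n cs)"
  using dom_tuple(1)[of N "take n cs"] dom_tuple(2)[of N "drop n cs"] unfolding fibre_def by force

text \<open>The fibre product of \<alpha> and \<beta> is presented by concatenated tuples with a
  common image, so it is again a natural predicate.\<close>

lemma fibre_npred: "npred (n + m) (fibre n m \<alpha> \<beta>)"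
  unfolding npred_def
proof (intro conjI ballI allI impI)
  fix N cs c assume N: "N \<in> Obj X" and cs: "fibre n m \<alpha> \<beta> N cs" and c: "c \<in> set cs"
  have "c \<in> set (take n cs) \<or> c \<in> set (drop n cs)" using c by (metis Un_iff append_take_drop_id set_append)
  then show "eqv N c c" using npred_dom[OF S N] npred_dom[OF S' N] fibre_parts[OF N cs] by blast
next
  fix h cs ds assume h: "h \<in> Mor X" and cs: "fibre n m \<alpha> \<beta> (fst (snd h)) cs" and l: "list_all2 (maps_to (fst h)) cs ds"
  have o: "fst (snd h) \<in> Obj X" "snd (snd h) \<in> Obj X" using h Mor_X by blast+
  note p = fibre_parts[OF o(1) cs]
  obtain c where c: "maps_to (fst \<alpha> (fst (snd h))) (tuple (take n cs)) c" "maps_to (fst \<beta> (fst (snd h))) (tuple (drop n cs)) c"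
    using cs unfolding fibre_def by blast
  have "(c, c) \<in> fst (snd (snd (snd \<alpha>)) h)"
    using maps_to_cod[OF c(1)] fmor_tgt[OF a o(1)] fobj_src[OF fmor_Tgt[OF a] h] by simp
  then obtain c' where c': "maps_to (snd (snd (snd \<alpha>)) h) c c'"
    using maps_to_total[OF fobj_mor[OF fmor_Tgt[OF a] h]] by blast
  have "maps_to (snd (relf S) h) (tuple (take n cs)) (tuple (take n ds))"
    using relf_snd[OF S h] p list_all2_takeI[OF l] by blast
  then have 1: "maps_to (fst \<alpha> (snd (snd h))) (tuple (take n ds)) c'" using fmor_nat[OF a h _ _ c'] c as by simp
  have "maps_to (snd (relf S') h) (tuple (drop n cs)) (tuple (drop n ds))"
    using relf_snd[OF S' h] p list_all2_dropI[OF l] by blast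
  then have 2: "maps_to (fst \<beta> (snd (snd h))) (tuple (drop n ds)) c'" using fmor_nat[OF b h, of _ _ c c'] c c' bs ab by simp
  show "fibre n m \<alpha> \<beta> (snd (snd h)) ds" using 1 2 cs list_all2_lengthD[OF l] unfolding fibre_def by auto
next
  fix M l cs assume M: "seqlim (model_space L ar T) M l" and cs: "fibre n m \<alpha> \<beta> l cs"
  obtain c where c: "maps_to (fst \<alpha> l) (tuple (take n cs)) c" "maps_to (fst \<beta> l) (tuple (drop n cs)) c"
    using cs unfolding fibre_def by blast
  have M': "seqlim (ObjTop X) M l" using M by simp
  have "\<forall>\<^sub>s k. maps_to (fst \<alpha> (M k)) (tuple (take n cs)) c"
    "\<forall>\<^sub>s k. maps_to (fst \<beta> (M k)) (tuple (drop n cs)) c"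
    using fmor_limD[OF a M'] fmor_limD[OF b M'] c unfolding limitin_ods_mor by blast+
  then show "\<forall>\<^sub>s k. fibre n m \<alpha> \<beta> (M k) cs"
    by eventually_elim (use cs in \<open>auto simp: fibre_def\<close>)
qed (auto simp: fibre_def)

lemma fibre_left: "reindex (n + m) (fibre n m \<alpha> \<beta>) n S [0..<n]"
  unfolding reindex_def
proof (intro conjI ballI allI impI fibre_npred S)
  fix N cs assume N: "N \<in> Obj X" and cs: "fibre n m \<alpha> \<beta> N cs"
  then have "map ((!) cs) [0..<n] = take n cs" by (intro map_nth_take) (simp add: fibre_def)
  then show "S N (map ((!) cs) [0..<n])" using fibre_parts[OF N cs] by simp
qed auto

lemma fibre_right: "reindex (n + m) (fibre n m \<alpha> \<beta>) m S' [n..<n + m]"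
  unfolding reindex_def
proof (intro conjI ballI allI impI fibre_npred S')
  fix N cs assume N: "N \<in> Obj X" and cs: "fibre n m \<alpha> \<beta> N cs"
  then have "map ((!) cs) [n..<n + m] = drop n cs" by (intro map_nth_drop) (simp add: fibre_def)
  then show "S' N (map ((!) cs) [n..<n + m])" using fibre_parts[OF N cs] by simp
qed auto

abbreviation "fp \<equiv> rx (fibre n m \<alpha> \<beta>) S [0..<n]"
abbreviation "fq \<equiv> rx (fibre n m \<alpha> \<beta>) S' [n..<n + m]"

lemma fp_rel: "N \<in> Obj X \<Longrightarrow> length cs = n + m \<Longrightarrow> length xs = n \<Longrightarrow>
    maps_to (fst fp N) (tuple cs) (tuple xs) \<longleftrightarrow> fibre n m \<alpha> \<beta> N cs \<and> list_all2 (eqv N) (take n cs) xs"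
  using rx_tuple[OF fibre_left, of N cs xs] map_nth_take[of n cs] by simp

lemma fq_rel: "N \<in> Obj X \<Longrightarrow> length cs = n + m \<Longrightarrow> length ys = m \<Longrightarrow>
    maps_to (fst fq N) (tuple cs) (tuple ys) \<longleftrightarrow> fibre n m \<alpha> \<beta> N cs \<and> list_all2 (eqv N) (drop n cs) ys"
  using rx_tuple[OF fibre_right, of N cs ys] map_nth_drop[of cs n m] by simp

lemma fibre_commutes: "Comp FC \<alpha> fp = Comp FC \<beta> fq"
proof (rule fmor_eqI)
  have e: "fst (snd \<alpha>) = snd (snd fp)" "fst (snd \<beta>) = snd (snd fq)" using as bs by simp_all
  note p = rx_mor[OF fibre_left] and q = rx_mor[OF fibre_right]
  show "Comp FC \<alpha> fp \<in> Mor FC" "Comp FC \<beta> fq \<in> Mor FC" using FC_Comp_mor[OF p a e(1)] FC_Comp_mor[OF q b e(2)] .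
  show "snd (Comp FC \<alpha> fp) = snd (Comp FC \<beta> fq)" using ab by (simp add: prod_eq_iff)
  fix N u d assume N: "N \<in> Obj X" and "maps_to (fst (Comp FC \<alpha> fp) N) u d"
  then obtain v where v: "maps_to (fst fp N) u v" "maps_to (fst \<alpha> N) v d"
    unfolding FC_maps_to_Comp[OF p a e(1) N] by blast
  obtain cs where cs: "u = tuple cs" "fibre n m \<alpha> \<beta> N cs" using v(1) rx_rel[OF fibre_left N] by blast
  then have l: "length cs = n + m" by (simp add: fibre_def)
  obtain c where c: "maps_to (fst \<alpha> N) (tuple (take n cs)) c" "maps_to (fst \<beta> N) (tuple (drop n cs)) c"
    using cs unfolding fibre_def by blast
  have parts: "list_all2 (eqv N) (take n cs) (take n cs)" "list_all2 (eqv N) (drop n cs) (drop n cs)"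
    using fibre_parts[OF N cs(2)] npred_dom[OF S N] npred_dom[OF S' N] by (auto simp: list_all2_same)
  have 1: "maps_to (fst fp N) u (tuple (take n cs))" "maps_to (fst fq N) u (tuple (drop n cs))"
    using fp_rel[OF N l, of "take n cs"] fq_rel[OF N l, of "drop n cs"] cs l parts by simp_all
  have "(v, tuple (take n cs)) \<in> fst (fst \<alpha> N)"
    using maps_to_fun[OF fmor_mor[OF p N] v(1) 1(1)] fmor_tgt[OF p N] fmor_src[OF a N] as by simp
  then have "(d, c) \<in> fst (snd (fst \<beta> N))"
    using maps_to_fun2[OF fmor_mor[OF a N] v(2) c(1)] fmor_tgt[OF a N] fmor_tgt[OF b N] ab by simp
  then have "(c, d) \<in> fst (snd (fst \<beta> N))" using per_sym ods_mors_per[OF fmor_mor[OF b N]] by blast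
  then have "maps_to (fst \<beta> N) (tuple (drop n cs)) d" using maps_to_cong[OF fmor_mor[OF b N] c(2)] maps_to_dom[OF c(2)] by blast
  then show "maps_to (fst (Comp FC \<beta> fq) N) u d" unfolding FC_maps_to_Comp[OF q b e(2) N] using 1 by blast
qed

lemma fibre_ex:
  assumes N: "N \<in> Obj X" and m: "maps_to (fst \<alpha> N) x c" "maps_to (fst \<beta> N) y c"
  shows "\<exists>w. maps_to (fst fp N) w x \<and> maps_to (fst fq N) w y"
proof -
  have "(x, x) \<in> fst (relf S) N" "(y, y) \<in> fst (relf S') N"
    using maps_to_dom[OF m(1)] maps_to_dom[OF m(2)] fmor_src[OF a N] fmor_src[OF b N] as bs by simp_all
  then obtain xs ys where 1: "x = tuple xs" "S N xs" "y = tuple ys" "S' N ys"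
    using relf_self[OF S N] relf_self[OF S' N] by blast
  have l: "length xs = n" "length ys = m" using npred_len[OF S N 1(2)] npred_len[OF S' N 1(4)] .
  have f: "fibre n m \<alpha> \<beta> N (xs @ ys)" unfolding fibre_def using m 1 l by auto
  have "list_all2 (eqv N) xs xs" "list_all2 (eqv N) ys ys"
    using npred_dom[OF S N 1(2)] npred_dom[OF S' N 1(4)] by (simp_all add: list_all2_same)
  then show ?thesis using fp_rel[OF N, of "xs @ ys" xs] fq_rel[OF N, of "xs @ ys" ys] f l 1 by auto
qed

lemma fibre_uniq:
  assumes N: "N \<in> Obj X" and m: "maps_to (fst fp N) w x" "maps_to (fst fp N) w' x" "maps_to (fst fq N) w y" "maps_to (fst fq N) w' y"
  shows "(w, w') \<in> fst (relf (fibre n m \<alpha> \<beta>)) N"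
proof -
  note p = Obj_per[OF N] and R = fibre_npred
  have "(x, x) \<in> fst (relf S) N" "(y, y) \<in> fst (relf S') N"
    using maps_to_cod[OF m(1)] maps_to_cod[OF m(3)] fmor_tgt[OF rx_mor[OF fibre_left] N] fmor_tgt[OF rx_mor[OF fibre_right] N] by simp_all
  then obtain xs ys where 1: "x = tuple xs" "S N xs" "y = tuple ys" "S' N ys"
    using relf_self[OF S N] relf_self[OF S' N] by blast
  obtain cs ds where 2: "w = tuple cs" "fibre n m \<alpha> \<beta> N cs" "w' = tuple ds" "fibre n m \<alpha> \<beta> N ds"
    using m(1,2) rx_rel[OF fibre_left N] by blast
  have l: "length xs = n" "length ys = m" "length cs = n + m" "length ds = n + m"
    using npred_len[OF S N 1(2)] npred_len[OF S' N 1(4)] npred_len[OF R N] 2 by auto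
  have e: "list_all2 (eqv N) (take n cs) xs" "list_all2 (eqv N) (take n ds) xs"
    "list_all2 (eqv N) (drop n cs) ys" "list_all2 (eqv N) (drop n ds) ys"
    using fp_rel[OF N l(3,1)] fp_rel[OF N l(4,1)] fq_rel[OF N l(3,2)] fq_rel[OF N l(4,2)] m 1 2 by simp_all
  have "list_all2 (eqv N) (take n cs @ drop n cs) (take n ds @ drop n ds)"
    using list_eqv_trans[OF p e(1) list_eqv_sym[OF p e(2)]] list_eqv_trans[OF p e(3) list_eqv_sym[OF p e(4)]]
    by (rule list_all2_appendI)
  then show ?thesis using relf_tuple[OF R N l(3,4)] 2 by simp
qed

end

section \<open>Forcing and the model read off from a morphism\<close>

text \<open>The image of a tuple functor under \<Phi> is not literally a set of tuples. An element z
  of it stands for the tuple of its images under the projections, taken in the value at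
  \<open>U\<close>.\<close>

definition wit where
  "wit \<Phi> S as z \<longleftrightarrow> (z, z) \<in> fst \<Phi> (relf S) \<and> (\<forall>i<length as. maps_to (snd \<Phi> (proj S i)) z (as ! i))"

definition forces where
  "forces \<Phi> n S as \<longleftrightarrow> length as = n \<and> (\<exists>z. wit \<Phi> S as z)"

definition model_of where
  "model_of \<Phi> = (fst \<Phi> U, \<lambda>P\<in>L. {(u, v). \<exists>as bs. u = tuple as \<and> v = tuple bs \<and> length as = ar P \<and>
     list_all2 (\<lambda>a b. (a, b) \<in> fst \<Phi> U) as bs \<and> forces \<Phi> (ar P) (atom_pred P) as})"

text \<open>An element \<open>a\<close> of \<open>F (model_of \<Phi>)\<close> corresponds to \<open>b\<close> in \<open>\<Phi> F\<close> if both are named by the same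
  definable parameters.\<close>

definition corr where
  "corr \<Phi> F a b \<longleftrightarrow> (\<exists>n S \<alpha> xs z. npred n S \<and> \<alpha> \<in> Mor FC \<and> fst (snd \<alpha>) = relf S \<and> snd (snd \<alpha>) = F \<and> length xs = n \<and>
     maps_to (fst \<alpha> (model_of \<Phi>)) (tuple xs) a \<and> wit \<Phi> S xs z \<and> maps_to (snd \<Phi> \<alpha>) z b)"

end

locale phi = models L ar T + sigma_mor "model_cat L ar T" \<Phi>
  for L :: "'p set" and ar :: "'p \<Rightarrow> nat" and T :: "'p sequent set"
    and \<Phi> :: "(('p struct, 'p hom, per, ods_mor) fctr, ('p struct, 'p hom, per, ods_mor) ntrans, per, ods_mor) fctr"
begin

abbreviation PU :: per where "PU \<equiv> fst \<Phi> U"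

lemma PU_per: "is_per PU" by (rule Phi_per[OF relf_obj[OF dom_npred]])

lemma Phi_proj:
  assumes S: "npred n S" and i: "i < n"
  shows "snd \<Phi> (proj S i) \<in> ods_mors" "fst (snd \<Phi> (proj S i)) = fst \<Phi> (relf S)"
    "fst (snd (snd \<Phi> (proj S i))) = PU"
  using rx_mor[OF reindex_proj[OF S i]] Phi_mor Phi_src Phi_tgt by auto

lemma wit_dom:
  assumes "npred n S" "length as = n" "wit \<Phi> S as z"
  shows "\<forall>a\<in>set as. (a, a) \<in> PU"
  using assms Phi_proj(3)[OF assms(1)] maps_to_cod unfolding wit_def by (metis in_set_conv_nth)

text \<open>The projections out of \<open>relf S\<close> are jointly injective at every model, and
  \<Phi> preserves joint injectivity.\<close>

lemma wit_unique:
  assumes S: "npred n S" and as: "length as = n" and w: "wit \<Phi> S as z" "wit \<Phi> S as z'"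
  shows "(z, z') \<in> fst \<Phi> (relf S)"
proof (rule Phi_jointly_inj[where n = n and p = "proj S"])
  show "relf S \<in> Obj FC" using relf_obj[OF S] .
  show "proj S i \<in> Mor FC \<and> fst (snd (proj S i)) = relf S" if "i < n" for i
    using rx_mor[OF reindex_proj[OF S that]] by simp
  show "(y, y') \<in> fst (relf S) N"
    if N: "N \<in> Obj X" and y: "(y, y) \<in> fst (relf S) N" "(y', y') \<in> fst (relf S) N"
      and e: "\<And>i. i < n \<Longrightarrow> \<exists>x. maps_to (fst (proj S i) N) y x \<and> maps_to (fst (proj S i) N) y' x" for N y y'
  proof -
    obtain as bs where 1: "y = tuple as" "S N as" "y' = tuple bs" "S N bs" using y relf_self[OF S N] by blast
    have l: "length as = n" "length bs = n" using 1 npred_len[OF S N] by auto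
    have "eqv N (as ! i) (bs ! i)" if i: "i < n" for i
    proof -
      obtain x where "eqv N (as ! i) x" "eqv N (bs ! i) x" using e[OF i] proj_rel[OF S i N] 1 l by auto
      then show ?thesis using per_sym[OF Obj_per[OF N]] per_trans[OF Obj_per[OF N]] by blast
    qed
    then show ?thesis using relf_tuple[OF S N l] 1 l by (simp add: list_all2_conv_all_nth)
  qed
qed (use w as in \<open>auto simp: wit_def\<close>)

lemma wit_cong:
  assumes S: "npred n S" and as: "length as = n" and w: "wit \<Phi> S as z"
    and e: "list_all2 (\<lambda>a b. (a, b) \<in> PU) as bs" "(z, z') \<in> fst \<Phi> (relf S)"
  shows "wit \<Phi> S bs z'"
  unfolding wit_def
proof (intro conjI allI impI)
  show "(z', z') \<in> fst \<Phi> (relf S)" using per_refl[OF Phi_per[OF relf_obj[OF S]] e(2)] by blast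
  fix i assume "i < length bs"
  then have i: "i < n" "(as ! i, bs ! i) \<in> PU" "i < length as" using e(1) as by (auto simp: list_all2_conv_all_nth)
  then have "maps_to (snd \<Phi> (proj S i)) z (as ! i)" using w unfolding wit_def by blast
  then show "maps_to (snd \<Phi> (proj S i)) z' (bs ! i)"
    using maps_to_cong[OF Phi_proj(1)[OF S i(1)]] Phi_proj(2,3)[OF S i(1)] e(2) i(2) by simp
qed

lemma wit_fun:
  assumes S: "npred n S" and w: "wit \<Phi> S as z" "wit \<Phi> S bs z" "length as = n" "length bs = n"
  shows "list_all2 (\<lambda>a b. (a, b) \<in> PU) as bs"
  using w maps_to_fun[OF Phi_proj(1)[OF S]] Phi_proj(3)[OF S]
  unfolding wit_def list_all2_conv_all_nth by (metis)

lemma wit_total: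
  assumes S: "npred n S" and z: "(z, z) \<in> fst \<Phi> (relf S)"
  shows "\<exists>as. length as = n \<and> wit \<Phi> S as z"
proof -
  have "\<exists>a. maps_to (snd \<Phi> (proj S i)) z a" if "i < n" for i
    using maps_to_total[OF Phi_proj(1)[OF S that]] Phi_proj(2)[OF S that] z by simp
  then obtain f where f: "\<And>i. i < n \<Longrightarrow> maps_to (snd \<Phi> (proj S i)) z (f i)" by metis
  then show ?thesis using z by (intro exI[of _ "map f [0..<n]"]) (simp add: wit_def)
qed

lemma wit_rx:
  assumes r: "reindex n S m S' \<sigma>" and as: "length as = n" and w: "wit \<Phi> S as z"
    and z: "maps_to (snd \<Phi> (rx S S' \<sigma>)) z z'"
  shows "wit \<Phi> S' (map ((!) as) \<sigma>) z'"
  unfolding wit_def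
proof (intro conjI allI impI)
  have S: "npred n S" and S': "npred m S'" and \<sigma>: "length \<sigma> = m" "\<And>i. i \<in> set \<sigma> \<Longrightarrow> i < n"
    using r unfolding reindex_def by blast+
  note rm = rx_mor[OF r]
  show "(z', z') \<in> fst \<Phi> (relf S')" using maps_to_cod[OF z] Phi_tgt[OF rm] by simp
  fix j assume "j < length (map ((!) as) \<sigma>)"
  then have j: "j < m" using \<sigma> by simp
  then have sj: "\<sigma> ! j < n" using \<sigma> by simp
  note rj = reindex_proj[OF S' j]
  have c: "Comp FC (proj S' j) (rx S S' \<sigma>) = proj S (\<sigma> ! j)" using rx_comp(2)[OF r rj] by simp
  have "maps_to (snd \<Phi> (proj S (\<sigma> ! j))) z (as ! (\<sigma> ! j))" using w sj as unfolding wit_def by simp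
  then obtain b where b: "maps_to (snd \<Phi> (rx S S' \<sigma>)) z b" "maps_to (snd \<Phi> (proj S' j)) b (as ! (\<sigma> ! j))"
    unfolding c[symmetric] using Phi_comp[OF rm rx_mor[OF rj]] by auto
  have "(b, z') \<in> fst (snd \<Phi> (proj S' j))"
    using maps_to_fun[OF Phi_mor[OF rm] b(1) z] Phi_tgt[OF rm] Phi_proj(2)[OF S' j] by simp
  then show "maps_to (snd \<Phi> (proj S' j)) z' (map ((!) as) \<sigma> ! j)"
    using maps_to_cong[OF Phi_proj(1)[OF S' j] b(2)] maps_to_cod[OF b(2)] j \<sigma> by simp
qed

lemma rx_total:
  assumes r: "reindex n S m S' \<sigma>" and z: "(z, z) \<in> fst \<Phi> (relf S)"
  shows "\<exists>z'. maps_to (snd \<Phi> (rx S S' \<sigma>)) z z'"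
  using maps_to_total[OF Phi_mor[OF rx_mor[OF r]]] Phi_src[OF rx_mor[OF r]] z by simp

lemma forces_rx:
  assumes r: "reindex n S m S' \<sigma>" and f: "forces \<Phi> n S as"
  shows "forces \<Phi> m S' (map ((!) as) \<sigma>)"
proof -
  obtain z where z: "length as = n" "wit \<Phi> S as z" using f unfolding forces_def by blast
  then obtain z' where "maps_to (snd \<Phi> (rx S S' \<sigma>)) z z'" using rx_total[OF r] unfolding wit_def by blast
  then have "wit \<Phi> S' (map ((!) as) \<sigma>) z'" using wit_rx[OF r z] by blast
  then show ?thesis using r unfolding forces_def reindex_def by auto
qed

lemma forces_mono:
  assumes "npred n S" "npred n S'" "\<And>N as. N \<in> Obj X \<Longrightarrow> S N as \<Longrightarrow> S' N as" and f: "forces \<Phi> n S as"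
  shows "forces \<Phi> n S' as"
  using forces_rx[OF reindex_mono[OF assms(1-3)] f] f by (simp add: forces_def map_nth_upt)

lemma forces_dom_of: "npred n S \<Longrightarrow> forces \<Phi> n S as \<Longrightarrow> \<forall>a\<in>set as. (a, a) \<in> PU"
  using wit_dom unfolding forces_def by blast

lemma forces_cong:
  assumes S: "npred n S" and f: "forces \<Phi> n S as" and e: "list_all2 (\<lambda>a b. (a, b) \<in> PU) as bs"
  shows "forces \<Phi> n S bs"
proof -
  obtain z where z: "length as = n" "wit \<Phi> S as z" using f unfolding forces_def by blast
  then have "wit \<Phi> S bs z" using wit_cong[OF S z e] unfolding wit_def by blast
  then show ?thesis using z list_all2_lengthD[OF e] unfolding forces_def by auto
qed

text \<open>The image of z is a witness for the reindexed tuple, and witnesses are unique up to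
  equivalence.\<close>

lemma cong_wit_shift:
  assumes r: "reindex n S m S' \<sigma>" and as: "length as = n" and w: "wit \<Phi> S as z"
    and w': "wit \<Phi> S' (map ((!) as) \<sigma>) z'"
  shows "maps_to (snd \<Phi> (rx S S' \<sigma>)) z z'"
proof -
  have S': "npred m S'" and l: "length \<sigma> = m" using r unfolding reindex_def by blast+
  obtain y where y: "maps_to (snd \<Phi> (rx S S' \<sigma>)) z y" using rx_total[OF r] w unfolding wit_def by blast
  have "(y, z') \<in> fst \<Phi> (relf S')"
    using wit_unique[OF S' _ wit_rx[OF r as w y] w'] l by simp
  then show ?thesis
    using maps_to_cong[OF Phi_mor[OF rx_mor[OF r]] y maps_to_dom[OF y]] Phi_tgt[OF rx_mor[OF r]] by simp
qed

text \<open>The projection of \<open>elems 1\<close> sends a to some b that is not yet known to be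
  a. Reindexing along [0] makes b a witness of [b], as a is by choice of b, so uniqueness identifies
  the two.\<close>

lemma wit_single:
  assumes a: "(a, a) \<in> PU"
  shows "wit \<Phi> (elems 1) [a] a"
proof -
  have r: "reindex 1 (elems 1) 1 (elems 1) [0]" by (rule reindex_proj[OF dom_npred]) simp
  obtain b where b: "maps_to (snd \<Phi> (rx (elems 1) (elems 1) [0])) a b" using rx_total[OF r a] by blast
  have w: "wit \<Phi> (elems 1) [b] a" using a b by (simp add: wit_def)
  have "wit \<Phi> (elems 1) [b] b" using wit_rx[OF r _ w b] by simp
  then have "(b, a) \<in> PU" using wit_unique[OF dom_npred[of 1] _ _ w] by simp
  then show ?thesis using wit_cong[OF dom_npred _ w _ a] by simp
qed

text \<open>\<Phi> preserves the fibre product, so z and z' over the same d come from one element v.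
  The coordinates of v are those of z followed by those of z'.\<close>

lemma forces_fibre:
  assumes S: "npred n S" and S': "npred m S'" and a: "\<alpha> \<in> Mor FC" and b: "\<beta> \<in> Mor FC"
    and as: "fst (snd \<alpha>) = relf S" and bs: "fst (snd \<beta>) = relf S'" and ab: "snd (snd \<alpha>) = snd (snd \<beta>)"
    and l: "length xs = n" "length ys = m" and w: "wit \<Phi> S xs z" "wit \<Phi> S' ys z'"
    and m: "maps_to (snd \<Phi> \<alpha>) z d" "maps_to (snd \<Phi> \<beta>) z' d"
  shows "forces \<Phi> (n + m) (fibre n m \<alpha> \<beta>) (xs @ ys)"
proof -
  let ?R = "fibre n m \<alpha> \<beta>"
  note ctx = S S' a b as bs ab
  note R = fibre_npred[OF ctx] and rl = fibre_left[OF ctx] and rr = fibre_right[OF ctx]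
  let ?p = "rx ?R S [0..<n]" and ?q = "rx ?R S' [n..<n + m]"
  note p = rx_mor[OF rl] and q = rx_mor[OF rr]
  have ep: "fst (snd \<alpha>) = snd (snd ?p)" "fst (snd \<beta>) = snd (snd ?q)" using as bs by simp_all
  have "\<exists>v. maps_to (snd \<Phi> ?p) v z \<and> maps_to (snd \<Phi> ?q) v z'"
  proof (rule Phi_pullback[OF a b ab p _ q _ _ _ _ _ m])
    show "maps_to (fst \<beta> N) y c"
      if N: "N \<in> Obj X" and t: "maps_to (fst ?p N) w x" "maps_to (fst ?q N) w y" "maps_to (fst \<alpha> N) x c" for N w x y c
    proof -
      have "maps_to (fst (Comp FC \<alpha> ?p) N) w c" unfolding FC_maps_to_Comp[OF p a ep(1) N] using t by blast
      then obtain y' where y': "maps_to (fst ?q N) w y'" "maps_to (fst \<beta> N) y' c"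
        unfolding fibre_commutes[OF ctx] FC_maps_to_Comp[OF q b ep(2) N] by blast
      have "(y', y) \<in> fst (fst \<beta> N)"
        using maps_to_fun[OF fmor_mor[OF q N] y'(1) t(2)] fmor_tgt[OF q N] fmor_src[OF b N] bs by simp
      then show ?thesis using maps_to_cong[OF fmor_mor[OF b N] y'(2)] maps_to_cod[OF y'(2)] by blast
    qed
    show "\<exists>w. maps_to (fst ?p N) w x \<and> maps_to (fst ?q N) w y"
      if "N \<in> Obj X" "maps_to (fst \<alpha> N) x c" "maps_to (fst \<beta> N) y c" for N x y c
      using fibre_ex[OF ctx that] .
    show "(w, w') \<in> fst (fst (snd ?p)) N"
      if "N \<in> Obj X" "maps_to (fst ?p N) w x" "maps_to (fst ?p N) w' x" "maps_to (fst ?q N) w y" "maps_to (fst ?q N) w' y" for N w w' x y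
      using fibre_uniq[OF ctx that] by simp
  qed (use as bs in simp_all)
  then obtain v where v: "maps_to (snd \<Phi> ?p) v z" "maps_to (snd \<Phi> ?q) v z'" by blast
  have "(v, v) \<in> fst \<Phi> (relf ?R)" using maps_to_dom[OF v(1)] Phi_src[OF p] by simp
  then obtain cs where cs: "length cs = n + m" "wit \<Phi> ?R cs v" using wit_total[OF R] by blast
  have w1: "wit \<Phi> S (take n cs) z" using wit_rx[OF rl cs v(1)] map_nth_take[of n cs] cs by simp
  have w2: "wit \<Phi> S' (drop n cs) z'" using wit_rx[OF rr cs v(2)] map_nth_drop[OF cs(1)] by simp
  have e: "list_all2 (\<lambda>a b. (a, b) \<in> PU) (take n cs) xs" "list_all2 (\<lambda>a b. (a, b) \<in> PU) (drop n cs) ys"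
    using wit_fun[OF S w1 w(1)] wit_fun[OF S' w2 w(2)] cs l by simp_all
  have "list_all2 (\<lambda>a b. (a, b) \<in> PU) cs (xs @ ys)"
    using list_all2_appendI[OF e] by simp
  then show ?thesis by (rule forces_cong[OF R, rotated]) (use cs in \<open>auto simp: forces_def\<close>)
qed

text \<open>Powers are built one factor at a time, as fibre products over the terminal functor
  \<open>relf (elems 0)\<close>.\<close>

lemma forces_dom: "\<forall>a\<in>set as. (a, a) \<in> PU \<Longrightarrow> forces \<Phi> (length as) (elems (length as)) as"
proof (induction as rule: rev_induct)
  case Nil
  have "\<exists>z. (z, z) \<in> fst \<Phi> (relf (elems 0))"
  proof (rule Phi_terminal)
    show "relf (elems 0) \<in> Obj FC" using relf_obj[OF dom_npred] .
    show "\<exists>y. (y, y) \<in> fst (relf (elems 0)) N" if N: "N \<in> Obj X" for N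
      using relf_self[OF dom_npred N, of "tuple []" 0] by (auto simp: elems_def)
    show "(y, y') \<in> fst (relf (elems 0)) N"
      if N: "N \<in> Obj X" and y: "(y, y) \<in> fst (relf (elems 0)) N" "(y', y') \<in> fst (relf (elems 0)) N" for N y y'
    proof -
      have "y = 0" "y' = 0" using y relf_self[OF dom_npred N] by (auto simp: elems_def)
      then show ?thesis using y by simp
    qed
  qed
  then show ?case unfolding forces_def wit_def by simp
next
  case (snoc a as)
  let ?n = "length as"
  obtain z where z: "wit \<Phi> (elems ?n) as z" using snoc unfolding forces_def by auto
  have a: "(a, a) \<in> fst \<Phi> (relf (elems 1))" using snoc by simp
  \<comment> \<open>The empty index list yields the map to the terminal functor.\<close>
  have r0: "reindex k (elems k) 0 (elems 0) []" for k
    unfolding reindex_def using dom_npred by (auto simp: elems_def)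
  obtain c where c: "maps_to (snd \<Phi> (rx (elems ?n) (elems 0) [])) z c" using rx_total[OF r0] z unfolding wit_def by blast
  have c2: "maps_to (snd \<Phi> (rx (elems 1) (elems 0) [])) a c"
  proof -
    obtain d where d: "maps_to (snd \<Phi> (rx (elems 1) (elems 0) [])) a d" using rx_total[OF r0 a] by blast
    have dd: "(d, d) \<in> fst \<Phi> (relf (elems 0))" "(c, c) \<in> fst \<Phi> (relf (elems 0))"
      using maps_to_cod[OF c] maps_to_cod[OF d] Phi_tgt[OF rx_mor[OF r0]] by auto
    have "(d, c) \<in> fst \<Phi> (relf (elems 0))"
      by (rule wit_unique[OF dom_npred, of "[]"]) (use dd in \<open>auto simp: wit_def\<close>)
    then show ?thesis using maps_to_cong[OF Phi_mor[OF rx_mor[OF r0]] d maps_to_dom[OF d]] Phi_tgt[OF rx_mor[OF r0]] by simp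
  qed
  have wa: "wit \<Phi> (elems 1) [a] a" using wit_single a by blast
  note ctx = dom_npred dom_npred rx_mor[OF r0] rx_mor[OF r0]
  have "forces \<Phi> (?n + 1) (fibre ?n 1 (rx (elems ?n) (elems 0) []) (rx (elems 1) (elems 0) [])) (as @ [a])"
    by (rule forces_fibre[OF ctx _ _ _ _ _ z wa c c2]) simp_all
  then have "forces \<Phi> (?n + 1) (elems (?n + 1)) (as @ [a])"
  proof (rule forces_mono[OF fibre_npred[OF ctx] dom_npred, rotated -1])
    fix N cs assume N: "N \<in> Obj X" and cs: "fibre ?n 1 (rx (elems ?n) (elems 0) []) (rx (elems 1) (elems 0) []) N cs"
    have "elems ?n N (take ?n cs) \<and> elems 1 N (drop ?n cs)" by (rule fibre_parts[OF ctx _ _ _ N cs]) simp_all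
    then have "\<forall>b\<in>set (take ?n cs @ drop ?n cs). eqv N b b" unfolding elems_def set_append by blast
    then show "elems (?n + 1) N cs" using cs by (simp add: elems_def fibre_def)
  qed simp_all
  then show ?case by simp
qed

text \<open>A conjunction is a fibre product over \<open>relf (elems m)\<close>, matching the
  \<sigma>-coordinates of the first tuple with the second tuple.\<close>

lemma forces_conj:
  assumes S: "npred n S" and S': "npred m S'" and \<sigma>: "length \<sigma> = m" "\<And>i. i \<in> set \<sigma> \<Longrightarrow> i < n"
    and f: "forces \<Phi> n S as" "forces \<Phi> m S' (map ((!) as) \<sigma>)"
  defines "R \<equiv> \<lambda>N xs. S N xs \<and> S' N (map ((!) xs) \<sigma>)"
  shows "npred n R" and "forces \<Phi> n R as"
proof -
  have mapr: "list_all2 Q (map ((!) as) \<sigma>) (map ((!) bs) \<sigma>)" if "list_all2 Q as bs" "length as = n" for Q and as bs :: "nat list"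
    using that \<sigma>(2) by (auto simp: list_all2_conv_all_nth)
  show R: "npred n R"
    unfolding npred_def
  proof (intro conjI ballI allI impI)
    fix N as assume N: "N \<in> Obj X" "R N as"
    then show "length as = n" "\<And>a. a \<in> set as \<Longrightarrow> eqv N a a"
      using npred_len[OF S] npred_dom[OF S] unfolding R_def by blast+
  next
    fix h as bs assume h: "h \<in> Mor X" "R (fst (snd h)) as" "list_all2 (maps_to (fst h)) as bs"
    have "length as = n" using h npred_len[OF S] Mor_X unfolding R_def by blast
    then show "R (snd (snd h)) bs"
      using h npred_hom[OF S h(1) _ h(3)] npred_hom[OF S' h(1) _ mapr[OF h(3)]] unfolding R_def by blast
  next
    fix M l as assume M: "seqlim (model_space L ar T) M l" "\<forall>k. M k \<in> Obj X" "R l as"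
    have "\<forall>\<^sub>s k. S (M k) as" "\<forall>\<^sub>s k. S' (M k) (map ((!) as) \<sigma>)"
      using npred_lim[OF S M(1)] npred_lim[OF S' M(1)] M unfolding R_def by blast+
    then show "\<forall>\<^sub>s k. R (M k) as" unfolding R_def by eventually_elim blast
  qed
  have ra: "reindex n S m (elems m) \<sigma>"
    unfolding reindex_def
  proof (intro conjI ballI allI impI S dom_npred)
    fix N as assume N: "N \<in> Obj X" "S N as"
    show "elems m N (map ((!) as) \<sigma>)"
      using npred_dom[OF S N] npred_len[OF S N] \<sigma> by (auto simp: elems_def)
  qed (use \<sigma> in auto)
  have rb: "reindex m S' m (elems m) [0..<m]"
    by (rule reindex_mono[OF S' dom_npred]) (use npred_dom[OF S'] npred_len[OF S'] in \<open>auto simp: elems_def\<close>)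
  obtain z z' where z: "wit \<Phi> S as z" "length as = n" and z': "wit \<Phi> S' (map ((!) as) \<sigma>) z'"
    using f unfolding forces_def by blast
  obtain c where c: "maps_to (snd \<Phi> (rx S (elems m) \<sigma>)) z c" using rx_total[OF ra] z unfolding wit_def by blast
  have "wit \<Phi> (elems m) (map ((!) as) \<sigma>) c" using wit_rx[OF ra z(2,1) c] .
  then have c2: "maps_to (snd \<Phi> (rx S' (elems m) [0..<m])) z' c"
    using cong_wit_shift[OF rb _ z'] \<sigma> map_nth_upt[of "map ((!) as) \<sigma>" m] by simp
  let ?A = "rx S (elems m) \<sigma>" and ?B = "rx S' (elems m) [0..<m]"
  note ctx = S S' rx_mor[OF ra] rx_mor[OF rb] rx_st(1) rx_st(1)
  have ab: "snd (snd ?A) = snd (snd ?B)" by simp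
  \<comment> \<open>A common image in \<open>elems m\<close> makes the second tuple equivalent to
    the \<sigma>-coordinates of the first, so S' transfers to them by congruence.\<close>
  have rr: "reindex (n + m) (fibre n m ?A ?B) n R [0..<n]"
    unfolding reindex_def
  proof (intro conjI ballI allI impI fibre_npred[OF ctx ab] R)
    fix N cs assume N: "N \<in> Obj X" and cs: "fibre n m ?A ?B N cs"
    let ?xs = "take n cs" and ?ys = "drop n cs"
    have p: "S N ?xs" "S' N ?ys" using fibre_parts[OF ctx ab N cs] by blast+
    have l: "length ?xs = n" "length ?ys = m" "length cs = n + m" using cs by (simp_all add: fibre_def)
    obtain d where d: "maps_to (fst ?A N) (tuple ?xs) d" "maps_to (fst ?B N) (tuple ?ys) d" using cs unfolding fibre_def by blast
    obtain ds where ds: "d = tuple ds" "length ds = m"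
      using maps_to_cod[OF d(1)] fmor_tgt[OF rx_mor[OF ra] N] relf_self[OF dom_npred N] by (auto simp: elems_def)
    have "list_all2 (eqv N) (map ((!) ?xs) \<sigma>) ds" "list_all2 (eqv N) ?ys ds"
      using rx_tuple[OF ra N l(1) ds(2)] rx_tuple[OF rb N l(2) ds(2)] d ds(1) map_nth_upt[OF l(2)] by simp_all
    then have "list_all2 (eqv N) ?ys (map ((!) ?xs) \<sigma>)"
      using list_eqv_trans[OF Obj_per[OF N]] list_eqv_sym[OF Obj_per[OF N]] by blast
    then have "R N ?xs" using npred_cong[OF S' N p(2)] p(1) by (simp add: R_def)
    then show "R N (map ((!) cs) [0..<n])" using map_nth_take[of n cs] l by simp
  qed auto
  have "forces \<Phi> (n + m) (fibre n m ?A ?B) (as @ map ((!) as) \<sigma>)"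
    by (rule forces_fibre[OF ctx ab z(2) _ z(1) z' c c2]) (simp add: \<sigma>)
  from forces_rx[OF rr this] show "forces \<Phi> n R as"
    using map_nth_take[of n "as @ map ((!) as) \<sigma>"] z(2) by simp
qed

lemma model_of_fst [simp]: "fst (model_of \<Phi>) = PU" by (simp add: model_of_def)

lemma mod_pred:
  assumes P: "P \<in> L" and as: "length as = ar P"
  shows "holds_pred (model_of \<Phi>) P as \<longleftrightarrow> forces \<Phi> (ar P) (atom_pred P) as"
proof
  assume "holds_pred (model_of \<Phi>) P as"
  then obtain as' where "tuple as = tuple as'" "length as' = ar P" "forces \<Phi> (ar P) (atom_pred P) as'"
    using P unfolding holds_pred_def model_of_def by auto
  then show "forces \<Phi> (ar P) (atom_pred P) as" using as tuple_eq_iff by metis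
next
  assume f: "forces \<Phi> (ar P) (atom_pred P) as"
  then have "list_all2 (\<lambda>a b. (a, b) \<in> PU) as as" using forces_dom_of[OF pred_npred[OF P]] by (simp add: list_all2_same)
  then show "holds_pred (model_of \<Phi>) P as" using P as f unfolding holds_pred_def model_of_def by auto
qed

text \<open>A countable family of coordinate maps onto S is jointly surjective, and \<Phi> preserves
  this. Disjunctions and existential quantifiers are both covers of this kind.\<close>

lemma forces_cover:
  assumes I: "countable I" and S: "npred n S"
    and r: "\<And>i. i \<in> I \<Longrightarrow> reindex (m i) (S' i) n S (\<sigma> i)"
    and cov: "\<And>N as. N \<in> Obj X \<Longrightarrow> S N as \<Longrightarrow> \<exists>i\<in>I. \<exists>xs. S' i N xs \<and> list_all2 (eqv N) (map ((!) xs) (\<sigma> i)) as"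
    and f: "forces \<Phi> n S as"
  shows "\<exists>i\<in>I. \<exists>xs. forces \<Phi> (m i) (S' i) xs \<and> list_all2 (\<lambda>a b. (a, b) \<in> PU) (map ((!) xs) (\<sigma> i)) as"
proof -
  obtain z where z: "length as = n" "wit \<Phi> S as z" using f unfolding forces_def by blast
  \<comment> \<open>Diagram shapes have numbers as objects, so I is replaced by its set of
    codes.\<close>
  let ?e = "\<lambda>k. from_nat_into I k"
  have e: "k \<in> to_nat_on I ` I \<Longrightarrow> ?e k \<in> I" for k using I by auto
  have "\<exists>k\<in>to_nat_on I ` I. \<exists>x. maps_to (snd \<Phi> (rx (S' (?e k)) S (\<sigma> (?e k)))) x z"
  proof (rule Phi_jointly_surj)
    show "relf S \<in> Obj FC" using relf_obj[OF S] .
    show "rx (S' (?e k)) S (\<sigma> (?e k)) \<in> Mor FC \<and> snd (snd (rx (S' (?e k)) S (\<sigma> (?e k)))) = relf S"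
      if "k \<in> to_nat_on I ` I" for k using rx_mor[OF r[OF e[OF that]]] by simp
    show "(z, z) \<in> fst \<Phi> (relf S)" using z unfolding wit_def by blast
    fix N y assume N: "N \<in> Obj X" and "(y, y) \<in> fst (relf S) N"
    then obtain as where as: "y = tuple as" "S N as" using relf_self[OF S N] by blast
    then obtain i xs where i: "i \<in> I" "S' i N xs" "list_all2 (eqv N) (map ((!) xs) (\<sigma> i)) as" using cov[OF N] by blast
    then have "maps_to (fst (rx (S' i) S (\<sigma> i)) N) (tuple xs) y" using rx_rel[OF r[OF i(1)] N] as by blast
    then show "\<exists>k\<in>to_nat_on I ` I. \<exists>x. maps_to (fst (rx (S' (?e k)) S (\<sigma> (?e k))) N) x y"
      using i(1) I by auto
  qed
  then obtain i x where i: "i \<in> I" "maps_to (snd \<Phi> (rx (S' i) S (\<sigma> i))) x z" using e by blast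
  note r = r[OF i(1)]
  have S': "npred (m i) (S' i)" and l: "length (\<sigma> i) = n" using r unfolding reindex_def by blast+
  have "(x, x) \<in> fst \<Phi> (relf (S' i))" using maps_to_dom[OF i(2)] Phi_src[OF rx_mor[OF r]] by simp
  then obtain xs where xs: "length xs = m i" "wit \<Phi> (S' i) xs x" using wit_total[OF S'] by blast
  have "wit \<Phi> S (map ((!) xs) (\<sigma> i)) z" using wit_rx[OF r xs i(2)] .
  then have "list_all2 (\<lambda>a b. (a, b) \<in> PU) (map ((!) xs) (\<sigma> i)) as"
    using wit_fun[OF S _ z(2)] z l by simp
  then show ?thesis using i xs unfolding forces_def by blast
qed

section \<open>Truth in the model coincides with forcing\<close>

text \<open>Every connective is a limit or colimit that \<Phi> preserves: truth is the full power,
  falsity the empty cover, equality the coincidence of two projections, conjunction a fibre product,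
  and disjunction and quantification are covers.\<close>

lemma holds_mod:
  assumes "wf_fm L ar xs \<phi>"
  shows "length as = length xs \<Longrightarrow> \<forall>a\<in>set as. (a, a) \<in> PU \<Longrightarrow>
    holds \<phi> (model_of \<Phi>) xs as \<longleftrightarrow> forces \<Phi> (length xs) (sat xs \<phi>) as"
  using assms
proof (induction arbitrary: as)
  case (1 xs)
  note S = sat_npred[OF wf_fm.intros(1)[OF 1(1), of L ar]]
  \<comment> \<open>Falsity is covered by the empty family, so nothing can be forced.\<close>
  have "\<not> forces \<Phi> (length xs) (sat xs FBot) as"
    using forces_cover[of "{}" "length xs" "sat xs FBot" "\<lambda>_. 0" "\<lambda>_. sat xs FBot" "\<lambda>_. []" as, OF _ S]
    by (auto simp: satisfies_def)
  then show ?case by simp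
next
  case (2 xs)
  note S = sat_npred[OF wf_fm.intros(2)[OF 2(1), of L ar]]
  have "forces \<Phi> (length xs) (elems (length xs)) as" using forces_dom[of as] 2 by simp
  then show ?case using forces_mono[OF dom_npred S] by (auto simp: satisfies_def elems_def)
next
  case (3 xs x y)
  note S = sat_npred[OF wf_fm.intros(3)[OF 3(1-3), of L ar]]
  let ?n = "length xs"
  obtain i j where ij: "i < ?n" "xs ! i = x" "j < ?n" "xs ! j = y" using 3 by (auto simp: in_set_conv_nth)
  have v: "val xs bs x = bs ! i" "val xs bs y = bs ! j" if "length bs = ?n" for bs
    using val_nth[OF 3(1) that] ij by auto
  show ?case
  proof
    assume "holds (FEq x y) (model_of \<Phi>) xs as"
    then have e: "(as ! i, as ! j) \<in> PU" using v 3 by simp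
    \<comment> \<open>Overwriting coordinate j by coordinate i makes the equation true of every
      tuple, and changes \<open>as\<close> only up to equivalence.\<close>
    let ?\<sigma> = "map (\<lambda>k. if k = j then i else k) [0..<?n]"
    have r: "reindex ?n (elems ?n) ?n (sat xs (FEq x y)) ?\<sigma>"
      unfolding reindex_def
    proof (intro conjI ballI allI impI S dom_npred)
      fix N bs assume N: "N \<in> Obj X" and bs: "elems ?n N bs"
      let ?bs = "map ((!) bs) ?\<sigma>"
      have l: "length ?bs = ?n" by simp
      have "val xs ?bs x = bs ! i" "val xs ?bs y = bs ! i" unfolding v[OF l] using ij by auto
      moreover have "eqv N (bs ! i) (bs ! i)" using bs ij by (auto simp: elems_def)
      moreover have "\<forall>b\<in>set ?bs. eqv N b b" using bs ij by (auto simp: elems_def)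
      ultimately show "sat xs (FEq x y) N ?bs" unfolding satisfies_def using l by simp
    qed (use ij in auto)
    have "forces \<Phi> ?n (elems ?n) as" using forces_dom[of as] 3 by simp
    from forces_rx[OF r this] show "forces \<Phi> ?n (sat xs (FEq x y)) as"
    proof (rule forces_cong[OF S])
      have "(as ! k, as ! k) \<in> PU" if "k < ?n" for k using 3 that by simp
      then show "list_all2 (\<lambda>a b. (a, b) \<in> PU) (map ((!) as) ?\<sigma>) as"
        using 3 e ij by (auto simp: list_all2_conv_all_nth)
    qed
  next
    assume "forces \<Phi> ?n (sat xs (FEq x y)) as"
    then obtain z where z: "wit \<Phi> (sat xs (FEq x y)) as z" unfolding forces_def by blast
    \<comment> \<open>On the solutions of the equation the two projections are one and the same
      morphism, so under \<Phi> both coordinates of z are values of the same function at z.\<close>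
    have "proj (sat xs (FEq x y)) i = proj (sat xs (FEq x y)) j"
    proof (rule fmor_eqI)
      show "proj (sat xs (FEq x y)) i \<in> Mor FC" "proj (sat xs (FEq x y)) j \<in> Mor FC"
        using rx_mor[OF reindex_proj[OF S]] ij by blast+
      fix N u w assume N: "N \<in> Obj X" and "maps_to (fst (proj (sat xs (FEq x y)) i) N) u w"
      then obtain bs where bs: "u = tuple bs" "sat xs (FEq x y) N bs" and uw: "maps_to (fst (proj (sat xs (FEq x y)) i) N) (tuple bs) w"
        using rx_rel[OF reindex_proj[OF S ij(1)] N] by blast
      have l: "length bs = ?n" using bs by (simp add: satisfies_def)
      have "eqv N (bs ! i) w" using proj_rel[OF S ij(1) N l] uw by blast
      moreover have "eqv N (bs ! i) (bs ! j)" using bs v[OF l] by (simp add: satisfies_def)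
      ultimately have "eqv N (bs ! j) w" using per_sym[OF Obj_per[OF N]] per_trans[OF Obj_per[OF N]] by blast
      then show "maps_to (fst (proj (sat xs (FEq x y)) j) N) u w" using proj_rel[OF S ij(3) N l] bs by blast
    qed simp
    then have "maps_to (snd \<Phi> (proj (sat xs (FEq x y)) i)) z (as ! i)" "maps_to (snd \<Phi> (proj (sat xs (FEq x y)) i)) z (as ! j)"
      using z ij 3 unfolding wit_def by auto
    then have "(as ! i, as ! j) \<in> PU" using maps_to_fun[OF Phi_proj(1)[OF S ij(1)]] Phi_proj(3)[OF S ij(1)] by simp
    then show "holds (FEq x y) (model_of \<Phi>) xs as" using v 3 by simp
  qed
next
  case (4 xs P ys)
  let ?n = "length xs"
  have wf: "wf_fm L ar xs (FPred P ys)" using 4(1-4) by (rule wf_fm.intros(4))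
  note S = sat_npred[OF wf]
  obtain \<sigma> where \<sigma>: "length \<sigma> = length ys" "\<And>i. i \<in> set \<sigma> \<Longrightarrow> i < ?n" "map ((!) xs) \<sigma> = ys"
    using index_ex[OF 4(4)] by blast
  have v: "map (val xs bs) ys = map ((!) bs) \<sigma>" if "length bs = ?n" for bs
  proof -
    have "map (val xs bs) ys = map (\<lambda>i. val xs bs (xs ! i)) \<sigma>" using \<sigma>(3) by (auto simp: o_def)
    also have "\<dots> = map ((!) bs) \<sigma>" using val_nth[OF 4(1) that] \<sigma>(2) by auto
    finally show ?thesis .
  qed
  have l: "length \<sigma> = ar P" using \<sigma> 4 by simp
  note pn = pred_npred[OF 4(2)]
  have h: "holds (FPred P ys) (model_of \<Phi>) xs as \<longleftrightarrow> forces \<Phi> (ar P) (atom_pred P) (map ((!) as) \<sigma>)"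
    unfolding holds.simps v[OF 4(5)] by (rule mod_pred[OF 4(2)]) (use l in simp)
  show ?case unfolding h
  proof
    assume f: "forces \<Phi> (ar P) (atom_pred P) (map ((!) as) \<sigma>)"
    have d: "forces \<Phi> ?n (elems ?n) as" using forces_dom[of as] 4 by simp
    note c = forces_conj[OF dom_npred pn l \<sigma>(2) d f]
    show "forces \<Phi> ?n (sat xs (FPred P ys)) as"
    proof (rule forces_mono[OF c(1) S _ c(2)])
      fix N bs assume "N \<in> Obj X" "elems ?n N bs \<and> atom_pred P N (map ((!) bs) \<sigma>)"
      then show "sat xs (FPred P ys) N bs"
        using v[of bs] by (simp add: satisfies_def elems_def atom_pred_def)
    qed
  next
    assume f: "forces \<Phi> ?n (sat xs (FPred P ys)) as"
    have r: "reindex ?n (sat xs (FPred P ys)) (ar P) (atom_pred P) \<sigma>"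
      unfolding reindex_def
    proof (intro conjI ballI allI impI S pn l)
      fix N bs assume N: "N \<in> Obj X" and bs: "sat xs (FPred P ys) N bs"
      then have b: "length bs = ?n" "\<forall>b\<in>set bs. eqv N b b" "holds_pred N P (map ((!) bs) \<sigma>)"
        using v[of bs] by (auto simp: satisfies_def)
      have "eqv N (bs ! i) (bs ! i)" if "i \<in> set \<sigma>" for i using b \<sigma>(2)[OF that] by simp
      then show "atom_pred P N (map ((!) bs) \<sigma>)" using b l by (simp add: atom_pred_def elems_def)
    qed (use \<sigma> in auto)
    show "forces \<Phi> (ar P) (atom_pred P) (map ((!) as) \<sigma>)" using forces_rx[OF r f] .
  qed
next
  case (5 xs \<phi> \<psi>)
  let ?n = "length xs"
  note S1 = sat_npred[OF 5(1)] and S2 = sat_npred[OF 5(2)] and S = sat_npred[OF wf_fm.intros(5)[OF 5(1,2)]]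
  have "forces \<Phi> ?n (sat xs (FAnd \<phi> \<psi>)) as \<longleftrightarrow> forces \<Phi> ?n (sat xs \<phi>) as \<and> forces \<Phi> ?n (sat xs \<psi>) as"
  proof (intro iffI conjI)
    assume f: "forces \<Phi> ?n (sat xs (FAnd \<phi> \<psi>)) as"
    show "forces \<Phi> ?n (sat xs \<phi>) as" by (rule forces_mono[OF S S1 _ f]) (auto simp: satisfies_def)
    show "forces \<Phi> ?n (sat xs \<psi>) as" by (rule forces_mono[OF S S2 _ f]) (auto simp: satisfies_def)
  next
    assume f: "forces \<Phi> ?n (sat xs \<phi>) as \<and> forces \<Phi> ?n (sat xs \<psi>) as"
    have m: "map ((!) bs) [0..<?n] = bs" if "length bs = ?n" for bs :: "nat list" using that by (rule map_nth_upt)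
    have f2: "forces \<Phi> ?n (sat xs \<psi>) (map ((!) as) [0..<?n])" using f m 5 by simp
    note c = forces_conj[OF S1 S2 _ _ f[THEN conjunct1] f2]
    show "forces \<Phi> ?n (sat xs (FAnd \<phi> \<psi>)) as"
    proof (rule forces_mono[OF c(1) S _ c(2)])
      fix N bs assume "N \<in> Obj X" "sat xs \<phi> N bs \<and> sat xs \<psi> N (map ((!) bs) [0..<?n])"
      then show "sat xs (FAnd \<phi> \<psi>) N bs" using m[of bs] by (simp add: satisfies_def)
    qed auto
  qed
  then show ?case using 5 by simp
next
  case (6 xs F)
  let ?n = "length xs"
  note Si = sat_npred[OF 6(1)] and S = sat_npred[OF wf_fm.intros(6)[of L ar xs F, OF 6(1)]]
  have m: "map ((!) bs) [0..<?n] = bs" if "length bs = ?n" for bs :: "nat list" using that by (rule map_nth_upt)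
  have imp: "sat xs (FOr F) N bs" if "sat xs (F i) N bs" for i N bs using that by (auto simp: satisfies_def)
  have "forces \<Phi> ?n (sat xs (FOr F)) as \<longleftrightarrow> (\<exists>i. forces \<Phi> ?n (sat xs (F i)) as)"
  proof
    assume f: "forces \<Phi> ?n (sat xs (FOr F)) as"
    have "\<exists>i\<in>UNIV. \<exists>ys. forces \<Phi> ?n (sat xs (F i)) ys \<and> list_all2 (\<lambda>a b. (a, b) \<in> PU) (map ((!) ys) [0..<?n]) as"
    proof (rule forces_cover[OF _ S _ _ f])
      show "reindex ?n (sat xs (F i)) ?n (sat xs (FOr F)) [0..<?n]" for i :: nat
        by (rule reindex_mono[OF Si S]) (rule imp)
      fix N bs assume N: "N \<in> Obj X" and bs: "sat xs (FOr F) N bs"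
      then obtain i where "sat xs (F i) N bs" by (auto simp: satisfies_def)
      moreover have "list_all2 (eqv N) (map ((!) bs) [0..<?n]) bs"
        using bs m[of bs] by (simp add: satisfies_def list_all2_same)
      ultimately show "\<exists>i\<in>UNIV. \<exists>ys. sat xs (F i) N ys \<and> list_all2 (eqv N) (map ((!) ys) [0..<?n]) bs" by blast
    qed simp
    then obtain i ys where i: "forces \<Phi> ?n (sat xs (F i)) ys" "list_all2 (\<lambda>a b. (a, b) \<in> PU) (map ((!) ys) [0..<?n]) as" by blast
    have "length ys = ?n" using i(1) by (simp add: forces_def)
    then have "forces \<Phi> ?n (sat xs (F i)) as" using forces_cong[OF Si i(1)] i(2) m by simp
    then show "\<exists>i. forces \<Phi> ?n (sat xs (F i)) as" by blast
  next
    assume "\<exists>i. forces \<Phi> ?n (sat xs (F i)) as"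
    then show "forces \<Phi> ?n (sat xs (FOr F)) as" using forces_mono[OF Si S] imp by blast
  qed
  then show ?case using 6 by simp
next
  case (7 xs y \<phi>)
  let ?n = "length xs"
  note S1 = sat_npred[OF 7(1)] and S = sat_npred[OF wf_fm.intros(7)[OF 7(1)]]
  have tk: "map ((!) bs) [0..<?n] = take ?n bs" if "length bs = Suc ?n" for bs :: "nat list"
    using that by (intro nth_equalityI) simp_all
  have r: "reindex (Suc ?n) (sat (xs @ [y]) \<phi>) ?n (sat xs (FEx y \<phi>)) [0..<?n]"
    unfolding reindex_def
  proof (intro conjI ballI allI impI S)
    show "npred (Suc ?n) (sat (xs @ [y]) \<phi>)" using S1 by simp
    fix N bs assume N: "N \<in> Obj X" and bs: "sat (xs @ [y]) \<phi> N bs"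
    then have l: "length bs = Suc ?n" by (simp add: satisfies_def)
    have b: "bs = take ?n bs @ [bs ! ?n]" using l take_Suc_conv_app_nth[of ?n bs] by simp
    have "eqv N (bs ! ?n) (bs ! ?n)" "\<forall>b\<in>set (take ?n bs). eqv N b b"
      using bs l by (auto simp: satisfies_def dest: in_set_takeD)
    moreover have "holds \<phi> N (xs @ [y]) (take ?n bs @ [bs ! ?n])" using bs b by (simp add: satisfies_def)
    ultimately show "sat xs (FEx y \<phi>) N (map ((!) bs) [0..<?n])"
      unfolding tk[OF l] satisfies_def using l by auto
  qed auto
  have "forces \<Phi> ?n (sat xs (FEx y \<phi>)) as \<longleftrightarrow> (\<exists>b. (b, b) \<in> PU \<and> forces \<Phi> (Suc ?n) (sat (xs @ [y]) \<phi>) (as @ [b]))"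
  proof
    assume f: "forces \<Phi> ?n (sat xs (FEx y \<phi>)) as"
    \<comment> \<open>The quantifier is a cover by a single map, the one that drops the last
      coordinate; hence the one-element index set.\<close>
    have "\<exists>i\<in>{()}. \<exists>ys. forces \<Phi> (Suc ?n) (sat (xs @ [y]) \<phi>) ys \<and> list_all2 (\<lambda>a b. (a, b) \<in> PU) (map ((!) ys) [0..<?n]) as"
    proof (rule forces_cover[OF _ S _ _ f])
      fix N bs assume N: "N \<in> Obj X" and bs: "sat xs (FEx y \<phi>) N bs"
      then obtain b where b: "eqv N b b" "holds \<phi> N (xs @ [y]) (bs @ [b])" by (auto simp: satisfies_def)
      have "sat (xs @ [y]) \<phi> N (bs @ [b])" using b bs by (auto simp: satisfies_def)
      moreover have "list_all2 (eqv N) (map ((!) (bs @ [b])) [0..<?n]) bs"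
        using bs tk[of "bs @ [b]"] by (simp add: satisfies_def list_all2_same)
      ultimately show "\<exists>i\<in>{()}. \<exists>ys. sat (xs @ [y]) \<phi> N ys \<and> list_all2 (eqv N) (map ((!) ys) [0..<?n]) bs" by blast
    qed (use r in auto)
    then obtain ys where ys: "forces \<Phi> (Suc ?n) (sat (xs @ [y]) \<phi>) ys" "list_all2 (\<lambda>a b. (a, b) \<in> PU) (map ((!) ys) [0..<?n]) as" by blast
    have l: "length ys = Suc ?n" using ys by (simp add: forces_def)
    have n: "(ys ! ?n, ys ! ?n) \<in> PU" using forces_dom_of[OF S1] ys l by simp
    have b: "ys = take ?n ys @ [ys ! ?n]" using l take_Suc_conv_app_nth[of ?n ys] by simp
    have "list_all2 (\<lambda>a b. (a, b) \<in> PU) (take ?n ys @ [ys ! ?n]) (as @ [ys ! ?n])"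
      using ys(2) tk[OF l] n by (auto intro: list_all2_appendI)
    then have "list_all2 (\<lambda>a b. (a, b) \<in> PU) ys (as @ [ys ! ?n])" using b by simp
    then have "forces \<Phi> (Suc ?n) (sat (xs @ [y]) \<phi>) (as @ [ys ! ?n])" using forces_cong[OF S1] ys by simp
    then show "\<exists>b. (b, b) \<in> PU \<and> forces \<Phi> (Suc ?n) (sat (xs @ [y]) \<phi>) (as @ [b])" using n by blast
  next
    assume "\<exists>b. (b, b) \<in> PU \<and> forces \<Phi> (Suc ?n) (sat (xs @ [y]) \<phi>) (as @ [b])"
    then obtain b where "forces \<Phi> (Suc ?n) (sat (xs @ [y]) \<phi>) (as @ [b])" by blast
    from forces_rx[OF r this] show "forces \<Phi> ?n (sat xs (FEx y \<phi>)) as" using tk[of "as @ [b]"] 7 by simp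
  qed
  moreover have "holds \<phi> (model_of \<Phi>) (xs @ [y]) (as @ [b]) \<longleftrightarrow> forces \<Phi> (Suc ?n) (sat (xs @ [y]) \<phi>) (as @ [b])"
    if "(b, b) \<in> PU" for b
    using "7.IH"[of "as @ [b]"] 7(3,4) that by simp
  ultimately show ?case unfolding holds.simps model_of_fst by blast
qed

lemma satisfies_mod:
  assumes wf: "wf_fm L ar xs \<phi>"
  shows "satisfies (model_of \<Phi>) xs \<phi> as \<longleftrightarrow> forces \<Phi> (length xs) (sat xs \<phi>) as"
  using holds_mod[OF wf, of as] forces_dom_of[OF sat_npred[OF wf], of as]
  unfolding satisfies_def by (auto simp: forces_def)

lemma mod_structure: "is_structure L ar (model_of \<Phi>)"
  unfolding is_structure_def
proof (intro conjI ballI)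
  show per: "is_per (fst (model_of \<Phi>))" using PU_per by simp
  show "snd (model_of \<Phi>) \<in> extensional L" by (simp add: model_of_def)
  fix P assume P: "P \<in> L"
  have "forces \<Phi> (ar P) (atom_pred P) bs"
    if "forces \<Phi> (ar P) (atom_pred P) as" "list_all2 (\<lambda>a b. (a, b) \<in> PU) as bs" for as bs
    using forces_cong[OF pred_npred[OF P] that] .
  from subobject_tuples[OF PU_per, of "ar P" "forces \<Phi> (ar P) (atom_pred P)", OF this]
  show "subobject (snd (model_of \<Phi>) P) (per_power (fst (model_of \<Phi>)) (ar P))"
    using P by (simp add: model_of_def)
qed

text \<open>An axiom is an inclusion of natural predicates that holds in every model, and forcing is
  monotone.\<close>

lemma mod_Obj: "model_of \<Phi> \<in> Obj X"
  unfolding Obj_X is_model_def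
proof (intro conjI allI impI mod_structure)
  fix \<phi> xs \<psi> as assume *: "Sequent \<phi> xs \<psi> \<in> T \<and> satisfies (model_of \<Phi>) xs \<phi> as"
  then have wf: "wf_fm L ar xs \<phi>" "wf_fm L ar xs \<psi>" using cT unfolding countable_theory_def by blast+
  have "sat xs \<psi> N bs" if "N \<in> Obj X" "sat xs \<phi> N bs" for N bs
    using that * unfolding Obj_X is_model_def by blast
  then show "satisfies (model_of \<Phi>) xs \<psi> as"
    using * satisfies_mod[OF wf(1)] satisfies_mod[OF wf(2)] forces_mono[OF sat_npred[OF wf(1)] sat_npred[OF wf(2)]] by blast
qed

end

subsection \<open>Comparing a \<open>\<sigma>\<close>-pretopos morphism with evaluation at its model\<close>

context phi
begin

text \<open>Extends the agreement of truth and forcing from formulas to all natural predicates, as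
  required for fibre products, which are not given by formulas. The bridge is the countable cover of
  S by basic formulas.\<close>

lemma forces_iff:
  assumes S: "npred n S"
  shows "forces \<Phi> n S as \<longleftrightarrow> S (model_of \<Phi>) as"
proof
  assume "S (model_of \<Phi>) as"
  then obtain bs \<phi> \<sigma> where b: "basic bs \<phi>" "sat bs \<phi> (model_of \<Phi>) bs" "reindex (length bs) (sat bs \<phi>) n S \<sigma>"
    "map ((!) bs) \<sigma> = as"
    using npred_basic[OF S mod_Obj] by blast
  have "forces \<Phi> (length bs) (sat bs \<phi>) bs" using b satisfies_mod[OF basic_wf[OF b(1)]] by blast
  from forces_rx[OF b(3) this] show "forces \<Phi> n S as" using b(4) by simp
next
  assume f: "forces \<Phi> n S as"
  define I where "I = {(bs, \<phi>, \<sigma>). basic bs \<phi> \<and> reindex (length bs) (sat bs \<phi>) n S \<sigma>}"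
  have "I \<subseteq> (\<lambda>((bs, \<phi>), \<sigma>). (bs, \<phi>, \<sigma>)) ` ({(bs, \<phi>). basic bs \<phi>} \<times> UNIV)"
    unfolding I_def by force
  moreover have "countable ({(bs, \<phi>). basic bs \<phi>} \<times> (UNIV :: nat list set))" using countable_basic by auto
  ultimately have cI: "countable I" by (rule countable_subset[OF _ countable_image])
  have "\<exists>i\<in>I. \<exists>xs. forces \<Phi> (length (fst i)) (sat (fst i) (fst (snd i))) xs \<and>
      list_all2 (\<lambda>a b. (a, b) \<in> PU) (map ((!) xs) (snd (snd i))) as"
  proof (rule forces_cover[OF cI S _ _ f])
    show "reindex (length (fst i)) (sat (fst i) (fst (snd i))) n S (snd (snd i))" if "i \<in> I" for i
      using that unfolding I_def by auto
    fix N as assume N: "N \<in> Obj X" and as: "S N as"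
    obtain bs \<phi> \<sigma> where b: "basic bs \<phi>" "sat bs \<phi> N bs" "reindex (length bs) (sat bs \<phi>) n S \<sigma>" "map ((!) bs) \<sigma> = as"
      using npred_basic[OF S N as] by blast
    have "(bs, \<phi>, \<sigma>) \<in> I" "list_all2 (eqv N) (map ((!) bs) \<sigma>) as"
      using b npred_dom[OF S N as] by (auto simp: I_def list_all2_same)
    then show "\<exists>i\<in>I. \<exists>xs. sat (fst i) (fst (snd i)) N xs \<and> list_all2 (eqv N) (map ((!) xs) (snd (snd i))) as"
      using b(2) by (intro bexI[of _ "(bs, \<phi>, \<sigma>)"] exI[of _ bs]) auto
  qed
  then obtain bs \<phi> \<sigma> xs where b: "basic bs \<phi>" "reindex (length bs) (sat bs \<phi>) n S \<sigma>"
    "forces \<Phi> (length bs) (sat bs \<phi>) xs" "list_all2 (\<lambda>a b. (a, b) \<in> PU) (map ((!) xs) \<sigma>) as"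
    unfolding I_def by auto
  have "sat bs \<phi> (model_of \<Phi>) xs" using satisfies_mod[OF basic_wf[OF b(1)]] b(3) by blast
  then have "S (model_of \<Phi>) (map ((!) xs) \<sigma>)" using b(2) mod_Obj unfolding reindex_def by blast
  then show "S (model_of \<Phi>) as" using npred_cong[OF S mod_Obj] b(4) by simp
qed

text \<open>Both sides say that xs @ ys lies in the fibre product of \<alpha> and \<beta>, once at
  the model and once under \<Phi>; the two readings agree because truth of a natural predicate at
  the model is forcing.\<close>

lemma corr_consistent:
  assumes S: "npred n S" and S': "npred m S'" and a: "\<alpha> \<in> Mor FC" and b: "\<beta> \<in> Mor FC"
    and as: "fst (snd \<alpha>) = relf S" and bs: "fst (snd \<beta>) = relf S'" and ab: "snd (snd \<alpha>) = snd (snd \<beta>)"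
    and l: "length xs = n" "length ys = m" and w: "wit \<Phi> S xs z" "wit \<Phi> S' ys z'"
    and m: "maps_to (fst \<alpha> (model_of \<Phi>)) (tuple xs) c" "maps_to (snd \<Phi> \<alpha>) z d"
  shows "maps_to (fst \<beta> (model_of \<Phi>)) (tuple ys) c \<longleftrightarrow> maps_to (snd \<Phi> \<beta>) z' d"
proof
  let ?M = "model_of \<Phi>" and ?R = "fibre n m \<alpha> \<beta>"
  note M = mod_Obj and ctx = S S' a b as bs ab
  note R = fibre_npred[OF ctx] and rl = fibre_left[OF ctx] and rr = fibre_right[OF ctx]
  let ?p = "rx ?R S [0..<n]" and ?q = "rx ?R S' [n..<n + m]"
  note p = rx_mor[OF rl] and q = rx_mor[OF rr]
  have ep: "fst (snd \<alpha>) = snd (snd ?p)" "fst (snd \<beta>) = snd (snd ?q)" using as bs by simp_all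
  assume "maps_to (fst \<beta> ?M) (tuple ys) c"
  then have "?R ?M (xs @ ys)" unfolding fibre_def using m l by auto
  then obtain v where v: "wit \<Phi> ?R (xs @ ys) v" using forces_iff[OF R] unfolding forces_def by blast
  have lv: "length (xs @ ys) = n + m" using l by simp
  have "maps_to (snd \<Phi> ?p) v z"
    by (rule cong_wit_shift[OF rl lv v]) (use w l map_nth_take[of n "xs @ ys"] in simp)
  moreover have vq: "maps_to (snd \<Phi> ?q) v z'"
    by (rule cong_wit_shift[OF rr lv v]) (use w l map_nth_drop[OF lv] in simp)
  ultimately have "maps_to (snd \<Phi> (Comp FC \<alpha> ?p)) v d"
    using Phi_comp[OF p a ep(1)] m by blast
  then obtain y where y: "maps_to (snd \<Phi> ?q) v y" "maps_to (snd \<Phi> \<beta>) y d"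
    unfolding fibre_commutes[OF ctx] using Phi_comp[OF q b ep(2)] by blast
  have "(y, z') \<in> fst (snd \<Phi> \<beta>)" using maps_to_fun[OF Phi_mor[OF q] y(1) vq] Phi_tgt[OF q] Phi_src[OF b] bs by simp
  then show "maps_to (snd \<Phi> \<beta>) z' d" using maps_to_cong[OF Phi_mor[OF b] y(2)] maps_to_cod[OF y(2)] by blast
next
  let ?M = "model_of \<Phi>"
  note M = mod_Obj and ctx = S S' a b as bs ab
  assume "maps_to (snd \<Phi> \<beta>) z' d"
  then have "fibre n m \<alpha> \<beta> ?M (xs @ ys)"
    using forces_fibre[OF ctx l w m(2)] forces_iff[OF fibre_npred[OF ctx]] by blast
  then obtain c' where c': "maps_to (fst \<alpha> ?M) (tuple xs) c'" "maps_to (fst \<beta> ?M) (tuple ys) c'"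
    unfolding fibre_def using l by auto
  have "(c', c) \<in> fst (snd (fst \<beta> ?M))"
    using maps_to_fun[OF fmor_mor[OF a M] c'(1) m(1)] fmor_tgt[OF a M] fmor_tgt[OF b M] ab by simp
  then show "maps_to (fst \<beta> ?M) (tuple ys) c" using maps_to_cong[OF fmor_mor[OF b M] c'(2)] maps_to_dom[OF c'(2)] by blast
qed

lemma corrI:
  assumes "npred n S" "\<alpha> \<in> Mor FC" "fst (snd \<alpha>) = relf S" "snd (snd \<alpha>) = F" "length xs = n"
    "maps_to (fst \<alpha> (model_of \<Phi>)) (tuple xs) a" "wit \<Phi> S xs z" "maps_to (snd \<Phi> \<alpha>) z b"
  shows "corr \<Phi> F a b"
  using assms unfolding corr_def by blast

text \<open>The correspondence is defined by the existence of some presentation; consistency allows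
  it to be tested on any presentation of a or of b that is at hand.\<close>

lemma corr_iff:
  assumes S: "npred n S" "\<alpha> \<in> Mor FC" "fst (snd \<alpha>) = relf S" "snd (snd \<alpha>) = F" "length xs = n" "wit \<Phi> S xs z"
  shows "maps_to (fst \<alpha> (model_of \<Phi>)) (tuple xs) a \<Longrightarrow> corr \<Phi> F a b \<longleftrightarrow> maps_to (snd \<Phi> \<alpha>) z b"
      (is "?A \<Longrightarrow> _ \<longleftrightarrow> ?B")
    and "maps_to (snd \<Phi> \<alpha>) z b \<Longrightarrow> corr \<Phi> F a b \<longleftrightarrow> maps_to (fst \<alpha> (model_of \<Phi>)) (tuple xs) a"
proof -
  have "?A \<longleftrightarrow> ?B" if c: "corr \<Phi> F a b"
  proof -
    obtain m S' \<beta> ys z' where b: "npred m S'" "\<beta> \<in> Mor FC" "fst (snd \<beta>) = relf S'" "snd (snd \<beta>) = F" "length ys = m"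
      "maps_to (fst \<beta> (model_of \<Phi>)) (tuple ys) a" "wit \<Phi> S' ys z'" "maps_to (snd \<Phi> \<beta>) z' b"
      using c unfolding corr_def by blast
    show ?thesis
      by (rule corr_consistent[OF b(1) S(1) b(2) S(2) b(3) S(3) _ b(5) S(5) b(7) S(6) b(6) b(8)]) (use b S in simp)
  qed
  then show "?A \<Longrightarrow> corr \<Phi> F a b \<longleftrightarrow> ?B" "?B \<Longrightarrow> corr \<Phi> F a b \<longleftrightarrow> ?A"
    using corrI[OF S(1-5) _ S(6)] by blast+
qed

lemma basic_wit:
  assumes b: "basic bs \<phi>" and s: "sat bs \<phi> (model_of \<Phi>) bs"
  shows "\<exists>z. wit \<Phi> (sat bs \<phi>) bs z"
  using satisfies_mod[OF basic_wf[OF b]] s unfolding forces_def by blast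

lemma Phi_total: "e \<in> Mor FC \<Longrightarrow> (z, z) \<in> fst \<Phi> (fst (snd e)) \<Longrightarrow> \<exists>b. maps_to (snd \<Phi> e) z b"
  using maps_to_total[OF Phi_mor] Phi_src by simp

lemma corr_total:
  assumes F: "F \<in> Obj FC" and a: "(a, a) \<in> fst F (model_of \<Phi>)"
  shows "\<exists>b. corr \<Phi> F a b"
proof -
  obtain bs \<phi> where b: "basic bs \<phi>" "sat bs \<phi> (model_of \<Phi>) bs" "good F bs \<phi> a"
    using good_const[OF F mod_Obj a] by blast
  note al = alpha_mor[OF F b(1,3)] and at = alpha_at[OF F b(1,3) mod_Obj b(2)]
  obtain z where z: "wit \<Phi> (sat bs \<phi>) bs z" using basic_wit[OF b(1,2)] by blast
  then obtain d where "maps_to (snd \<Phi> (alpha bs \<phi> a F)) z d" using Phi_total[OF al] unfolding wit_def by auto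
  then have "corr \<Phi> F a d" using corrI[OF sat_npred[OF basic_wf[OF b(1)]] al _ _ _ at z] by simp
  then show ?thesis by blast
qed

text \<open>The maps \<open>alpha\<close> over all basic names of all elements jointly cover F and
  are countably many, so d is already a value of \<Phi> at one of them.\<close>

lemma corr_surj:
  assumes F: "F \<in> Obj FC" and d: "(d, d) \<in> fst \<Phi> F"
  shows "\<exists>a. corr \<Phi> F a d"
proof -
  define I where "I = {(bs, \<phi>, a). basic bs \<phi> \<and> good F bs \<phi> a}"
  have "I \<subseteq> (\<lambda>((bs, \<phi>), a). (bs, \<phi>, a)) ` ({(bs, \<phi>). basic bs \<phi>} \<times> UNIV)"
    unfolding I_def by force
  moreover have "countable ({(bs, \<phi>). basic bs \<phi>} \<times> (UNIV :: nat set))" using countable_basic by auto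
  ultimately have cI: "countable I" by (rule countable_subset[OF _ countable_image])
  let ?e = "from_nat_into I" and ?al = "\<lambda>i. alpha (fst i) (fst (snd i)) (snd (snd i)) F"
  have e: "k \<in> to_nat_on I ` I \<Longrightarrow> ?e k \<in> I" for k using cI by auto
  have Ii: "basic (fst i) (fst (snd i))" "good F (fst i) (fst (snd i)) (snd (snd i))" if "i \<in> I" for i
    using that unfolding I_def by auto
  have "\<exists>k\<in>to_nat_on I ` I. \<exists>x. maps_to (snd \<Phi> (?al (?e k))) x d"
  proof (rule Phi_jointly_surj[OF F _ _ d])
    show "?al (?e k) \<in> Mor FC \<and> snd (snd (?al (?e k))) = F" if "k \<in> to_nat_on I ` I" for k
      using alpha_mor[OF F Ii[OF e[OF that]]] by simp
    fix N y assume N: "N \<in> Obj X" and y: "(y, y) \<in> fst F N"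
    obtain bs \<phi> where b: "basic bs \<phi>" "sat bs \<phi> N bs" "good F bs \<phi> y" using good_const[OF F N y] by blast
    then have i: "(bs, \<phi>, y) \<in> I" by (simp add: I_def)
    have "maps_to (fst (alpha bs \<phi> y F) N) (tuple bs) y" using alpha_at[OF F b(1,3) N b(2)] .
    then show "\<exists>k\<in>to_nat_on I ` I. \<exists>x. maps_to (fst (?al (?e k)) N) x y"
      using i cI by (intro bexI[of _ "to_nat_on I (bs, \<phi>, y)"]) auto
  qed
  then obtain i x where i: "i \<in> I" "maps_to (snd \<Phi> (?al i)) x d" using e by blast
  note al = alpha_mor[OF F Ii[OF i(1)]]
  let ?S = "sat (fst i) (fst (snd i))"
  note S = sat_npred[OF basic_wf[OF Ii(1)[OF i(1)]]]
  have "(x, x) \<in> fst \<Phi> (relf ?S)" using maps_to_dom[OF i(2)] Phi_src[OF al] by simp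
  then obtain xs where xs: "length xs = length (fst i)" "wit \<Phi> ?S xs x" using wit_total[OF S] by blast
  have "?S (model_of \<Phi>) xs" using forces_iff[OF S] xs unfolding forces_def by blast
  then have "(tuple xs, tuple xs) \<in> fst (fst (?al i) (model_of \<Phi>))"
    using relf_self[OF S mod_Obj] fmor_src[OF al mod_Obj] by auto
  then obtain a where "maps_to (fst (?al i) (model_of \<Phi>)) (tuple xs) a" using maps_to_total[OF fmor_mor[OF al mod_Obj]] by blast
  then have "corr \<Phi> F a d" using corrI[OF S al _ _ xs(1) _ xs(2) i(2)] by simp
  then show ?thesis by blast
qed

lemma corr_dom:
  assumes "corr \<Phi> F a b"
  shows "(a, a) \<in> fst F (model_of \<Phi>)" "(b, b) \<in> fst \<Phi> F" "F \<in> Obj FC"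
proof -
  obtain S \<alpha> xs z where al: "npred (length xs) S" "\<alpha> \<in> Mor FC" "fst (snd \<alpha>) = relf S" "snd (snd \<alpha>) = F"
    "maps_to (fst \<alpha> (model_of \<Phi>)) (tuple xs) a" "wit \<Phi> S xs z" "maps_to (snd \<Phi> \<alpha>) z b"
    using assms unfolding corr_def by blast
  show "(a, a) \<in> fst F (model_of \<Phi>)" "(b, b) \<in> fst \<Phi> F" "F \<in> Obj FC"
    using maps_to_cod[OF al(5)] maps_to_cod[OF al(7)] fmor_tgt[OF al(2) mod_Obj] Phi_tgt[OF al(2)] fmor_Tgt[OF al(2)] al(4) by simp_all
qed

text \<open>Through one fixed presentation, the correspondents of a are the values of a single
  morphism, and likewise for b; so the correspondence is one-to-one up to equivalence.\<close>

lemma corr_rel: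
  assumes c: "corr \<Phi> F a b"
  shows "corr \<Phi> F a b' \<longleftrightarrow> (b, b') \<in> fst \<Phi> F" and "corr \<Phi> F a' b \<longleftrightarrow> (a, a') \<in> fst F (model_of \<Phi>)"
proof -
  obtain n S \<alpha> xs z where al: "npred n S" "\<alpha> \<in> Mor FC" "fst (snd \<alpha>) = relf S" "snd (snd \<alpha>) = F" "length xs = n"
    "maps_to (fst \<alpha> (model_of \<Phi>)) (tuple xs) a" "wit \<Phi> S xs z" "maps_to (snd \<Phi> \<alpha>) z b"
    using c unfolding corr_def by blast
  note i = corr_iff[OF al(1-5,7)]
  show "corr \<Phi> F a b' \<longleftrightarrow> (b, b') \<in> fst \<Phi> F"
    unfolding i(1)[OF al(6)]
    using maps_to_fun[OF Phi_mor[OF al(2)] al(8)] maps_to_cong[OF Phi_mor[OF al(2)] al(8) maps_to_dom[OF al(8)]] Phi_tgt[OF al(2)] al(4)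
    by auto
  show "corr \<Phi> F a' b \<longleftrightarrow> (a, a') \<in> fst F (model_of \<Phi>)"
    unfolding i(2)[OF al(8)]
    using maps_to_fun[OF fmor_mor[OF al(2) mod_Obj] al(6)] maps_to_cong[OF fmor_mor[OF al(2) mod_Obj] al(6) maps_to_dom[OF al(6)]]
      fmor_tgt[OF al(2) mod_Obj] al(4) by auto
qed

lemma corr_map:
  assumes F: "F \<in> Obj FC"
  shows "is_map (fst F (model_of \<Phi>)) (fst \<Phi> F) (corr \<Phi> F)"
    and "is_map (fst \<Phi> F) (fst F (model_of \<Phi>)) (\<lambda>b a. corr \<Phi> F a b)"
proof -
  note pers = fobj_per[OF F mod_Obj] Phi_per[OF F]
  have cong: "corr \<Phi> F a' b'" if "corr \<Phi> F a b" "(a, a') \<in> fst F (model_of \<Phi>)" "(b, b') \<in> fst \<Phi> F" for a a' b b'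
  proof -
    have "corr \<Phi> F a' b" using corr_rel(2)[OF that(1)] that(2) by blast
    then show ?thesis using corr_rel(1) that(3) by blast
  qed
  show "is_map (fst F (model_of \<Phi>)) (fst \<Phi> F) (corr \<Phi> F)"
    unfolding is_map_def
    by (intro conjI allI impI pers) (erule corr_dom(1) corr_dom(2) corr_total[OF F] | erule (2) cong | erule (1) corr_rel(1)[THEN iffD1])+
  show "is_map (fst \<Phi> F) (fst F (model_of \<Phi>)) (\<lambda>b a. corr \<Phi> F a b)"
    unfolding is_map_def
    by (intro conjI allI impI pers) (erule corr_dom(1) corr_dom(2) corr_surj[OF F] | erule (1) cong, assumption | erule (1) corr_rel(2)[THEN iffD1])+
qed

text \<open>A presentation of a, composed with e, presents the image of a by the same
  parameters.\<close>

lemma corr_nat: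
  assumes c: "corr \<Phi> F a b" and e: "e \<in> Mor FC" "fst (snd e) = F" "maps_to (fst e (model_of \<Phi>)) a a'" "maps_to (snd \<Phi> e) b b'"
  shows "corr \<Phi> (snd (snd e)) a' b'"
proof -
  obtain n S \<alpha> xs z where al: "npred n S" "\<alpha> \<in> Mor FC" "fst (snd \<alpha>) = relf S" "snd (snd \<alpha>) = F" "length xs = n"
    "maps_to (fst \<alpha> (model_of \<Phi>)) (tuple xs) a" "wit \<Phi> S xs z" "maps_to (snd \<Phi> \<alpha>) z b"
    using c unfolding corr_def by blast
  have s: "fst (snd e) = snd (snd \<alpha>)" using al e by simp
  show ?thesis
  proof (rule corrI[OF al(1) FC_Comp_mor[OF al(2) e(1) s] _ _ al(5) _ al(7)])
    show "maps_to (fst (Comp FC e \<alpha>) (model_of \<Phi>)) (tuple xs) a'"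
      unfolding FC_maps_to_Comp[OF al(2) e(1) s mod_Obj] using al e by blast
    show "maps_to (snd \<Phi> (Comp FC e \<alpha>)) z b'" unfolding Phi_comp[OF al(2) e(1) s] using al e by blast
  qed (use al in simp_all)
qed

end

subsection \<open>The dual functor is a continuous equivalence\<close>

context tcat
begin

interpretation P: tcat FC by (rule FC_tcat)

lemma dual_obj_Obj: "M \<in> Obj C \<Longrightarrow> dual_obj C M \<in> Obj P.FC"
  unfolding P.fobj_iff by (rule dual_obj_functor)

lemma dual_functor_fst: "M \<in> Obj C \<Longrightarrow> fst (dual_functor C) M = dual_obj C M"
  by (simp add: dual_functor_def)

lemma dual_functor_snd: "h \<in> Mor C \<Longrightarrow>
    snd (dual_functor C) h = ((\<lambda>F\<in>Obj FC. snd F h), dual_obj C (Src C h), dual_obj C (Tgt C h))"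
  by (simp add: dual_functor_def)

text \<open>Naturality of F(h) in F is the naturality square of a transformation at h with the roles
  of the two variables exchanged.\<close>

lemma dual_functor_Mor:
  assumes h: "h \<in> Mor C"
  shows "snd (dual_functor C) h \<in> Mor P.FC"
proof -
  note s = Src_Obj[OF h] and t = Tgt_Obj[OF h]
  let ?e = "\<lambda>F\<in>Obj FC. snd F h"
  have "nat_trans FC ODS (dual_obj C (Src C h)) (dual_obj C (Tgt C h)) ?e"
    unfolding nat_trans_def
  proof (intro conjI ballI)
    show "?e \<in> Obj FC \<rightarrow>\<^sub>E Mor ODS" using fobj_mor h by auto
    show "Src ODS (?e F) = fst (dual_obj C (Src C h)) F" "Tgt ODS (?e F) = fst (dual_obj C (Tgt C h)) F" if "F \<in> Obj FC" for F
      using that fobj_src[OF that h] fobj_tgt[OF that h] by simp_all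
    fix f assume f: "f \<in> Mor FC"
    have o: "Src FC f \<in> Obj FC" "Tgt FC f \<in> Obj FC" using P.Src_Obj[OF f] P.Tgt_Obj[OF f] .
    have "Comp ODS (fst f (Tgt C h)) (snd (Src FC f) h) = Comp ODS (snd (Tgt FC f) h) (fst f (Src C h))"
      using f h unfolding fmor_iff continuous_nat_trans_def nat_trans_def FC_simps(1,2) by blast
    then show "Comp ODS (?e (Tgt FC f)) (snd (dual_obj C (Src C h)) f) = Comp ODS (snd (dual_obj C (Tgt C h)) f) (?e (Src FC f))"
      using o f by simp
  qed
  moreover have "continuous_map (ObjTop FC) (MorTop ODS) ?e"
  proof (rule P.continuous_mapsI_obj)
    fix F G assume F: "seqlim (ObjTop FC) F G" "\<And>k. F k \<in> Obj FC"
    have "seqlim (MorTop C) (\<lambda>_. h) h" using h top_Mor by simp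
    then have "seqlim ods_mor_top (\<lambda>k. snd (F k) h) (snd G h)"
      using lim_fobjD(2)[of F G "\<lambda>_. h" h] F by (simp add: FC_simps(4))
    then show "seqlim (MorTop ODS) (\<lambda>k. ?e (F k)) (?e G)"
      using F(2) P.lim_Obj[OF F(1)] by simp
  qed (use fobj_mor h in simp)
  ultimately show ?thesis
    unfolding P.fmor_iff continuous_nat_trans_def dual_functor_snd[OF h]
    using dual_obj_Obj[OF s] dual_obj_Obj[OF t] by simp
qed

text \<open>Convergence in the function space controls values at moving arguments, so evaluation is
  jointly continuous in functor and model.\<close>

lemma lim_dual:
  assumes M: "seqlim (ObjTop C) M l" "\<And>k. M k \<in> Obj C"
  shows "seqlim (functor_obj_space FC ODS) (\<lambda>k. dual_obj C (M k)) (dual_obj C l)"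
proof (rule P.lim_fobjI)
  show "dual_obj C (M k) \<in> Obj P.FC" for k using dual_obj_Obj M(2) .
  show "dual_obj C l \<in> Obj P.FC" using dual_obj_Obj lim_Obj[OF M(1)] .
  show "seqlim ods_obj_top (\<lambda>k. fst (dual_obj C (M k)) (F k)) (fst (dual_obj C l) G)"
    if F: "seqlim (ObjTop FC) F G" "\<And>k. F k \<in> Obj FC" for F G
    using lim_fobjD(1)[of F G M l] F P.lim_Obj[OF F(1)] M(1) by (simp add: FC_simps(4))
  show "seqlim ods_mor_top (\<lambda>k. snd (dual_obj C (M k)) (F k)) (snd (dual_obj C l) G)"
    if F: "seqlim (MorTop FC) F G" "\<And>k. F k \<in> Mor FC" for F G
    using lim_fmorD(1)[of F G M l] F P.lim_Mor[OF F(1)] M(1) by (simp add: FC_simps(5))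
qed

lemma dual_functor_continuous: "continuous_functor C (functor_cat FC ODS) (dual_functor C)"
  unfolding continuous_functor_def is_functor_def
proof (intro conjI ballI impI)
  let ?D = "dual_functor C"
  show "fst ?D \<in> Obj C \<rightarrow>\<^sub>E Obj P.FC" using dual_obj_Obj by (auto simp: dual_functor_def)
  show "snd ?D \<in> Mor C \<rightarrow>\<^sub>E Mor P.FC"
    using dual_functor_Mor by (auto simp: dual_functor_def)
  show "Src P.FC (snd ?D h) = fst ?D (Src C h)" "Tgt P.FC (snd ?D h) = fst ?D (Tgt C h)" if h: "h \<in> Mor C" for h
    using dual_functor_snd[OF h] dual_functor_fst Src_Obj[OF h] Tgt_Obj[OF h] by (simp_all add: P.FC_simps(1,2))
  show "snd ?D (Idn C x) = Idn P.FC (fst ?D x)" if x: "x \<in> Obj C" for x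
  proof -
    have "snd F (Idn C x) = Idn ODS (fst (dual_obj C x) F)" if F: "F \<in> Obj FC" for F
      using F x unfolding fobj_iff continuous_functor_def is_functor_def by (simp add: fobj_iff[symmetric])
        (simp add: F)
    then show ?thesis
      unfolding dual_functor_snd[OF Idn_Mor[OF x]] dual_functor_fst[OF x] P.FC_simps(3) Src_Idn[OF x] Tgt_Idn[OF x]
      by (simp cong: restrict_cong)
  qed
  show "snd ?D (Comp C g f) = Comp P.FC (snd ?D g) (snd ?D f)"
    if fg: "f \<in> Mor C" "g \<in> Mor C" "Src C g = Tgt C f" for f g
  proof -
    have "snd F (Comp C g f) = Comp ODS (snd F g) (snd F f)" if "F \<in> Obj FC" for F
      using that fg unfolding fobj_iff continuous_functor_def is_functor_def by blast
    then show ?thesis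
      unfolding P.Comp_FC dual_functor_snd[OF fg(1)] dual_functor_snd[OF fg(2)] dual_functor_snd[OF Comp_Mor[OF fg]]
        Src_Comp[OF fg] Tgt_Comp[OF fg]
      by (simp cong: restrict_cong)
  qed
  show "continuous_map (ObjTop C) (ObjTop P.FC) (fst ?D)"
  proof (rule continuous_mapsI_obj)
    show "fst ?D x \<in> topspace (ObjTop P.FC)" if "x \<in> Obj C" for x
      using dual_obj_Obj[OF that] dual_functor_fst[OF that] by (simp add: P.FC_simps)
    show "seqlim (ObjTop P.FC) (\<lambda>k. fst ?D (x k)) (fst ?D l)"
      if "seqlim (ObjTop C) x l" "\<And>k. x k \<in> Obj C" for x l
      using lim_dual[OF that] dual_functor_fst that(2) lim_Obj[OF that(1)] by (simp add: P.FC_simps(4))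
  qed
  show "continuous_map (MorTop C) (MorTop P.FC) (snd ?D)"
  proof (rule continuous_mapsI_mor)
    show "snd ?D x \<in> topspace (MorTop P.FC)" if "x \<in> Mor C" for x
      using dual_functor_Mor[OF that] by (simp add: P.FC_simps)
    fix h h0 assume h: "seqlim (MorTop C) h h0" "\<And>k. h k \<in> Mor C"
    note h0 = lim_Mor[OF h(1)]
    show "seqlim (MorTop P.FC) (\<lambda>k. snd ?D (h k)) (snd ?D h0)"
      unfolding P.FC_simps(5)
    proof (rule P.lim_fmorI)
      show "snd ?D (h k) \<in> Mor P.FC" for k using dual_functor_Mor h(2) .
      show "snd ?D h0 \<in> Mor P.FC" using dual_functor_Mor h0 .
      show "seqlim ods_mor_top (\<lambda>k. fst (snd ?D (h k)) (F k)) (fst (snd ?D h0) G)"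
        if F: "seqlim (ObjTop FC) F G" "\<And>k. F k \<in> Obj FC" for F G
        using lim_fobjD(2)[of F G h h0] F P.lim_Obj[OF F(1)] h(1) dual_functor_snd[OF h(2)] dual_functor_snd[OF h0]
        by (simp add: FC_simps(4))
      show "seqlim (functor_obj_space FC ODS) (\<lambda>k. fst (snd (snd ?D (h k)))) (fst (snd (snd ?D h0)))"
        using lim_dual[OF src_lim[OF h]] Src_Obj[OF h(2)] dual_functor_snd[OF h(2)] dual_functor_snd[OF h0] by simp
      show "seqlim (functor_obj_space FC ODS) (\<lambda>k. snd (snd (snd ?D (h k)))) (snd (snd (snd ?D h0)))"
        using lim_dual[OF tgt_lim[OF h]] Tgt_Obj[OF h(2)] dual_functor_snd[OF h(2)] dual_functor_snd[OF h0] by simp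
    qed
  qed
qed

end

context models
begin

interpretation P: tcat FC by (rule FC_tcat)

abbreviation sigma where "sigma \<equiv> sigma_pretopos_morphism FC ODS"

lemma phiI: "sigma \<Phi> \<Longrightarrow> phi L ar T \<Phi>"
  by unfold_locales

lemma sigma_Obj: "sigma \<Phi> \<Longrightarrow> \<Phi> \<in> Obj P.FC"
  unfolding P.fobj_iff sigma_pretopos_morphism_def by blast

lemma const_lim_FC: "F \<in> Obj FC \<Longrightarrow> seqlim (ObjTop FC) (\<lambda>_. F) F"
  "e \<in> Mor FC \<Longrightarrow> seqlim (MorTop FC) (\<lambda>_. e) e"
  using P.top_Obj P.top_Mor by simp_all

section \<open>Continuity of the model and of the correspondence in the morphism\<close>

context
  fixes \<Phi> \<Phi>0
  assumes lim: "seqlim (functor_obj_space FC ODS) \<Phi> \<Phi>0"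
    and sk: "\<And>k. sigma (\<Phi> k)" and s0: "sigma \<Phi>0"
begin

text \<open>Being a witness is a finite conjunction of facts about the values of the morphism at
  fixed arguments.\<close>

lemma wit_lim:
  assumes S: "npred n S" and as: "length as = n" and w: "wit \<Phi>0 S as z"
  shows "\<forall>\<^sub>s k. wit (\<Phi> k) S as z"
proof -
  have "\<forall>\<^sub>s k. (z, z) \<in> fst (\<Phi> k) (relf S)"
    using P.lim_fobjD(1)[OF lim const_lim_FC(1)[OF relf_obj[OF S]]] w unfolding limitin_ods_obj wit_def by blast
  moreover have "\<forall>\<^sub>s k. \<forall>i\<in>{..<length as}. maps_to (snd (\<Phi> k) (proj S i)) z (as ! i)"
  proof (rule eventually_ball_finite, simp, rule ballI)
    fix i assume "i \<in> {..<length as}"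
    then have i: "i < n" "i < length as" using as by auto
    show "\<forall>\<^sub>s k. maps_to (snd (\<Phi> k) (proj S i)) z (as ! i)"
      using P.lim_fobjD(2)[OF lim const_lim_FC(2)[OF rx_mor[OF reindex_proj[OF S i(1)]]]] w i(2)
      unfolding limitin_ods_mor wit_def by blast
  qed
  ultimately show ?thesis by eventually_elim (simp add: wit_def)
qed

lemma model_lim: "seqlim (model_space L ar T) (\<lambda>k. model_of (\<Phi> k)) (model_of \<Phi>0)"
proof (rule lim_modelI)
  show "model_of (\<Phi> k) \<in> Obj X" for k using phi.mod_Obj[OF phiI[OF sk]] .
  show "model_of \<Phi>0 \<in> Obj X" using phi.mod_Obj[OF phiI[OF s0]] .
  show "\<forall>\<^sub>s k. eqv (model_of (\<Phi> k)) a b" if "eqv (model_of \<Phi>0) a b" for a b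
    using P.lim_fobjD(1)[OF lim const_lim_FC(1)[OF relf_obj[OF dom_npred]]] that
    unfolding limitin_ods_obj model_of_def fst_conv by blast
  fix P as assume P: "P \<in> L" "length as = ar P" and "holds_pred (model_of \<Phi>0) P as"
  then obtain z where z: "wit \<Phi>0 (atom_pred P) as z"
    using phi.mod_pred[OF phiI[OF s0] P] unfolding forces_def by blast
  from wit_lim[OF pred_npred[OF P(1)] P(2) z]
  show "\<forall>\<^sub>s k. holds_pred (model_of (\<Phi> k)) P as"
    by eventually_elim (use phi.mod_pred[OF phiI[OF sk] P] P in \<open>auto simp: forces_def\<close>)
qed

text \<open>The pair (a, b) is witnessed by a basic name of a, an element z for that name and the
  value b of \<open>alpha\<close> at z. Each of these data persists when the morphism and the
  functor vary together.\<close>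

lemma corr_lim:
  assumes F: "seqlim (functor_obj_space X ODS) F G" "\<And>k. F k \<in> Obj FC" "G \<in> Obj FC"
    and c: "corr \<Phi>0 G a b"
  shows "\<forall>\<^sub>s k. corr (\<Phi> k) (F k) a b"
proof -
  interpret p0: phi L ar T \<Phi>0 using s0 by (rule phiI)
  obtain bs \<phi> k0 where b: "basic bs \<phi>" "sat bs \<phi> (model_of \<Phi>0) bs" "good G bs \<phi> a" "\<And>k. k \<ge> k0 \<Longrightarrow> good (F k) bs \<phi> a"
    using good_neighbourhood[OF F(1,3) p0.mod_Obj p0.corr_dom(1)[OF c]] by blast
  note S = sat_npred[OF basic_wf[OF b(1)]]
  obtain z where z: "wit \<Phi>0 (sat bs \<phi>) bs z" using p0.basic_wit[OF b(1,2)] by blast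
  note at = alpha_at[OF F(3) b(1,3) p0.mod_Obj b(2)]
  have zb: "maps_to (snd \<Phi>0 (alpha bs \<phi> a G)) z b"
    using p0.corr_iff(1)[OF S alpha_mor[OF F(3) b(1,3)] _ _ _ z at] c by simp
  \<comment> \<open>\<open>alpha\<close> is a natural transformation only where a is good, so the
    early functors are replaced by G before the limit is taken.\<close>
  define F' where "F' k = (if k \<ge> k0 then F k else G)" for k
  have ev: "\<forall>\<^sub>s k. F k = F' k"
    using eventually_ge_at_top[of k0] by eventually_elim (simp add: F'_def)
  have F': "seqlim (functor_obj_space X ODS) F' G"
    using limitin_transform_eventually[OF ev F(1)] .
  have F'k: "F' k \<in> Obj FC" "good (F' k) bs \<phi> a" for k using F b by (simp_all add: F'_def)
  have "seqlim (MorTop FC) (\<lambda>k. alpha bs \<phi> a (F' k)) (alpha bs \<phi> a G)"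
    unfolding FC_simps(5) by (rule alpha_lim[OF F' F'k(1) F(3) b(1) F'k(2) b(3)])
  then have "\<forall>\<^sub>s k. maps_to (snd (\<Phi> k) (alpha bs \<phi> a (F' k))) z b"
    using P.lim_fobjD(2)[OF lim] zb unfolding limitin_ods_mor by blast
  moreover have "\<forall>\<^sub>s k. wit (\<Phi> k) (sat bs \<phi>) bs z" using wit_lim[OF S _ z] by simp
  moreover have "\<forall>\<^sub>s k. sat bs \<phi> (model_of (\<Phi> k)) bs"
    by (rule npred_lim[OF S model_lim phi.mod_Obj[OF phiI[OF sk]] b(2)])
  ultimately show ?thesis using ev
  proof eventually_elim
    case (elim k)
    note at = alpha_at[OF F'k(1) b(1) F'k(2) phi.mod_Obj[OF phiI[OF sk]] elim(3)]
    have "corr (\<Phi> k) (F' k) a b"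
      by (rule phi.corrI[OF phiI[OF sk] S alpha_mor[OF F'k(1) b(1) F'k(2)] _ _ _ at elim(2,1)]) simp_all
    then show ?case using elim(4) by simp
  qed
qed

end

section \<open>From natural transformations to homomorphisms\<close>

definition hom_of where
  "hom_of e = (fst e U, model_of (fst (snd e)), model_of (snd (snd e)))"

context
  fixes e
  assumes e: "e \<in> Mor P.FC" and s: "sigma (fst (snd e))" and t: "sigma (snd (snd e))"
begin

interpretation src: phi L ar T "fst (snd e)" using s by (rule phiI)
interpretation tgt: phi L ar T "snd (snd e)" using t by (rule phiI)

lemma e_nat:
  assumes h: "h \<in> Mor FC" and m: "maps_to (snd (fst (snd e)) h) a b" "maps_to (fst e (fst (snd h))) a c" "maps_to (snd (snd (snd e)) h) c d"
  shows "maps_to (fst e (snd (snd h))) b d"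
  using P.fmor_nat[OF e h] m by (simp add: FC_simps(1,2))

lemma e_mor: "F \<in> Obj FC \<Longrightarrow> fst e F \<in> ods_mors \<and> fst (fst e F) = fst (fst (snd e)) F \<and> fst (snd (fst e F)) = fst (snd (snd e)) F"
  using P.fmor_mor[OF e] P.fmor_src[OF e] P.fmor_tgt[OF e] by blast

text \<open>Naturality of e at the projections: its component at \<open>relf S\<close> acts
  coordinatewise like its component at \<open>U\<close>. Applied to the predicate symbols, this
  makes the component at \<open>U\<close> a homomorphism.\<close>

lemma wit_nat:
  assumes S: "npred n S" and l: "length xs = n" and w: "wit (fst (snd e)) S xs z"
    and xy: "list_all2 (maps_to (fst e U)) xs ys" and zw: "maps_to (fst e (relf S)) z v"
  shows "wit (snd (snd e)) S ys v"
  unfolding wit_def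
proof (intro conjI allI impI)
  show vv: "(v, v) \<in> fst (snd (snd e)) (relf S)" using maps_to_cod[OF zw] e_mor[OF relf_obj[OF S]] by simp
  fix i assume "i < length ys"
  then have i: "i < n" "i < length xs" "maps_to (fst e U) (xs ! i) (ys ! i)"
    using xy l by (auto simp: list_all2_conv_all_nth)
  note U = U_obj
  obtain d where d: "maps_to (snd (snd (snd e)) (proj S i)) v d"
    using maps_to_total[OF tgt.Phi_proj(1)[OF S i(1)]] tgt.Phi_proj(2)[OF S i(1)] vv by auto
  have "maps_to (fst e U) (xs ! i) d"
    using e_nat[OF rx_mor[OF reindex_proj[OF S i(1)]], of z "xs ! i" v d] w i(2) zw d unfolding wit_def by simp
  then have "(d, ys ! i) \<in> fst (snd (snd (snd (snd e)) (proj S i)))"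
    using maps_to_fun[OF e_mor[OF U, THEN conjunct1] _ i(3)] e_mor[OF U] tgt.Phi_proj(3)[OF S i(1)] by simp
  then show "maps_to (snd (snd (snd e)) (proj S i)) v (ys ! i)"
    using maps_to_cong[OF tgt.Phi_proj(1)[OF S i(1)] d maps_to_dom[OF d]] by blast
qed

lemma hom_of_Mor: "hom_of e \<in> Mor X"
  unfolding hom_of_def
proof (rule MorI)
  note U = U_obj
  show "fst e U \<in> ods_mors" "fst (fst e U) = fst (model_of (fst (snd e)))" "fst (snd (fst e U)) = fst (model_of (snd (snd e)))"
    using e_mor[OF U] by simp_all
  fix P as bs assume P: "P \<in> L" "length as = ar P" and ab: "list_all2 (maps_to (fst e U)) as bs"
    and h: "holds_pred (model_of (fst (snd e))) P as"
  obtain z where z: "wit (fst (snd e)) (atom_pred P) as z" using src.mod_pred[OF P] h unfolding forces_def by blast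
  note S = pred_npred[OF P(1)]
  obtain v where v: "maps_to (fst e (relf (atom_pred P))) z v"
    using maps_to_total[of "fst e (relf (atom_pred P))" z] e_mor[OF relf_obj[OF S]] z unfolding wit_def by auto
  have "wit (snd (snd e)) (atom_pred P) bs v" using wit_nat[OF S P(2) z ab v] .
  moreover have "length bs = ar P" using list_all2_lengthD[OF ab] P by simp
  ultimately show "holds_pred (model_of (snd (snd e))) P bs" using tgt.mod_pred[OF P(1)] unfolding forces_def by blast
qed (rule src.mod_Obj tgt.mod_Obj)+

text \<open>Naturality of the correspondence in the morphism: a presentation of a is pushed along e,
  its parameters by the component at \<open>U\<close> and its witness by the component at
  \<open>relf S\<close>.\<close>

lemma corr_hom_of:
  assumes c: "corr (fst (snd e)) F a b" and a: "maps_to (snd F (hom_of e)) a a'" and b: "maps_to (fst e F) b b'"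
  shows "corr (snd (snd e)) F a' b'"
proof -
  obtain n S \<alpha> xs z where al: "npred n S" "\<alpha> \<in> Mor FC" "fst (snd \<alpha>) = relf S" "snd (snd \<alpha>) = F" "length xs = n"
    "maps_to (fst \<alpha> (model_of (fst (snd e)))) (tuple xs) a" "wit (fst (snd e)) S xs z" "maps_to (snd (fst (snd e)) \<alpha>) z b"
    using c unfolding corr_def by blast
  note h = hom_of_Mor
  have st: "fst (snd (hom_of e)) = model_of (fst (snd e))" "snd (snd (hom_of e)) = model_of (snd (snd e))" "fst (hom_of e) = fst e U"
    by (simp_all add: hom_of_def)
  have Sxs: "S (model_of (fst (snd e))) xs" using src.forces_iff[OF al(1)] al(5,7) unfolding forces_def by blast
  have "\<exists>ys. list_all2 (maps_to (fst (hom_of e))) xs ys"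
    by (rule list_all2_total, rule maps_to_total[OF hom_mor[OF h]])
      (use npred_dom[OF al(1) src.mod_Obj Sxs] hom_src[OF h] st in simp)
  then obtain ys where ys: "list_all2 (maps_to (fst (hom_of e))) xs ys" by blast
  obtain v where v: "maps_to (fst e (relf S)) z v"
    using maps_to_total[of "fst e (relf S)" z] e_mor[OF relf_obj[OF al(1)]] al(7) unfolding wit_def by auto
  have w: "wit (snd (snd e)) S ys v" using wit_nat[OF al(1,5,7) _ v] ys st by simp
  show ?thesis
  proof (rule tgt.corrI[OF al(1-4)])
    show "length ys = n" using list_all2_lengthD[OF ys] al by simp
    have "maps_to (snd (relf S) (hom_of e)) (tuple xs) (tuple ys)"
      using relf_snd[OF al(1) h] Sxs ys st by auto
    then show "maps_to (fst \<alpha> (model_of (snd (snd e)))) (tuple ys) a'"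
      using fmor_nat[OF al(2) h, of "tuple xs" "tuple ys" a a'] al(3,4,6) a st by simp
    show "wit (snd (snd e)) S ys v" by (rule w)
    obtain d where d: "maps_to (snd (snd (snd e)) \<alpha>) v d"
      using tgt.Phi_total[OF al(2), of v] w al(3) unfolding wit_def by auto
    have F: "F \<in> Obj FC" using fmor_Tgt[OF al(2)] al by simp
    have "maps_to (fst e F) b d" using e_nat[OF al(2), of z b v d] al(3,4,8) v d by simp
    then have "(d, b') \<in> fst (snd (snd (snd (snd e)) \<alpha>))"
      using maps_to_fun[OF e_mor[OF F, THEN conjunct1] _ b] e_mor[OF F] tgt.Phi_tgt[OF al(2)] al(4) by simp
    then show "maps_to (snd (snd (snd e)) \<alpha>) v b'" using maps_to_cong[OF tgt.Phi_mor[OF al(2)] d maps_to_dom[OF d]] by blast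
  qed
qed

end

text \<open>An equality, since \<open>U\<close> returns the underlying PER itself and the predicates
  are determined by the tuples satisfying them.\<close>

lemma model_of_dual:
  assumes M: "M \<in> Obj X"
  shows "model_of (dual_obj X M) = M"
proof (rule prod_eqI)
  note U = U_obj
  show u: "fst (model_of (dual_obj X M)) = fst M" using U_fst[OF M] U by (simp add: model_of_def)
  have ex: "snd M \<in> extensional L" using Obj_structure[OF M] unfolding is_structure_def by blast
  have "forces (dual_obj X M) (ar P) (atom_pred P) as \<longleftrightarrow> holds_pred M P as" if P: "P \<in> L" "length as = ar P" for P as
  proof -
    note S = pred_npred[OF P(1)]
    have w: "wit (dual_obj X M) (atom_pred P) as z \<longleftrightarrow> (z, z) \<in> fst (relf (atom_pred P)) M \<and>
        (\<forall>i<length as. maps_to (fst (proj (atom_pred P) i) M) z (as ! i))" for z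
      unfolding wit_def using relf_obj[OF S] rx_mor[OF reindex_proj[OF S]] P by simp
    show ?thesis
    proof
      assume "forces (dual_obj X M) (ar P) (atom_pred P) as"
      then obtain z where z: "(z, z) \<in> fst (relf (atom_pred P)) M" "\<And>i. i < length as \<Longrightarrow> maps_to (fst (proj (atom_pred P) i) M) z (as ! i)"
        unfolding forces_def w by blast
      obtain xs where xs: "z = tuple xs" "atom_pred P M xs" using z(1) relf_self[OF S M] by blast
      then have l: "length xs = ar P" using npred_len[OF S M] by blast
      have "list_all2 (eqv M) xs as"
        using z(2) proj_rel[OF S _ M l] xs l P by (simp add: list_all2_conv_all_nth)
      then show "holds_pred M P as" using npred_cong[OF S M xs(2)] by (simp add: atom_pred_def)
    next
      assume h: "holds_pred M P as"
      then have d: "\<forall>a\<in>set as. eqv M a a" using pred_dom[OF Obj_structure[OF M] P(1)] P by blast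
      then have a: "atom_pred P M as" using h P by (simp add: atom_pred_def elems_def)
      then have "wit (dual_obj X M) (atom_pred P) as (tuple as)"
        unfolding w using relf_self[OF S M] proj_rel[OF S _ M P(2)] d P by auto
      then show "forces (dual_obj X M) (ar P) (atom_pred P) as" using P unfolding forces_def by blast
    qed
  qed
  then have "(u, v) \<in> snd (model_of (dual_obj X M)) P \<longleftrightarrow> (u, v) \<in> snd M P" if "P \<in> L" for u v P
    unfolding pred_iff[OF Obj_structure[OF M] that] using that u by (auto simp: model_of_def)
  then show "snd (model_of (dual_obj X M)) = snd M"
    by (intro extensionalityI[OF _ ex]) (auto simp: model_of_def)
qed

lemma U_snd:
  assumes h: "h \<in> Mor X"
  shows "snd U h = fst h"
proof (rule ods_mor_eqI)
  note U = U_obj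
  have o: "fst (snd h) \<in> Obj X" "snd (snd h) \<in> Obj X" using h Mor_X by blast+
  show "snd U h \<in> ods_mors" "fst h \<in> ods_mors" using fobj_mor[OF U h] hom_mor[OF h] .
  show "fst (snd U h) = fst (fst h)" "fst (snd (snd U h)) = fst (snd (fst h))"
    using fobj_src[OF U h] fobj_tgt[OF U h] U_fst[OF o(1)] U_fst[OF o(2)] hom_src[OF h] hom_tgt[OF h] by simp_all
  fix a b assume "maps_to (snd U h) a b"
  then obtain as bs where 1: "a = tuple as" "b = tuple bs" "elems 1 (fst (snd h)) as" "list_all2 (maps_to (fst h)) as bs"
    using relf_snd[OF dom_npred h] by blast
  then show "maps_to (fst h) a b" by (cases as; cases bs) (auto simp: elems_def)
qed

section \<open>The inverse functor and the comparison isomorphism\<close>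

abbreviation Q where "Q \<equiv> full_subcat (functor_cat FC ODS) sigma"

lemma Collect_sigma: "{\<Phi> \<in> Obj P.FC. sigma \<Phi>} = {\<Phi>. sigma \<Phi>}"
  using sigma_Obj by blast

lemma Q_simps:
  "Obj Q = {\<Phi>. sigma \<Phi>}" "Mor Q = {e \<in> Mor P.FC. sigma (fst (snd e)) \<and> sigma (snd (snd e))}"
  "Src Q e = fst (snd e)" "Tgt Q e = snd (snd e)" "Idn Q = Idn P.FC" "Comp Q = Comp P.FC"
  "ObjTop Q = qcb_sub (functor_obj_space FC ODS) {\<Phi>. sigma \<Phi>}"
  "MorTop Q = qcb_sub (functor_mor_space FC ODS) {e \<in> Mor P.FC. sigma (fst (snd e)) \<and> sigma (snd (snd e))}"
  unfolding full_subcat_def Let_def by (simp_all add: Collect_sigma P.FC_simps(1,2,4,5))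

lemma topspace_Q: "topspace (ObjTop Q) = Obj Q" "topspace (MorTop Q) = Mor Q"
  using sigma_Obj unfolding Q_simps by (auto simp: P.FC_simps)

lemma sequential_Q: "sequential_space (ObjTop Q)" "sequential_space (MorTop Q)"
  unfolding Q_simps by simp_all

lemma lim_Q: "seqlim (ObjTop Q) x l \<Longrightarrow> seqlim (functor_obj_space FC ODS) x l"
  "seqlim (MorTop Q) y m \<Longrightarrow> seqlim (functor_mor_space FC ODS) y m"
  "seqlim (ObjTop Q) x l \<Longrightarrow> l \<in> Obj Q" "seqlim (MorTop Q) y m \<Longrightarrow> m \<in> Mor Q"
  unfolding Q_simps limitin_qcb_sub by simp_all

lemma lim_QI:
  "seqlim (functor_obj_space FC ODS) x l \<Longrightarrow> (\<And>k. x k \<in> Obj Q) \<Longrightarrow> l \<in> Obj Q \<Longrightarrow> seqlim (ObjTop Q) x l"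
  "seqlim (functor_mor_space FC ODS) y m \<Longrightarrow> (\<And>k. y k \<in> Mor Q) \<Longrightarrow> m \<in> Mor Q \<Longrightarrow> seqlim (MorTop Q) y m"
  unfolding Q_simps limitin_qcb_sub by simp_all

lemma dual_functor_Q: "continuous_functor X Q (dual_functor X)"
proof -
  note c = dual_functor_continuous[unfolded continuous_functor_def is_functor_def]
  have o: "fst (dual_functor X) M \<in> Obj Q" if "M \<in> Obj X" for M
    using dual_obj_sigma[OF that] dual_functor_fst[OF that] unfolding Q_simps by simp
  have m: "snd (dual_functor X) h \<in> Mor Q" if h: "h \<in> Mor X" for h
    using dual_functor_Mor[OF h] dual_functor_snd[OF h] dual_obj_sigma[OF Src_Obj[OF h]] dual_obj_sigma[OF Tgt_Obj[OF h]]
    unfolding Q_simps by simp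
  have "is_functor X Q (dual_functor X)"
    unfolding is_functor_def Q_simps(3-6)
    using c o m unfolding P.FC_simps(1,2) by (auto simp: PiE_iff)
  moreover have "continuous_map (ObjTop X) (ObjTop Q) (fst (dual_functor X))"
  proof (rule continuous_mapsI_obj)
    show "fst (dual_functor X) x \<in> topspace (ObjTop Q)" if "x \<in> Obj X" for x using o[OF that] topspace_Q by simp
    show "seqlim (ObjTop Q) (\<lambda>k. fst (dual_functor X) (x k)) (fst (dual_functor X) l)"
      if x: "seqlim (ObjTop X) x l" "\<And>k. x k \<in> Obj X" for x l
      by (rule lim_QI) (use o x lim_Obj[OF x(1)] lim_dual[OF x] dual_functor_fst in simp_all)
  qed
  moreover have "continuous_map (MorTop X) (MorTop Q) (snd (dual_functor X))"
  proof (rule continuous_mapsI_mor)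
    show "snd (dual_functor X) x \<in> topspace (MorTop Q)" if "x \<in> Mor X" for x using m[OF that] topspace_Q by simp
    show "seqlim (MorTop Q) (\<lambda>k. snd (dual_functor X) (x k)) (snd (dual_functor X) l)"
      if x: "seqlim (MorTop X) x l" "\<And>k. x k \<in> Mor X" for x l
    proof (rule lim_QI)
      have "continuous_map (MorTop X) (functor_mor_space FC ODS) (snd (dual_functor X))" using c by (simp add: P.FC_simps(5))
      from continuous_map_limit[OF this x(1)]
      show "seqlim (functor_mor_space FC ODS) (\<lambda>k. snd (dual_functor X) (x k)) (snd (dual_functor X) l)"
        by (simp add: o_def)
    qed (use m x lim_Mor[OF x(1)] in blast)+
  qed
  ultimately show ?thesis unfolding continuous_functor_def by blast
qed

definition inverse where
  "inverse = ((\<lambda>\<Phi>\<in>Obj Q. model_of \<Phi>), (\<lambda>e\<in>Mor Q. hom_of e))"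

lemma inverse_Q: "continuous_functor Q X inverse"
proof -
  note U = U_obj
  have o: "model_of \<Phi> \<in> Obj X" if "sigma \<Phi>" for \<Phi> using phi.mod_Obj[OF phiI[OF that]] .
  have m: "hom_of e \<in> Mor X" if "e \<in> Mor Q" for e using hom_of_Mor[of e] that unfolding Q_simps by blast
  have "is_functor Q X inverse"
    unfolding is_functor_def
  proof (intro conjI ballI impI)
    show "fst inverse \<in> Obj Q \<rightarrow>\<^sub>E Obj X" "snd inverse \<in> Mor Q \<rightarrow>\<^sub>E Mor X"
      using o m by (auto simp: inverse_def Q_simps(1))
    show "Src X (snd inverse e) = fst inverse (Src Q e)" "Tgt X (snd inverse e) = fst inverse (Tgt Q e)" if "e \<in> Mor Q" for e
      using that by (simp_all add: inverse_def hom_of_def Q_simps)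
    show "snd inverse (Idn Q \<Phi>) = Idn X (fst inverse \<Phi>)" if \<Phi>: "\<Phi> \<in> Obj Q" for \<Phi>
    proof -
      have s: "sigma \<Phi>" using \<Phi> unfolding Q_simps by simp
      have "Idn P.FC \<Phi> \<in> Mor Q" using P.FC_Idn_mor[OF sigma_Obj[OF s]] s unfolding Q_simps by (simp add: P.FC_simps(3))
      then have "snd inverse (Idn Q \<Phi>) = hom_of (Idn P.FC \<Phi>)" unfolding Q_simps(5) inverse_def by simp
      then show ?thesis using \<Phi> U by (simp add: inverse_def hom_of_def P.FC_simps(3) model_of_def)
    qed
    show "snd inverse (Comp Q g f) = Comp X (snd inverse g) (snd inverse f)"
      if fg: "f \<in> Mor Q" "g \<in> Mor Q" "Src Q g = Tgt Q f" for f g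
    proof -
      have "Comp P.FC g f \<in> Mor Q"
        using fg P.FC_Comp_mor[of f g] unfolding Q_simps by simp
      then have "snd inverse (Comp Q g f) = hom_of (Comp P.FC g f)" unfolding Q_simps(6) inverse_def by simp
      then show ?thesis using fg U by (simp add: inverse_def hom_of_def P.Comp_FC)
    qed
  qed
  moreover have "continuous_map (ObjTop Q) (ObjTop X) (fst inverse)"
  proof (rule continuous_map_sequentialI[OF sequential_Q(1)], unfold topspace_Q)
    show "fst inverse \<Phi> \<in> topspace (ObjTop X)" if "\<Phi> \<in> Obj Q" for \<Phi>
      using that o top_Obj by (simp add: inverse_def Q_simps(1))
    show "seqlim (ObjTop X) (\<lambda>k. fst inverse (\<Phi> k)) (fst inverse \<Phi>0)"
      if x: "\<And>k. \<Phi> k \<in> Obj Q" "seqlim (ObjTop Q) \<Phi> \<Phi>0" for \<Phi> \<Phi>0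
      using model_lim[OF lim_Q(1)[OF x(2)]] x(1) lim_Q(3)[OF x(2)] by (simp add: inverse_def Q_simps(1))
  qed
  moreover have "continuous_map (MorTop Q) (MorTop X) (snd inverse)"
  proof (rule continuous_map_sequentialI[OF sequential_Q(2)], unfold topspace_Q)
    show "snd inverse e \<in> topspace (MorTop X)" if "e \<in> Mor Q" for e
      using that m top_Mor by (simp add: inverse_def)
    fix e e0 assume x: "\<And>k. e k \<in> Mor Q" "seqlim (MorTop Q) e e0"
    note e0 = lim_Q(4)[OF x(2)] and l = lim_Q(2)[OF x(2)]
    have s: "sigma (fst (snd (e k)))" "sigma (snd (snd (e k)))" "sigma (fst (snd e0))" "sigma (snd (snd e0))" for k
      using x(1)[of k] e0 unfolding Q_simps by blast+
    have "seqlim (hom_space L ar T) (\<lambda>k. hom_of (e k)) (hom_of e0)"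
      unfolding lim_hom[OF m[OF x(1)] m[OF e0]]
      using P.lim_fmorD(1)[OF l const_lim_FC(1)[OF U]] model_lim[OF P.lim_fmorD(2)[OF l] s(1,3)] model_lim[OF P.lim_fmorD(3)[OF l] s(2,4)]
      by (simp add: hom_of_def)
    then show "seqlim (MorTop X) (\<lambda>k. snd inverse (e k)) (snd inverse e0)"
      using x(1) e0 by (simp add: inverse_def)
  qed
  ultimately show ?thesis unfolding continuous_functor_def by blast
qed

lemma inverse_dual: "comp_functor X inverse (dual_functor X) = id_functor X"
proof -
  have "fst inverse (fst (dual_functor X) M) = M" if M: "M \<in> Obj X" for M
    using dual_obj_sigma[OF M] model_of_dual[OF M] dual_functor_fst[OF M] by (simp add: inverse_def Q_simps(1))
  moreover have "snd inverse (snd (dual_functor X) h) = h" if h: "h \<in> Mor X" for h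
  proof -
    note U = U_obj
    have "snd (dual_functor X) h \<in> Mor Q"
      using dual_functor_Q h unfolding continuous_functor_def is_functor_def by blast
    then have "snd inverse (snd (dual_functor X) h) = hom_of (snd (dual_functor X) h)" by (simp add: inverse_def)
    also have "\<dots> = h"
      unfolding dual_functor_snd[OF h] hom_of_def
      using U U_snd[OF h] model_of_dual[OF Src_Obj[OF h]] model_of_dual[OF Tgt_Obj[OF h]] by (simp add: prod_eq_iff)
    finally show ?thesis .
  qed
  ultimately show ?thesis
    unfolding comp_functor_def id_functor_def compose_def by (auto cong: restrict_cong)
qed

text \<open>One composite is equal to the identity functor, so on that side only the continuity of
  the identity transformation remains.\<close>

lemma id_X_isomorphic: "continuously_isomorphic X X (id_functor X) (id_functor X)"
proof -
  let ?\<eta> = "\<lambda>M\<in>Obj X. Idn X M"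
  have c: "category X" by (rule cat)
  have i: "Comp X f (Idn X (Src X f)) = f" "Comp X (Idn X (Tgt X f)) f = f" if "f \<in> Mor X" for f
    using c that unfolding category_def by blast+
  have "nat_trans X X (id_functor X) (id_functor X) ?\<eta>"
    unfolding nat_trans_def
  proof (intro conjI ballI)
    show "?\<eta> \<in> Obj X \<rightarrow>\<^sub>E Mor X" using Idn_Mor by auto
    show "Src X (?\<eta> x) = fst (id_functor X) x" "Tgt X (?\<eta> x) = fst (id_functor X) x" if "x \<in> Obj X" for x
      using that by (simp_all add: id_functor_def)
    show "Comp X (?\<eta> (Tgt X f)) (snd (id_functor X) f) = Comp X (snd (id_functor X) f) (?\<eta> (Src X f))" if f: "f \<in> Mor X" for f
    proof -
      have "?\<eta> (Tgt X f) = Idn X (Tgt X f)" "?\<eta> (Src X f) = Idn X (Src X f)" "snd (id_functor X) f = f"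
        using Src_Obj[OF f] Tgt_Obj[OF f] f by (simp_all add: id_functor_def)
      then show ?thesis using i[OF f] by metis
    qed
  qed
  moreover have "continuous_map (ObjTop X) (MorTop X) ?\<eta>"
  proof (rule continuous_mapsI_obj)
    show "?\<eta> x \<in> topspace (MorTop X)" if "x \<in> Obj X" for x using Idn_Mor[OF that] top_Mor that by simp
    fix M l assume M: "seqlim (ObjTop X) M l" "\<And>k. M k \<in> Obj X"
    have M': "seqlim (model_space L ar T) M l" using M by simp
    have l: "l \<in> Obj X" using lim_Obj[OF M(1)] .
    have "seqlim ods_mor_top (\<lambda>k. Idn ODS (fst (M k))) (Idn ODS (fst l))"
      unfolding limitin_ods_mor
      using Idn_in_mors[OF Obj_per] maps_to_Idn[OF Obj_per] M(2) l lim_model_eqv[OF M'] by simp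
    then have "seqlim (hom_space L ar T) (\<lambda>k. Idn X (M k)) (Idn X l)"
      unfolding lim_hom[OF Idn_hom[OF M(2)] Idn_hom[OF l]] using M' by simp
    then show "seqlim (MorTop X) (\<lambda>k. ?\<eta> (M k)) (?\<eta> l)" using M(2) l by simp
  qed
  ultimately have "continuous_nat_trans X X (id_functor X) (id_functor X) ?\<eta>"
    unfolding continuous_nat_trans_def by blast
  moreover have "Comp X (?\<eta> x) (?\<eta> x) = Idn X (fst (id_functor X) x)" if x: "x \<in> Obj X" for x
  proof -
    have "?\<eta> x = Idn X x" "fst (id_functor X) x = x" using x by (simp_all add: id_functor_def)
    then show ?thesis using i(1)[OF Idn_Mor[OF x]] Src_Idn[OF x] by metis
  qed
  ultimately show ?thesis unfolding continuously_isomorphic_def by blast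
qed

definition compare where
  "compare \<Phi> = P.mk_nt (dual_obj X (model_of \<Phi>)) \<Phi> (corr \<Phi>)"

definition compare_back where
  "compare_back \<Phi> = P.mk_nt \<Phi> (dual_obj X (model_of \<Phi>)) (\<lambda>F b a. corr \<Phi> F a b)"

lemma compare_ok:
  assumes s: "sigma \<Phi>"
  shows "P.nt_ok (dual_obj X (model_of \<Phi>)) \<Phi> (corr \<Phi>)"
    and "P.nt_ok \<Phi> (dual_obj X (model_of \<Phi>)) (\<lambda>F b a. corr \<Phi> F a b)"
proof -
  interpret p: phi L ar T \<Phi> using s by (rule phiI)
  note M = p.mod_Obj and O = sigma_Obj[OF s] dual_obj_Obj[OF p.mod_Obj]
  \<comment> \<open>The persistence of the correspondence for the constant sequence \<Phi>, which is
    continuity in F alone.\<close>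
  have cl: "\<forall>\<^sub>s k. corr \<Phi> (F k) a b"
    if F: "seqlim (ObjTop FC) F G" "\<And>k. F k \<in> Obj FC" "corr \<Phi> G a b" for F G a b
  proof -
    have "seqlim (functor_obj_space FC ODS) (\<lambda>_. \<Phi>) \<Phi>" using O(1) by (simp add: P.FC_simps)
    from corr_lim[OF this s s _ F(2) _ F(3)] show ?thesis using F(1) P.lim_Obj[OF F(1)] by (simp add: FC_simps(4))
  qed
  show "P.nt_ok (dual_obj X (model_of \<Phi>)) \<Phi> (corr \<Phi>)"
  proof (rule P.nt_okI[OF O(2,1)])
    show "is_map (fst (dual_obj X (model_of \<Phi>)) F) (fst \<Phi> F) (corr \<Phi> F)" if "F \<in> Obj FC" for F
      using p.corr_map(1)[OF that] that by simp
    show "corr \<Phi> (Tgt FC e) b d"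
      if "e \<in> Mor FC" "maps_to (snd (dual_obj X (model_of \<Phi>)) e) a b" "corr \<Phi> (Src FC e) a c" "maps_to (snd \<Phi> e) c d" for e a b c d
      using p.corr_nat[OF that(3,1) _ _ that(4)] that by (simp add: FC_simps(1,2))
    show "\<forall>\<^sub>s k. corr \<Phi> (F k) a b"
      if "seqlim (ObjTop FC) F G" "\<And>k. F k \<in> Obj FC" "corr \<Phi> G a b" for F G a b using cl[OF that] .
  qed
  show "P.nt_ok \<Phi> (dual_obj X (model_of \<Phi>)) (\<lambda>F b a. corr \<Phi> F a b)"
  proof (rule P.nt_okI[OF O])
    show "is_map (fst \<Phi> F) (fst (dual_obj X (model_of \<Phi>)) F) (\<lambda>b a. corr \<Phi> F a b)" if "F \<in> Obj FC" for F
      using p.corr_map(2)[OF that] that by simp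
    show "corr \<Phi> (Tgt FC e) d b"
      if "e \<in> Mor FC" "maps_to (snd \<Phi> e) a b" "corr \<Phi> (Src FC e) c a" "maps_to (snd (dual_obj X (model_of \<Phi>)) e) c d" for e a b c d
      using p.corr_nat[OF that(3,1) _ _ that(2)] that by (simp add: FC_simps(1,2))
    show "\<forall>\<^sub>s k. corr \<Phi> (F k) b a"
      if "seqlim (ObjTop FC) F G" "\<And>k. F k \<in> Obj FC" "corr \<Phi> G b a" for F G a b using cl[OF that] .
  qed
qed

lemma compare_Mor:
  assumes s: "sigma \<Phi>"
  shows "compare \<Phi> \<in> Mor Q" "compare_back \<Phi> \<in> Mor Q"
  using P.mk_nt_mor[OF compare_ok(1)[OF s]] P.mk_nt_mor[OF compare_ok(2)[OF s]]
    s dual_obj_sigma[OF phi.mod_Obj[OF phiI[OF s]]]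
  unfolding Q_simps compare_def compare_back_def by simp_all

lemma compare_st [simp]:
  "fst (snd (compare \<Phi>)) = dual_obj X (model_of \<Phi>)" "snd (snd (compare \<Phi>)) = \<Phi>"
  "fst (snd (compare_back \<Phi>)) = \<Phi>" "snd (snd (compare_back \<Phi>)) = dual_obj X (model_of \<Phi>)"
  by (simp_all add: compare_def compare_back_def)

lemma compare_rel:
  assumes s: "sigma \<Phi>" and F: "F \<in> Obj FC"
  shows "maps_to (fst (compare \<Phi>) F) a b \<longleftrightarrow> corr \<Phi> F a b" "maps_to (fst (compare_back \<Phi>) F) b a \<longleftrightarrow> corr \<Phi> F a b"
  unfolding compare_def compare_back_def
  using P.maps_to_mk_nt[OF compare_ok(1)[OF s] F] P.maps_to_mk_nt[OF compare_ok(2)[OF s] F] by blast+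

lemma compare_lim:
  assumes x: "seqlim (ObjTop Q) \<Phi> \<Phi>0" "\<And>k. \<Phi> k \<in> Obj Q"
  shows "seqlim (MorTop Q) (\<lambda>k. compare (\<Phi> k)) (compare \<Phi>0)"
    and "seqlim (MorTop Q) (\<lambda>k. compare_back (\<Phi> k)) (compare_back \<Phi>0)"
proof -
  note l = lim_Q(1)[OF x(1)]
  have s: "sigma (\<Phi> k)" "sigma \<Phi>0" for k using x(2)[of k] lim_Q(3)[OF x(1)] by (simp_all add: Q_simps(1))
  have dl: "seqlim (functor_obj_space FC ODS) (\<lambda>k. dual_obj X (model_of (\<Phi> k))) (dual_obj X (model_of \<Phi>0))"
    by (rule lim_dual) (use model_lim[OF l s] phi.mod_Obj[OF phiI[OF s(1)]] in simp_all)
  have cl: "\<forall>\<^sub>s k. corr (\<Phi> k) (F k) a b"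
    if F: "seqlim (ObjTop FC) F G" "\<And>k. F k \<in> Obj FC" "corr \<Phi>0 G a b" for F G a b
    using corr_lim[OF l s _ F(2) _ F(3)] F(1) P.lim_Obj[OF F(1)] by (simp add: FC_simps(4))
  note C = compare_Mor[OF s(1)] compare_Mor[OF s(2)]
  show "seqlim (MorTop Q) (\<lambda>k. compare (\<Phi> k)) (compare \<Phi>0)"
    by (rule lim_QI(2)[OF _ C(1,3)], unfold compare_def,
        rule P.mk_nt_lim[OF compare_ok(1)[OF s(1)] compare_ok(1)[OF s(2)] dl l cl])
  show "seqlim (MorTop Q) (\<lambda>k. compare_back (\<Phi> k)) (compare_back \<Phi>0)"
    by (rule lim_QI(2)[OF _ C(2,4)], unfold compare_back_def,
        rule P.mk_nt_lim[OF compare_ok(2)[OF s(1)] compare_ok(2)[OF s(2)] l dl cl])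
qed

lemma dual_inverse_fst: "\<Phi> \<in> Obj Q \<Longrightarrow> fst (comp_functor Q (dual_functor X) inverse) \<Phi> = dual_obj X (model_of \<Phi>)"
  using dual_functor_fst[OF phi.mod_Obj[OF phiI]] by (simp add: comp_functor_def compose_def inverse_def Q_simps(1))

lemma dual_inverse_snd: "e \<in> Mor Q \<Longrightarrow> snd (comp_functor Q (dual_functor X) inverse) e = snd (dual_functor X) (hom_of e)"
  by (simp add: comp_functor_def compose_def inverse_def)

lemma compare_inverse:
  assumes s: "sigma \<Phi>"
  shows "Comp P.FC (compare_back \<Phi>) (compare \<Phi>) = Idn P.FC (dual_obj X (model_of \<Phi>))"
    and "Comp P.FC (compare \<Phi>) (compare_back \<Phi>) = Idn P.FC \<Phi>"
proof -
  interpret p: phi L ar T \<Phi> using s by (rule phiI)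
  have c: "compare \<Phi> \<in> Mor P.FC" "compare_back \<Phi> \<in> Mor P.FC" using compare_Mor[OF s] unfolding Q_simps by blast+
  have e: "fst (snd (compare_back \<Phi>)) = snd (snd (compare \<Phi>))" "fst (snd (compare \<Phi>)) = snd (snd (compare_back \<Phi>))" by simp_all
  note O = dual_obj_Obj[OF p.mod_Obj] sigma_Obj[OF s]
  show "Comp P.FC (compare_back \<Phi>) (compare \<Phi>) = Idn P.FC (dual_obj X (model_of \<Phi>))"
  proof (rule P.fmor_eqI)
    fix F a b assume F: "F \<in> Obj FC" and "maps_to (fst (Comp P.FC (compare_back \<Phi>) (compare \<Phi>)) F) a b"
    then obtain k where k: "corr \<Phi> F a k" "corr \<Phi> F b k"
      unfolding P.FC_maps_to_Comp[OF c e(1) F] compare_rel[OF s F] by blast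
    then show "maps_to (fst (Idn P.FC (dual_obj X (model_of \<Phi>))) F) a b"
      unfolding P.FC_maps_to_Idn[OF O(1) F] using p.corr_rel(2)[OF k(1)] F by simp
  qed (use P.FC_Comp_mor[OF c e(1)] P.FC_Idn_mor[OF O(1)] in \<open>simp_all add: prod_eq_iff P.FC_simps(3)\<close>)
  show "Comp P.FC (compare \<Phi>) (compare_back \<Phi>) = Idn P.FC \<Phi>"
  proof (rule P.fmor_eqI)
    fix F a b assume F: "F \<in> Obj FC" and "maps_to (fst (Comp P.FC (compare \<Phi>) (compare_back \<Phi>)) F) a b"
    then obtain k where k: "corr \<Phi> F k a" "corr \<Phi> F k b"
      unfolding P.FC_maps_to_Comp[OF c(2,1) e(2) F] compare_rel[OF s F] by blast
    then show "maps_to (fst (Idn P.FC \<Phi>) F) a b"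
      unfolding P.FC_maps_to_Idn[OF O(2) F] using p.corr_rel(1)[OF k(1)] by simp
  qed (use P.FC_Comp_mor[OF c(2,1) e(2)] P.FC_Idn_mor[OF O(2)] in \<open>simp_all add: prod_eq_iff P.FC_simps(3)\<close>)
qed

lemma compare_natural:
  assumes e: "e \<in> Mor Q"
  shows "Comp P.FC (compare (snd (snd e))) (snd (dual_functor X) (hom_of e)) = Comp P.FC e (compare (fst (snd e)))"
    and "Comp P.FC (compare_back (snd (snd e))) e = Comp P.FC (snd (dual_functor X) (hom_of e)) (compare_back (fst (snd e)))"
proof -
  have em: "e \<in> Mor P.FC" and s: "sigma (fst (snd e))" and t: "sigma (snd (snd e))"
    using e unfolding Q_simps by blast+
  interpret p: phi L ar T "fst (snd e)" using s by (rule phiI)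
  interpret q: phi L ar T "snd (snd e)" using t by (rule phiI)
  note h = hom_of_Mor[OF em s t] and hc = corr_hom_of[OF em s t]
  have hst: "fst (snd (hom_of e)) = model_of (fst (snd e))" "snd (snd (hom_of e)) = model_of (snd (snd e))"
    by (simp_all add: hom_of_def)
  let ?d = "snd (dual_functor X) (hom_of e)"
  note d = dual_functor_Mor[OF h]
  have dst: "fst (snd ?d) = dual_obj X (model_of (fst (snd e)))" "snd (snd ?d) = dual_obj X (model_of (snd (snd e)))"
    using dual_functor_snd[OF h] hst by simp_all
  have dr: "fst ?d F = snd F (hom_of e)" if "F \<in> Obj FC" for F using dual_functor_snd[OF h] that by simp
  have c: "compare (snd (snd e)) \<in> Mor P.FC" "compare_back (snd (snd e)) \<in> Mor P.FC"
    "compare (fst (snd e)) \<in> Mor P.FC" "compare_back (fst (snd e)) \<in> Mor P.FC"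
    using compare_Mor[OF s] compare_Mor[OF t] unfolding Q_simps by blast+
  have e1: "fst (snd (compare (snd (snd e)))) = snd (snd ?d)" "fst (snd e) = snd (snd (compare (fst (snd e))))"
    "fst (snd (compare_back (snd (snd e)))) = snd (snd e)" "fst (snd ?d) = snd (snd (compare_back (fst (snd e))))"
    using dst by simp_all
  show 1: "Comp P.FC (compare (snd (snd e))) ?d = Comp P.FC e (compare (fst (snd e)))"
  proof (rule P.fmor_eqI)
    fix F a b assume F: "F \<in> Obj FC" and "maps_to (fst (Comp P.FC (compare (snd (snd e))) ?d) F) a b"
    then obtain a' where a': "maps_to (snd F (hom_of e)) a a'" "corr (snd (snd e)) F a' b"
      unfolding P.FC_maps_to_Comp[OF d c(1) e1(1) F] compare_rel(1)[OF t F] dr[OF F] by blast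
    have "(a, a) \<in> fst F (model_of (fst (snd e)))" using maps_to_dom[OF a'(1)] fobj_src[OF F h] hst by simp
    then obtain k where k: "corr (fst (snd e)) F a k" using p.corr_total[OF F] by blast
    have "(k, k) \<in> fst (fst e F)" using p.corr_dom(2)[OF k] P.fmor_src[OF em F] by simp
    then obtain b' where b': "maps_to (fst e F) k b'" using maps_to_total[OF P.fmor_mor[OF em F]] by blast
    have "corr (snd (snd e)) F a' b'" using hc[OF k a'(1) b'] .
    then have "(b', b) \<in> fst (snd (fst e F))" using q.corr_rel(1) a'(2) P.fmor_tgt[OF em F] by blast
    then have "maps_to (fst e F) k b" using maps_to_cong[OF P.fmor_mor[OF em F] b'] maps_to_dom[OF b'] by blast
    then show "maps_to (fst (Comp P.FC e (compare (fst (snd e)))) F) a b"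
      unfolding P.FC_maps_to_Comp[OF c(3) em e1(2) F] compare_rel(1)[OF s F] using k by blast
  qed (use P.FC_Comp_mor[OF d c(1) e1(1)] P.FC_Comp_mor[OF c(3) em e1(2)] dst in \<open>simp_all add: prod_eq_iff\<close>)
  \<comment> \<open>Naturality of the inverse components is formal: the inverses are cancelled in
    the square already proved.\<close>
  note inv = compare_inverse(2)[OF s] compare_inverse(1)[OF t]
  show "Comp P.FC (compare_back (snd (snd e))) e = Comp P.FC ?d (compare_back (fst (snd e)))"
    by (rule natural_inverse[OF P.FC_category em d c(3,4,1,2) _ _ _ _ _ _ _ _ 1])
      (use dst inv in \<open>simp_all add: P.FC_simps(1,2)\<close>)
qed

lemma dual_inverse: "continuously_isomorphic Q Q (comp_functor Q (dual_functor X) inverse) (id_functor Q)"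
proof -
  let ?DG = "comp_functor Q (dual_functor X) inverse"
  let ?\<eta> = "\<lambda>\<Phi>\<in>Obj Q. compare \<Phi>" and ?\<theta> = "\<lambda>\<Phi>\<in>Obj Q. compare_back \<Phi>"
  have s: "sigma \<Phi>" if "\<Phi> \<in> Obj Q" for \<Phi> using that by (simp add: Q_simps(1))
  have st: "Src Q e \<in> Obj Q" "Tgt Q e \<in> Obj Q" if "e \<in> Mor Q" for e using that by (simp_all add: Q_simps)
  have id1: "fst (id_functor Q) \<Phi> = \<Phi>" if "\<Phi> \<in> Obj Q" for \<Phi> using that by (simp add: id_functor_def)
  have id2: "snd (id_functor Q) e = e" if "e \<in> Mor Q" for e using that by (simp add: id_functor_def)
  have "nat_trans Q Q ?DG (id_functor Q) ?\<eta>"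
    unfolding nat_trans_def
  proof (intro conjI ballI)
    show "?\<eta> \<in> Obj Q \<rightarrow>\<^sub>E Mor Q" using compare_Mor s by auto
    show "Src Q (?\<eta> x) = fst ?DG x" "Tgt Q (?\<eta> x) = fst (id_functor Q) x" if "x \<in> Obj Q" for x
      using that by (simp_all add: dual_inverse_fst id1 Q_simps(3,4))
    show "Comp Q (?\<eta> (Tgt Q e)) (snd ?DG e) = Comp Q (snd (id_functor Q) e) (?\<eta> (Src Q e))" if e: "e \<in> Mor Q" for e
      using compare_natural(1)[OF e] st[OF e] by (simp add: dual_inverse_snd[OF e] id2[OF e] Q_simps(3,4,6))
  qed
  moreover have "nat_trans Q Q (id_functor Q) ?DG ?\<theta>"
    unfolding nat_trans_def
  proof (intro conjI ballI)
    show "?\<theta> \<in> Obj Q \<rightarrow>\<^sub>E Mor Q" using compare_Mor s by auto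
    show "Src Q (?\<theta> x) = fst (id_functor Q) x" "Tgt Q (?\<theta> x) = fst ?DG x" if "x \<in> Obj Q" for x
      using that by (simp_all add: dual_inverse_fst id1 Q_simps(3,4))
    show "Comp Q (?\<theta> (Tgt Q e)) (snd (id_functor Q) e) = Comp Q (snd ?DG e) (?\<theta> (Src Q e))" if e: "e \<in> Mor Q" for e
      using compare_natural(2)[OF e] st[OF e] by (simp add: dual_inverse_snd[OF e] id2[OF e] Q_simps(3,4,6))
  qed
  moreover have "continuous_map (ObjTop Q) (MorTop Q) ?\<eta>" "continuous_map (ObjTop Q) (MorTop Q) ?\<theta>"
  proof -
    show "continuous_map (ObjTop Q) (MorTop Q) ?\<eta>"
      by (rule continuous_map_sequentialI[OF sequential_Q(1)])
        (use compare_Mor s compare_lim(1) lim_Q(3) topspace_Q in simp_all)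
    show "continuous_map (ObjTop Q) (MorTop Q) ?\<theta>"
      by (rule continuous_map_sequentialI[OF sequential_Q(1)])
        (use compare_Mor s compare_lim(2) lim_Q(3) topspace_Q in simp_all)
  qed
  moreover have "Comp Q (?\<theta> x) (?\<eta> x) = Idn Q (fst ?DG x)" "Comp Q (?\<eta> x) (?\<theta> x) = Idn Q (fst (id_functor Q) x)" if "x \<in> Obj Q" for x
    using that compare_inverse[OF s[OF that]] by (simp_all add: dual_inverse_fst id1 Q_simps(5,6))
  ultimately show ?thesis unfolding continuously_isomorphic_def continuous_nat_trans_def by blast
qed

end

theorem theorem14:
  fixes L :: "'p set" and ar :: "'p \<Rightarrow> nat" and T :: "'p sequent set"
  assumes "countable L" and "countable_theory L ar T"
  shows "let X = model_cat L ar T; P = functor_cat X ODS in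
    continuous_functor X (functor_cat P ODS) (dual_functor X) \<and>
    (\<forall>M \<in> Obj X. sigma_pretopos_morphism P ODS (fst (dual_functor X) M)) \<and>
    continuous_equivalence X
      (full_subcat (functor_cat P ODS) (sigma_pretopos_morphism P ODS))
      (dual_functor X)"
proof -
  interpret models L ar T using assms by unfold_locales
  show ?thesis
    unfolding Let_def continuous_equivalence_def
  proof (intro conjI ballI exI[of _ inverse])
    show "continuous_functor X (functor_cat FC ODS) (dual_functor X)" by (rule dual_functor_continuous)
    show "sigma_pretopos_morphism FC ODS (fst (dual_functor X) M)" if "M \<in> Obj X" for M
      using dual_obj_sigma[OF that] dual_functor_fst[OF that] by simp
    show "continuous_functor X Q (dual_functor X)" by (rule dual_functor_Q)
    show "continuous_functor Q X inverse" by (rule inverse_Q)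
    show "continuously_isomorphic X X (comp_functor X inverse (dual_functor X)) (id_functor X)"
      unfolding inverse_dual by (rule id_X_isomorphic)
    show "continuously_isomorphic Q Q (comp_functor Q (dual_functor X) inverse) (id_functor Q)"
      by (rule dual_inverse)
  qed
qed

end
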